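(* Let $d\ge2$ and $k\ge 1$ be integers with $k<2d$, let $0<\epsilon\le1$, and let $S:\Sigma_d^{dual}\to \mathrm{Simp}_{2d-2}$ be a function. The following are equivalent: 1. There exists a $C^{k+\epsilon}$ embedding of $\Sigma_d$ with scaling function $S$. 2. There exists a constant $C$ such that for all $j\neq j'$ in $\Sigma_d^{dual}$ and all $j_0=1,\dots,d$, $$D^k_{var}\big(C(j_0j,j_0j')\big)\big(A(j_0j),A(j_0j')\big)\ \cap\ R_{j_0}\Big(D^k_{var}\big(C(j,j')\big)\big(A(j),A(j')\big)\Big)\ \neq\ \emptyset,$$ where for all $i,i'\in\Sigma_d^{dual}$, $C(i,i')=C\,\rho_S(i,i')^{k+\epsilon-1}$.
   Context: Embeddings. $\Sigma_d=\{1,\dots,d\}^{\mathbb N}$ with the product topology, and the shift $\sigma(\alpha_1\alpha_2\dots)=(\alpha_2\alpha_3\dots)$, with right-inverses $\sigma_i^{-1}(\alpha_1\alpha_2\dots)=(i\alpha_1\alpha_2\dots)$, $i=1,\dots,d$. An embedding is a topological embedding $h:\Sigma_d\to\mathbb R$ that respects the order: for $\alpha\ne\beta$, $h(\alpha)>h(\beta)$ iff $\alpha_m>\beta_m$, where $m$ is the first index with $\alpha_m\ne\beta_m$. It is always assumed that the convex hull of $h(\Sigma_d)$ is $[0,1]$. Let $f=h\circ\sigma\circ h^{-1}$ be the induced shift map on $h(\Sigma_d)$ and $f_i^{-1}=h\circ\sigma_i^{-1}\circ h^{-1}$ its right-inverses. For $r>1$, $h$ is called $C^r$ if each $f_i^{-1}$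 extends to a $C^r$ contraction of $\mathbb R$ (Lipschitz constant $<1$) which is a diffeomorphism onto its image, i.e. an inverse branch of an orientation preserving smooth expanding map. For an integer $k\ge1$ and $0<\epsilon\le1$, $C^{k+\epsilon}$ means $C^k$ with $k$-th derivative locally $\epsilon$-Hölder; $\epsilon=1$ means locally Lipschitz $k$-th derivative. Scaling function. For a finite string $j_1\dots j_n$ in $\{1,\dots,d\}$ put $I_{j_1\dots j_n}=h(\{\alpha:\alpha_1=j_n,\alpha_2=j_{n-1},\dots,\alpha_n=j_1\})$ (note the reversed order), and let $|J|$ denote the length of the convex hull of a set $J\subset\mathbb R$. Then $I_{j_0j_1\dots j_n}\subset I_{j_1\dots j_n}$ for $j_0=1,\dots,d$, and the convex hulls of these $d$ subsets are disjoint intervals, ordered left to right by $j_0$, separated by $d-1$ gaps. Let $\mathrm{Simp}_{2d-2}$ be the set of vectors in $(0,1)^{2d-1}$ whose coordinates sum to $1$. Define $S(j_1\dots j_n)\in \mathrm{Simp}_{2d-2}$ as follows: for $j_0=1,\dots,d$ its $j_0$-th coordinate is $S(j_1\dots j_n)_{j_0}=|I_{j_0j_1\dots j_n}|/|I_{j_1\dots j_n}|$, and its last $d-1$ coordinates are the lengths of the $d-1$ gaps (from left to right) divided by $|I_{j_1\dots j_n}|$. The dual Cantor set $\Sigma_d^{dual}$ is the set of infinite sequences $j=(j_1j_2\dots)$ with entries in $\{1,\dots,d\}$. The embedding $h$ has scaling function $S:\Sigma_d^{dual}\to \mathrm{Simp}_{2d-2}$ if $S(j)=\lim_{n\to\infty}S(j_1\dots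 j_n)$ for every $j\in\Sigma_d^{dual}$ (the limit exists for every $C^{1+\epsilon}$ embedding). Metric. For $j\neq j'$ in $\Sigma_d^{dual}$, let $j\cap j'$ be their longest common initial string and $\sharp(j\cap j')$ its length. Given a function $S:\Sigma_d^{dual}\to \mathrm{Simp}_{2d-2}$, define, for $j\ne j'$ and $n=\sharp(j\cap j')$, $$\rho_S(j,j')=\sup_{w\in\Sigma_d^{dual}}\ \prod_{t=1}^{n} S(j_{t+1}j_{t+2}\dots j_n w)_{j_t},$$ where $j_{t+1}\dots j_nw$ denotes concatenation (equal to $w$ when $t=n$) and the empty product is $1$; put $\rho_S(j,j)=0$. For $j\in\Sigma_d^{dual}$ and $j_0\in\{1,\dots,d\}$, $j_0j$ denotes the sequence $(j_0j_1j_2\dots)$. The sets $A(j)$. For $j\in\Sigma_d^{dual}$ with $S(j)=(s_1,\dots,s_d,g_1,\dots,g_{d-1})$, partition $[0,1]$ from left to right into $2d-1$ consecutive intervals of lengths $s_1,g_1,s_2,g_2,\dots,g_{d-1},s_d$. $A(j)\subset[0,1]$ is the set of the $2d$ end points of these intervals (it contains $0$ and $1$). The interval of length $s_{j_0}$ in this partition is called the $j_0$-th interval of $j$. Spaces of diffeomorphisms. For finite sets $A_1,A_2\subset[0,1]$ of equal cardinality, both containing $0$ and $1$, $D^k(A_1,A_2)$ is the set of orientation preserving $C^k$ diffeomorphisms $\phi$ of $[0,1]$ with $\phi(A_1)=A_2$. With $D^k\phi$ denoting the $k$-th derivative of $\phi$, for $M>0$ let $$D^k_{var}(M)(A_1,A_2)=\Big\{\phi\in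 D^k(A_1,A_2):\ \sup_{x,y\in[0,1]}|D^k\phi(x)-D^k\phi(y)|<M\Big\}.$$ Renormalized restriction. For $j,j'\in\Sigma_d^{dual}$ and $j_0\in\{1,\dots,d\}$, every $\phi\in D^k(A(j),A(j'))$ maps the $j_0$-th interval of $j$ onto the $j_0$-th interval of $j'$. Define $R_{j_0}:D^k(A(j),A(j'))\to D^k(\{0,1\},\{0,1\})$ by $R_{j_0}\phi=L'^{-1}\circ\phi\circ L$, where $L$ (resp. $L'$) is the increasing affine map from $[0,1]$ onto the $j_0$-th interval of $j$ (resp. of $j'$). *)

theory Defs
  imports "HOL-Analysis.Analysis" "HOL-Library.Omega_Words_Fun"
begin

text \<open>
  Sequences are functions on the natural numbers with positions counted from 0, so that
  \<open>\<alpha> m\<close> stands for the entry with subscript \<open>m + 1\<close>. Their topology is the product topology of the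
  library's function space, with the discrete topology on \<open>nat\<close>. From Omega_Words_Fun we use
  \<open>i ## \<alpha>\<close> (prepend a symbol), \<open>xs \<frown> w\<close> (concatenation), \<open>prefix n \<alpha>\<close> (the list of the first \<open>n\<close>
  entries) and \<open>\<alpha> [a \<rightarrow> b]\<close> (the list of the entries at positions \<open>a, \<dots>, b - 1\<close>).
\<close>

definition Sigma_seq :: "nat \<Rightarrow> (nat \<Rightarrow> nat) set" where
  "Sigma_seq d = {\<alpha>. \<forall>n. \<alpha> n \<in> {1..d}}"

abbreviation Sigma_dual :: "nat \<Rightarrow> (nat \<Rightarrow> nat) set" where
  "Sigma_dual \<equiv> Sigma_seq"

definition common_len :: "(nat \<Rightarrow> nat) \<Rightarrow> (nat \<Rightarrow> nat) \<Rightarrow> nat" where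
  "common_len \<alpha> \<beta> = (LEAST m. \<alpha> m \<noteq> \<beta> m)"


section \<open>Smoothness classes\<close>

text \<open>
  Derivatives are taken within the domain \<open>X\<close>, hence one-sided at the end points of \<open>[0,1]\<close>.
  The definitions are used only for open intervals and for \<open>[0,1]\<close>.
\<close>

primrec nth_deriv :: "real set \<Rightarrow> nat \<Rightarrow> (real \<Rightarrow> real) \<Rightarrow> real \<Rightarrow> real" where
  "nth_deriv X 0 f = f"
| "nth_deriv X (Suc n) f = (\<lambda>x. vector_derivative (nth_deriv X n f) (at x within X))"

definition Ck_on :: "nat \<Rightarrow> real set \<Rightarrow> (real \<Rightarrow> real) \<Rightarrow> bool" where
  "Ck_on k X f \<longleftrightarrow> (\<forall>i<k. nth_deriv X i f differentiable_on X) \<and> continuous_on X (nth_deriv X k f)"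

definition locally_Hoelder_on :: "real \<Rightarrow> real set \<Rightarrow> (real \<Rightarrow> real) \<Rightarrow> bool" where
  "locally_Hoelder_on \<epsilon> X f \<longleftrightarrow>
     (\<forall>x\<in>X. \<exists>U B. open U \<and> x \<in> U \<and>
        (\<forall>y\<in>U \<inter> X. \<forall>z\<in>U \<inter> X. \<bar>f y - f z\<bar> \<le> B * \<bar>y - z\<bar> powr \<epsilon>))"

definition Ck_eps_on :: "nat \<Rightarrow> real \<Rightarrow> real set \<Rightarrow> (real \<Rightarrow> real) \<Rightarrow> bool" where
  "Ck_eps_on k \<epsilon> X f \<longleftrightarrow> Ck_on k X f \<and> locally_Hoelder_on \<epsilon> X (nth_deriv X k f)"


section \<open>Embeddings\<close>

definition is_embedding :: "nat \<Rightarrow> ((nat \<Rightarrow> nat) \<Rightarrow> real) \<Rightarrow> bool" where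
  "is_embedding d h \<longleftrightarrow>
     embedding_map (top_of_set (Sigma_seq d)) euclidean h \<and>
     (\<forall>\<alpha>\<in>Sigma_seq d. \<forall>\<beta>\<in>Sigma_seq d. \<alpha> \<noteq> \<beta> \<longrightarrow>
        (h \<alpha> > h \<beta> \<longleftrightarrow> \<alpha> (common_len \<alpha> \<beta>) > \<beta> (common_len \<alpha> \<beta>))) \<and>
     convex hull (h ` Sigma_seq d) = {0..1}"

definition branch :: "nat \<Rightarrow> ((nat \<Rightarrow> nat) \<Rightarrow> real) \<Rightarrow> nat \<Rightarrow> real \<Rightarrow> real" where
  "branch d h i = h \<circ> (\<lambda>\<alpha>. i ## \<alpha>) \<circ> inv_into (Sigma_seq d) h"

definition smooth_contraction :: "nat \<Rightarrow> real \<Rightarrow> (real \<Rightarrow> real) \<Rightarrow> bool" where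
  "smooth_contraction k \<epsilon> g \<longleftrightarrow>
     (\<exists>L<1. L-lipschitz_on UNIV g) \<and>
     strict_mono g \<and>
     Ck_eps_on k \<epsilon> UNIV g \<and>
     Ck_eps_on k \<epsilon> (range g) (inv g)"

definition C_embedding :: "nat \<Rightarrow> nat \<Rightarrow> real \<Rightarrow> ((nat \<Rightarrow> nat) \<Rightarrow> real) \<Rightarrow> bool" where
  "C_embedding d k \<epsilon> h \<longleftrightarrow>
     is_embedding d h \<and>
     (\<forall>i\<in>{1..d}. \<exists>g. smooth_contraction k \<epsilon> g \<and> (\<forall>x\<in>h ` Sigma_seq d. g x = branch d h i x))"


section \<open>Scaling functions\<close>

text \<open>
  A finite string is a list of symbols. A vector of \<open>2 * d - 1\<close> coordinates is a function
  on \<open>nat\<close> of which only the values at \<open>1, \<dots>, 2 * d - 1\<close> matter; coordinates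
  \<open>1, \<dots>, d\<close> are the scaling ratios and \<open>d + 1, \<dots>, 2 * d - 1\<close> the gap ratios.
\<close>

definition Simp :: "nat \<Rightarrow> (nat \<Rightarrow> real) set" where
  "Simp d = {v. (\<forall>i\<in>{1..2*d-1}. v i \<in> {0<..<1}) \<and> (\<Sum>i=1..2*d-1. v i) = 1}"

definition cyl :: "nat \<Rightarrow> ((nat \<Rightarrow> nat) \<Rightarrow> real) \<Rightarrow> nat list \<Rightarrow> real set" where
  "cyl d h js = h ` {\<alpha> \<in> Sigma_seq d. prefix (length js) \<alpha> = rev js}"

definition hull_length :: "real set \<Rightarrow> real" where
  "hull_length J = measure lborel (convex hull J)"

definition gap_length :: "real set \<Rightarrow> real set \<Rightarrow> real" where
  "gap_length J K = Inf (convex hull K) - Sup (convex hull J)"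

definition finite_scaling ::
    "nat \<Rightarrow> ((nat \<Rightarrow> nat) \<Rightarrow> real) \<Rightarrow> nat list \<Rightarrow> nat \<Rightarrow> real" where
  "finite_scaling d h js i =
     (if i \<le> d then hull_length (cyl d h (i # js))
      else gap_length (cyl d h ((i - d) # js)) (cyl d h ((i - d + 1) # js)))
     / hull_length (cyl d h js)"

definition has_scaling_function ::
    "nat \<Rightarrow> ((nat \<Rightarrow> nat) \<Rightarrow> real) \<Rightarrow> ((nat \<Rightarrow> nat) \<Rightarrow> nat \<Rightarrow> real) \<Rightarrow> bool" where
  "has_scaling_function d h S \<longleftrightarrow>
     (\<forall>j\<in>Sigma_dual d. \<forall>i\<in>{1..2*d-1}. (\<lambda>n. finite_scaling d h (prefix n j) i) \<longlonglongrightarrow> S j i)"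


section \<open>The metric\<close>

definition rho ::
    "nat \<Rightarrow> ((nat \<Rightarrow> nat) \<Rightarrow> nat \<Rightarrow> real) \<Rightarrow> (nat \<Rightarrow> nat) \<Rightarrow> (nat \<Rightarrow> nat) \<Rightarrow> real" where
  "rho d S j j' =
     (if j = j' then 0
      else let n = common_len j j'
           in SUP w\<in>Sigma_dual d. \<Prod>t<n. S ((j [Suc t \<rightarrow> n]) \<frown> w) (j t))"


section \<open>Spaces of diffeomorphisms\<close>

definition left_end :: "nat \<Rightarrow> (nat \<Rightarrow> real) \<Rightarrow> nat \<Rightarrow> real" where
  "left_end d v i = (\<Sum>m\<in>{1..<i}. v m + v (d + m))"

definition A_set :: "nat \<Rightarrow> (nat \<Rightarrow> real) \<Rightarrow> real set" where
  "A_set d v = (\<Union>i\<in>{1..d}. {left_end d v i, left_end d v i + v i})"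

text \<open>A diffeomorphism of \<open>[0,1]\<close> is represented by its extension by \<open>undefined\<close> to all reals.\<close>

definition Diff :: "nat \<Rightarrow> real set \<Rightarrow> real set \<Rightarrow> (real \<Rightarrow> real) set" where
  "Diff k A\<^sub>1 A\<^sub>2 =
     {\<phi> \<in> extensional {0..1}.
        bij_betw \<phi> {0..1} {0..1} \<and>
        strict_mono_on {0..1} \<phi> \<and>
        Ck_on k {0..1} \<phi> \<and>
        Ck_on k {0..1} (inv_into {0..1} \<phi>) \<and>
        \<phi> ` A\<^sub>1 = A\<^sub>2}"

definition Diff_var :: "nat \<Rightarrow> real \<Rightarrow> real set \<Rightarrow> real set \<Rightarrow> (real \<Rightarrow> real) set" where
  "Diff_var k M A\<^sub>1 A\<^sub>2 =
     {\<phi> \<in> Diff k A\<^sub>1 A\<^sub>2.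
        (SUP (x, y)\<in>{0..1} \<times> {0..1}. \<bar>nth_deriv {0..1} k \<phi> x - nth_deriv {0..1} k \<phi> y\<bar>) < M}"

text \<open>
  The argument vectors \<open>v\<close> and \<open>v'\<close> are the values of the scaling function at the two
  sequences in question.
\<close>

definition renorm ::
    "nat \<Rightarrow> (nat \<Rightarrow> real) \<Rightarrow> (nat \<Rightarrow> real) \<Rightarrow> nat \<Rightarrow> (real \<Rightarrow> real) \<Rightarrow> real \<Rightarrow> real" where
  "renorm d v v' i \<phi> =
     (\<lambda>x\<in>{0..1}. (\<phi> (left_end d v i + v i * x) - left_end d v' i) / v' i)"

end

theory Submission
  imports Defs "HOL-Computational_Algebra.Polynomial"
begin

text \<open>
  Both directions work with maps between partitions that refine each other when a symbol is put in
  front of a dual sequence.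

  Suppose that an embedding of class \<open>C^(k + \<epsilon>)\<close> is given. The iterated branches along a dual
  sequence \<open>j\<close>, rescaled to the unit interval, converge to a limit chart of \<open>j\<close>, because the
  logarithms of their derivatives add up to a geometric series (\<open>chart_shift\<close> and the lemmas before it).
  The charts form a bounded family of class \<open>C^(k + \<epsilon>)\<close>, the chart of \<open>j\<close> maps the first level of the
  Cantor set to \<open>A(j)\<close>, and the chart of \<open>ij\<close> is the \<open>i\<close>-th branch seen in the chart of \<open>j\<close>. Hence the
  transition map between the charts of \<open>j\<close> and \<open>j'\<close> lies in \<open>D^k(A(j), A(j'))\<close>, and its renormalized
  restriction is exactly the transition map of \<open>ij\<close> and \<open>ij'\<close>. If \<open>j\<close> and \<open>j'\<close> have \<open>n\<close> symbols in
  common, the transition map is an affine rescaling of a piece, of length at most \<open>\<rho>(j, j')\<close>, of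
  another transition map. Rescaling a piece of length \<open>s\<close> multiplies \<open>k\<close>-th derivatives by a bounded
  multiple of \<open>s^(k - 1)\<close>, and the Hoelder condition contributes \<open>s^\<epsilon>\<close>; this is the exponent
  \<open>k + \<epsilon> - 1\<close> (\<open>scaling_condition\<close>).

  Conversely, a function \<open>S\<close> determines for every dual sequence \<open>w\<close> a Cantor set, with points \<open>p \<alpha> w\<close>,
  in which the interval with address \<open>\<alpha>_0 ... \<alpha>_(n-1)\<close> is subdivided in the ratios
  \<open>S(\<alpha>_(n-1) ... \<alpha>_0 w)\<close>. Near \<open>p \<alpha> w\<close> and at the scale of the \<open>n\<close>-th interval, the map
  \<open>p \<alpha> w \<mapsto> p \<alpha> w'\<close> should look like a diffeomorphism from the space that belongs to
  \<open>\<alpha>_(n-1) ... \<alpha>_0 w\<close> and \<open>\<alpha>_(n-1) ... \<alpha>_0 w'\<close>. By hypothesis some member of the space at depth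
  \<open>n + 1\<close> is the renormalization of a member of the space at depth \<open>n\<close>. Since \<open>k < 2d\<close>, two members of one
  space agree at more than \<open>k\<close> points, so by Rolle's theorem all their derivatives up to order \<open>k\<close>
  differ by no more than twice the variation allowed. Therefore the derivatives at depth \<open>n\<close> converge
  geometrically, and their limits satisfy Whitney's conditions for class \<open>C^(k + \<epsilon>)\<close>
  (\<open>distortion\<close>, \<open>jet_limit\<close>, \<open>F_whitney\<close>).

  No single \<open>p\<close> gives the embedding, because \<open>p (i \<alpha>) w\<close> is an affine image of \<open>p \<alpha> (i w)\<close>, with another
  parameter. The embedding is the average \<open>h \<alpha> = mean (\<lambda>w. p \<alpha> w)\<close> for a positive functional with
  \<open>mean (\<lambda>w. S w i * f (i w)) \<le> \<mu> * mean f\<close> for some \<open>\<mu> < 1\<close> and all \<open>f \<ge> 0\<close>. Such a functional is a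
  normalized resolvent of the transfer operator \<open>f \<mapsto> (\<lambda>w. \<Sum>i. S w i * f (i w))\<close>, whose norm is
  less than 1 since the gaps take a definite share of each interval; the inequality says that the
  branches of \<open>h\<close> contract the Cantor set (\<open>mean_contract\<close>). Averages of Whitney jets are Whitney jets, so
  \<open>h\<close> and its branches extend from the Cantor set to functions of class \<open>C^(k + \<epsilon>)\<close> on the line. Away
  from the Cantor set the extensions are changed so that their derivatives stay, up to a small error,
  between the bounds that hold for the secants of the Cantor set; this makes the extended branches
  contractions and diffeomorphisms (\<open>adjust_derivative\<close>, \<open>contraction_from_jets\<close>). The scaling
  function of \<open>h\<close> is \<open>S\<close>, since \<open>S\<close> varies little on sequences with a long common initial string
  (\<open>S_uniform\<close>).
\<close>

section \<open>Uniform Hoelder families\<close>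

text \<open>
 Class \<open>C^(m + e)\<close> with constants that do not depend on the index. The derivatives are existentially
 quantified one at a time, so that closure properties follow by induction on \<open>m\<close> without any formula for
 higher derivatives.
\<close>

primrec bfam :: "nat \<Rightarrow> real \<Rightarrow> real set \<Rightarrow> 'i set \<Rightarrow> ('i \<Rightarrow> real \<Rightarrow> real) \<Rightarrow> bool" where
 "bfam 0 e X I F \<longleftrightarrow> (\<exists>K. \<forall>i\<in>I. \<forall>x\<in>X. \<bar>F i x\<bar> \<le> K \<and> (\<forall>y\<in>X. \<bar>F i x - F i y\<bar> \<le> K * \<bar>x - y\<bar> powr e))"
| "bfam (Suc m) e X I F \<longleftrightarrow> (\<exists>K. \<forall>i\<in>I. \<forall>x\<in>X. \<bar>F i x\<bar> \<le> K) \<and>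
   (\<exists>F'. (\<forall>i\<in>I. \<forall>x\<in>X. (F i has_real_derivative F' i x) (at x within X)) \<and> bfam m e X I F')"

text \<open>
 What the inner function of a composition has to satisfy: the values need not be bounded, and at order
 0 a Lipschitz condition takes the place of the Hoelder condition.
\<close>

primrec lfam :: "nat \<Rightarrow> real \<Rightarrow> real set \<Rightarrow> 'i set \<Rightarrow> ('i \<Rightarrow> real \<Rightarrow> real) \<Rightarrow> bool" where
 "lfam 0 e X I F \<longleftrightarrow> (\<exists>K. \<forall>i\<in>I. \<forall>x\<in>X. \<forall>y\<in>X. \<bar>F i x - F i y\<bar> \<le> K * \<bar>x - y\<bar>)"
| "lfam (Suc m) e X I F \<longleftrightarrow>
   (\<exists>F'. (\<forall>i\<in>I. \<forall>x\<in>X. (F i has_real_derivative F' i x) (at x within X)) \<and> bfam m e X I F')"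

lemma bfam_SucI:
 assumes "\<And>i x. i \<in> I ==> x \<in> X ==> \<bar>F i x\<bar> \<le> K"
  and "\<And>i x. i \<in> I ==> x \<in> X ==> (F i has_real_derivative F' i x) (at x within X)"
  and "bfam m e X I F'"
 shows "bfam (Suc m) e X I F"
 unfolding bfam.simps using assms by blast

lemma lfam_SucI:
 assumes "\<And>i x. i \<in> I ==> x \<in> X ==> (F i has_real_derivative F' i x) (at x within X)"
  and "bfam m e X I F'"
 shows "lfam (Suc m) e X I F"
 unfolding lfam.simps using assms by blast

lemma bfam_0I:
 assumes "\<And>i x. i \<in> I ==> x \<in> X ==> \<bar>F i x\<bar> \<le> K"
  and "\<And>i x y. i \<in> I ==> x \<in> X ==> y \<in> X ==> \<bar>F i x - F i y\<bar> \<le> K * \<bar>x - y\<bar> powr e"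
 shows "bfam 0 e X I F"
 unfolding bfam.simps using assms by blast

lemma bfam_0E:
 assumes "bfam 0 e X I F"
 obtains K where "K \<ge> 0" "\<And>i x. i \<in> I ==> x \<in> X ==> \<bar>F i x\<bar> \<le> K"
  "\<And>i x y. i \<in> I ==> x \<in> X ==> y \<in> X ==> \<bar>F i x - F i y\<bar> \<le> K * \<bar>x - y\<bar> powr e"
proof -
 obtain K where K: "\<And>i x. i \<in> I ==> x \<in> X ==> \<bar>F i x\<bar> \<le> K"
  "\<And>i x y. i \<in> I ==> x \<in> X ==> y \<in> X ==> \<bar>F i x - F i y\<bar> \<le> K * \<bar>x - y\<bar> powr e"
  using assms unfolding bfam.simps by blast
 have "\<bar>F i x - F i y\<bar> \<le> max K 0 * \<bar>x - y\<bar> powr e" if "i \<in> I" "x \<in> X" "y \<in> X" for i x y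
  by (rule order_trans[OF K(2)[OF that]]) (auto intro: mult_right_mono)
 moreover have "\<bar>F i x\<bar> \<le> max K 0" if "i \<in> I" "x \<in> X" for i x using K(1)[OF that] by linarith
 ultimately show thesis using that[of "max K 0"] by simp
qed

lemma bfam_SucE:
 assumes "bfam (Suc m) e X I F"
 obtains K F' where "\<And>i x. i \<in> I ==> x \<in> X ==> \<bar>F i x\<bar> \<le> K"
  "\<And>i x. i \<in> I ==> x \<in> X ==> (F i has_real_derivative F' i x) (at x within X)" "bfam m e X I F'"
 using assms unfolding bfam.simps by blast

lemma lfam_0I:
 assumes "\<And>i x y. i \<in> I ==> x \<in> X ==> y \<in> X ==> \<bar>F i x - F i y\<bar> \<le> K * \<bar>x - y\<bar>"
 shows "lfam 0 e X I F"
 unfolding lfam.simps using assms by blast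

lemma lfam_0E:
 assumes "lfam 0 e X I F"
 obtains K where "K \<ge> 0" "\<And>i x y. i \<in> I ==> x \<in> X ==> y \<in> X ==> \<bar>F i x - F i y\<bar> \<le> K * \<bar>x - y\<bar>"
proof -
 obtain K where K: "\<And>i x y. i \<in> I ==> x \<in> X ==> y \<in> X ==> \<bar>F i x - F i y\<bar> \<le> K * \<bar>x - y\<bar>"
  using assms unfolding lfam.simps by blast
 have "\<bar>F i x - F i y\<bar> \<le> max K 0 * \<bar>x - y\<bar>" if "i \<in> I" "x \<in> X" "y \<in> X" for i x y
  by (rule order_trans[OF K[OF that]]) (auto intro: mult_right_mono)
 then show thesis using that[of "max K 0"] by simp
qed

lemma lfam_SucE:
 assumes "lfam (Suc m) e X I F"
 obtains F' where
  "\<And>i x. i \<in> I ==> x \<in> X ==> (F i has_real_derivative F' i x) (at x within X)" "bfam m e X I F'"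
 using assms unfolding lfam.simps by blast

lemma bfam_bounded:
 assumes "bfam m e X I F" obtains K where "K > 0" "\<And>i x. i \<in> I ==> x \<in> X ==> \<bar>F i x\<bar> \<le> K"
proof -
 obtain K where "\<And>i x. i \<in> I ==> x \<in> X ==> \<bar>F i x\<bar> \<le> K"
  using assms by (cases m) (auto simp del: bfam.simps elim!: bfam_0E bfam_SucE)
 then have "\<bar>F i x\<bar> \<le> max K 1" if "i \<in> I" "x \<in> X" for i x using that by fastforce
 then show thesis using that[of "max K 1"] by auto
qed

lemma abs_le_powr:
 fixes t e :: real assumes "0 < e" "e \<le> 1" "\<bar>t\<bar> \<le> 1" shows "\<bar>t\<bar> \<le> \<bar>t\<bar> powr e"
proof (cases "t = 0")
 case False
 then have "\<bar>t\<bar> powr 1 \<le> \<bar>t\<bar> powr e" using assms by (intro powr_mono') auto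
 then show ?thesis using False by simp
qed simp

text \<open>
 The Lipschitz bound serves for \<open>\<bar>t\<bar> \<le> 1\<close>, the absolute bound for larger \<open>t\<close>.
\<close>

lemma hoelder_of_lipschitz:
 fixes e :: real assumes "0 < e" "e \<le> 1" "\<bar>u\<bar> \<le> K * \<bar>t\<bar>" "\<bar>u\<bar> \<le> B" "K \<ge> 0"
 shows "\<bar>u\<bar> \<le> (K + B) * \<bar>t\<bar> powr e"
proof (cases "\<bar>t\<bar> \<le> 1")
 case True
 have "K * \<bar>t\<bar> \<le> K * \<bar>t\<bar> powr e"
  using abs_le_powr[OF assms(1,2) True] assms(5) by (intro mult_left_mono)
 moreover have "0 \<le> B * \<bar>t\<bar> powr e" using assms(4) by auto
 ultimately show ?thesis using assms(3) unfolding distrib_right by linarith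
next
 case False
 then have "1 \<le> \<bar>t\<bar> powr e" using assms by (simp add: ge_one_powr_ge_zero)
 then have "B * 1 \<le> B * \<bar>t\<bar> powr e" using assms(4) by (intro mult_left_mono) auto
 moreover have "0 \<le> K * \<bar>t\<bar> powr e" using assms by auto
 ultimately show ?thesis using assms(4) unfolding distrib_right by linarith
qed

definition ln_bound :: "real \<Rightarrow> real \<Rightarrow> real" where "ln_bound c K = \<bar>ln c\<bar> + \<bar>ln K\<bar>"

lemma ln_bound: assumes "0 < c" "c \<le> t" "\<bar>t\<bar> \<le> K" shows "\<bar>ln t\<bar> \<le> ln_bound c K"
proof -
 have "ln c \<le> ln t" "ln t \<le> ln K" using assms by (simp_all add: ln_mono)
 then show ?thesis unfolding ln_bound_def by linarith
qed

lemma abs_suminf_weighted_le: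
 fixes a W :: "nat \<Rightarrow> real"
 assumes a: "summable a" "\<And>n. a n \<ge> 0" and W: "\<And>n. \<bar>W n\<bar> \<le> B"
 shows "summable (\<lambda>n. a n * W n)" "\<bar>\<Sum>n. a n * W n\<bar> \<le> (\<Sum>n. a n) * B"
proof -
 have 1: "summable (\<lambda>n. norm (a n * W n))"
  by (rule summable_comparison_test'[OF summable_mult2[OF a(1), of B], of 0])
   (use W a in \<open>auto simp: abs_mult intro!: mult_left_mono\<close>)
 show "summable (\<lambda>n. a n * W n)" using 1 by (rule summable_norm_cancel)
 have "norm (\<Sum>n. a n * W n) \<le> (\<Sum>n. norm (a n * W n))" by (rule summable_norm[OF 1])
 also have "\<dots> \<le> (\<Sum>n. a n * B)"
  by (rule suminf_le[OF _ 1 summable_mult2[OF a(1)]]) (use W a in \<open>auto simp: abs_mult intro!: mult_left_mono\<close>)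
 also have "\<dots> = (\<Sum>n. a n) * B" using suminf_mult2[OF a(1)] by simp
 finally show "\<bar>\<Sum>n. a n * W n\<bar> \<le> (\<Sum>n. a n) * B" by simp
qed

lemma bfam_const:
 assumes "\<And>i. i \<in> I ==> \<bar>c i\<bar> \<le> K" shows "bfam m e X I (\<lambda>i x. c i)"
 using assms
proof (induction m arbitrary: c K)
 case 0
 then have "\<bar>c i\<bar> \<le> \<bar>K\<bar>" if "i \<in> I" for i using that by (metis abs_ge_self order_trans)
 then show ?case by (intro bfam_0I[of _ _ _ "\<bar>K\<bar>"]) auto
next
 case (Suc m)
 show ?case by (rule bfam_SucI[where F' = "\<lambda>i x. 0" and K = K]) (use Suc.prems Suc.IH[of "\<lambda>_. 0" 0] in auto)
qed

lemma bfam_add: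
 assumes "bfam m e X I F" "bfam m e X I G" shows "bfam m e X I (\<lambda>i x. F i x + G i x)"
 using assms
proof (induction m arbitrary: F G)
 case 0
 obtain K where K: "\<And>i x. i \<in> I ==> x \<in> X ==> \<bar>F i x\<bar> \<le> K"
  "\<And>i x y. i \<in> I ==> x \<in> X ==> y \<in> X ==> \<bar>F i x - F i y\<bar> \<le> K * \<bar>x - y\<bar> powr e" by (rule bfam_0E[OF 0(1)]) (rule that)
 obtain L where L: "\<And>i x. i \<in> I ==> x \<in> X ==> \<bar>G i x\<bar> \<le> L"
  "\<And>i x y. i \<in> I ==> x \<in> X ==> y \<in> X ==> \<bar>G i x - G i y\<bar> \<le> L * \<bar>x - y\<bar> powr e" by (rule bfam_0E[OF 0(2)]) (rule that)
 show ?case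
 proof (rule bfam_0I[of _ _ _ "K + L"])
  fix i x y assume i: "i \<in> I" "x \<in> X" "y \<in> X"
  show "\<bar>F i x + G i x - (F i y + G i y)\<bar> \<le> (K + L) * \<bar>x - y\<bar> powr e"
   using K(2)[OF i] L(2)[OF i] unfolding distrib_right by linarith
 next
  fix i x assume i: "i \<in> I" "x \<in> X"
  show "\<bar>F i x + G i x\<bar> \<le> K + L" using K(1)[OF i] L(1)[OF i] by linarith
 qed
next
 case (Suc m)
 obtain K F' where F: "\<And>i x. i \<in> I ==> x \<in> X ==> \<bar>F i x\<bar> \<le> K"
  "\<And>i x. i \<in> I ==> x \<in> X ==> (F i has_real_derivative F' i x) (at x within X)" "bfam m e X I F'"
  by (rule bfam_SucE[OF Suc.prems(1)]) (rule that)
 obtain L G' where G: "\<And>i x. i \<in> I ==> x \<in> X ==> \<bar>G i x\<bar> \<le> L"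
  "\<And>i x. i \<in> I ==> x \<in> X ==> (G i has_real_derivative G' i x) (at x within X)" "bfam m e X I G'"
  by (rule bfam_SucE[OF Suc.prems(2)]) (rule that)
 show ?case
 proof (rule bfam_SucI[OF _ _ Suc.IH[OF F(3) G(3)], where K = "K + L"])
  fix i x assume i: "i \<in> I" "x \<in> X"
  show "\<bar>F i x + G i x\<bar> \<le> K + L" using F(1)[OF i] G(1)[OF i] by linarith
  show "((\<lambda>x. F i x + G i x) has_real_derivative F' i x + G' i x) (at x within X)"
   using F(2)[OF i] G(2)[OF i] by (rule DERIV_add)
 qed
qed

lemma bfam_transfer:
 assumes "bfam m e X I F" "\<And>j. j \<in> J ==> r j \<in> I" "\<And>j x. j \<in> J ==> x \<in> X ==> G j x = F (r j) x"
 shows "bfam m e X J G"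
 using assms(1,3)
proof (induction m arbitrary: F G)
 case 0
 obtain K where K: "\<And>i x. i \<in> I ==> x \<in> X ==> \<bar>F i x\<bar> \<le> K"
  "\<And>i x y. i \<in> I ==> x \<in> X ==> y \<in> X ==> \<bar>F i x - F i y\<bar> \<le> K * \<bar>x - y\<bar> powr e" by (rule bfam_0E[OF 0(1)]) (rule that)
 show ?case by (rule bfam_0I[of _ _ _ K]) (simp_all add: K assms(2) 0(2))
next
 case (Suc m)
 obtain K F' where *: "\<And>i x. i \<in> I ==> x \<in> X ==> \<bar>F i x\<bar> \<le> K"
  "\<And>i x. i \<in> I ==> x \<in> X ==> (F i has_real_derivative F' i x) (at x within X)" "bfam m e X I F'"
  by (rule bfam_SucE[OF Suc.prems(1)]) (rule that)
 show ?case
 proof (rule bfam_SucI[OF _ _ Suc.IH[OF *(3) refl], where K = K])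
  fix j x assume j: "j \<in> J" "x \<in> X"
  show "\<bar>G j x\<bar> \<le> K" using *(1)[OF assms(2)[OF j(1)] j(2)] Suc.prems(2)[OF j] by simp
  show "(G j has_real_derivative F' (r j) x) (at x within X)"
   using has_field_derivative_transform_within[OF *(2)[OF assms(2)[OF j(1)] j(2)] zero_less_one j(2)] Suc.prems(2)[OF j(1)] by simp
 qed
qed

lemma bfam_reindex: "bfam m e X I F ==> (\<And>j. j \<in> J ==> r j \<in> I) ==> bfam m e X J (\<lambda>j. F (r j))"
 by (rule bfam_transfer) (assumption | rule refl)+

lemma bfam_cong: "bfam m e X I F ==> (\<And>i x. i \<in> I ==> x \<in> X ==> F i x = G i x) ==> bfam m e X I G"
 by (rule bfam_transfer[where r = "\<lambda>i. i" and I = I and F = F]) simp_all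

lemma lfam_reindex:
 assumes "lfam m e X I F" "\<And>j. j \<in> J ==> r j \<in> I" shows "lfam m e X J (\<lambda>j. F (r j))"
proof (cases m)
 case 0
 obtain K where "\<And>i x y. i \<in> I ==> x \<in> X ==> y \<in> X ==> \<bar>F i x - F i y\<bar> \<le> K * \<bar>x - y\<bar>"
  by (rule lfam_0E[OF assms(1)[unfolded 0]]) (rule that)
 then show ?thesis unfolding 0 using assms(2) by (intro lfam_0I) auto
next
 case (Suc n)
 obtain F' where *: "\<And>i x. i \<in> I ==> x \<in> X ==> (F i has_real_derivative F' i x) (at x within X)" "bfam n e X I F'"
  by (rule lfam_SucE[OF assms(1)[unfolded Suc]]) (rule that)
 show ?thesis unfolding Suc by (rule lfam_SucI[OF _ bfam_reindex[OF *(2)]]) (use * assms(2) in auto)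
qed

context
 fixes e :: real
 assumes e0: "0 < e" and e1: "e \<le> 1"
begin

lemma bfam_0_of_deriv:
 assumes cX: "convex X" and b: "\<And>i x. i \<in> I ==> x \<in> X ==> \<bar>F i x\<bar> \<le> K"
  and b': "\<And>i x. i \<in> I ==> x \<in> X ==> \<bar>F' i x\<bar> \<le> K'"
  and d: "\<And>i x. i \<in> I ==> x \<in> X ==> (F i has_real_derivative F' i x) (at x within X)"
 shows "bfam 0 e X I F"
proof -
 have *: "\<bar>F i x - F i y\<bar> \<le> (\<bar>K'\<bar> + 2 * \<bar>K\<bar>) * \<bar>x - y\<bar> powr e" if "i \<in> I" "x \<in> X" "y \<in> X" for i x y
 proof (rule hoelder_of_lipschitz[OF e0 e1])
  have "norm (F i x - F i y) \<le> \<bar>K'\<bar> * norm (x - y)"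
   by (rule field_differentiable_bound[OF cX, of "F i" "F' i"]) (use that b'[OF that(1)] d[OF that(1)] in \<open>auto intro: order_trans[OF _ abs_ge_self]\<close>)
  then show "\<bar>F i x - F i y\<bar> \<le> \<bar>K'\<bar> * \<bar>x - y\<bar>" by simp
  show "\<bar>F i x - F i y\<bar> \<le> 2 * \<bar>K\<bar>" using b[of i x] b[of i y] that by linarith
 qed auto
 have "\<bar>F i x\<bar> \<le> \<bar>K'\<bar> + 2 * \<bar>K\<bar>" if "i \<in> I" "x \<in> X" for i x using b[OF that] by linarith
 then show ?thesis using * by (rule bfam_0I)
qed

lemma bfam_Suc_imp:
 assumes "convex X" "bfam (Suc m) e X I F" shows "bfam m e X I F"
 using assms(2)
proof (induction m arbitrary: F)
 case 0
 then obtain K F' where a: "\<And>i x. i \<in> I ==> x \<in> X ==> \<bar>F i x\<bar> \<le> K"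
  "\<And>i x. i \<in> I ==> x \<in> X ==> (F i has_real_derivative F' i x) (at x within X)" "bfam 0 e X I F'" by (rule bfam_SucE) blast
 obtain K' where K': "\<And>i x. i \<in> I ==> x \<in> X ==> \<bar>F' i x\<bar> \<le> K'" by (rule bfam_bounded[OF a(3)]) (rule that)
 show ?case by (rule bfam_0_of_deriv[OF assms(1) a(1) K' a(2)])
next
 case (Suc m)
 obtain K F' where a: "\<And>i x. i \<in> I ==> x \<in> X ==> \<bar>F i x\<bar> \<le> K"
  "\<And>i x. i \<in> I ==> x \<in> X ==> (F i has_real_derivative F' i x) (at x within X)" "bfam (Suc m) e X I F'"
  by (rule bfam_SucE[OF Suc.prems]) (rule that)
 show ?case by (rule bfam_SucI[OF a(1,2) Suc.IH[OF a(3)]])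
qed

lemma bfam_mono: "convex X ==> bfam n e X I F ==> m \<le> n ==> bfam m e X I F"
 by (induction n) (simp, metis bfam_Suc_imp le_SucE)

lemma lfam_Suc_imp:
 assumes "convex X" "lfam (Suc m) e X I F" shows "lfam m e X I F"
proof -
 obtain F' where d: "\<And>i x. i\<in>I ==> x\<in>X ==> (F i has_real_derivative F' i x) (at x within X)" and b: "bfam m e X I F'"
  by (rule lfam_SucE[OF assms(2)]) (rule that)
 show ?thesis
 proof (cases m)
  case 0
  obtain K where K: "\<And>i x. i \<in> I ==> x \<in> X ==> \<bar>F' i x\<bar> \<le> K" by (rule bfam_bounded[OF b]) (rule that)
  have "norm (F i x - F i y) \<le> K * norm (x - y)" if "i \<in> I" "x \<in> X" "y \<in> X" for i x y
   by (rule field_differentiable_bound[OF assms(1), of "F i" "F' i"]) (use that K d in auto)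
  then show ?thesis unfolding 0 by (intro lfam_0I) auto
 next
  case (Suc n)
  then show ?thesis using lfam_SucI[OF d bfam_Suc_imp[OF assms(1)]] b by simp
 qed
qed

lemma lfam_mono: "convex X ==> lfam n e X I F ==> m \<le> n ==> lfam m e X I F"
 by (induction n) (simp, metis lfam_Suc_imp le_SucE)

lemma bfam_mult:
 assumes X: "convex X" and "bfam m e X I F" "bfam m e X I G" shows "bfam m e X I (\<lambda>i x. F i x * G i x)"
 using assms(2,3)
proof (induction m arbitrary: F G)
 case 0
 obtain K where K: "K \<ge> 0" "\<And>i x. i \<in> I ==> x \<in> X ==> \<bar>F i x\<bar> \<le> K"
  "\<And>i x y. i \<in> I ==> x \<in> X ==> y \<in> X ==> \<bar>F i x - F i y\<bar> \<le> K * \<bar>x - y\<bar> powr e" by (rule bfam_0E[OF 0(1)]) (rule that)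
 obtain L where L: "L \<ge> 0" "\<And>i x. i \<in> I ==> x \<in> X ==> \<bar>G i x\<bar> \<le> L"
  "\<And>i x y. i \<in> I ==> x \<in> X ==> y \<in> X ==> \<bar>G i x - G i y\<bar> \<le> L * \<bar>x - y\<bar> powr e" by (rule bfam_0E[OF 0(2)]) (rule that)
 show ?case
 proof (rule bfam_0I[of _ _ _ "2 * (K * L)"])
  fix i x assume i: "i \<in> I" "x \<in> X"
  have "\<bar>F i x\<bar> * \<bar>G i x\<bar> \<le> K * L" using K(2)[OF i] L(2)[OF i] K(1) by (intro mult_mono) auto
  moreover have "0 \<le> K * L" using K(1) L(1) by simp
  ultimately show "\<bar>F i x * G i x\<bar> \<le> 2 * (K * L)" unfolding abs_mult by linarith
 next
  fix i x y assume i: "i \<in> I" "x \<in> X" and y: "y \<in> X"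
  have "F i x * G i x - F i y * G i y = (F i x - F i y) * G i x + F i y * (G i x - G i y)" by algebra
  then have "\<bar>F i x * G i x - F i y * G i y\<bar> \<le> \<bar>F i x - F i y\<bar> * \<bar>G i x\<bar> + \<bar>F i y\<bar> * \<bar>G i x - G i y\<bar>"
   by (metis abs_mult abs_triangle_ineq)
  also have "\<dots> \<le> (K * \<bar>x - y\<bar> powr e) * L + K * (L * \<bar>x - y\<bar> powr e)"
   using K L i y by (intro add_mono mult_mono) auto
  finally show "\<bar>F i x * G i x - F i y * G i y\<bar> \<le> 2 * (K * L) * \<bar>x - y\<bar> powr e"
   by (simp add: algebra_simps)
 qed
next
 case (Suc m)
 obtain K F' where F: "\<And>i x. i \<in> I ==> x \<in> X ==> \<bar>F i x\<bar> \<le> K"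
  "\<And>i x. i \<in> I ==> x \<in> X ==> (F i has_real_derivative F' i x) (at x within X)" "bfam m e X I F'"
  by (rule bfam_SucE[OF Suc.prems(1)]) (rule that)
 obtain L G' where G: "\<And>i x. i \<in> I ==> x \<in> X ==> \<bar>G i x\<bar> \<le> L"
  "\<And>i x. i \<in> I ==> x \<in> X ==> (G i has_real_derivative G' i x) (at x within X)" "bfam m e X I G'"
  by (rule bfam_SucE[OF Suc.prems(2)]) (rule that)
 have FG: "bfam m e X I F" "bfam m e X I G" using Suc.prems bfam_Suc_imp[OF X] by blast+
 show ?case
 proof (rule bfam_SucI[OF _ _ bfam_add[OF Suc.IH[OF F(3) FG(2)] Suc.IH[OF FG(1) G(3)]], where K = "K * L"])
  fix i x assume i: "i \<in> I" "x \<in> X"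
  show "\<bar>F i x * G i x\<bar> \<le> K * L" unfolding abs_mult
   using F(1)[OF i] G(1)[OF i] abs_ge_zero[of "F i x"] by (intro mult_mono) linarith+
  show "((\<lambda>x. F i x * G i x) has_real_derivative F' i x * G i x + F i x * G' i x) (at x within X)"
   using DERIV_mult[OF F(2)[OF i] G(2)[OF i]] by (simp add: mult.commute)
 qed
qed

lemma bfam_scale:
 assumes "convex X" "bfam m e X I F" "\<And>i. i \<in> I ==> \<bar>c i\<bar> \<le> K"
 shows "bfam m e X I (\<lambda>i x. c i * F i x)"
 using bfam_mult[OF assms(1) bfam_const[of I c K] assms(2)] assms(3) by blast

lemma bfam_diff:
 assumes "convex X" "bfam m e X I F" "bfam m e X I G" shows "bfam m e X I (\<lambda>i x. F i x - G i x)"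
proof -
 have "bfam m e X I (\<lambda>i x. F i x + (-1) * G i x)"
  using bfam_add[OF assms(2) bfam_scale[OF assms(1,3), of "\<lambda>_. -1" 1]] by simp
 then show ?thesis by simp
qed

lemma lfam_scale:
 assumes X: "convex X" and "lfam m e X I F" "\<And>i. i \<in> I ==> \<bar>c i\<bar> \<le> K"
 shows "lfam m e X I (\<lambda>i x. b i + c i * F i x)"
proof (cases m)
 case 0
 obtain B where B: "\<And>i x y. i\<in>I ==> x\<in>X ==> y\<in>X ==> \<bar>F i x - F i y\<bar> \<le> B * \<bar>x - y\<bar>"
  by (rule lfam_0E[OF assms(2)[unfolded 0]]) (rule that)
 have "\<bar>b i + c i * F i x - (b i + c i * F i y)\<bar> \<le> (K * B) * \<bar>x - y\<bar>" if i: "i \<in> I" "x \<in> X" "y \<in> X" for i x y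
 proof -
  have "\<bar>b i + c i * F i x - (b i + c i * F i y)\<bar> = \<bar>c i\<bar> * \<bar>F i x - F i y\<bar>"
   by (simp add: abs_mult[symmetric] algebra_simps)
  also have "\<dots> \<le> K * (B * \<bar>x - y\<bar>)"
   using assms(3)[OF i(1)] B[OF i] abs_ge_zero[of "c i"] by (intro mult_mono) linarith+
  finally show ?thesis by simp
 qed
 then show ?thesis unfolding 0 by (intro lfam_0I)
next
 case (Suc n)
 obtain F' where *: "\<And>i x. i \<in> I ==> x \<in> X ==> (F i has_real_derivative F' i x) (at x within X)" "bfam n e X I F'"
  by (rule lfam_SucE[OF assms(2)[unfolded Suc]]) (rule that)
 show ?thesis unfolding Suc
  by (rule lfam_SucI[OF _ bfam_scale[OF X *(2) assms(3)]]) (use * in \<open>auto intro!: derivative_eq_intros\<close>)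
qed

text \<open>
 A derivative of the composition is a product of a composition with one derivative less and a derivative
 of the inner function, so the chain rule and closure under products suffice.
\<close>

lemma bfam_comp:
 assumes X: "convex X" and "bfam m e X I F" "lfam m e Y I G" and Y: "convex Y"
  and GX: "\<And>i y. i \<in> I ==> y \<in> Y ==> G i y \<in> X"
 shows "bfam m e Y I (\<lambda>i y. F i (G i y))"
 using assms(2,3)
proof (induction m arbitrary: F)
 case 0
 obtain K where K: "K \<ge> 0" "\<And>i x. i \<in> I ==> x \<in> X ==> \<bar>F i x\<bar> \<le> K"
  "\<And>i x y. i \<in> I ==> x \<in> X ==> y \<in> X ==> \<bar>F i x - F i y\<bar> \<le> K * \<bar>x - y\<bar> powr e" by (rule bfam_0E[OF 0(1)]) (rule that)
 obtain L where L: "L \<ge> 0" "\<And>i x y. i\<in>I ==> x\<in>Y ==> y\<in>Y ==> \<bar>G i x - G i y\<bar> \<le> L * \<bar>x - y\<bar>"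
  by (rule lfam_0E[OF 0(2)]) (rule that)
 define K' where "K' = K * (1 + L powr e)"
 have KK: "K \<le> K'" unfolding K'_def using K(1) by (simp add: mult_le_cancel_left1)
 show ?case
 proof (rule bfam_0I[of _ _ _ K'])
  fix i x assume i: "i \<in> I" "x \<in> Y"
  show "\<bar>F i (G i x)\<bar> \<le> K'" using K(2)[OF i(1) GX[OF i]] KK by linarith
 next
  fix i x y assume i: "i \<in> I" "x \<in> Y" and y: "y \<in> Y"
  have "\<bar>F i (G i x) - F i (G i y)\<bar> \<le> K * \<bar>G i x - G i y\<bar> powr e" using K(3) GX i y by blast
  also have "\<dots> \<le> K * (L * \<bar>x - y\<bar>) powr e"
   using L i y e0 K(1) by (intro mult_left_mono powr_mono2) auto
  also have "\<dots> \<le> K' * \<bar>x - y\<bar> powr e" unfolding K'_def using K(1) L(1)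
   by (simp add: powr_mult algebra_simps)
  finally show "\<bar>F i (G i x) - F i (G i y)\<bar> \<le> K' * \<bar>x - y\<bar> powr e" .
 qed
next
 case (Suc m)
 obtain K F' where F: "\<And>i x. i \<in> I ==> x \<in> X ==> \<bar>F i x\<bar> \<le> K"
  "\<And>i x. i \<in> I ==> x \<in> X ==> (F i has_real_derivative F' i x) (at x within X)" "bfam m e X I F'"
  by (rule bfam_SucE[OF Suc.prems(1)]) (rule that)
 obtain G' where G: "\<And>i x. i \<in> I ==> x \<in> Y ==> (G i has_real_derivative G' i x) (at x within Y)" "bfam m e Y I G'"
  by (rule lfam_SucE[OF Suc.prems(2)]) (rule that)
 show ?case
 proof (rule bfam_SucI[OF _ _ bfam_mult[OF Y Suc.IH[OF F(3) lfam_Suc_imp[OF Y Suc.prems(2)]] G(2)], where K = K])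
  fix i y assume i: "i \<in> I" "y \<in> Y"
  show "\<bar>F i (G i y)\<bar> \<le> K" using F(1)[OF i(1) GX[OF i]] .
  have "(F i has_real_derivative F' i (G i y)) (at (G i y) within G i ` Y)"
   using F(2)[OF i(1) GX[OF i]] by (rule has_field_derivative_subset) (use GX i in auto)
  then show "((\<lambda>y. F i (G i y)) has_real_derivative F' i (G i y) * G' i y) (at y within Y)"
   using DERIV_image_chain[of "F i" _ "G i" y Y] G(1)[OF i] by (auto simp: o_def)
 qed
qed

lemma bfam_exp:
 assumes X: "convex X" and "bfam m e X I F" shows "bfam m e X I (\<lambda>i x. exp (F i x))"
 using assms(2)
proof (induction m)
 case 0
 obtain K where K: "K \<ge> 0" "\<And>i x. i \<in> I ==> x \<in> X ==> \<bar>F i x\<bar> \<le> K"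
  "\<And>i x y. i \<in> I ==> x \<in> X ==> y \<in> X ==> \<bar>F i x - F i y\<bar> \<le> K * \<bar>x - y\<bar> powr e" by (rule bfam_0E[OF 0]) (rule that)
 show ?case
 proof (rule bfam_0I[of _ _ _ "exp K * (1 + K)"])
  fix i x assume i: "i \<in> I" "x \<in> X"
  have "exp (F i x) \<le> exp K" using K(2)[OF i] by simp
  also have "\<dots> \<le> exp K * (1 + K)" using K(1) by (simp add: mult_le_cancel_left1)
  finally show "\<bar>exp (F i x)\<bar> \<le> exp K * (1 + K)" by simp
 next
  fix i x y assume i: "i \<in> I" "x \<in> X" and y: "y \<in> X"
  have "norm (exp (F i x) - exp (F i y)) \<le> exp K * norm (F i x - F i y)"
   by (rule field_differentiable_bound[of "{-K..K}" exp exp])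
    (use K(2)[OF i] K(2)[OF i(1) y] in \<open>auto intro!: derivative_eq_intros simp: abs_le_iff\<close>)
  also have "\<dots> \<le> exp K * (K * \<bar>x - y\<bar> powr e)" using K(3)[OF i y] by (intro mult_left_mono) auto
  also have "\<dots> \<le> exp K * ((1 + K) * \<bar>x - y\<bar> powr e)" by (intro mult_left_mono mult_right_mono) auto
  finally show "\<bar>exp (F i x) - exp (F i y)\<bar> \<le> exp K * (1 + K) * \<bar>x - y\<bar> powr e" by simp
 qed
next
 case (Suc m)
 obtain K F' where F: "\<And>i x. i \<in> I ==> x \<in> X ==> \<bar>F i x\<bar> \<le> K"
  "\<And>i x. i \<in> I ==> x \<in> X ==> (F i has_real_derivative F' i x) (at x within X)" "bfam m e X I F'"
  by (rule bfam_SucE[OF Suc.prems(1)]) (rule that)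
 have b: "bfam m e X I (\<lambda>i x. exp (F i x) * F' i x)"
  using Suc.IH[OF bfam_Suc_imp[OF X Suc.prems]] F(3) by (rule bfam_mult[OF X])
 show ?case
 proof (rule bfam_SucI[OF _ _ b, where K = "exp K"])
  fix i x assume i: "i \<in> I" "x \<in> X"
  show "\<bar>exp (F i x)\<bar> \<le> exp K" using F(1)[OF i] by simp
  show "((\<lambda>x. exp (F i x)) has_real_derivative exp (F i x) * F' i x) (at x within X)"
   using F(2)[OF i] by (auto intro!: derivative_eq_intros)
 qed
qed

text \<open>
 The derivative of \<open>ln \<circ> F\<close> is \<open>exp (- ln F) * F'\<close>; written in this way it is covered by the induction
 hypothesis and the closure under \<open>exp\<close>.
\<close>

lemma bfam_ln:
 assumes X: "convex X" and "bfam m e X I F" and c: "c > 0" "\<And>i x. i \<in> I ==> x \<in> X ==> F i x \<ge> c"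
 shows "bfam m e X I (\<lambda>i x. ln (F i x))"
 using assms(2)
proof (induction m)
 case 0
 obtain K where K: "K \<ge> 0" "\<And>i x. i \<in> I ==> x \<in> X ==> \<bar>F i x\<bar> \<le> K"
  "\<And>i x y. i \<in> I ==> x \<in> X ==> y \<in> X ==> \<bar>F i x - F i y\<bar> \<le> K * \<bar>x - y\<bar> powr e" by (rule bfam_0E[OF 0]) (rule that)
 show ?case
 proof (rule bfam_0I[of _ _ _ "ln_bound c K + K / c"])
  fix i x assume i: "i \<in> I" "x \<in> X"
  have "0 \<le> K / c" using c(1) K(1) by simp
  then show "\<bar>ln (F i x)\<bar> \<le> ln_bound c K + K / c" using ln_bound[OF c(1) c(2)[OF i] K(2)[OF i]] by linarith
 next
  fix i x y assume i: "i \<in> I" "x \<in> X" and y: "y \<in> X"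
  have d: "((\<lambda>z. ln z) has_field_derivative 1 / z) (at z within {c..})" "norm (1/z) \<le> 1 / c" if "z \<in> {c..}" for z
   using c(1) that by (auto intro!: derivative_eq_intros frac_le)
  have "norm (ln (F i x) - ln (F i y)) \<le> 1 / c * norm (F i x - F i y)"
   by (rule field_differentiable_bound[of "{c..}" ln "\<lambda>z. 1 / z"]) (use d c(2)[OF i] c(2)[OF i(1) y] in auto)
  also have "\<dots> \<le> 1 / c * (K * \<bar>x - y\<bar> powr e)" using c(1) K(3)[OF i y] by (intro mult_left_mono) auto
  also have "\<dots> \<le> (ln_bound c K + K / c) * \<bar>x - y\<bar> powr e" unfolding ln_bound_def by (simp add: algebra_simps)
  finally show "\<bar>ln (F i x) - ln (F i y)\<bar> \<le> (ln_bound c K + K / c) * \<bar>x - y\<bar> powr e" by simp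
 qed
next
 case (Suc n)
 obtain K F' where F: "\<And>i x. i \<in> I ==> x \<in> X ==> \<bar>F i x\<bar> \<le> K"
  "\<And>i x. i \<in> I ==> x \<in> X ==> (F i has_real_derivative F' i x) (at x within X)" "bfam n e X I F'"
  by (rule bfam_SucE[OF Suc.prems]) (rule that)
 have "bfam n e X I (\<lambda>i x. exp (-1 * ln (F i x)))"
  by (rule bfam_exp[OF X bfam_scale[OF X Suc.IH[OF bfam_Suc_imp[OF X Suc.prems]], of _ 1]]) simp
 then have b: "bfam n e X I (\<lambda>i x. exp (-1 * ln (F i x)) * F' i x)" using F(3) by (rule bfam_mult[OF X])
 show ?case
 proof (rule bfam_SucI[OF _ _ b])
  fix i x assume i: "i \<in> I" "x \<in> X"
  show "\<bar>ln (F i x)\<bar> \<le> ln_bound c K" by (rule ln_bound[OF c(1) c(2)[OF i] F(1)[OF i]])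
  show "((\<lambda>x. ln (F i x)) has_real_derivative exp (-1 * ln (F i x)) * F' i x) (at x within X)"
   using F(2)[OF i] c(2)[OF i] c(1) by (auto intro!: derivative_eq_intros simp: exp_minus divide_simps)
 qed
qed

lemma bfam_inverse:
 assumes X: "convex X" and "bfam m e X I F" and c: "c > 0" "\<And>i x. i \<in> I ==> x \<in> X ==> F i x \<ge> c"
 shows "bfam m e X I (\<lambda>i x. 1 / F i x)"
proof (rule bfam_cong)
 show "bfam m e X I (\<lambda>i x. exp (-1 * ln (F i x)))"
  by (rule bfam_exp[OF X bfam_scale[OF X bfam_ln[OF X assms(2) c], of _ 1]]) simp_all
 show "exp (-1 * ln (F i x)) = 1 / F i x" if "i \<in> I" "x \<in> X" for i x
  using c(1) c(2)[OF that] by (simp add: exp_minus field_simps)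
qed

text \<open>
 Allows termwise differentiation: all terms are bounded by the same constants up to the summable weights.
\<close>

lemma bfam_series:
 assumes X: "convex X" and "bfam m e X (I \<times> UNIV) (\<lambda>(i,n). V i n)" and a: "summable a" "\<And>n::nat. a n \<ge> 0"
 shows "bfam m e X I (\<lambda>i x. \<Sum>n. a n * V i n x)"
 using assms(2)
proof (induction m arbitrary: V)
 case 0
 obtain K where K0: "\<forall>p\<in>I\<times>(UNIV::nat set). \<forall>x\<in>X. \<bar>(case p of (i,n) \<Rightarrow> V i n) x\<bar> \<le> K \<and>
   (\<forall>y\<in>X. \<bar>(case p of (i,n) \<Rightarrow> V i n) x - (case p of (i,n) \<Rightarrow> V i n) y\<bar> \<le> K * \<bar>x - y\<bar> powr e)"
  using "0" unfolding bfam.simps by blast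
 have K: "\<bar>V i n x\<bar> \<le> K" "\<bar>V i n x - V i n y\<bar> \<le> K * \<bar>x - y\<bar> powr e" if "i \<in> I" "x \<in> X" "y \<in> X" for i n x y
  using bspec[OF K0, of "(i,n)"] that by auto
 have s: "summable (\<lambda>n. a n * V i n x)" "\<bar>\<Sum>n. a n * V i n x\<bar> \<le> (\<Sum>n. a n) * K" if "i \<in> I" "x \<in> X" for i x
  using abs_suminf_weighted_le[OF a, of "\<lambda>n. V i n x" K] K(1)[OF that that(2)] by auto
 have "\<bar>(\<Sum>n. a n * V i n x) - (\<Sum>n. a n * V i n y)\<bar> \<le> (\<Sum>n. a n) * K * \<bar>x - y\<bar> powr e"
  if i: "i \<in> I" "x \<in> X" and y: "y \<in> X" for i x y
 proof -
  have "(\<Sum>n. a n * V i n x) - (\<Sum>n. a n * V i n y) = (\<Sum>n. a n * (V i n x - V i n y))"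
   by (subst suminf_diff[OF s(1)[OF i] s(1)[OF i(1) y]]) (simp add: algebra_simps)
  then show ?thesis
   using abs_suminf_weighted_le(2)[OF a, of "\<lambda>n. V i n x - V i n y" "K * \<bar>x - y\<bar> powr e"] K(2) i y
   by (simp add: mult.assoc)
 qed
 then show ?case using s(2) K(1)
  by (intro bfam_0I[of _ _ _ "(\<Sum>n. a n) * K"]) auto
next
 case (Suc m)
 then obtain F' K where 0: "\<forall>p\<in>I\<times>(UNIV::nat set). \<forall>x\<in>X. \<bar>(case p of (i,n) \<Rightarrow> V i n) x\<bar> \<le> K"
  "\<forall>p\<in>I\<times>UNIV. \<forall>x\<in>X. ((case p of (i,n) \<Rightarrow> V i n) has_real_derivative F' p x) (at x within X)" "bfam m e X (I\<times>UNIV) F'"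
  unfolding bfam.simps by blast
 define V' where "V' = (\<lambda>i n. F' (i,n))"
 have b': "bfam m e X (I\<times>UNIV) (\<lambda>(i,n). V' i n)" using 0(3) unfolding V'_def by (simp add: case_prod_unfold)
 have d: "(V i n has_real_derivative V' i n x) (at x within X)" "\<bar>V i n x\<bar> \<le> K" if "i \<in> I" "x \<in> X" for i n x
  using bspec[OF 0(1), of "(i,n)"] bspec[OF 0(2), of "(i,n)"] that unfolding V'_def by auto
 obtain K' where K'0: "\<And>p x. p \<in> I \<times> UNIV ==> x \<in> X ==> \<bar>(\<lambda>(i,n). V' i n) p x\<bar> \<le> K'"
  by (rule bfam_bounded[OF b']) (rule that)
 have K': "\<bar>V' i n x\<bar> \<le> K'" if "i \<in> I" "x \<in> X" for i n x using K'0[of "(i,n)" x] that by auto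
 have der: "((\<lambda>x. \<Sum>n. a n * V i n x) has_real_derivative (\<Sum>n. a n * V' i n x)) (at x within X)"
  if i: "i \<in> I" and x: "x \<in> X" for i x
 proof -
  have "uniform_limit X (\<lambda>n x. \<Sum>k<n. a k * V' i k x) (\<lambda>x. \<Sum>k. a k * V' i k x) sequentially"
   by (rule Weierstrass_m_test[OF _ summable_mult2[OF a(1), of K']])
    (use K' i a in \<open>auto simp: abs_mult intro!: mult_left_mono\<close>)
  from has_field_derivative_series[OF X _ this x, of "\<lambda>n x. a n * V i n x"] obtain g where
   g: "\<forall>x\<in>X. (\<lambda>n. a n * V i n x) sums g x \<and> (g has_field_derivative (\<Sum>k. a k * V' i k x)) (at x within X)"
   using d[OF i] abs_suminf_weighted_le(1)[OF a, of "\<lambda>n. V i n x" K] x by (auto intro!: DERIV_cmult)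
  show ?thesis
   by (rule has_field_derivative_transform_within[of g _ _ _ 1]) (use g x in \<open>auto simp: sums_iff\<close>)
 qed
 show ?case
  by (rule bfam_SucI[OF _ der Suc.IH[OF b'], where K = "(\<Sum>n. a n) * K"])
   (use abs_suminf_weighted_le(2)[OF a] d in auto)
qed

lemma lfam_inv:
 assumes X: "convex X" and Y: "convex Y"
  and d: "\<And>i x. i \<in> I ==> x \<in> X ==> (G i has_real_derivative G' i x) (at x within X)"
  and c: "c > 0" "\<And>i x. i \<in> I ==> x \<in> X ==> G' i x \<ge> c"
  and GY: "\<And>i. i \<in> I ==> G i ` X = Y"
  and Hi: "\<And>i x. i \<in> I ==> x \<in> X ==> H i (G i x) = x"
  and b: "m > 0 ==> bfam (m - 1) e X I G'"
 shows "lfam m e Y I H"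
  and "\<And>i y. i \<in> I ==> y \<in> Y ==> (H i has_real_derivative 1 / G' i (H i y)) (at y within Y)"
proof -
 have HX: "H i y \<in> X" "G i (H i y) = y" if "i \<in> I" "y \<in> Y" for i y using that GY Hi by (metis imageE)+
 have low: "c * (v - u) \<le> G i v - G i u" if i: "i \<in> I" and uv: "u \<in> X" "v \<in> X" "u \<le> v" for i u v
 proof -
  have sub: "{u..v} \<subseteq> X" using X uv
   by (metis closed_segment_eq_real_ivl1 closed_segment_subset)
  have "\<exists>x\<in>{u..v}. G i v - G i u = (\<lambda>h. G' i x * h) (v - u)"
   using d[OF i] sub has_field_derivative_subset[of "G i" _ _ X "{u..v}"]
   by (intro mvt_very_simple[OF uv(3)]) (auto simp: has_field_derivative_def[symmetric])
  then obtain x where "x \<in> {u..v}" "G i v - G i u = G' i x * (v - u)" by auto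
  then show ?thesis using c(2)[OF i, of x] sub uv(3) by (metis diff_ge_0_iff_ge mult_right_mono subsetD)
 qed
 have lip: "\<bar>H i y - H i z\<bar> \<le> 1 / c * \<bar>y - z\<bar>" if i: "i \<in> I" "y \<in> Y" "z \<in> Y" for i y z
 proof -
  have "c * \<bar>H i y - H i z\<bar> \<le> \<bar>G i (H i y) - G i (H i z)\<bar>"
   using low[OF i(1) HX(1)[OF i(1,2)] HX(1)[OF i(1,3)]] low[OF i(1) HX(1)[OF i(1,3)] HX(1)[OF i(1,2)]]
   by (smt (verit))
  then show ?thesis using HX(2) i c(1) by (simp add: field_simps)
 qed
 show dH: "(H i has_real_derivative 1 / G' i (H i y)) (at y within Y)" if i: "i \<in> I" and y: "y \<in> Y" for i y
 proof -
  have "((\<lambda>u. (G i u - G i (H i y)) / (u - H i y)) \<longlongrightarrow> G' i (H i y)) (at (H i y) within X)"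
   using d[OF i HX(1)[OF i y]] by (simp add: has_field_derivative_iff)
  moreover have "filterlim (H i) (at (H i y) within X) (at y within Y)"
   unfolding filterlim_at
  proof (rule conjI[rotated])
   have "continuous_on Y (H i)"
    by (rule lipschitz_on_continuous_on[of "1 / c"]) (use lip[OF i] c(1) in \<open>auto simp: lipschitz_on_def dist_real_def\<close>)
   then show "(H i \<longlongrightarrow> H i y) (at y within Y)" using y by (simp add: continuous_on_def)
   show "eventually (\<lambda>z. H i z \<in> X \<and> H i z \<noteq> H i y) (at y within Y)"
    unfolding eventually_at using HX i y by (metis zero_less_one)
  qed
  ultimately have "((\<lambda>z. (G i (H i z) - G i (H i y)) / (H i z - H i y)) \<longlongrightarrow> G' i (H i y)) (at y within Y)"
   by (rule filterlim_compose)
  then have "((\<lambda>z. inverse ((G i (H i z) - G i (H i y)) / (H i z - H i y))) \<longlongrightarrow> inverse (G' i (H i y))) (at y within Y)"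
   by (rule tendsto_inverse) (use c HX(1)[OF i y] i in \<open>smt (verit)\<close>)
  then have "((\<lambda>z. (H i z - H i y) / (z - y)) \<longlongrightarrow> 1 / G' i (H i y)) (at y within Y)"
   by (rule tendsto_eq_rhs[OF Lim_transform_within[OF _ zero_less_one]])
    (use HX(2) i y in \<open>auto simp: inverse_eq_divide\<close>)
  then show ?thesis by (simp add: has_field_derivative_iff)
 qed
 show "lfam m e Y I H"
  using b
 proof (induction m)
  case 0
  then show ?case using lip by (intro lfam_0I)
 next
  case (Suc m)
  then have bG: "bfam m e X I G'" by simp
  have "lfam m e Y I H" using Suc.IH bfam_mono[OF X bG, of "m - 1"] by auto
  then have "bfam m e Y I (\<lambda>i y. 1 / G' i (H i y))"
   using bfam_comp[OF X bfam_inverse[OF X bG c] _ Y] HX(1) by blast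
  then show ?case using dH by (intro lfam_SucI)
 qed
qed

end

section \<open>Families and iterated derivatives\<close>

abbreviation "D01 \<equiv> nth_deriv {0..1}"

lemma has_real_derivative_cong_on:
 assumes "x \<in> X" "\<And>x. x \<in> X ==> f x = g x"
 shows "(f has_real_derivative D) (at x within X) \<longleftrightarrow> (g has_real_derivative D) (at x within X)"
 using assms has_field_derivative_transform_within[of _ D x X 1] by (metis zero_less_one)

lemma nth_deriv_cong:
 assumes "\<And>x. x \<in> X ==> f x = g x" "x \<in> X"
 shows "nth_deriv X n f x = nth_deriv X n g x"
 using assms(2)
proof (induction n arbitrary: x)
 case (Suc n)
 have "(nth_deriv X n f has_vector_derivative D) (at x within X) \<longleftrightarrow> (nth_deriv X n g has_vector_derivative D) (at x within X)" for D
  using has_real_derivative_cong_on[OF Suc.prems, of "nth_deriv X n f" "nth_deriv X n g" D] Suc.IH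
  by (simp add: has_real_derivative_iff_has_vector_derivative)
 then show ?case by (simp add: vector_derivative_def)
qed (use assms in auto)

lemma at_within_nontrivial: "x \<in> {0..1::real} ==> at x within {0..1} \<noteq> bot" "at (x::real) within UNIV \<noteq> bot"
 by (auto simp: trivial_limit_within islimpt_Icc)

lemma Ck_on_0: "Ck_on 0 X f \<longleftrightarrow> continuous_on X f" by (simp add: Ck_on_def)

lemma Ck_eps_on_0: "Ck_eps_on 0 e X f \<longleftrightarrow> continuous_on X f \<and> locally_Hoelder_on e X f" by (simp add: Ck_eps_on_def Ck_on_0)

lemma locally_Hoelder_cong: "(\<And>x. x \<in> X ==> f x = g x) ==> locally_Hoelder_on e X f = locally_Hoelder_on e X g"
 unfolding locally_Hoelder_on_def by simp

lemma differentiable_on_cong: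
 fixes f g :: "real \<Rightarrow> real"
 assumes "\<And>x. x \<in> X ==> f x = g x" shows "f differentiable_on X \<longleftrightarrow> g differentiable_on X"
 unfolding differentiable_on_def real_differentiable_def
 using has_real_derivative_cong_on[of _ X f g] assms by simp

lemma Ck_on_cong:
 assumes "\<And>x. x \<in> X ==> f x = g x" shows "Ck_on k X f \<longleftrightarrow> Ck_on k X g"
proof -
 have "nth_deriv X i f differentiable_on X \<longleftrightarrow> nth_deriv X i g differentiable_on X" for i
  by (rule differentiable_on_cong) (rule nth_deriv_cong[OF assms])
 moreover have "continuous_on X (nth_deriv X k f) \<longleftrightarrow> continuous_on X (nth_deriv X k g)"
  by (rule continuous_on_cong[OF refl]) (rule nth_deriv_cong[OF assms])
 ultimately show ?thesis unfolding Ck_on_def by simp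
qed

context
 fixes X :: "real set"
 assumes nt: "\<And>x. x \<in> X ==> at x within X \<noteq> bot"
begin

lemma vector_derivative_eq_real:
 assumes "(f has_real_derivative D) (at x within X)" "x \<in> X"
 shows "vector_derivative f (at x within X) = D"
 using assms nt by (intro vector_derivative_within) (auto simp: has_real_derivative_iff_has_vector_derivative)

text \<open>
 Iterated derivatives are defined by differentiating once more at the end, whereas the families
 differentiate first.
\<close>

lemma nth_deriv_Suc_shift:
 assumes "\<And>x. x \<in> X ==> (f has_real_derivative f' x) (at x within X)" "x \<in> X"
 shows "nth_deriv X (Suc n) f x = nth_deriv X n f' x"
 using assms(2)
proof (induction n arbitrary: x)
 case 0 then show ?case using vector_derivative_eq_real[OF assms(1)] by simp
next
 case (Suc n)
 have "nth_deriv X (Suc (Suc n)) f x = nth_deriv X (Suc 0) (nth_deriv X (Suc n) f) x" by simp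
 also have "\<dots> = nth_deriv X (Suc 0) (nth_deriv X n f') x"
  by (rule nth_deriv_cong[OF Suc.IH Suc.prems])
 finally show ?case by simp
qed

lemma differentiable_on_real_iff:
 "f differentiable_on X \<longleftrightarrow> (\<forall>x\<in>X. (f has_real_derivative vector_derivative f (at x within X)) (at x within X))"
proof -
 have "f differentiable (at x within X) \<longleftrightarrow> (f has_real_derivative vector_derivative f (at x within X)) (at x within X)" if "x \<in> X" for x
  using that vector_derivative_eq_real real_differentiable_def by metis
 then show ?thesis unfolding differentiable_on_def by blast
qed

lemma Ck_on_Suc:
 "Ck_on (Suc m) X f \<longleftrightarrow> (\<exists>f'. (\<forall>x\<in>X. (f has_real_derivative f' x) (at x within X)) \<and> Ck_on m X f')" (is "?A = ?B")
proof
 assume A: ?A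
 define f' where "f' = nth_deriv X 1 f"
 have d: "(f has_real_derivative f' x) (at x within X)" if "x \<in> X" for x
  using A that unfolding Ck_on_def f'_def by (auto simp: differentiable_on_real_iff)
 have "nth_deriv X i f' differentiable_on X \<longleftrightarrow> nth_deriv X (Suc i) f differentiable_on X" for i
  by (rule differentiable_on_cong) (use nth_deriv_Suc_shift[OF d] in simp)
 moreover have "continuous_on X (nth_deriv X m f') \<longleftrightarrow> continuous_on X (nth_deriv X (Suc m) f)"
  by (rule continuous_on_cong[OF refl]) (use nth_deriv_Suc_shift[OF d] in simp)
 ultimately show ?B using A d unfolding Ck_on_def by (intro exI[of _ f']) auto
next
 assume ?B
 then obtain f' where d: "\<And>x. x \<in> X ==> (f has_real_derivative f' x) (at x within X)" and B: "Ck_on m X f'" by blast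
 have "nth_deriv X i f' differentiable_on X \<longleftrightarrow> nth_deriv X (Suc i) f differentiable_on X" for i
  by (rule differentiable_on_cong) (use nth_deriv_Suc_shift[OF d] in simp)
 moreover have "continuous_on X (nth_deriv X m f') \<longleftrightarrow> continuous_on X (nth_deriv X (Suc m) f)"
  by (rule continuous_on_cong[OF refl]) (use nth_deriv_Suc_shift[OF d] in simp)
 moreover have "nth_deriv X 0 f differentiable_on X"
  using d real_differentiable_def by (auto simp: differentiable_on_def)
 ultimately show ?A using B unfolding Ck_on_def by (metis less_Suc_eq_0_disj)
qed

lemma Ck_eps_on_Suc:
 "Ck_eps_on (Suc m) e X f \<longleftrightarrow> (\<exists>f'. (\<forall>x\<in>X. (f has_real_derivative f' x) (at x within X)) \<and> Ck_eps_on m e X f')"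
proof -
 have "locally_Hoelder_on e X (nth_deriv X (Suc m) f) \<longleftrightarrow> locally_Hoelder_on e X (nth_deriv X m f')"
  if "\<And>x. x \<in> X ==> (f has_real_derivative f' x) (at x within X)" for f'
  by (rule locally_Hoelder_cong) (use nth_deriv_Suc_shift[OF that] in simp)
 then show ?thesis unfolding Ck_eps_on_def Ck_on_Suc by blast
qed

lemma Ck_on_has_derivative:
 assumes "Ck_on k X f" "i < k" "x \<in> X"
 shows "(nth_deriv X i f has_real_derivative nth_deriv X (Suc i) f x) (at x within X)"
 using assms by (auto simp: Ck_on_def differentiable_on_real_iff)

lemma nth_deriv_diff:
 assumes "Ck_on k X f" "Ck_on k X g" "x \<in> X" "n \<le> k"
 shows "nth_deriv X n (\<lambda>x. f x - g x) x = nth_deriv X n f x - nth_deriv X n g x"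
 using assms
proof (induction n arbitrary: k f g)
 case (Suc n)
 then obtain m where k: "k = Suc m" by (metis Suc_le_D)
 obtain f' g' where d: "\<And>x. x \<in> X ==> (f has_real_derivative f' x) (at x within X)" "Ck_on m X f'"
  "\<And>x. x \<in> X ==> (g has_real_derivative g' x) (at x within X)" "Ck_on m X g'"
  using Suc.prems unfolding k Ck_on_Suc by blast
 have "((\<lambda>x. f x - g x) has_real_derivative f' x - g' x) (at x within X)" if "x \<in> X" for x
  using d that by (auto intro!: derivative_intros)
 from nth_deriv_Suc_shift[OF this Suc.prems(3), of n] show ?case
  using Suc.IH[OF d(2,4) Suc.prems(3)] Suc.prems(4) k nth_deriv_Suc_shift[OF d(1) Suc.prems(3), of n]
   nth_deriv_Suc_shift[OF d(3) Suc.prems(3), of n] by simp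
qed simp

lemma Ck_on_diff:
 assumes "Ck_on k X f" "Ck_on k X g" shows "Ck_on k X (\<lambda>x. f x - g x)"
 using assms
proof (induction k arbitrary: f g)
 case (Suc n)
 then obtain f' g' where d: "\<And>x. x \<in> X ==> (f has_real_derivative f' x) (at x within X)" "Ck_on n X f'"
  "\<And>x. x \<in> X ==> (g has_real_derivative g' x) (at x within X)" "Ck_on n X g'"
  unfolding Ck_on_Suc by blast
 then show ?case unfolding Ck_on_Suc using Suc.IH[OF d(2,4)]
  by (intro exI[of _ "\<lambda>x. f' x - g' x"]) (auto intro!: derivative_intros)
qed (auto simp: Ck_on_0 intro: continuous_intros)

lemma bfam_imp_Ck_eps_on:
 assumes e: "0 < e" "bfam k e X I F" "i \<in> I"
 shows "Ck_eps_on k e X (F i)"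
 using e(2)
proof (induction k arbitrary: F)
 case 0
 obtain K where K0: "\<And>i x y. i \<in> I ==> x \<in> X ==> y \<in> X ==> \<bar>F i x - F i y\<bar> \<le> K * \<bar>x - y\<bar> powr e"
  by (rule bfam_0E[OF 0]) (rule that)
 note K = K0[OF e(3)]
 have "continuous_on X (F i)"
  unfolding continuous_on_def
 proof
  fix x assume x: "x \<in> X"
  have "((\<lambda>y. x - y) \<longlongrightarrow> x - x) (at x within X)" by (intro tendsto_intros)
  then have "((\<lambda>y. \<bar>x - y\<bar>) \<longlongrightarrow> 0) (at x within X)" using tendsto_rabs by fastforce
  from tendsto_powr'[OF this tendsto_const[of e]] have "((\<lambda>y. \<bar>x - y\<bar> powr e) \<longlongrightarrow> 0) (at x within X)" using e(1) by simp
  from tendsto_mult_left[OF this, of K] have lim: "((\<lambda>y. K * \<bar>x - y\<bar> powr e) \<longlongrightarrow> 0) (at x within X)" by simp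
  have "eventually (\<lambda>y. norm (F i x - F i y) \<le> K * \<bar>x - y\<bar> powr e) (at x within X)"
   unfolding eventually_at using K[OF x] by (intro exI[of _ 1]) auto
  from Lim_null_comparison[OF this lim] have "((\<lambda>y. F i x - F i y) \<longlongrightarrow> 0) (at x within X)" .
  from tendsto_diff[OF tendsto_const[of "F i x"] this] show "(F i \<longlongrightarrow> F i x) (at x within X)" by simp
 qed
 moreover have "locally_Hoelder_on e X (F i)"
  unfolding locally_Hoelder_on_def using K by (auto intro!: exI[of _ UNIV] exI[of _ K])
 ultimately show ?case by (simp add: Ck_eps_on_0)
next
 case (Suc k)
 obtain K F' where *: "\<And>j x. j \<in> I ==> x \<in> X ==> \<bar>F j x\<bar> \<le> K"
  "\<And>j x. j \<in> I ==> x \<in> X ==> (F j has_real_derivative F' j x) (at x within X)" "bfam k e X I F'"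
  by (rule bfam_SucE[OF Suc.prems]) (rule that)
 show ?case unfolding Ck_eps_on_Suc
  by (intro exI[of _ "F' i"] conjI ballI *(2)[OF e(3)] Suc.IH[OF *(3)])
qed

lemma lfam_imp_Ck_eps_on:
 assumes "0 < e" "lfam (Suc m) e X I F" "i \<in> I"
 shows "Ck_eps_on (Suc m) e X (F i)"
proof -
 obtain F' where *: "\<And>i x. i\<in>I ==> x\<in>X ==> (F i has_real_derivative F' i x) (at x within X)" "bfam m e X I F'"
  by (rule lfam_SucE[OF assms(2)]) (rule that)
 show ?thesis unfolding Ck_eps_on_Suc
  by (intro exI[of _ "F' i"] conjI ballI *(1)[OF assms(3)] bfam_imp_Ck_eps_on[OF assms(1) *(2) assms(3)])
qed

lemma bfam_nth_deriv_Hoelder: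
 assumes "bfam m e X I F"
 shows "\<exists>K. \<forall>i\<in>I. \<forall>x\<in>X. \<forall>y\<in>X. \<bar>nth_deriv X m (F i) x - nth_deriv X m (F i) y\<bar> \<le> K * \<bar>x - y\<bar> powr e"
 using assms
proof (induction m arbitrary: F)
 case 0 then show ?case by auto
next
 case (Suc m)
 obtain K F' where d0: "\<And>i x. i\<in>I ==> x\<in>X ==> \<bar>F i x\<bar> \<le> K"
  and d: "\<And>i x. i\<in>I ==> x\<in>X ==> (F i has_real_derivative F' i x) (at x within X)" and b: "bfam m e X I F'"
  by (rule bfam_SucE[OF Suc.prems]) (rule that)
 have eq: "nth_deriv X (Suc m) (F i) x = nth_deriv X m (F' i) x" if "i \<in> I" "x \<in> X" for i x
  by (rule nth_deriv_Suc_shift[OF d]) (use that in auto)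
 show ?case using Suc.IH[OF b] by (simp add: eq del: nth_deriv.simps)
qed

lemma lfam_nth_deriv_Hoelder:
 assumes "lfam (Suc m) e X I F"
 shows "\<exists>K. \<forall>i\<in>I. \<forall>x\<in>X. \<forall>y\<in>X. \<bar>nth_deriv X (Suc m) (F i) x - nth_deriv X (Suc m) (F i) y\<bar> \<le> K * \<bar>x - y\<bar> powr e"
proof -
 obtain F' where d: "\<And>i x. i\<in>I ==> x\<in>X ==> (F i has_real_derivative F' i x) (at x within X)" and b: "bfam m e X I F'"
  by (rule lfam_SucE[OF assms]) (rule that)
 have eq: "nth_deriv X (Suc m) (F i) x = nth_deriv X m (F' i) x" if "i \<in> I" "x \<in> X" for i x
  by (rule nth_deriv_Suc_shift[OF d]) (use that in auto)
 show ?thesis using bfam_nth_deriv_Hoelder[OF b] by (simp add: eq del: nth_deriv.simps)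
qed

end

lemma Ck_on_Suc01:
 "Ck_on (Suc m) {0..1} f \<longleftrightarrow> (\<exists>f'. (\<forall>x\<in>{0..1}. (f has_real_derivative f' x) (at x within {0..1})) \<and> Ck_on m {0..1} f')"
 by (rule Ck_on_Suc) (rule at_within_nontrivial)

lemma Ck_eps_on_Suc_UNIV:
 "Ck_eps_on (Suc m) e UNIV f \<longleftrightarrow> (\<exists>f'. (\<forall>x. (f has_real_derivative f' x) (at x)) \<and> Ck_eps_on m e UNIV f')"
 using Ck_eps_on_Suc[of UNIV m e f] at_within_nontrivial(2) by simp

lemma nth_deriv_Suc_shift01:
 assumes "\<And>x. x \<in> {0..1} ==> (f has_real_derivative f' x) (at x within {0..1})" "x \<in> {0..1}"
 shows "D01 (Suc n) f x = D01 n f' x"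
 by (rule nth_deriv_Suc_shift[OF _ assms]) (rule at_within_nontrivial)

lemma Ck_on_SucE01:
 assumes "Ck_on (Suc m) {0..1} f"
 obtains f' where "\<And>x. x \<in> {0..1} ==> (f has_real_derivative f' x) (at x within {0..1})" "Ck_on m {0..1} f'"
 using assms that unfolding Ck_on_Suc01 by metis

lemma nth_deriv_affine:
 assumes "Ck_on k {0..1} f" "n \<le> k" "x \<in> {0..1}" and as: "\<And>x. x \<in> {0..1} ==> a + s * x \<in> {0..1::real}"
 shows "D01 n (\<lambda>x. c * (f (a + s * x))) x = c * s ^ n * D01 n f (a + s * x)"
  and "Ck_on k {0..1} (\<lambda>x. c * (f (a + s * x)))"
proof -
 have der: "((\<lambda>x. c * (f (a + s * x))) has_real_derivative c * s * f' (a + s * x)) (at x within {0..1})"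
  if d: "\<And>x. x \<in> {0..1} ==> (f has_real_derivative f' x) (at x within {0..1})" and x: "x \<in> {0..1}" for f f' c x
 proof -
  have "(f has_real_derivative f' (a + s * x)) (at (a + s * x) within (\<lambda>x. a + s * x) ` {0..1})"
   by (rule has_field_derivative_subset[OF d[OF as[OF x]]]) (use as in blast)
  moreover have "((\<lambda>x. a + s * x) has_real_derivative s) (at x within {0..1})"
   by (auto intro!: derivative_eq_intros)
  ultimately have "((f \<circ> (\<lambda>x. a + s * x)) has_real_derivative f' (a + s * x) * s) (at x within {0..1})"
   by (rule DERIV_image_chain)
  from DERIV_cmult[OF this, of c] show ?thesis by (simp add: o_def mult_ac)
 qed
 show "Ck_on k {0..1} (\<lambda>x. c * (f (a + s * x)))" using assms(1)
 proof (induction k arbitrary: f c)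
  case 0
  have sub: "(\<lambda>x. a + s * x) ` {0..1} \<subseteq> {0..1}" using as by blast
  have "continuous_on {0..1} (\<lambda>x. f (a + s * x))"
   by (rule continuous_on_compose2[OF 0[unfolded Ck_on_0] _ sub]) (intro continuous_intros)
  then show ?case unfolding Ck_on_0 by (intro continuous_intros)
 next
  case (Suc k)
  obtain f' where d: "\<And>x. x \<in> {0..1} ==> (f has_real_derivative f' x) (at x within {0..1})" "Ck_on k {0..1} f'"
   by (rule Ck_on_SucE01[OF Suc.prems]) (rule that)
  show ?case unfolding Ck_on_Suc01
   by (intro exI[of _ "\<lambda>x. c * s * f' (a + s * x)"] conjI ballI der[OF d(1)] Suc.IH[OF d(2)])
 qed
 show "D01 n (\<lambda>x. c * (f (a + s * x))) x = c * s ^ n * D01 n f (a + s * x)"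
  using assms(1,2)
 proof (induction n arbitrary: k f c)
  case (Suc n)
  then obtain m where k: "k = Suc m" by (metis Suc_le_D)
  obtain f' where d: "\<And>x. x \<in> {0..1} ==> (f has_real_derivative f' x) (at x within {0..1})" "Ck_on m {0..1} f'"
   by (rule Ck_on_SucE01[OF Suc.prems(1)[unfolded k]]) (rule that)
  have "D01 (Suc n) (\<lambda>x. c * (f (a + s * x))) x = D01 n (\<lambda>x. c * s * f' (a + s * x)) x"
   by (rule nth_deriv_Suc_shift01[OF der[OF d(1)] assms(3)])
  also have "\<dots> = c * s * s ^ n * D01 n f' (a + s * x)"
   using Suc.IH[OF d(2)] Suc.prems(2) k by simp
  also have "D01 n f' (a + s * x) = D01 (Suc n) f (a + s * x)"
   using nth_deriv_Suc_shift01[OF d(1) as[OF assms(3)]] by simp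
  finally show ?case by simp
 qed simp
qed

lemma nth_deriv_const: "x \<in> {0..1} ==> D01 n (\<lambda>x. b) x = (if n = 0 then b else 0)"
proof (induction n arbitrary: x b)
 case (Suc n)
 have "D01 (Suc n) (\<lambda>x. b) x = D01 n (\<lambda>x. 0) x"
  by (rule nth_deriv_Suc_shift01) (use Suc.prems in auto)
 then show ?case using Suc.IH[OF Suc.prems, of 0] by auto
qed simp

lemma Ck_on_const: "Ck_on k {0..1} (\<lambda>x. b)"
proof (induction k arbitrary: b)
 case (Suc k)
 show ?case by (subst Ck_on_Suc01) (auto intro!: exI[of _ "\<lambda>_. 0"] Suc)
qed (simp add: Ck_on_0)

lemma nth_deriv_affine_shift:
 assumes "Ck_on k {0..1} f" "n \<le> k" "x \<in> {0..1}" and as: "\<And>x. x \<in> {0..1} ==> a + s * x \<in> {0..1::real}"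
 shows "D01 n (\<lambda>x. (f (a + s * x) - b) / c) x = (s ^ n / c) * D01 n f (a + s * x) - (if n = 0 then b / c else 0)"
proof -
 have "D01 n (\<lambda>x. (1 / c) * (f (a + s * x)) - b / c) x = (s ^ n / c) * D01 n f (a + s * x) - (if n = 0 then b / c else 0)"
  using nth_deriv_diff[OF _ nth_deriv_affine(2)[OF assms(1-3) as, of "1 / c"] Ck_on_const assms(3,2), of "b / c"]
   nth_deriv_affine(1)[OF assms, of "1 / c"] nth_deriv_const[OF assms(3), of n "b / c"] at_within_nontrivial(1) by simp
 then show ?thesis by (simp add: diff_divide_distrib)
qed

lemma bfam_singleton:
 assumes "bfam m e X {i} F" shows "bfam m e X {j} (\<lambda>_. F i)"
 using bfam_reindex[OF assms, of "{j}" "\<lambda>_. i"] by simp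

lemma bfam_insert:
 assumes "bfam m e X {i} F" "bfam m e X I F" "i \<notin> I" shows "bfam m e X (insert i I) F"
 using assms(1,2)
proof (induction m arbitrary: F)
 case 0
 obtain K where K: "K \<ge> 0" "\<And>j x. j \<in> {i} ==> x \<in> X ==> \<bar>F j x\<bar> \<le> K"
  "\<And>j x y. j \<in> {i} ==> x \<in> X ==> y \<in> X ==> \<bar>F j x - F j y\<bar> \<le> K * \<bar>x - y\<bar> powr e" by (rule bfam_0E[OF 0(1)]) (rule that)
 obtain L where L: "L \<ge> 0" "\<And>j x. j \<in> I ==> x \<in> X ==> \<bar>F j x\<bar> \<le> L"
  "\<And>j x y. j \<in> I ==> x \<in> X ==> y \<in> X ==> \<bar>F j x - F j y\<bar> \<le> L * \<bar>x - y\<bar> powr e" by (rule bfam_0E[OF 0(2)]) (rule that)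
 show ?case
 proof (rule bfam_0I[of _ _ _ "K + L"])
  fix j x y assume j: "j \<in> insert i I" and xy: "x \<in> X" "y \<in> X"
  have n: "0 \<le> K * \<bar>x - y\<bar> powr e" "0 \<le> L * \<bar>x - y\<bar> powr e" using K(1) L(1) by simp_all
  show "\<bar>F j x - F j y\<bar> \<le> (K + L) * \<bar>x - y\<bar> powr e"
   unfolding distrib_right using j K(3)[OF _ xy, of j] L(3)[OF _ xy, of j] n by (cases "j = i") auto
 next
  fix j x assume "j \<in> insert i I" "x \<in> X"
  then show "\<bar>F j x\<bar> \<le> K + L" using K(1) K(2)[of j x] L(1) L(2)[of j x] by (cases "j = i") auto
 qed
next
 case (Suc m)
 obtain K F' where F: "\<And>j x. j \<in> {i} ==> x \<in> X ==> \<bar>F j x\<bar> \<le> K"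
  "\<And>j x. j \<in> {i} ==> x \<in> X ==> (F j has_real_derivative F' j x) (at x within X)" "bfam m e X {i} F'" by (rule bfam_SucE[OF Suc.prems(1)]) (rule that)
 obtain L G' where G: "\<And>j x. j \<in> I ==> x \<in> X ==> \<bar>F j x\<bar> \<le> L"
  "\<And>j x. j \<in> I ==> x \<in> X ==> (F j has_real_derivative G' j x) (at x within X)" "bfam m e X I G'" by (rule bfam_SucE[OF Suc.prems(2)]) (rule that)
 define H where "H = (\<lambda>j. if j = i then F' j else G' j)"
 have b: "bfam m e X (insert i I) H"
  by (rule Suc.IH[OF bfam_cong[OF F(3)] bfam_cong[OF G(3)]]) (use assms(3) in \<open>auto simp: H_def\<close>)
 show ?case
 proof (rule bfam_SucI[OF _ _ b])
  fix j x assume j: "j \<in> insert i I" "x \<in> X"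
  show "\<bar>F j x\<bar> \<le> \<bar>K\<bar> + \<bar>L\<bar>" using j F(1)[of j x] G(1)[of j x] by (cases "j = i") auto
  show "(F j has_real_derivative H j x) (at x within X)" using j F(2)[of j x] G(2)[of j x] unfolding H_def by (cases "j = i") auto
 qed
qed

lemma bfam_finite:
 assumes "finite I" "\<And>i. i \<in> I ==> bfam m e X {i} F" shows "bfam m e X I F"
 using assms
proof (induction I)
 case empty
 show ?case by (rule bfam_cong[OF bfam_const[of "{}" "\<lambda>_. 0" 0]]) auto
qed (simp add: bfam_insert)

text \<open>
 A Lebesgue number \<open>L\<close> of a finite cover: points with distance less than \<open>L\<close> lie in one set of the
 cover, and for all other pairs the bound of \<open>f\<close> suffices.
\<close>

lemma Hoelder_local_to_global:
 assumes "locally_Hoelder_on e UNIV f" "continuous_on UNIV f" "0 < e"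
 shows "\<exists>K. \<forall>x\<in>{0..1}. \<forall>y\<in>{0..1}. \<bar>f x - f y\<bar> \<le> K * \<bar>x - y\<bar> powr e"
proof -
 have "\<forall>x. \<exists>r B. r > 0 \<and> (\<forall>y\<in>ball x r. \<forall>z\<in>ball x r. \<bar>f y - f z\<bar> \<le> B * \<bar>y - z\<bar> powr e)"
 proof
  fix x
  obtain U B where "open U" "x \<in> U" "\<forall>y\<in>U. \<forall>z\<in>U. \<bar>f y - f z\<bar> \<le> B * \<bar>y - z\<bar> powr e"
   using assms(1) unfolding locally_Hoelder_on_def by (metis IntI UNIV_I)
  then show "\<exists>r B. r > 0 \<and> (\<forall>y\<in>ball x r. \<forall>z\<in>ball x r. \<bar>f y - f z\<bar> \<le> B * \<bar>y - z\<bar> powr e)"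
   by (meson open_contains_ball subsetD)
 qed
 then obtain r B where rB: "\<And>x. r x > 0" "\<And>x y z. y \<in> ball x (r x) ==> z \<in> ball x (r x) ==> \<bar>f y - f z\<bar> \<le> B x * \<bar>y - z\<bar> powr e"
  by metis
 have "{0..1::real} \<subseteq> (\<Union>x\<in>{0..1}. ball x (r x))" using rB(1) by force
 then obtain D where D: "D \<subseteq> {0..1::real}" "finite D" "{0..1} \<subseteq> (\<Union>x\<in>D. ball x (r x))"
  using compactE_image[OF compact_Icc, of "{0..1}" "\<lambda>x. ball x (r x)" 0 1] by (metis open_ball)
 obtain L where L: "L > 0" "\<And>x. x \<in> {0..1} ==> \<exists>G\<in>(\<lambda>x. ball x (r x)) ` D. ball x L \<subseteq> G"
  using Heine_Borel_lemma[OF compact_Icc, of 0 1 "(\<lambda>x. ball x (r x)) ` D"] D(3) by (metis (no_types, lifting) imageE open_ball)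
 define BB where "BB = (\<Sum>x\<in>D. \<bar>B x\<bar>)"
 obtain M where M: "\<And>x. x \<in> {0..1} ==> \<bar>f x\<bar> \<le> M"
  using compact_continuous_image[OF continuous_on_subset[OF assms(2)], of "{0..1}"] compact_imp_bounded bounded_real by fastforce
 show ?thesis
 proof (intro exI[of _ "BB + 2 * M / L powr e"] ballI)
  fix x y :: real assume xy: "x \<in> {0..1}" "y \<in> {0..1}"
  have M0: "M \<ge> 0" using M[of 0] by auto
  have BB0: "BB \<ge> 0" unfolding BB_def by (simp add: sum_nonneg)
  show "\<bar>f x - f y\<bar> \<le> (BB + 2 * M / L powr e) * \<bar>x - y\<bar> powr e"
  proof (cases "\<bar>x - y\<bar> < L")
   case True
   then obtain z where z: "z \<in> D" "ball x L \<subseteq> ball z (r z)" using L(2)[OF xy(1)] by auto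
   then have "x \<in> ball z (r z)" "y \<in> ball z (r z)" using True L(1) by (auto simp: dist_real_def subset_iff)
   then have "\<bar>f x - f y\<bar> \<le> B z * \<bar>x - y\<bar> powr e" using rB(2) by blast
   also have "\<dots> \<le> BB * \<bar>x - y\<bar> powr e"
    using member_le_sum[of z D "\<lambda>x. \<bar>B x\<bar>"] D(2) z(1) unfolding BB_def by (intro mult_right_mono) auto
   also have "\<dots> \<le> (BB + 2 * M / L powr e) * \<bar>x - y\<bar> powr e" using M0 by (intro mult_right_mono) auto
   finally show ?thesis .
  next
   case False
   have "\<bar>f x - f y\<bar> \<le> 2 * M" using M[OF xy(1)] M[OF xy(2)] by linarith
   also have "\<dots> = 2 * M / L powr e * L powr e" using L(1) by simp
   also have "\<dots> \<le> 2 * M / L powr e * \<bar>x - y\<bar> powr e"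
    using False L(1) M0 assms(3) by (intro mult_left_mono powr_mono2) auto
   also have "\<dots> \<le> (BB + 2 * M / L powr e) * \<bar>x - y\<bar> powr e" using BB0 by (intro mult_right_mono) auto
   finally show ?thesis .
  qed
 qed
qed

lemma Ck_eps_on_imp_bfam:
 assumes "Ck_eps_on m e UNIV f" "0 < e"
 shows "bfam m e {0..1} {i} (\<lambda>_. f)"
 using assms(1)
proof (induction m arbitrary: f)
 have bd: "\<exists>M. \<forall>x\<in>{0..1}. \<bar>f x\<bar> \<le> M" if "continuous_on UNIV f" for f :: "real \<Rightarrow> real"
  using compact_continuous_image[OF continuous_on_subset[OF that], of "{0..1}"] compact_imp_bounded bounded_real by fastforce
 {
  case 0
  then have c: "continuous_on UNIV f" "locally_Hoelder_on e UNIV f" by (auto simp: Ck_eps_on_0)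
  obtain K M where "\<forall>x\<in>{0..1}. \<forall>y\<in>{0..1}. \<bar>f x - f y\<bar> \<le> K * \<bar>x - y\<bar> powr e" "\<forall>x\<in>{0..1}. \<bar>f x\<bar> \<le> M"
   using Hoelder_local_to_global[OF c(2,1) assms(2)] bd[OF c(1)] by blast
  then have "\<forall>x\<in>{0..1}. \<bar>f x\<bar> \<le> max K M \<and> (\<forall>y\<in>{0..1}. \<bar>f x - f y\<bar> \<le> max K M * \<bar>x - y\<bar> powr e)"
   by (smt (verit) mult_right_mono powr_ge_zero)
  then show ?case by (intro bfam_0I[of _ _ _ "max K M"]) auto
 next
  case (Suc m)
  then obtain f' where d: "\<And>x. (f has_real_derivative f' x) (at x)" and f': "Ck_eps_on m e UNIV f'"
   unfolding Ck_eps_on_Suc_UNIV by auto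
  have "continuous_on UNIV f" using d DERIV_continuous continuous_at_imp_continuous_on by blast
  then obtain M where "\<forall>x\<in>{0..1}. \<bar>f x\<bar> \<le> M" using bd by blast
  then show ?case
   using has_field_derivative_at_within[OF d] by (intro bfam_SucI[OF _ _ Suc.IH[OF f'], where K = M]) auto
 }
qed

section \<open>Flat polynomials\<close>

lemma pderiv_funpow_Suc: "(pderiv ^^ Suc n) p = (pderiv ^^ n) (pderiv (p :: real poly))"
 by (simp only: funpow_Suc_right o_apply)

lemma pderiv_funpow_0: "(pderiv ^^ n) (0 :: real poly) = 0"
 by (induction n) auto

lemma pderiv_root_power_dvd:
 fixes p :: "real poly"
 assumes "[:-a, 1:] ^ Suc n dvd p" shows "[:-a, 1:] ^ n dvd pderiv p"
proof -
 obtain r where r: "p = [:-a, 1:] ^ Suc n * r" using assms by (rule dvdE)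
 have "pderiv p = [:-a, 1:] ^ n * ([:-a, 1:] * pderiv r + smult (of_nat (Suc n)) (r * pderiv [:-a, 1:]))"
  unfolding r pderiv_mult pderiv_power_Suc
  by (simp only: power_Suc mult_smult_left mult_smult_right distrib_left mult_ac)
 then show ?thesis by (metis dvd_triv_left)
qed

text \<open>
 Differentiating \<open>i\<close> times lowers the multiplicity of a root by at most \<open>i\<close>.
\<close>

lemma pderiv_root_eq_0:
 fixes p :: "real poly"
 assumes "[:-a, 1:] ^ Suc n dvd p" "i \<le> n" shows "poly ((pderiv ^^ i) p) a = 0"
 using assms
proof (induction i arbitrary: n p)
 case 0
 have "[:-a, 1:] dvd p" using 0(1) by (meson dvd_power dvd_trans zero_less_Suc)
 then show ?case by (simp add: poly_eq_0_iff_dvd)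
next
 case (Suc i)
 then obtain m where m: "n = Suc m" by (metis Suc_le_D)
 show ?case using Suc.IH[OF pderiv_root_power_dvd[OF Suc.prems(1)[unfolded m]]] Suc.prems(2) m
  unfolding pderiv_funpow_Suc by simp
qed

text \<open>
 The upper half of the Bernstein polynomials of degree \<open>2k + 1\<close>: it increases from 0 to 1 and is flat
 to order \<open>k\<close> at both ends.
\<close>

definition step_poly :: "nat \<Rightarrow> real poly" where
 "step_poly k = (\<Sum>i\<in>{Suc k..2*k+1}. of_nat ((2*k+1) choose i) * [:0,1:] ^ i * [:1,-1:] ^ (2*k+1-i))"

lemma one_minus_step_poly:
 "1 - step_poly k = (\<Sum>i\<in>{..k}. of_nat ((2*k+1) choose i) * [:0,1:] ^ i * [:1,-1:] ^ (2*k+1-i))"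
proof -
 have "[:0,1:] + [:1,-1:] = (1 :: real poly)" by (simp add: one_pCons)
 then have "1 = ([:0,1:] + [:1,-1:] :: real poly) ^ (2*k+1)" by (simp only: power_one)
 also have "\<dots> = (\<Sum>i\<in>{..2*k+1}. of_nat ((2*k+1) choose i) * [:0,1:] ^ i * [:1,-1:] ^ (2*k+1-i))"
  by (rule binomial_ring)
 also have "{..2*k+1} = {..k} \<union> {Suc k..2*k+1}" by auto
 finally show ?thesis unfolding step_poly_def by (subst (asm) sum.union_disjoint) (auto simp: algebra_simps)
qed

lemma step_poly_dvd: "[:-0,1:] ^ Suc k dvd step_poly k" "[:-1,1:] ^ Suc k dvd 1 - step_poly k"
proof -
 show "[:-0,1:] ^ Suc k dvd step_poly k"
  unfolding step_poly_def minus_zero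
 proof (intro dvd_sum)
  fix i assume "i \<in> {Suc k..2*k+1}"
  then have "[:0,1:] ^ Suc k dvd ([:0,1:] :: real poly) ^ i" by (intro le_imp_power_dvd) auto
  then show "[:0,1::real:] ^ Suc k dvd of_nat ((2*k+1) choose i) * [:0,1:] ^ i * [:1,-1:] ^ (2*k+1-i)"
   by (rule dvd_mult2[OF dvd_mult])
 qed
 have "[:1,-1:] ^ Suc k dvd 1 - step_poly k"
  unfolding one_minus_step_poly
 proof (intro dvd_sum)
  fix i assume "i \<in> {..k}"
  then have "[:1,-1:] ^ Suc k dvd ([:1,-1:] :: real poly) ^ (2*k+1-i)" by (intro le_imp_power_dvd) auto
  then show "[:1,-1::real:] ^ Suc k dvd of_nat ((2*k+1) choose i) * [:0,1:] ^ i * [:1,-1:] ^ (2*k+1-i)"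
   by (rule dvd_mult)
 qed
 moreover have "[:-1,1:] = - ([:1,-1:] :: real poly)" by simp
 moreover have "(- q) ^ n dvd x" if "q ^ n dvd x" for q x :: "real poly" and n
  using that by (subst power_minus) (simp add: minus_one_power_iff)
 ultimately show "[:-1,1:] ^ Suc k dvd 1 - step_poly k" by metis
qed

lemma pderiv_funpow_diff: "(pderiv ^^ i) (p - q) = (pderiv ^^ i) p - (pderiv ^^ i) (q :: real poly)"
 by (induction i) (auto simp: pderiv_diff)

text \<open>The polynomial with vanishing k-jet at 0 and the k-jet of \<open>(t - 1) ^ m / m!\<close> at 1.\<close>

definition jet_poly :: "nat \<Rightarrow> nat \<Rightarrow> real poly" where
 "jet_poly k m = step_poly k * smult (1 / fact m) ([:-1,1:] ^ m)"

lemma pderiv_funpow_monomial: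
 "poly ((pderiv ^^ i) (smult (1 / fact m) ([:-1,1:] ^ m))) 1 = (if i = m then 1 else (0::real))"
proof (induction i arbitrary: m)
 case 0
 then show ?case by (cases m) (auto simp: poly_power)
next
 case (Suc i)
 show ?case
 proof (cases m)
  case 0
  have "pderiv (smult (1 / fact m) ([:-1,1:] ^ m)) = (0 :: real poly)" using 0 by (simp add: pderiv_smult)
  then show ?thesis using 0 by (simp only: pderiv_funpow_Suc pderiv_funpow_0) simp
 next
  case (Suc m')
  have "pderiv (smult (1 / fact m) ([:-1,1:] ^ m)) = smult (1 / fact m') ([:-1,1:] ^ m' :: real poly)"
  proof -
   have c: "1 / fact (Suc m') * real (Suc m') = (1 / fact m' :: real)"
    by (subst fact_Suc) (simp del: of_nat_Suc)
   have "pderiv [:-1,1::real:] = 1" by (simp add: pderiv_pCons one_pCons)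
   then show ?thesis unfolding Suc pderiv_smult pderiv_power_Suc using c by simp
  qed
  then show ?thesis using Suc.IH[of m'] Suc by (simp only: pderiv_funpow_Suc) simp
 qed
qed

lemma jet_poly_ends:
 assumes "i \<le> k"
 shows "poly ((pderiv ^^ i) (jet_poly k m)) 0 = 0" "poly ((pderiv ^^ i) (jet_poly k m)) 1 = (if i = m then 1 else 0)"
proof -
 show "poly ((pderiv ^^ i) (jet_poly k m)) 0 = 0"
  by (rule pderiv_root_eq_0[OF _ assms]) (unfold jet_poly_def, rule dvd_mult2[OF step_poly_dvd(1)])
 have "[:-1,1:] ^ Suc k dvd smult (1 / fact m) ([:-1,1:] ^ m) - jet_poly k m"
 proof -
  have "smult (1 / fact m) ([:-1,1:] ^ m) - jet_poly k m = (1 - step_poly k) * smult (1 / fact m) ([:-1,1:] ^ m)"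
   unfolding jet_poly_def by (simp only: left_diff_distrib mult_1_left)
  then show ?thesis using dvd_mult2[OF step_poly_dvd(2)] by metis
 qed
 from pderiv_root_eq_0[OF this assms]
 show "poly ((pderiv ^^ i) (jet_poly k m)) 1 = (if i = m then 1 else 0)"
  using pderiv_funpow_monomial[of i m] by (simp add: pderiv_funpow_diff)
qed

lemma poly_bounded_unit: "\<exists>B\<ge>0. \<forall>t\<in>{0..1}. \<bar>poly p t\<bar> \<le> (B::real)"
proof -
 have "compact (poly p ` {0..1})" by (intro compact_continuous_image continuous_intros) auto
 then obtain B where "\<forall>x\<in>poly p ` {0..1}. norm x \<le> B" using compact_imp_bounded bounded_iff by metis
 then have "\<forall>t\<in>{0..1}. \<bar>poly p t\<bar> \<le> max B 0" by (simp add: le_max_iff_disj)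
 then show ?thesis by (intro exI[of _ "max B 0"]) auto
qed

lemma poly_lipschitz_unit: "\<exists>B\<ge>0. \<forall>s\<in>{0..1}. \<forall>t\<in>{0..1}. \<bar>poly p s - poly p t\<bar> \<le> B * \<bar>s - (t::real)\<bar>"
proof -
 obtain B where B: "B \<ge> 0" "\<forall>t\<in>{0..1}. \<bar>poly (pderiv p) t\<bar> \<le> B" using poly_bounded_unit by blast
 have "norm (poly p s - poly p t) \<le> B * norm (s - t)" if "s \<in> {0..1}" "t \<in> {0..1}" for s t
  by (rule field_differentiable_bound[of "{0..1}" "poly p" "poly (pderiv p)"])
   (use that B in \<open>auto intro: has_field_derivative_at_within poly_DERIV\<close>)
 then show ?thesis using B(1) by (intro exI[of _ B]) auto
qed

section \<open>Gluing derivatives across gaps\<close>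

definition is_gap :: "real set \<Rightarrow> real \<Rightarrow> real \<Rightarrow> bool" where
 "is_gap L a b \<longleftrightarrow> a \<in> L \<and> b \<in> L \<and> a < b \<and> {a<..<b} \<inter> L = {}"

lemma is_gap_unique:
 assumes "is_gap L a b" "is_gap L c d" "x \<in> {a<..<b}" "x \<in> {c<..<d}"
 shows "a = c" "b = d"
proof -
 have L: "a \<in> L" "b \<in> L" "c \<in> L" "d \<in> L" and n: "{a<..<b} \<inter> L = {}" "{c<..<d} \<inter> L = {}"
  using assms(1,2) unfolding is_gap_def by auto
 have "\<not> a < c" "\<not> c < a" "\<not> b < d" "\<not> d < b"
  using L n assms(3,4) by (auto simp: disjoint_iff)
 then show "a = c" "b = d" by auto
qed

text \<open>
 The estimate is needed only between points of \<open>L\<close>. An increment from \<open>x \<in> L\<close> into a gap is split at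
 the end point of the gap that lies between; the second part is a mean value of \<open>v\<close> near \<open>x\<close>.
\<close>

lemma glue_derivative:
 fixes u v :: "real \<Rightarrow> real"
 assumes gaps: "\<And>x. x \<notin> L ==> \<exists>a b. is_gap L a b \<and> x \<in> {a<..<b}"
  and v: "continuous_on UNIV v"
  and dg: "\<And>a b x. is_gap L a b ==> x \<in> {a..b} ==> (u has_real_derivative v x) (at x within {a..b})"
  and est: "\<And>x y. x \<in> L ==> y \<in> L ==> \<bar>y - x\<bar> < 1 ==> \<bar>u y - u x - v x * (y - x)\<bar> \<le> K * \<bar>y - x\<bar> powr (1 + e)"
  and e: "e > 0"
 shows "(u has_real_derivative v x) (at x)"
proof (cases "x \<in> L")
 case False
 then obtain a b where ab: "is_gap L a b" "x \<in> {a<..<b}" using gaps by blast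
 have "(u has_real_derivative v x) (at x within {a..b})" using dg[OF ab(1)] ab(2) by simp
 then have "(u has_real_derivative v x) (at x within {a<..<b})" by (rule has_field_derivative_subset) auto
 then show ?thesis using ab(2) at_within_open[of x "{a<..<b}"] by simp
next
 case x: True
 have "\<exists>d>0. \<forall>y. \<bar>y - x\<bar> < d \<longrightarrow> \<bar>u y - u x - v x * (y - x)\<bar> \<le> E * \<bar>y - x\<bar>" if E: "E > 0" for E
 proof -
  have "isCont v x" using v by (simp add: continuous_on_eq_continuous_at)
  then obtain d1 where d1: "d1 > 0" "\<And>z. \<bar>z - x\<bar> < d1 ==> \<bar>v z - v x\<bar> < E / 2"
   using E unfolding continuous_at_eps_delta dist_real_def by (metis half_gt_zero)
  define w d2 where "w = E / (2 * (\<bar>K\<bar> + 1))" and "d2 = w powr (1 / e)"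
  have w: "w > 0" "\<bar>K\<bar> * w \<le> E / 2" unfolding w_def using E by (auto simp: field_simps)
  have d2: "\<bar>K\<bar> * t powr e \<le> E / 2" if t: "0 < t" "t < d2" for t
  proof -
   have "t powr e \<le> d2 powr e" using t e by (intro powr_mono2) auto
   also have "\<dots> = w" unfolding d2_def using w(1) e by (simp add: powr_powr)
   finally have "\<bar>K\<bar> * t powr e \<le> \<bar>K\<bar> * w" by (intro mult_left_mono) auto
   then show "\<bar>K\<bar> * t powr e \<le> E / 2" using w(2) by linarith
  qed
  have d20: "d2 > 0" using w(1) unfolding d2_def by simp
  define d where "d = min (min d1 d2) 1"
  have d: "d > 0" "d \<le> d1" "d \<le> d2" "d \<le> 1" unfolding d_def using d1 d20 by auto
  have L: "\<bar>u z - u x - v x * (z - x)\<bar> \<le> E / 2 * \<bar>z - x\<bar>" if z: "z \<in> L" "\<bar>z - x\<bar> < d" for z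
  proof (cases "z = x")
   case False
   have "\<bar>u z - u x - v x * (z - x)\<bar> \<le> K * \<bar>z - x\<bar> powr (1 + e)" using est[OF x z(1)] z(2) d by auto
   also have "\<dots> \<le> \<bar>K\<bar> * \<bar>z - x\<bar> powr (1 + e)" by (intro mult_right_mono) auto
   also have "\<dots> = (\<bar>K\<bar> * \<bar>z - x\<bar> powr e) * \<bar>z - x\<bar>" using False by (simp add: powr_add)
   also have "\<dots> \<le> E / 2 * \<bar>z - x\<bar>"
    using d2[of "\<bar>z - x\<bar>"] False z(2) d by (intro mult_right_mono) auto
   finally show ?thesis .
  qed simp
  have mvt: "\<exists>\<xi>. p \<le> \<xi> \<and> \<xi> \<le> q \<and> u q - u p = v \<xi> * (q - p)"
   if g: "is_gap L a b" "a \<le> p" "p \<le> q" "q \<le> b" for a b p q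
  proof -
   have "(u has_derivative (\<lambda>h. v z * h)) (at z within {p..q})" if "p \<le> z" "z \<le> q" for z
    using has_field_derivative_subset[OF dg[OF g(1)], of z "{p..q}"] that g
    by (auto simp: has_field_derivative_def)
   from mvt_very_simple[OF g(3) this] show ?thesis by auto
  qed
  have "\<bar>u y - u x - v x * (y - x)\<bar> \<le> E * \<bar>y - x\<bar>" if y: "\<bar>y - x\<bar> < d" for y
  proof (cases "y \<in> L")
   case True
   have "E / 2 * \<bar>y - x\<bar> \<le> E * \<bar>y - x\<bar>" using E by (intro mult_right_mono) auto
   then show ?thesis using L[OF True y] by linarith
  next
   case False
   then obtain a b where ab: "is_gap L a b" "y \<in> {a<..<b}" using gaps by blast
   obtain z \<xi> where z: "z \<in> L" "\<bar>z - x\<bar> \<le> \<bar>y - x\<bar>" "\<bar>\<xi> - x\<bar> \<le> \<bar>y - x\<bar>" "\<bar>y - z\<bar> \<le> \<bar>y - x\<bar>" "u y - u z = v \<xi> * (y - z)"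
   proof (cases "x < y")
    case True
    have "x \<notin> {a<..<b}" using ab(1) x unfolding is_gap_def by blast
    then have "x \<le> a" using ab(2) True by auto
    moreover obtain \<xi> where "a \<le> \<xi>" "\<xi> \<le> y" "u y - u a = v \<xi> * (y - a)" using mvt[OF ab(1), of a y] ab(2) by auto
    ultimately show thesis using that[of a \<xi>] ab unfolding is_gap_def by auto
   next
    case F: False
    have "x \<notin> {a<..<b}" using ab(1) x unfolding is_gap_def by blast
    moreover have "y \<noteq> x" using False x by blast
    ultimately have "b \<le> x" using ab(2) F by auto
    moreover obtain \<xi> where "y \<le> \<xi>" "\<xi> \<le> b" "u b - u y = v \<xi> * (b - y)" using mvt[OF ab(1), of y b] ab(2) by auto
    moreover have "u y - u b = v \<xi> * (y - b)" using calculation(4) by (simp add: algebra_simps)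
    ultimately show thesis using that[of b \<xi>] ab unfolding is_gap_def by auto
   qed
   have "u y - u x - v x * (y - x) = (v \<xi> - v x) * (y - z) + (u z - u x - v x * (z - x))"
    using z(5) by (simp add: algebra_simps)
   also have "\<bar>\<dots>\<bar> \<le> \<bar>v \<xi> - v x\<bar> * \<bar>y - z\<bar> + \<bar>u z - u x - v x * (z - x)\<bar>"
    by (metis abs_mult abs_triangle_ineq)
   also have "\<dots> \<le> E / 2 * \<bar>y - x\<bar> + E / 2 * \<bar>z - x\<bar>"
    using d1(2)[of \<xi>] L[OF z(1)] z y d E by (intro add_mono mult_mono) auto
   also have "\<dots> \<le> E * \<bar>y - x\<bar>"
    using mult_left_mono[OF z(2), of E] E by (simp add: field_simps)
   finally show ?thesis .
  qed
  then show ?thesis using d(1) by blast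
 qed
 then have "(u has_derivative (\<lambda>h. v x * h)) (at x)"
  unfolding has_derivative_at_alt by (auto simp: bounded_linear_mult_right abs_minus_commute)
 then show ?thesis by (simp add: has_field_derivative_def)
qed

section \<open>Whitney extension\<close>

text \<open>
 For a jet \<open>F\<close>, the \<open>m\<close>-th derivative at \<open>y\<close> of its Taylor polynomial of degree \<open>k\<close> at \<open>x\<close>.
\<close>

definition jet_taylor :: "nat \<Rightarrow> (nat \<Rightarrow> real \<Rightarrow> real) \<Rightarrow> nat \<Rightarrow> real \<Rightarrow> real \<Rightarrow> real" where
 "jet_taylor k F m x y = (\<Sum>l\<le>k-m. F (m+l) x * (y - x) ^ l / fact l)"

lemma jet_taylor_deriv:
 assumes "i < k"
 shows "(jet_taylor k F i a has_real_derivative jet_taylor k F (Suc i) a x) (at x within X)"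
proof -
 obtain n where n: "k - i = Suc n" "k - Suc i = n" using assms by (metis Suc_diff_Suc)
 have "((\<lambda>y. F i a + (\<Sum>l\<le>n. F (Suc i + l) a * ((y - a) ^ Suc l / fact (Suc l)))) has_real_derivative
   0 + (\<Sum>l\<le>n. F (Suc i + l) a * ((x - a) ^ l / fact l))) (at x within X)"
 proof (intro derivative_intros DERIV_cmult DERIV_sum)
  fix l
  show "((\<lambda>y. (y - a) ^ Suc l / fact (Suc l)) has_real_derivative (x - a) ^ l / fact l) (at x within X)"
  proof -
   have "((\<lambda>y. (y - a) ^ Suc l) has_real_derivative real (Suc l) * (x - a) ^ l) (at x within X)"
    by (auto intro!: derivative_eq_intros simp del: power_Suc)
   from DERIV_cdivide[OF this, of "fact (Suc l)"] show ?thesis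
    by (subst (asm) (2) fact_Suc) (simp del: of_nat_Suc power_Suc fact_Suc)
  qed
 qed
 moreover have "(\<Sum>l\<le>Suc n. F (i+l) a * (y - a) ^ l / fact l) = F i a + (\<Sum>l\<le>n. F (Suc i + l) a * ((y - a) ^ Suc l / fact (Suc l)))" for y
  by (subst sum.atMost_Suc_shift) simp
 ultimately show ?thesis unfolding jet_taylor_def n by simp
qed

lemma jet_taylor_self: "jet_taylor k F i a a = F i a"
proof -
 have "(\<Sum>l\<le>k-i. F (i+l) a * 0 ^ l / fact l) = (\<Sum>l\<in>{0}. F (i+l) a * 0 ^ l / fact l)"
  by (rule sum.mono_neutral_right) auto
 then show ?thesis unfolding jet_taylor_def by simp
qed

text \<open>
 The \<open>i\<close>-th derivative of a polynomial on \<open>[a, b]\<close>: the Taylor polynomial at \<open>a\<close>, corrected by terms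
 that vanish to order \<open>k\<close> at \<open>a\<close> and carry at \<open>b\<close> the difference between the two jets.
\<close>

definition gap_fill :: "nat \<Rightarrow> (nat \<Rightarrow> real \<Rightarrow> real) \<Rightarrow> real \<Rightarrow> real \<Rightarrow> nat \<Rightarrow> real \<Rightarrow> real" where
 "gap_fill k F a b i x = jet_taylor k F i a x +
   (\<Sum>m\<le>k. (F m b - jet_taylor k F m a b) * (b - a) ^ m * (poly ((pderiv ^^ i) (jet_poly k m)) ((x - a) / (b - a)) / (b - a) ^ i))"

lemma gap_fill_deriv:
 assumes "i < k" "a < b"
 shows "(gap_fill k F a b i has_real_derivative gap_fill k F a b (Suc i) x) (at x within X)"
proof -
 have "((\<lambda>x. poly ((pderiv ^^ i) (jet_poly k m)) ((x - a) / (b - a)) / (b - a) ^ i) has_real_derivative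
   poly ((pderiv ^^ Suc i) (jet_poly k m)) ((x - a) / (b - a)) / (b - a) ^ Suc i) (at x within X)" for m
 proof -
  have "((\<lambda>x. (x - a) / (b - a)) has_real_derivative 1 / (b - a)) (at x within X)"
   using assms(2) by (auto intro!: derivative_eq_intros)
  from DERIV_chain2[OF poly_DERIV this] have "((\<lambda>x. poly ((pderiv ^^ i) (jet_poly k m)) ((x - a) / (b - a))) has_real_derivative
   poly (pderiv ((pderiv ^^ i) (jet_poly k m))) ((x - a) / (b - a)) * (1 / (b - a))) (at x within X)" .
  from DERIV_cdivide[OF this, of "(b - a) ^ i"] show ?thesis by (simp add: mult.commute)
 qed
 then show ?thesis unfolding gap_fill_def
  by (intro DERIV_add jet_taylor_deriv[OF assms(1)] DERIV_sum DERIV_cmult)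
qed

lemma gap_fill_ends:
 assumes "i \<le> k" "a < b" shows "gap_fill k F a b i a = F i a" "gap_fill k F a b i b = F i b"
proof -
 show "gap_fill k F a b i a = F i a"
  unfolding gap_fill_def using jet_poly_ends(1)[OF assms(1)] by (simp add: jet_taylor_self)
 have "(\<Sum>m\<le>k. (F m b - jet_taylor k F m a b) * (b - a) ^ m * (poly ((pderiv ^^ i) (jet_poly k m)) ((b - a) / (b - a)) / (b - a) ^ i))
   = (\<Sum>m\<le>k. if i = m then F m b - jet_taylor k F m a b else 0)"
  by (rule sum.cong) (use assms jet_poly_ends(2)[OF assms(1)] in auto)
 also have "\<dots> = F i b - jet_taylor k F i a b" using assms(1) by (subst sum.delta') auto
 finally show "gap_fill k F a b i b = F i b" unfolding gap_fill_def by simp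
qed

lemma abs_sum_le_card:
 fixes f :: "'a \<Rightarrow> real"
 assumes "\<And>m. m \<in> A ==> \<bar>f m\<bar> \<le> c" shows "\<bar>sum f A\<bar> \<le> real (card A) * c"
 using order_trans[OF sum_abs sum_bounded_above[of A "\<lambda>m. \<bar>f m\<bar>" c]] assms by simp

text \<open>
 On the line the extension can be made in each gap separately. The Whitney condition bounds the
 contribution of the correction in \<open>gap_fill\<close> to the \<open>i\<close>-th derivative by a multiple of
 \<open>(b - a) powr (k + e - i)\<close>, which is exactly what makes the \<open>k\<close>-th derivatives Hoelder continuous with a constant that is the same for all gaps. Points in
 different gaps are compared through the ends of the gaps that lie between them.
\<close>

theorem whitney_extension:
 fixes F :: "nat \<Rightarrow> real \<Rightarrow> real" and e K :: real
 assumes e: "0 < e" "e \<le> 1" and K0: "K \<ge> 0"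
  and gaps: "\<And>x. x \<notin> L ==> \<exists>a b. is_gap L a b \<and> x \<in> {a<..<b}"
  and len: "\<And>a b. is_gap L a b ==> b - a \<le> 1"
  and W: "\<And>m x y. m \<le> k ==> x \<in> L ==> y \<in> L ==> \<bar>F m y - jet_taylor k F m x y\<bar> \<le> K * \<bar>y - x\<bar> powr (real k + e - real m)"
  and bd: "\<And>m x. m \<le> k ==> x \<in> L ==> \<bar>F m x\<bar> \<le> K"
 obtains D where "\<And>i x. i \<le> k ==> x \<in> L ==> D i x = F i x"
  "\<And>i x. i < k ==> (D i has_real_derivative D (Suc i) x) (at x)"
  "\<And>i. i \<le> k ==> bfam (k - i) e UNIV {()} (\<lambda>_. D i)"
proof -
 define ga where "ga = (\<lambda>x. SOME p. is_gap L (fst p) (snd p) \<and> x \<in> {fst p<..<snd p})"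
 have ga: "is_gap L (fst (ga x)) (snd (ga x))" "x \<in> {fst (ga x)<..<snd (ga x)}" if "x \<notin> L" for x
 proof -
  obtain a b where "is_gap L a b \<and> x \<in> {a<..<b}" using gaps[OF \<open>x \<notin> L\<close>] by blast
  then have "is_gap L (fst (a,b)) (snd (a,b)) \<and> x \<in> {fst (a,b)<..<snd (a,b)}" by simp
  from someI[of "\<lambda>p. is_gap L (fst p) (snd p) \<and> x \<in> {fst p<..<snd p}", OF this]
  show "is_gap L (fst (ga x)) (snd (ga x))" "x \<in> {fst (ga x)<..<snd (ga x)}" unfolding ga_def by blast+
 qed
 define D where "D = (\<lambda>i x. if x \<in> L then F i x else gap_fill k F (fst (ga x)) (snd (ga x)) i x)"
 have DL: "D i x = F i x" if "x \<in> L" for i x unfolding D_def using that by simp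
 have Dg: "D i x = gap_fill k F a b i x" if g: "is_gap L a b" "x \<in> {a..b}" "i \<le> k" for a b i x
 proof (cases "x \<in> {a<..<b}")
  case True
  then have xL: "x \<notin> L" using g unfolding is_gap_def by auto
  have "fst (ga x) = a" "snd (ga x) = b" using is_gap_unique[OF ga(1)[OF xL] g(1) ga(2)[OF xL] True] by auto
  then show ?thesis unfolding D_def using xL by simp
 next
  case False
  then have "x = a \<or> x = b" using g by auto
  moreover have "a \<in> L" "b \<in> L" "a < b" using g unfolding is_gap_def by auto
  ultimately show ?thesis using DL gap_fill_ends[OF g(3)] by metis
 qed
 \<comment> \<open>uniform bounds for the finitely many derivatives of the polynomials that enter gap_fill\<close>
 define BB where "BB = (\<lambda>(i,m). SOME B. B \<ge> 0 \<and> (\<forall>t\<in>{0..1}. \<bar>poly ((pderiv ^^ i) (jet_poly k m)) t\<bar> \<le> B) \<and>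
   (\<forall>s\<in>{0..1}. \<forall>t\<in>{0..1}. \<bar>poly ((pderiv ^^ i) (jet_poly k m)) s - poly ((pderiv ^^ i) (jet_poly k m)) t\<bar> \<le> B * \<bar>s - t\<bar>))"
 have BB: "BB (i,m) \<ge> 0 \<and> (\<forall>t\<in>{0..1}. \<bar>poly ((pderiv ^^ i) (jet_poly k m)) t\<bar> \<le> BB (i,m)) \<and>
   (\<forall>s\<in>{0..1}. \<forall>t\<in>{0..1}. \<bar>poly ((pderiv ^^ i) (jet_poly k m)) s - poly ((pderiv ^^ i) (jet_poly k m)) t\<bar> \<le> BB (i,m) * \<bar>s - t\<bar>)" for i m
 proof -
  let ?p = "(pderiv ^^ i) (jet_poly k m)"
  obtain B1 where B1: "B1 \<ge> 0" "\<forall>t\<in>{0..1}. \<bar>poly ?p t\<bar> \<le> B1" using poly_bounded_unit by blast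
  obtain B2 where B2: "B2 \<ge> 0" "\<forall>s\<in>{0..1}. \<forall>t\<in>{0..1}. \<bar>poly ?p s - poly ?p t\<bar> \<le> B2 * \<bar>s - t\<bar>" using poly_lipschitz_unit by blast
  have "(B1 + B2) \<ge> 0 \<and> (\<forall>t\<in>{0..1}. \<bar>poly ?p t\<bar> \<le> B1 + B2) \<and> (\<forall>s\<in>{0..1}. \<forall>t\<in>{0..1}. \<bar>poly ?p s - poly ?p t\<bar> \<le> (B1 + B2) * \<bar>s - t\<bar>)"
  proof (intro conjI ballI)
   show "B1 + B2 \<ge> 0" using B1 B2 by simp
   show "\<bar>poly ?p t\<bar> \<le> B1 + B2" if "t \<in> {0..1}" for t using B1(2) B2(1) that by fastforce
   show "\<bar>poly ?p s - poly ?p t\<bar> \<le> (B1 + B2) * \<bar>s - t\<bar>" if "s \<in> {0..1}" "t \<in> {0..1}" for s t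
    by (rule order_trans[OF B2(2)[rule_format, OF that] mult_right_mono]) (use B1(1) in auto)
  qed
  from someI[of "\<lambda>B. B \<ge> 0 \<and> (\<forall>t\<in>{0..1}. \<bar>poly ?p t\<bar> \<le> B) \<and> (\<forall>s\<in>{0..1}. \<forall>t\<in>{0..1}. \<bar>poly ?p s - poly ?p t\<bar> \<le> B * \<bar>s - t\<bar>)", OF this]
  show ?thesis unfolding BB_def by simp
 qed
 define B where "B = (\<Sum>p\<in>{..k}\<times>{..k}. BB p)"
 have BBle: "BB (i,m) \<le> B" if "i \<le> k" "m \<le> k" for i m
  unfolding B_def by (rule member_le_sum) (use that BB in auto)
 have B0: "B \<ge> 0" using BBle[of 0 0] BB[of 0 0] by auto
 have Bb: "\<bar>poly ((pderiv ^^ i) (jet_poly k m)) t\<bar> \<le> B" if "i \<le> k" "m \<le> k" "t \<in> {0..1}" for i m t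
  using BB[of i m] BBle[OF that(1,2)] that(3) by (meson order_trans)
 have Bl: "\<bar>poly ((pderiv ^^ i) (jet_poly k m)) s - poly ((pderiv ^^ i) (jet_poly k m)) t\<bar> \<le> B * \<bar>s - t\<bar>"
  if "i \<le> k" "m \<le> k" "s \<in> {0..1}" "t \<in> {0..1}" for i m s t
 proof -
  have "\<bar>poly ((pderiv ^^ i) (jet_poly k m)) s - poly ((pderiv ^^ i) (jet_poly k m)) t\<bar> \<le> BB (i,m) * \<bar>s - t\<bar>"
   using BB[of i m] that by blast
  also have "\<dots> \<le> B * \<bar>s - t\<bar>" using BBle[OF that(1,2)] by (intro mult_right_mono) auto
  finally show ?thesis .
 qed
 have q: "\<bar>(F m b - jet_taylor k F m a b) * (b - a) ^ m\<bar> / (b - a) ^ i \<le> K * (b - a) powr (real k + e - real i)"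
  if g: "is_gap L a b" and m: "m \<le> k" and i: "i \<le> k" for a b m i
 proof -
  have ab: "a < b" "a \<in> L" "b \<in> L" using g unfolding is_gap_def by auto
  have "\<bar>(F m b - jet_taylor k F m a b) * (b - a) ^ m\<bar> / (b - a) ^ i = \<bar>F m b - jet_taylor k F m a b\<bar> * ((b - a) powr (real m - real i))"
   using ab by (simp add: abs_mult powr_diff powr_realpow)
  also have "\<dots> \<le> (K * \<bar>b - a\<bar> powr (real k + e - real m)) * ((b - a) powr (real m - real i))"
   using W[OF m ab(2,3)] by (intro mult_right_mono) auto
  also have "\<dots> = K * (b - a) powr (real k + e - real i)"
  proof -
   have "(b - a) powr (real k + e - real m) * (b - a) powr (real m - real i) = (b - a) powr (real k + e - real i)"
    by (subst powr_add[symmetric]) (rule arg_cong2[where f = "(powr)"], simp_all)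
   then show ?thesis using ab by (simp add: mult.assoc)
  qed
  finally show ?thesis .
 qed
 have fill: "\<bar>(\<Sum>m\<le>k. (F m b - jet_taylor k F m a b) * (b - a) ^ m * (P m / (b - a) ^ i))\<bar> \<le> real (Suc k) * (K * (b - a) powr (real k + e - real i) * Q)"
  if g: "is_gap L a b" and i: "i \<le> k" and PQ: "\<And>m. m \<le> k ==> \<bar>P m\<bar> \<le> Q" for a b i P Q
 proof -
  have ab: "a < b" using g unfolding is_gap_def by auto
  have "\<bar>(F m b - jet_taylor k F m a b) * (b - a) ^ m * (P m / (b - a) ^ i)\<bar> \<le> K * (b - a) powr (real k + e - real i) * Q" if m: "m \<in> {..k}" for m
  proof -
   have "\<bar>(F m b - jet_taylor k F m a b) * (b - a) ^ m * (P m / (b - a) ^ i)\<bar> = (\<bar>(F m b - jet_taylor k F m a b) * (b - a) ^ m\<bar> / (b - a) ^ i) * \<bar>P m\<bar>"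
    using ab by (simp add: abs_mult abs_divide)
   also have "\<dots> \<le> K * (b - a) powr (real k + e - real i) * Q"
    using q[OF g _ i] PQ m K0 by (intro mult_mono) auto
   finally show ?thesis .
  qed
  then have "\<bar>(\<Sum>m\<le>k. (F m b - jet_taylor k F m a b) * (b - a) ^ m * (P m / (b - a) ^ i))\<bar> \<le> real (card {..k}) * (K * (b - a) powr (real k + e - real i) * Q)"
   by (rule abs_sum_le_card)
  then show ?thesis by simp
 qed
 define Kh where "Kh = real (Suc k) * (K * B) + K"
 have Kh0: "Kh \<ge> 0" unfolding Kh_def using K0 B0 by simp
 have hg: "\<bar>D k x - D k y\<bar> \<le> Kh * \<bar>x - y\<bar> powr e" if g: "is_gap L a b" and xy: "x \<in> {a..b}" "y \<in> {a..b}" for a b x y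
 proof -
  have ab: "a < b" using g unfolding is_gap_def by auto
  let ?p = "\<lambda>m. poly ((pderiv ^^ k) (jet_poly k m))"
  define s t where "s = (x - a) / (b - a)" and "t = (y - a) / (b - a)"
  have st: "s \<in> {0..1}" "t \<in> {0..1}" "\<bar>s - t\<bar> = \<bar>x - y\<bar> / (b - a)" "\<bar>s - t\<bar> \<le> 1"
   unfolding s_def t_def using ab xy by (auto simp: diff_divide_distrib[symmetric] abs_divide divide_le_eq_1)
  have "D k x - D k y = (\<Sum>m\<le>k. (F m b - jet_taylor k F m a b) * (b - a) ^ m * ((?p m s - ?p m t) / (b - a) ^ k))"
   unfolding Dg[OF g xy(1) order_refl] Dg[OF g xy(2) order_refl] gap_fill_def jet_taylor_def s_def t_def
   by (simp add: sum_subtractf[symmetric] diff_divide_distrib right_diff_distrib)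
  then have "\<bar>D k x - D k y\<bar> \<le> real (Suc k) * (K * (b - a) powr (real k + e - real k) * (B * \<bar>s - t\<bar>))"
   using fill[OF g order_refl, of "\<lambda>m. ?p m s - ?p m t" "B * \<bar>s - t\<bar>"] Bl[OF order_refl _ st(1,2)] by simp
  also have "\<dots> = real (Suc k) * (K * B) * ((b - a) powr e * \<bar>s - t\<bar>)" by simp
  also have "\<dots> \<le> real (Suc k) * (K * B) * ((b - a) powr e * \<bar>s - t\<bar> powr e)"
   using abs_le_powr[OF e st(4)] K0 B0 by (intro mult_left_mono) auto
  also have "(b - a) powr e * \<bar>s - t\<bar> powr e = \<bar>x - y\<bar> powr e"
   using ab unfolding st(3) by (simp add: powr_mult[symmetric])
  also have "real (Suc k) * (K * B) * \<bar>x - y\<bar> powr e \<le> Kh * \<bar>x - y\<bar> powr e"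
   unfolding Kh_def using K0 by (intro mult_right_mono) auto
  finally show ?thesis .
 qed
 have hL: "\<bar>D k x - D k y\<bar> \<le> Kh * \<bar>x - y\<bar> powr e" if xy: "x \<in> L" "y \<in> L" for x y
 proof -
  have "\<bar>D k x - D k y\<bar> = \<bar>F k x - jet_taylor k F k y x\<bar>" using DL xy by (simp add: jet_taylor_def)
  also have "\<dots> \<le> K * \<bar>x - y\<bar> powr e" using W[OF order_refl xy(2,1)] by simp
  also have "\<dots> \<le> Kh * \<bar>x - y\<bar> powr e" unfolding Kh_def using K0 B0 by (intro mult_right_mono) auto
  finally show ?thesis .
 qed
 have hxy: "\<bar>D k x - D k y\<bar> \<le> 3 * Kh * \<bar>x - y\<bar> powr e" if xy: "x < y" for x y
 proof -
  \<comment> \<open>the ends of the gaps of x and y that face each other\<close>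
  define x' where "x' = (if x \<in> L then x else snd (ga x))"
  define y' where "y' = (if y \<in> L then y else fst (ga y))"
  have x': "x \<le> x'" "x' \<in> L" unfolding x'_def using ga[of x] by (auto simp: is_gap_def)
  have y': "y' \<le> y" "y' \<in> L" unfolding y'_def using ga[of y] by (auto simp: is_gap_def)
  show ?thesis
  proof (cases "x' \<le> y'")
   case True
   have mono: "Kh * \<bar>p - q\<bar> powr e \<le> Kh * \<bar>x - y\<bar> powr e" if "x \<le> p" "p \<le> q" "q \<le> y" for p q
    using that e Kh0 by (intro mult_left_mono powr_mono2) auto
   have 1: "\<bar>D k x - D k x'\<bar> \<le> Kh * \<bar>x - y\<bar> powr e"
   proof (cases "x \<in> L")
    case F: False
    then have "\<bar>D k x - D k x'\<bar> \<le> Kh * \<bar>x - x'\<bar> powr e" using hg[OF ga(1)[OF F], of x x'] ga[OF F] unfolding x'_def by auto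
    then show ?thesis using mono[of x x'] x' y' True by linarith
   qed (use Kh0 in \<open>simp add: x'_def\<close>)
   have 2: "\<bar>D k y' - D k y\<bar> \<le> Kh * \<bar>x - y\<bar> powr e"
   proof (cases "y \<in> L")
    case F: False
    then have "\<bar>D k y' - D k y\<bar> \<le> Kh * \<bar>y' - y\<bar> powr e" using hg[OF ga(1)[OF F], of y' y] ga[OF F] unfolding y'_def by auto
    then show ?thesis using mono[of y' y] x' y' True by linarith
   qed (use Kh0 in \<open>simp add: y'_def\<close>)
   have 3: "\<bar>D k x' - D k y'\<bar> \<le> Kh * \<bar>x - y\<bar> powr e"
    using hL[OF x'(2) y'(2)] mono[of x' y'] x' y' True by linarith
   show ?thesis using 1 2 3 by linarith
  next
   case False
   have xL: "x \<notin> L"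
   proof
    assume "x \<in> L"
    then have "x' = x" unfolding x'_def by simp
    then have "y' < x" "x < y" using False xy by auto
    then have "y \<notin> L" unfolding y'_def by (auto split: if_splits)
    then show False using ga[of y] \<open>x \<in> L\<close> \<open>y' < x\<close> xy unfolding y'_def is_gap_def by (auto simp: disjoint_iff)
   qed
   have "y \<le> snd (ga x)"
   proof (rule ccontr)
    assume n: "\<not> y \<le> snd (ga x)"
    have "y \<notin> L" using False n unfolding x'_def y'_def using xL by (auto split: if_splits)
    then show False using ga[of y] x'(2) False n unfolding y'_def x'_def is_gap_def using xL by (auto simp: disjoint_iff)
   qed
   then have "\<bar>D k x - D k y\<bar> \<le> Kh * \<bar>x - y\<bar> powr e" using hg[OF ga(1)[OF xL], of x y] ga(2)[OF xL] xy by auto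
   also have "\<dots> \<le> 3 * Kh * \<bar>x - y\<bar> powr e" using Kh0 by (intro mult_right_mono) auto
   finally show ?thesis .
  qed
 qed
 have h: "\<bar>D k x - D k y\<bar> \<le> 3 * Kh * \<bar>x - y\<bar> powr e" for x y
 proof (cases x y rule: linorder_cases)
  case less then show ?thesis using hxy by blast
 next
  case greater then show ?thesis using hxy[of y x] by (simp add: abs_minus_commute)
 qed simp
 define Kb where "Kb = real (Suc k) * K + real (Suc k) * (K * B)"
 have bdD: "\<bar>D i x\<bar> \<le> Kb" if i: "i \<le> k" for i x
 proof (cases "x \<in> L")
  case True
  have "K * 1 \<le> K * real (Suc k)" using K0 by (intro mult_left_mono) auto
  moreover have "0 \<le> real (Suc k) * (K * B)" using K0 B0 by simp
  ultimately have "K \<le> Kb" unfolding Kb_def by (simp add: mult.commute)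
  then show ?thesis using DL[OF True] bd[OF i True] by simp
 next
  case False
  define a b where "a = fst (ga x)" and "b = snd (ga x)"
  have g: "is_gap L a b" "x \<in> {a<..<b}" using ga[OF False] unfolding a_def b_def by auto
  have ab: "a < b" "b - a \<le> 1" "a \<in> L" using g len unfolding is_gap_def by auto
  have "\<bar>F (i+l) a * (x - a) ^ l / fact l\<bar> \<le> K" if "l \<in> {..k-i}" for l
  proof -
   have "\<bar>x - a\<bar> ^ l \<le> 1" using g ab by (intro power_le_one) auto
   then have "\<bar>x - a\<bar> ^ l \<le> fact l" using fact_ge_1[of l, where 'a = real] by (rule order_trans)
   then have "\<bar>x - a\<bar> ^ l / fact l \<le> 1" by (simp add: divide_le_eq_1)
   then have "\<bar>F (i+l) a\<bar> * (\<bar>x - a\<bar> ^ l / fact l) \<le> K * 1"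
    using bd[of "i+l" a] ab that i K0 by (intro mult_mono) auto
   then show ?thesis by (simp add: abs_mult power_abs)
  qed
  then have "\<bar>jet_taylor k F i a x\<bar> \<le> real (card {..k-i}) * K" unfolding jet_taylor_def by (rule abs_sum_le_card)
  also have "\<dots> = real (Suc (k - i)) * K" by simp
  also have "\<dots> \<le> real (Suc k) * K" using K0 by (intro mult_right_mono) auto
  finally have 1: "\<bar>jet_taylor k F i a x\<bar> \<le> real (Suc k) * K" .
  have "(x - a) / (b - a) \<in> {0..1}" using g ab by (auto simp: divide_le_eq_1)
  from fill[OF g(1) i, of "\<lambda>m. poly ((pderiv ^^ i) (jet_poly k m)) ((x - a) / (b - a))" B] Bb[OF i _ this]
  have "\<bar>(\<Sum>m\<le>k. (F m b - jet_taylor k F m a b) * (b - a) ^ m * (poly ((pderiv ^^ i) (jet_poly k m)) ((x - a) / (b - a)) / (b - a) ^ i))\<bar>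
    \<le> real (Suc k) * (K * (b - a) powr (real k + e - real i) * B)" by blast
  also have "\<dots> \<le> real (Suc k) * (K * 1 * B)"
   using ab i e K0 B0 by (intro mult_left_mono mult_right_mono powr_le1) auto
  finally show ?thesis using 1 Dg[OF g(1) _ i, of x] g(2) unfolding gap_fill_def Kb_def by auto
 qed
 have bk: "bfam 0 e UNIV {()} (\<lambda>_. D k)"
 proof (rule bfam_0I[of _ _ _ "max Kb (3 * Kh)"])
  show "\<bar>D k x\<bar> \<le> max Kb (3 * Kh)" for x using bdD[OF order_refl, of x] by linarith
  show "\<bar>D k x - D k y\<bar> \<le> max Kb (3 * Kh) * \<bar>x - y\<bar> powr e" for x y
   by (rule order_trans[OF h mult_right_mono]) auto
 qed
 have contk: "continuous_on UNIV (D k)"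
  using bfam_imp_Ck_eps_on[OF at_within_nontrivial(2) e(1) bk] by (simp add: Ck_eps_on_0)
 have stp: "(D i has_real_derivative D (Suc i) x) (at x)" if i: "i < k" and c: "continuous_on UNIV (D (Suc i))" for i x
 proof (rule glue_derivative[OF gaps c _ _ e(1), where K = "K + real (Suc k) * K"])
  fix a b x assume g: "is_gap L a b" "x \<in> {a..b}"
  have "a < b" using g unfolding is_gap_def by auto
  then have "(gap_fill k F a b i has_real_derivative gap_fill k F a b (Suc i) x) (at x within {a..b})"
   by (rule gap_fill_deriv[OF i])
  then have "(gap_fill k F a b i has_real_derivative D (Suc i) x) (at x within {a..b})"
   using Dg[OF g, of "Suc i"] i by simp
  then show "(D i has_real_derivative D (Suc i) x) (at x within {a..b})"
   by (rule has_field_derivative_transform_within[OF _ zero_less_one g(2)]) (use Dg[OF g(1)] i in auto)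
 next
  fix x y assume xy: "x \<in> L" "y \<in> L" "\<bar>y - x\<bar> < 1"
  show "\<bar>D i y - D i x - D (Suc i) x * (y - x)\<bar> \<le> (K + real (Suc k) * K) * \<bar>y - x\<bar> powr (1 + e)"
  proof (cases "y = x")
   case False
   have U: "{..k-i} = {0,1} \<union> {2..k-i}" using i by auto
   define R where "R = (\<Sum>l\<in>{2..k-i}. F (i+l) x * (y - x) ^ l / fact l)"
   have T: "jet_taylor k F i x y = F i x + F (Suc i) x * (y - x) + R"
    unfolding jet_taylor_def U R_def by (subst sum.union_disjoint) auto
   have "\<bar>F (i+l) x * (y - x) ^ l / fact l\<bar> \<le> K * \<bar>y - x\<bar> powr (1 + e)" if l: "l \<in> {2..k-i}" for l
   proof -
    have "\<bar>y - x\<bar> powr real l \<le> \<bar>y - x\<bar> powr (1 + e)"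
     by (rule powr_mono') (use l e xy(3) in auto)
    moreover have "\<bar>y - x\<bar> powr real l = \<bar>y - x\<bar> ^ l" using False by (simp add: powr_realpow)
    moreover have "\<bar>y - x\<bar> ^ l / fact l \<le> \<bar>y - x\<bar> ^ l" by (simp add: divide_le_eq mult_le_cancel_left1)
    ultimately have "\<bar>y - x\<bar> ^ l / fact l \<le> \<bar>y - x\<bar> powr (1 + e)" by linarith
    then have "\<bar>F (i+l) x\<bar> * (\<bar>y - x\<bar> ^ l / fact l) \<le> K * \<bar>y - x\<bar> powr (1 + e)"
     using bd[of "i+l" x] xy(1) l i K0 by (intro mult_mono) auto
    then show ?thesis by (simp add: abs_mult power_abs)
   qed
   then have "\<bar>R\<bar> \<le> real (card {2..k-i}) * (K * \<bar>y - x\<bar> powr (1 + e))" unfolding R_def by (rule abs_sum_le_card)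
   also have "\<dots> \<le> real (Suc k) * (K * \<bar>y - x\<bar> powr (1 + e))" using K0 by (intro mult_right_mono) auto
   finally have R: "\<bar>R\<bar> \<le> real (Suc k) * K * \<bar>y - x\<bar> powr (1 + e)" by (simp add: mult.assoc)
   have "\<bar>F i y - jet_taylor k F i x y\<bar> \<le> K * \<bar>y - x\<bar> powr (real k + e - real i)"
    using W[OF _ xy(1,2)] i by simp
   also have "\<dots> \<le> K * \<bar>y - x\<bar> powr (1 + e)"
    using K0 i xy(3) by (intro mult_left_mono powr_mono') auto
   finally have "\<bar>F i y - jet_taylor k F i x y\<bar> \<le> K * \<bar>y - x\<bar> powr (1 + e)" .
   then show ?thesis using R unfolding T DL[OF xy(1)] DL[OF xy(2)] distrib_right by linarith
  qed (use K0 in simp)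
 qed
 have cont: "continuous_on UNIV (D (k - j))" if "j \<le> k" for j using that
 proof (induction j)
  case 0 then show ?case using contk by simp
 next
  case (Suc j)
  then have "k - j = Suc (k - Suc j)" "k - Suc j < k" by auto
  then have "(D (k - Suc j) has_real_derivative D (k - j) x) (at x)" for x using stp[of "k - Suc j"] Suc by simp
  then show ?case using DERIV_continuous continuous_at_imp_continuous_on by blast
 qed
 have der: "(D i has_real_derivative D (Suc i) x) (at x)" if i: "i < k" for i x
  using stp[OF i] cont[of "k - Suc i"] i by simp
 have "bfam (k - i) e UNIV {()} (\<lambda>_. D i)" if "i \<le> k" for i
  using that
 proof (induction "k - i" arbitrary: i)
  case 0
  then have ik: "i = k" by simp
  show ?case unfolding ik diff_self_eq_0 by (rule bk)
 next
  case (Suc n)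
  then have i: "i < k" "k - Suc i = n" "k - i = Suc n" by auto
  have b: "bfam n e UNIV {()} (\<lambda>_. D (Suc i))" using Suc.hyps(1)[of "Suc i"] i by simp
  show ?case unfolding i(3) using bdD[of i] i(1) by (intro bfam_SucI[OF _ _ b] der) auto
 qed
 then show thesis using that[of D] DL der by blast
qed

section \<open>Extension from a compact subset of the unit interval\<close>

lemma is_gap_notin: "is_gap L a b ==> a < z ==> z < b ==> z \<notin> L"
 unfolding is_gap_def by auto

lemma closed_gap_exists:
 fixes L :: "real set"
 assumes "closed L" "x \<notin> L" "p \<in> L" "p < x" "q \<in> L" "x < q"
 shows "\<exists>a b. is_gap L a b \<and> x \<in> {a<..<b}"
proof -
 have c: "compact (L \<inter> {p..x})" "compact (L \<inter> {x..q})"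
  using assms(1) by (auto intro: closed_Int_compact)
 have ne: "L \<inter> {p..x} \<noteq> {}" "L \<inter> {x..q} \<noteq> {}" using assms by auto
 obtain a where a: "a \<in> L \<inter> {p..x}" "\<And>t. t \<in> L \<inter> {p..x} ==> t \<le> a" using compact_attains_sup[OF c(1) ne(1)] by blast
 obtain b where b: "b \<in> L \<inter> {x..q}" "\<And>t. t \<in> L \<inter> {x..q} ==> b \<le> t" using compact_attains_inf[OF c(2) ne(2)] by blast
 have ab: "a < x" "x < b" using a(1) b(1) assms(2) by (auto simp: less_le)
 have "z \<notin> L" if z: "a < z" "z < b" for z
 proof
  assume "z \<in> L"
  then show False using a(1) b(1) a(2)[of z] b(2)[of z] z by (cases "z \<le> x") auto
 qed
 then have "is_gap L a b" using a(1) b(1) ab unfolding is_gap_def by auto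
 then show ?thesis using ab by auto
qed

lemma jet_taylor_affine:
 assumes "1 \<le> k" "m \<le> k"
 shows "jet_taylor k (\<lambda>m x. if m = 0 then A + s * x else if m = 1 then s else 0) m x y =
  (if m = 0 then A + s * y else if m = 1 then s else (0::real))"
proof (cases "m = 0")
 case True
 have "{..k} = {0,1} \<union> {2..k}" using assms by auto
 then show ?thesis unfolding jet_taylor_def True
  by (simp only: diff_zero) (subst sum.union_disjoint, auto simp: algebra_simps)
next
 case False
 have "(\<Sum>l\<le>k-m. (if m+l = 0 then A + s * x else if m+l = 1 then s else 0) * (y - x) ^ l / fact l) =
  (\<Sum>l\<in>{0}. (if m+l = 0 then A + s * x else if m+l = 1 then s else 0) * (y - x) ^ l / fact l)"
  by (rule sum.mono_neutral_right) (use False in auto)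
 then show ?thesis unfolding jet_taylor_def using False by simp
qed

text \<open>
 With the two rays added all gaps are bounded, and prescribing an affine function there makes the
 extensions surjective.
\<close>

definition with_rays :: "real set \<Rightarrow> real set" where "with_rays S = {..-1} \<union> S \<union> {2..}"

lemma with_rays_gaps:
 assumes "compact S" "x \<notin> with_rays S"
 shows "\<exists>a b. is_gap (with_rays S) a b \<and> x \<in> {a<..<b}"
proof (rule closed_gap_exists[of _ x "-1" 2])
 show "closed (with_rays S)" unfolding with_rays_def using assms(1) by (intro closed_Un closed_atMost closed_atLeast compact_imp_closed)
qed (use assms(2) in \<open>auto simp: with_rays_def\<close>)

lemma with_rays_gap_bounds:
 assumes S: "S \<subseteq> {0..1}" "0 \<in> S" "1 \<in> S" and g: "is_gap (with_rays S) a b"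
 shows "-1 \<le> a" "b \<le> 2" "b - a \<le> 1"
proof -
 have ab: "a \<in> with_rays S" "b \<in> with_rays S" "a < b" and no: "\<And>z. a < z ==> z < b ==> z \<notin> with_rays S"
  using g unfolding is_gap_def by auto
 have in_L: "z \<le> -1 ==> z \<in> with_rays S" "z \<ge> 2 ==> z \<in> with_rays S" "0 \<in> with_rays S" "1 \<in> with_rays S" for z
  using S unfolding with_rays_def by auto
 show 1: "-1 \<le> a"
 proof (rule ccontr)
  assume "\<not> -1 \<le> a"
  then obtain z where "a < z" "z < min b (-1)" using dense[of a "min b (-1)"] ab by auto
  then show False using no[of z] in_L(1)[of z] by auto
 qed
 show 2: "b \<le> 2"
 proof (rule ccontr)
  assume "\<not> b \<le> 2"
  then obtain z where "max a 2 < z" "z < b" using dense[of "max a 2" b] ab by auto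
  then show False using no[of z] in_L(2)[of z] by auto
 qed
 have a: "a = -1 \<or> (0 \<le> a \<and> a \<le> 1)" using ab 1 2 S(1) unfolding with_rays_def by auto
 show "b - a \<le> 1"
 proof (cases "a < 0")
  case True
  then show ?thesis using no[of 0] in_L(3) a by force
 next
  case False
  then show ?thesis using no[of 1] in_L(4) a 2 by force
 qed
qed

text \<open>
 After subtraction of the affine function through the values at 0 and 1 the jet may be continued by 0
 on the rays: these have distance 1 from \<open>S\<close>, so the Whitney condition between them and \<open>S\<close> follows from
 boundedness.
\<close>

theorem extension_from_compact:
 fixes F :: "nat \<Rightarrow> real \<Rightarrow> real" and e K :: real
 assumes e: "0 < e" "e \<le> 1" and k: "1 \<le> k" and K0: "K \<ge> 0"
  and S: "compact S" "S \<subseteq> {0..1}" "0 \<in> S" "1 \<in> S"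
  and W: "\<And>m x y. m \<le> k ==> x \<in> S ==> y \<in> S ==> \<bar>F m y - jet_taylor k F m x y\<bar> \<le> K * \<bar>y - x\<bar> powr (real k + e - real m)"
  and bd: "\<And>m x. m \<le> k ==> x \<in> S ==> \<bar>F m x\<bar> \<le> K"
 obtains f f' where "\<And>x. (f has_real_derivative f' x) (at x)" "bfam (k - 1) e UNIV {()} (\<lambda>_. f')"
  "\<And>x. x \<in> S ==> f x = F 0 x"
  "\<And>x. x \<le> -1 \<or> 2 \<le> x ==> f x = F 0 0 + (F 0 1 - F 0 0) * x"
proof -
 define A s where "A = F 0 0" and "s = F 0 1 - F 0 0"
 define aff where "aff = (\<lambda>(m::nat) x. if m = 0 then A + s * x else if m = 1 then s else 0)"
 define F' where "F' = (\<lambda>m x. if x \<in> S then F m x - aff m x else 0)"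
 have Taff: "jet_taylor k aff m x y = aff m y" if "m \<le> k" for m x y
  unfolding aff_def by (rule jet_taylor_affine[OF k that])
 have As: "\<bar>A\<bar> \<le> K" "\<bar>s\<bar> \<le> 2 * K" using bd[of 0 0] bd[of 0 1] S unfolding A_def s_def by auto
 have affb: "\<bar>aff m x\<bar> \<le> 3 * K" if x: "x \<in> S" for m x
 proof -
  have "\<bar>s * x\<bar> \<le> 2 * K * 1" unfolding abs_mult using As(2) x S(2) by (intro mult_mono) auto
  then show ?thesis unfolding aff_def using As K0 by (auto intro: order_trans[OF abs_triangle_ineq])
 qed
 have F'b: "\<bar>F' m x\<bar> \<le> 4 * K" if "m \<le> k" for m x
  unfolding F'_def using bd[OF that, of x] affb[of x m] K0 by auto
 define K' where "K' = real (k + 1) * (4 * K)"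
 have K': "K \<le> K'" "4 * K \<le> K'" "0 \<le> K'"
  unfolding K'_def using mult_right_mono[of 1 "real (k+1)" "4 * K"] K0 by auto
 have T0: "jet_taylor k F' m x y = 0" if "x \<notin> S" for m x y unfolding jet_taylor_def F'_def using that by simp
 have TS: "jet_taylor k F' m x y = jet_taylor k F m x y - jet_taylor k aff m x y" if "x \<in> S" for m x y
  unfolding jet_taylor_def F'_def using that
  by (simp add: sum_subtractf[symmetric] left_diff_distrib diff_divide_distrib)
 have W': "\<bar>F' m y - jet_taylor k F' m x y\<bar> \<le> K' * \<bar>y - x\<bar> powr (real k + e - real m)"
  if m: "m \<le> k" and x: "x \<in> with_rays S" and y: "y \<in> with_rays S" for m x y
 proof -
  have p0: "0 \<le> \<bar>y - x\<bar> powr (real k + e - real m)" by simp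
  have far: "1 \<le> \<bar>y - x\<bar>" if "(x \<in> S) \<noteq> (y \<in> S)"
   using that x y S(2) unfolding with_rays_def by force
  have p1: "1 \<le> \<bar>y - x\<bar> powr (real k + e - real m)" if "(x \<in> S) \<noteq> (y \<in> S)"
   using far[OF that] e m by (intro ge_one_powr_ge_zero) auto
  consider "x \<in> S" "y \<in> S" | "x \<notin> S" "y \<notin> S" | "x \<notin> S" "y \<in> S" | "x \<in> S" "y \<notin> S" by blast
  then show ?thesis
  proof cases
   case 1
   have "F' m y - jet_taylor k F' m x y = F m y - jet_taylor k F m x y"
    using TS[OF 1(1), of m y] Taff[OF m, of x y] 1(2) by (simp add: F'_def[THEN fun_cong, THEN fun_cong, of m y])
   then show ?thesis using W[OF m 1] mult_right_mono[OF K'(1) p0] by linarith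
  next
   case 2
   then show ?thesis using T0 K'(3) unfolding F'_def by simp
  next
   case 3
   have "K' * 1 \<le> K' * \<bar>y - x\<bar> powr (real k + e - real m)" using K'(3) p1 3 by (intro mult_left_mono) auto
   then show ?thesis using F'b[OF m, of y] K'(2) unfolding T0[OF 3(1)] by simp
  next
   case 4
   have d: "1 \<le> \<bar>y - x\<bar>" using far 4 by blast
   have "\<bar>F' (m+l) x * (y - x) ^ l / fact l\<bar> \<le> 4 * K * \<bar>y - x\<bar> powr (real k + e - real m)" if l: "l \<in> {..k-m}" for l
   proof -
    have "\<bar>y - x\<bar> ^ l / fact l \<le> \<bar>y - x\<bar> ^ l / 1" by (intro divide_left_mono) auto
    also have "\<dots> = \<bar>y - x\<bar> powr real l" using d by (simp add: powr_realpow)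
    also have "\<dots> \<le> \<bar>y - x\<bar> powr (real k + e - real m)" using d l m e by (intro powr_mono) auto
    finally have "\<bar>F' (m+l) x\<bar> * (\<bar>y - x\<bar> ^ l / fact l) \<le> 4 * K * \<bar>y - x\<bar> powr (real k + e - real m)"
     using F'b[of "m+l" x] l m K0 by (intro mult_mono) auto
    then show ?thesis by (simp add: abs_mult power_abs)
   qed
   then have "\<bar>jet_taylor k F' m x y\<bar> \<le> real (card {..k-m}) * (4 * K * \<bar>y - x\<bar> powr (real k + e - real m))"
    unfolding jet_taylor_def by (rule abs_sum_le_card)
   also have "\<dots> \<le> real (k + 1) * (4 * K * \<bar>y - x\<bar> powr (real k + e - real m))"
    using K0 by (intro mult_right_mono) auto
   finally show ?thesis using 4(2) unfolding K'_def F'_def by (simp add: mult.assoc)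
  qed
 qed
 have bd': "\<bar>F' m x\<bar> \<le> K'" if "m \<le> k" for m x using F'b[OF that, of x] K'(2) by linarith
 obtain D where D: "\<And>i x. i \<le> k ==> x \<in> with_rays S ==> D i x = F' i x"
  "\<And>i x. i < k ==> (D i has_real_derivative D (Suc i) x) (at x)"
  "\<And>i. i \<le> k ==> bfam (k - i) e UNIV {()} (\<lambda>_. D i)"
  by (rule whitney_extension[OF e K'(3) with_rays_gaps[OF S(1)] with_rays_gap_bounds(3)[OF S(2-4)] W' bd']) (assumption | (rule that; assumption))+
 show thesis
 proof (rule that[of "\<lambda>x. D 0 x + (A + s * x)" "\<lambda>x. D 1 x + s"])
  show "((\<lambda>x. D 0 x + (A + s * x)) has_real_derivative D 1 x + s) (at x)" for x
   using D(2)[of 0 x] k by (auto intro!: derivative_eq_intros)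
  show "bfam (k - 1) e UNIV {()} (\<lambda>_ x. D 1 x + s)"
   by (rule bfam_add[OF D(3)[OF k] bfam_const[of _ "\<lambda>_. s" "\<bar>s\<bar>"]]) simp
  show "D 0 x + (A + s * x) = F 0 x" if "x \<in> S" for x
   using D(1)[of 0 x] that unfolding with_rays_def F'_def aff_def by simp
  show "D 0 x + (A + s * x) = F 0 0 + (F 0 1 - F 0 0) * x" if "x \<le> -1 \<or> 2 \<le> x" for x
  proof -
   have "x \<in> with_rays S" "x \<notin> S" using that S(2) unfolding with_rays_def by auto
   then show ?thesis using D(1)[of 0 x] unfolding F'_def A_def s_def by simp
  qed
 qed
qed

section \<open>Adjusting the derivative in the gaps\<close>

lemma lfam_id: "lfam m e UNIV I (\<lambda>i x. x)"
proof (cases m)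
 case 0 show ?thesis unfolding 0 by (rule lfam_0I[of _ _ _ 1]) simp
next
 case (Suc n)
 show ?thesis unfolding Suc by (rule lfam_SucI[where F' = "\<lambda>i x. 1", OF _ bfam_const[of _ _ 1]]) auto
qed

lemma bfam_continuous:
 assumes "0 < e" "e \<le> 1" "bfam n e UNIV {()} (\<lambda>_. f)" shows "continuous_on UNIV f"
proof -
 have "bfam 0 e UNIV {()} (\<lambda>_. f)" by (rule bfam_mono[OF assms(1,2) _ assms(3)]) auto
 from bfam_imp_Ck_eps_on[OF at_within_nontrivial(2) assms(1) this] show ?thesis by (simp add: Ck_eps_on_0)
qed

text \<open>
 A Whitney extension need not stay between 0 and 1; \<open>u\<^sup>2 / (u\<^sup>2 + (1 - u)\<^sup>2)\<close> does, with the same values at 0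
 and 1.
\<close>

lemma smooth_step_exists:
 assumes e: "0 < e" "e \<le> 1"
 obtains \<theta> where "bfam n e UNIV {()} (\<lambda>_. \<theta>)" "\<And>t. 0 \<le> \<theta> t" "\<And>t. \<theta> t \<le> (1::real)"
  "\<And>t. t \<le> 0 ==> \<theta> t = 0" "\<And>t. 1 \<le> t ==> \<theta> t = 1"
proof -
 let ?L = "{..0} \<union> {1..} :: real set"
 define F where "F = (\<lambda>(m::nat) x::real. if m = 0 \<and> 1 \<le> x then 1 else 0::real)"
 obtain D where D: "\<And>i x. i \<le> n ==> x \<in> ?L ==> D i x = F i x"
  "\<And>i x. i < n ==> (D i has_real_derivative D (Suc i) x) (at x)" "\<And>i. i \<le> n ==> bfam (n - i) e UNIV {()} (\<lambda>_. D i)"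
 proof (rule whitney_extension[OF e zero_le_one, of ?L n F])
  show "\<exists>a b. is_gap ?L a b \<and> x \<in> {a<..<b}" if "x \<notin> ?L" for x
   by (rule exI[of _ 0], rule exI[of _ 1]) (use that in \<open>auto simp: is_gap_def\<close>)
  show "b - a \<le> 1" if g: "is_gap ?L a b" for a b
  proof (rule ccontr)
   assume c: "\<not> b - a \<le> 1"
   define \<delta> where "\<delta> = (b - a - 1) / 4"
   have \<delta>: "4 * \<delta> = b - a - 1" "0 < \<delta>" using c unfolding \<delta>_def by auto
   have d: "a < a + \<delta>" "a + \<delta> < b" "a < b - \<delta>" "b - \<delta> < b" using \<delta> c by auto
   have "a + \<delta> \<notin> ?L" "b - \<delta> \<notin> ?L" using is_gap_notin[OF g d(1,2)] is_gap_notin[OF g d(3,4)] .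
   then have "0 < a + \<delta>" "b - \<delta> < 1" by auto
   then show False using c \<delta> by linarith
  qed
  fix m x y assume m: "m \<le> n" and xy: "x \<in> ?L" "y \<in> ?L"
  have "jet_taylor n F m x y = (\<Sum>l\<le>n-m. if l = 0 then F m x else 0)"
   unfolding jet_taylor_def by (rule sum.cong) (auto simp: F_def)
  then have t: "jet_taylor n F m x y = F m x" by simp
  show "\<bar>F m y - jet_taylor n F m x y\<bar> \<le> 1 * \<bar>y - x\<bar> powr (real n + e - real m)"
  proof (cases "F m y = F m x")
   case False
   then have "1 \<le> \<bar>y - x\<bar>" using xy unfolding F_def by (auto split: if_splits)
   then have "1 \<le> \<bar>y - x\<bar> powr (real n + e - real m)" using m e(1) by (intro ge_one_powr_ge_zero) auto
   moreover have "\<bar>F m y - F m x\<bar> \<le> 1" unfolding F_def by auto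
   ultimately show ?thesis unfolding t by linarith
  qed (simp add: t)
 qed (simp add: F_def, (rule that; assumption))
 define u where "u = D 0"
 define v where "v = (\<lambda>t. u t * u t + (1 - u t) * (1 - u t))"
 have u: "bfam n e UNIV {()} (\<lambda>_. u)" using D(3)[of 0] unfolding u_def by simp
 have u1: "bfam n e UNIV {()} (\<lambda>_ t. 1 - u t)" by (rule bfam_diff[OF e convex_UNIV bfam_const[of _ _ 1] u]) simp
 have v: "1/2 \<le> v t" for t
 proof -
  have "v t = 1/2 + (2 * u t - 1) * (2 * u t - 1) / 2" unfolding v_def by (simp add: field_simps)
  then show ?thesis by simp
 qed
 have uu: "bfam n e UNIV {()} (\<lambda>_ t. u t * u t)" by (rule bfam_mult[OF e convex_UNIV u u])
 have vb: "bfam n e UNIV {()} (\<lambda>_. v)"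
  unfolding v_def by (rule bfam_add[OF uu bfam_mult[OF e convex_UNIV u1 u1]])
 have iv: "bfam n e UNIV {()} (\<lambda>_ t. 1 / v t)" by (rule bfam_inverse[OF e convex_UNIV vb, of "1/2"]) (use v in auto)
 have le: "u t * u t \<le> v t" "0 < v t" for t using v[of t] unfolding v_def by auto
 show thesis
 proof (rule that[of "\<lambda>t. u t * u t * (1 / v t)"])
  show "bfam n e UNIV {()} (\<lambda>_ t. u t * u t * (1 / v t))" by (rule bfam_mult[OF e convex_UNIV uu iv])
  show "u t * u t * (1 / v t) \<le> 1" "0 \<le> u t * u t * (1 / v t)" for t using le[of t] by auto
  show "u t * u t * (1 / v t) = 0" if "t \<le> 0" for t using D(1)[of 0 t] that by (simp add: u_def F_def)
  show "u t * u t * (1 / v t) = 1" if "1 \<le> t" for t using D(1)[of 0 t] that by (simp add: u_def v_def F_def)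
 qed
qed

lemma cutoff_exists:
 fixes a b \<tau> :: real
 assumes e: "0 < e" "e \<le> 1" and t: "0 < \<tau>"
 obtains ct where "bfam n e UNIV {()} (\<lambda>_. ct)" "\<And>x. 0 \<le> ct x \<and> ct x \<le> 1"
  "\<And>x. x \<le> a \<or> b \<le> x ==> ct x = 0" "\<And>x. a + \<tau> \<le> x ==> x \<le> b - \<tau> ==> ct x = 1"
proof -
 obtain \<theta> where b: "bfam n e UNIV {()} (\<lambda>_. \<theta>)" and r: "\<And>t. 0 \<le> \<theta> t" "\<And>t. \<theta> t \<le> (1::real)"
  and z: "\<And>t. t \<le> 0 ==> \<theta> t = 0" and o: "\<And>t. 1 \<le> t ==> \<theta> t = 1"
  by (rule smooth_step_exists[OF e]) (rule that)
 have aff: "bfam n e UNIV {()} (\<lambda>_ x. \<theta> (p + q * x))" for p q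
  by (rule bfam_comp[OF e convex_UNIV b lfam_scale[OF e convex_UNIV lfam_id, where K = "\<bar>q\<bar>" and b = "\<lambda>_. p" and c = "\<lambda>_. q"] convex_UNIV]) auto
 show thesis
 proof (rule that[of "\<lambda>x. \<theta> (- a / \<tau> + 1 / \<tau> * x) * \<theta> (b / \<tau> + (- 1 / \<tau>) * x)"])
  show "bfam n e UNIV {()} (\<lambda>_ x. \<theta> (- a / \<tau> + 1 / \<tau> * x) * \<theta> (b / \<tau> + (- 1 / \<tau>) * x))"
   by (rule bfam_mult[OF e convex_UNIV aff aff])
  show "0 \<le> \<theta> (- a / \<tau> + 1 / \<tau> * x) * \<theta> (b / \<tau> + (- 1 / \<tau>) * x) \<and> \<theta> (- a / \<tau> + 1 / \<tau> * x) * \<theta> (b / \<tau> + (- 1 / \<tau>) * x) \<le> 1" for x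
   using r by (auto intro: mult_le_one)
  have eq: "- a / \<tau> + 1 / \<tau> * x = (x - a) / \<tau>" "b / \<tau> + (- 1 / \<tau>) * x = (b - x) / \<tau>" for x
   by (simp_all add: diff_divide_distrib)
  show "\<theta> (- a / \<tau> + 1 / \<tau> * x) * \<theta> (b / \<tau> + (- 1 / \<tau>) * x) = 0" if "x \<le> a \<or> b \<le> x" for x
   unfolding eq using that z t by (auto simp: divide_nonpos_pos)
  show "\<theta> (- a / \<tau> + 1 / \<tau> * x) * \<theta> (b / \<tau> + (- 1 / \<tau>) * x) = 1" if "a + \<tau> \<le> x" "x \<le> b - \<tau>" for x
  proof -
   have "1 \<le> (x - a) / \<tau>" "1 \<le> (b - x) / \<tau>" using that t by (auto simp: le_divide_eq)
   then show ?thesis unfolding eq using o by simp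
  qed
 qed
qed

text \<open>
 The vanishing integral is what lets the antiderivative return to 0 at \<open>b\<close>.
\<close>

lemma antiderivative_supported:
 fixes g :: "real \<Rightarrow> real"
 assumes c: "continuous_on UNIV g" and z: "\<And>x. x \<notin> {a<..<b} ==> g x = 0" and i: "integral {a..b} g = 0" and ab: "a < b"
 obtains G where "\<And>x. (G has_real_derivative g x) (at x)" "\<And>x. x \<notin> {a<..<b} ==> G x = 0"
proof -
 define G where "G = (\<lambda>x. integral {a-1..x} g)"
 have ic: "g integrable_on {p..q}" for p q by (rule integrable_continuous_real[OF continuous_on_subset[OF c]]) auto
 have zero: "integral {p..q} g = 0" if "\<And>x. x \<in> {p..q} ==> x \<notin> {a<..<b}" for p q
  using integral_cong[of "{p..q}" g "\<lambda>_. 0"] z that by auto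
 have Gl: "G x = 0" if "x \<le> a" for x unfolding G_def by (rule zero) (use that in auto)
 have Gr: "G x = 0" if "b \<le> x" for x
 proof -
  have "G x = integral {a-1..a} g + integral {a..x} g" unfolding G_def
   by (rule Henstock_Kurzweil_Integration.integral_combine[symmetric, OF _ _ ic]) (use that ab in auto)
  also have "integral {a..x} g = integral {a..b} g + integral {b..x} g"
   by (rule Henstock_Kurzweil_Integration.integral_combine[symmetric, OF _ _ ic]) (use that ab in auto)
  finally show ?thesis using i zero[of "a-1" a] zero[of b x] by simp
 qed
 have "(G has_real_derivative g x) (at x)" for x
 proof (cases "x < a")
  case True
  have "((\<lambda>_. 0) has_real_derivative g x) (at x)" using z[of x] True by simp
  then show ?thesis
   by (rule has_field_derivative_transform_within_open[of _ _ _ "{..<a}"]) (use True Gl in auto)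
 next
  case False
  have "(G has_real_derivative g x) (at x within {a-1..x+1})" unfolding G_def
   by (rule integral_has_real_derivative[OF continuous_on_subset[OF c]]) (use False in auto)
  then show ?thesis using at_within_Icc_at[of "a-1" x "x+1"] False by simp
 qed
 then show thesis using that[of G] Gl Gr by (metis greaterThanLessThan_iff not_less)
qed

text \<open>
 Inside the gap \<open>f'\<close> is replaced by a constant, by means of a cutoff. The constant is determined by the
 requirement that the increment over the gap does not change; since the increment lies between
 \<open>c * (b - a)\<close> and \<open>l * (b - a)\<close> and the transition zones are short, the constant lies between \<open>c - \<eta>\<close> and
 \<open>l + \<eta>\<close>. Near the ends \<open>f'\<close> is within these bounds by continuity.
\<close>

lemma gap_correction:
 fixes f f' :: "real \<Rightarrow> real"
 assumes e: "0 < e" "e \<le> 1" and ab: "a < b" and d: "\<And>x. (f has_real_derivative f' x) (at x)"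
  and bf: "bfam n e UNIV {()} (\<lambda>_. f')"
  and ends: "c \<le> f' a" "f' a \<le> l" "c \<le> f' b" "f' b \<le> l"
  and sec: "c * (b - a) \<le> f b - f a" "f b - f a \<le> l * (b - a)" and h: "\<eta> > 0"
 obtains \<kappa> \<kappa>' where "\<And>x. (\<kappa> has_real_derivative \<kappa>' x) (at x)" "bfam n e UNIV {()} (\<lambda>_. \<kappa>')"
  "\<And>x. x \<notin> {a<..<b} ==> \<kappa> x = 0 \<and> \<kappa>' x = 0"
  "\<And>x. x \<in> {a..b} ==> c - \<eta> \<le> f' x + \<kappa>' x \<and> f' x + \<kappa>' x \<le> l + \<eta>"
proof -
 have cf: "continuous_on UNIV f'" by (rule bfam_continuous[OF e bf])
 have cl: "c \<le> l" using ends by linarith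
 have "isCont f' a" "isCont f' b" using cf by (auto simp: continuous_on_eq_continuous_at)
 then obtain d1 d2 where d12: "d1 > 0" "\<And>x. \<bar>x - a\<bar> < d1 ==> \<bar>f' x - f' a\<bar> < \<eta> / 2" "d2 > 0" "\<And>x. \<bar>x - b\<bar> < d2 ==> \<bar>f' x - f' b\<bar> < \<eta> / 2"
  using h unfolding continuous_at_eps_delta dist_real_def by (metis half_gt_zero)
 have near: "c - \<eta> / 2 \<le> f' x \<and> f' x \<le> l + \<eta> / 2" if "\<bar>x - a\<bar> < d1 \<or> \<bar>x - b\<bar> < d2" for x
  using d12(2)[of x] d12(4)[of x] that ends by linarith
 \<comment> \<open>width of the transition zones: short enough for continuity at the ends and for the last bound, which controls the change of the mean slope\<close>
 define \<tau> where "\<tau> = min (min (d1/2) (d2/2)) (min ((b - a) / 4) (\<eta> * (b - a) / (4 * (l - c + \<eta>))))"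
 have den: "0 < l - c + \<eta>" using cl h by linarith
 have t: "\<tau> > 0" "\<tau> < d1" "\<tau> < d2" "\<tau> \<le> (b - a) / 4" "\<tau> \<le> \<eta> * (b - a) / (4 * (l - c + \<eta>))"
 proof -
  show "\<tau> \<le> (b - a) / 4" unfolding \<tau>_def by (rule min.coboundedI2, rule min.coboundedI1, rule order_refl)
  show "\<tau> \<le> \<eta> * (b - a) / (4 * (l - c + \<eta>))" unfolding \<tau>_def by (rule min.coboundedI2, rule min.coboundedI2, rule order_refl)
  have "\<tau> \<le> d1/2" "\<tau> \<le> d2/2" unfolding \<tau>_def by (rule min.coboundedI1, rule min.coboundedI1, rule order_refl, rule min.coboundedI1, rule min.coboundedI2, rule order_refl)
  then show "\<tau> < d1" "\<tau> < d2" using d12 by linarith+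
  have "0 < \<eta> * (b - a) / (4 * (l - c + \<eta>))" using ab h den by (intro divide_pos_pos mult_pos_pos) auto
  then show "\<tau> > 0" unfolding \<tau>_def using d12 ab by simp
 qed
 have t5: "(l - c + \<eta>) * (2 * \<tau>) \<le> \<eta> * (b - a) / 2" using t(5) den by (simp add: field_simps)
 obtain ct where X: "bfam n e UNIV {()} (\<lambda>_. ct)" "\<And>x. 0 \<le> ct x \<and> ct x \<le> 1"
  "\<And>x. x \<le> a \<or> b \<le> x ==> ct x = 0" "\<And>x. a + \<tau> \<le> x ==> x \<le> b - \<tau> ==> ct x = 1"
  by (rule cutoff_exists[OF e t(1), of n a b]) (rule that)
 have cX: "continuous_on UNIV ct" by (rule bfam_continuous[OF e X(1)])
 have ic: "g integrable_on {p..q}" if "continuous_on UNIV g" for g :: "real \<Rightarrow> real" and p q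
  by (rule integrable_continuous_real[OF continuous_on_subset[OF that]]) auto
 define I1 where "I1 = integral {a..b} ct"
 define P where "P = integral {a..b} (\<lambda>x. 1 - ct x)"
 define Q where "Q = integral {a..b} (\<lambda>x. (1 - ct x) * f' x)"
 define J where "J = integral {a..b} (\<lambda>x. ct x * f' x)"
 have c1: "continuous_on UNIV (\<lambda>x. 1 - ct x)" "continuous_on UNIV (\<lambda>x. (1 - ct x) * f' x)" "continuous_on UNIV (\<lambda>x. ct x * f' x)"
  using cX cf by (auto intro!: continuous_intros)
 have P_eq: "P = (b - a) - I1" unfolding P_def I1_def
  using integral_diff[OF ic[of "\<lambda>_. 1"] ic[OF cX], of a b] ab by simp
 have I1: "b - a - 2 * \<tau> \<le> I1"
 proof -
  have "integral {a+\<tau>..b-\<tau>} ct \<le> integral {a..b} ct"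
   by (rule integral_subset_le) (use t ic[OF cX] X(2) in auto)
  moreover have "integral {a+\<tau>..b-\<tau>} ct = integral {a+\<tau>..b-\<tau>} (\<lambda>_. 1)"
   by (rule integral_cong) (use X(4) in auto)
  ultimately show ?thesis unfolding I1_def using t(4) ab by simp
 qed
 have I1h: "(b - a) / 2 \<le> I1"
 proof -
  have "2 * \<tau> \<le> 2 * ((b - a) / 4)" using t(4) by (intro mult_left_mono) auto
  moreover have "2 * ((b - a) / 4) = (b - a) / 2" "b - a = (b - a) / 2 + (b - a) / 2" by simp_all
  ultimately show ?thesis using I1 by linarith
 qed
 have "0 < (b - a) / 2" using ab by simp
 then have I1p: "I1 > 0" using I1h by (rule less_le_trans)
 have P0: "0 \<le> P" unfolding P_def by (rule integral_nonneg[OF ic[OF c1(1)]]) (use X(2) in auto)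
 have P2: "P \<le> 2 * \<tau>" using P_eq I1 by linarith
 have Xin: "ct x = 1 \<or> (c - \<eta> / 2 \<le> f' x \<and> f' x \<le> l + \<eta> / 2)" if "x \<in> {a..b}" for x
 proof (cases "a + \<tau> \<le> x \<and> x \<le> b - \<tau>")
  case False
  then have "\<bar>x - a\<bar> < d1 \<or> \<bar>x - b\<bar> < d2" using that t by auto
  then show ?thesis using near by blast
 qed (use X(4) in auto)
 have Q1: "(c - \<eta> / 2) * P \<le> Q"
 proof -
  have "integral {a..b} (\<lambda>x. (c - \<eta> / 2) * (1 - ct x)) \<le> Q" unfolding Q_def
  proof (rule integral_le[OF ic ic[OF c1(2)]])
   show "continuous_on UNIV (\<lambda>x. (c - \<eta> / 2) * (1 - ct x))" using cX by (intro continuous_intros)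
   fix x assume "x \<in> {a..b}"
   then have "(1 - ct x) * (c - \<eta> / 2) \<le> (1 - ct x) * f' x"
    using Xin[of x] X(2)[of x] mult_left_mono[of "c - \<eta> / 2" "f' x" "1 - ct x"] by auto
   then show "(c - \<eta> / 2) * (1 - ct x) \<le> (1 - ct x) * f' x" by (simp only: mult.commute)
  qed
  then show ?thesis unfolding P_def by simp
 qed
 have Q2: "Q \<le> (l + \<eta> / 2) * P"
 proof -
  have "Q \<le> integral {a..b} (\<lambda>x. (l + \<eta> / 2) * (1 - ct x))" unfolding Q_def
  proof (rule integral_le[OF ic[OF c1(2)] ic])
   show "continuous_on UNIV (\<lambda>x. (l + \<eta> / 2) * (1 - ct x))" using cX by (intro continuous_intros)
   fix x assume "x \<in> {a..b}"
   then have "(1 - ct x) * f' x \<le> (1 - ct x) * (l + \<eta> / 2)"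
    using Xin[of x] X(2)[of x] mult_left_mono[of "f' x" "l + \<eta> / 2" "1 - ct x"] by auto
   then show "(1 - ct x) * f' x \<le> (l + \<eta> / 2) * (1 - ct x)" by (simp only: mult.commute)
  qed
  then show ?thesis unfolding P_def by simp
 qed
 have "(f' has_integral (f b - f a)) {a..b}"
  by (rule fundamental_theorem_of_calculus)
   (use ab d in \<open>auto simp: has_real_derivative_iff_has_vector_derivative[symmetric] intro: has_field_derivative_at_within\<close>)
 then have "integral {a..b} f' = f b - f a" by (rule integral_unique)
 moreover have "integral {a..b} f' = integral {a..b} (\<lambda>x. ct x * f' x + (1 - ct x) * f' x)"
  by (simp add: algebra_simps)
 moreover have "\<dots> = J + Q" unfolding J_def Q_def by (rule integral_add[OF ic[OF c1(3)] ic[OF c1(2)]])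
 ultimately have J_eq: "J = f b - f a - Q" by linarith
 \<comment> \<open>the constant slope for which the integral of the correction vanishes\<close>
 define m where "m = J / I1"
 have PP: "(l - c + \<eta> / 2) * P \<le> \<eta> * I1"
 proof -
  have "(l - c + \<eta> / 2) * P \<le> (l - c + \<eta>) * (2 * \<tau>)" using P2 P0 cl h by (intro mult_mono) auto
  also have "\<dots> \<le> \<eta> * ((b - a) / 2)" using t5 by simp
  also have "\<dots> \<le> \<eta> * I1" using I1h h by (intro mult_left_mono) auto
  finally show ?thesis .
 qed
 have ba: "b - a = I1 + P" using P_eq by simp
 have "J \<le> (l + \<eta>) * I1"
  using J_eq Q1 sec(2) PP unfolding ba by (simp add: algebra_simps)
 then have m2: "m \<le> l + \<eta>" unfolding m_def using I1p by (simp add: divide_le_eq)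
 have "(c - \<eta>) * I1 \<le> J"
  using J_eq Q2 sec(1) PP unfolding ba by (simp add: algebra_simps)
 then have m1: "c - \<eta> \<le> m" unfolding m_def using I1p by (simp add: le_divide_eq)
 define \<kappa>' where "\<kappa>' = (\<lambda>x. ct x * (m - f' x))"
 have ck: "continuous_on UNIV \<kappa>'" unfolding \<kappa>'_def using cX cf by (intro continuous_intros)
 have zk: "\<kappa>' x = 0" if "x \<notin> {a<..<b}" for x unfolding \<kappa>'_def using X(3)[of x] that by auto
 have "integral {a..b} \<kappa>' = integral {a..b} (\<lambda>x. m * ct x - ct x * f' x)" unfolding \<kappa>'_def by (simp add: algebra_simps)
 also have "\<dots> = integral {a..b} (\<lambda>x. m * ct x) - J" unfolding J_def
  by (rule integral_diff[OF ic ic[OF c1(3)]]) (use cX in \<open>intro continuous_intros\<close>)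
 also have "\<dots> = 0" unfolding m_def using I1p by (simp add: I1_def)
 finally have ik: "integral {a..b} \<kappa>' = 0" .
 obtain \<kappa> where k: "\<And>x. (\<kappa> has_real_derivative \<kappa>' x) (at x)" "\<And>x. x \<notin> {a<..<b} ==> \<kappa> x = 0"
  by (rule antiderivative_supported[OF ck zk ik ab]) (assumption | (rule that; assumption))+
 have bk: "bfam n e UNIV {()} (\<lambda>_. \<kappa>')" unfolding \<kappa>'_def
  by (rule bfam_mult[OF e convex_UNIV X(1) bfam_diff[OF e convex_UNIV bfam_const[of _ "\<lambda>_. m" "\<bar>m\<bar>"] bf]]) simp
 have "c - \<eta> \<le> f' x + \<kappa>' x \<and> f' x + \<kappa>' x \<le> l + \<eta>" if x: "x \<in> {a..b}" for x
 proof (cases "ct x = 1")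
  case True
  then show ?thesis unfolding \<kappa>'_def using m1 m2 by simp
 next
  case False
  then have f: "c - \<eta> \<le> f' x" "f' x \<le> l + \<eta>" using Xin[OF x] h by auto
  have eq: "f' x + \<kappa>' x = (1 - ct x) * f' x + ct x * m" unfolding \<kappa>'_def by (simp add: algebra_simps)
  have "(1 - ct x) * (c - \<eta>) + ct x * (c - \<eta>) \<le> (1 - ct x) * f' x + ct x * m"
   using f m1 X(2)[of x] by (intro add_mono mult_left_mono) auto
  moreover have "(1 - ct x) * f' x + ct x * m \<le> (1 - ct x) * (l + \<eta>) + ct x * (l + \<eta>)"
   using f m2 X(2)[of x] by (intro add_mono mult_left_mono) auto
  ultimately show ?thesis unfolding eq by (simp add: algebra_simps)
 qed
 then show thesis using that[OF k(1) bk] k(2) zk by blast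
qed

lemma bfam_sum:
 assumes "finite A" "\<And>a. a \<in> A ==> bfam m e X {()} (\<lambda>_. f a)"
 shows "bfam m e X {()} (\<lambda>_ x. \<Sum>a\<in>A. f a x)"
 using assms
proof (induction A rule: finite_induct)
 case empty show ?case by (simp, rule bfam_const[of _ _ 0]) simp
next
 case (insert a A)
 then show ?case using bfam_add[of m e X "{()}" "\<lambda>_. f a" "\<lambda>_ x. \<Sum>a\<in>A. f a x"] by simp
qed

text \<open>
 In a gap shorter than \<open>\<delta>\<close> the derivative is close to its value at an end, which lies in \<open>L\<close>. Only
 finitely many gaps are longer, so a finite sum of corrections suffices and stays in the class.
\<close>

theorem adjust_derivative:
 fixes f f' :: "real \<Rightarrow> real"
 assumes e: "0 < e" "e \<le> 1"
  and gaps: "\<And>x. x \<notin> L ==> \<exists>a b. is_gap L a b \<and> x \<in> {a<..<b}"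
  and gb: "\<And>a b. is_gap L a b ==> -1 \<le> a \<and> b \<le> 2"
  and d: "\<And>x. (f has_real_derivative f' x) (at x)"
  and bf: "bfam n e UNIV {()} (\<lambda>_. f')"
  and onL: "\<And>x. x \<in> L ==> c \<le> f' x \<and> f' x \<le> l"
  and sec: "\<And>a b. is_gap L a b ==> c * (b - a) \<le> f b - f a \<and> f b - f a \<le> l * (b - a)" and h: "\<eta> > 0"
 obtains g g' where "\<And>x. (g has_real_derivative g' x) (at x)" "bfam n e UNIV {()} (\<lambda>_. g')"
  "\<And>x. x \<in> L ==> g x = f x" "\<And>x. c - \<eta> \<le> g' x \<and> g' x \<le> l + \<eta>"
proof -
 have b0: "bfam 0 e UNIV {()} (\<lambda>_. f')" by (rule bfam_mono[OF e convex_UNIV bf]) simp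
 obtain K where K: "K \<ge> 0" "\<And>i x. i \<in> {()} ==> x \<in> UNIV ==> \<bar>f' x\<bar> \<le> K"
  "\<And>i x y. i \<in> {()} ==> x \<in> UNIV ==> y \<in> UNIV ==> \<bar>f' x - f' y\<bar> \<le> K * \<bar>x - y\<bar> powr e"
  by (rule bfam_0E[OF b0]) (rule that)
 define \<delta> where "\<delta> = (\<eta> / (K + 1)) powr (1 / e)"
 have del: "\<delta> > 0" unfolding \<delta>_def using h K(1) by simp
 have near: "\<bar>f' x - f' y\<bar> \<le> \<eta>" if "\<bar>x - y\<bar> \<le> \<delta>" for x y
 proof -
  have "\<bar>x - y\<bar> powr e \<le> \<delta> powr e" using that e by (intro powr_mono2) auto
  also have "\<dots> = \<eta> / (K + 1)" unfolding \<delta>_def using h K(1) e by (simp add: powr_powr)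
  finally have "K * \<bar>x - y\<bar> powr e \<le> K * (\<eta> / (K + 1))" using K(1) by (intro mult_left_mono) auto
  also have "\<dots> \<le> \<eta>" using K(1) h by (simp add: field_simps)
  finally show ?thesis using K(3)[of "()" x y] by simp
 qed
 define G where "G = {(a, b). is_gap L a b \<and> \<delta> \<le> b - a}"
 have fin: "finite G"
 proof -
  have lt: "fst q < fst p ==> snd q \<le> fst p" if "p \<in> G" "q \<in> G" for p q
  proof -
   assume l: "fst q < fst p"
   have "fst p \<in> L" "{fst q<..<snd q} \<inter> L = {}" using that unfolding G_def is_gap_def by auto
   then show "snd q \<le> fst p" using l by (force simp: disjoint_iff)
  qed
  have "inj_on (\<lambda>p. \<lfloor>fst p / \<delta>\<rfloor>) G"
  proof (rule inj_onI)
   have sep: "\<lfloor>fst q / \<delta>\<rfloor> < \<lfloor>fst p / \<delta>\<rfloor>" if "p \<in> G" "q \<in> G" "fst q < fst p" for p q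
   proof -
    have "fst q + \<delta> \<le> fst p" using lt[OF that] that(2) unfolding G_def by auto
    then have "(fst q + \<delta>) / \<delta> \<le> fst p / \<delta>" using del by (intro divide_right_mono) auto
    then have "fst q / \<delta> + 1 \<le> fst p / \<delta>" using del by (simp add: add_divide_distrib)
    then show ?thesis by linarith
   qed
   fix p q assume pq: "p \<in> G" "q \<in> G" "\<lfloor>fst p / \<delta>\<rfloor> = \<lfloor>fst q / \<delta>\<rfloor>"
   have 1: "fst p = fst q" using sep[of p q] sep[of q p] pq by (metis less_irrefl linorder_neqE_linordered_idom)
   have "is_gap L (fst p) (snd p)" "is_gap L (fst q) (snd q)" using pq unfolding G_def by auto
   moreover have "(fst p + min (snd p) (snd q)) / 2 \<in> {fst p<..<snd p}" "(fst p + min (snd p) (snd q)) / 2 \<in> {fst q<..<snd q}"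
    using calculation 1 unfolding is_gap_def by auto
   ultimately have "snd p = snd q" by (rule is_gap_unique(2))
   then show "p = q" using 1 by (simp add: prod_eq_iff)
  qed
  moreover have "(\<lambda>p. \<lfloor>fst p / \<delta>\<rfloor>) ` G \<subseteq> {\<lfloor>-1 / \<delta>\<rfloor>..\<lfloor>2 / \<delta>\<rfloor>}"
  proof (intro image_subsetI)
   fix p assume "p \<in> G"
   then have "is_gap L (fst p) (snd p)" unfolding G_def by auto
   then have "-1 \<le> fst p" "fst p \<le> 2" using gb[of "fst p" "snd p"] unfolding is_gap_def by auto
   then have "-1 / \<delta> \<le> fst p / \<delta>" "fst p / \<delta> \<le> 2 / \<delta>" using divide_right_mono[of "-1" "fst p" \<delta>] divide_right_mono[of "fst p" 2 \<delta>] del by simp_all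
   then show "\<lfloor>fst p / \<delta>\<rfloor> \<in> {\<lfloor>-1 / \<delta>\<rfloor>..\<lfloor>2 / \<delta>\<rfloor>}" by (auto intro: floor_mono)
  qed
  ultimately show ?thesis using inj_on_finite by blast
 qed
 have "\<forall>p\<in>G. \<exists>q. (\<forall>x. (fst q has_real_derivative snd q x) (at x)) \<and> bfam n e UNIV {()} (\<lambda>_. snd q) \<and>
  (\<forall>x. x \<notin> {fst p<..<snd p} \<longrightarrow> fst q x = 0 \<and> snd q x = 0) \<and>
  (\<forall>x\<in>{fst p..snd p}. c - \<eta> \<le> f' x + snd q x \<and> f' x + snd q x \<le> l + \<eta>)"
 proof
  fix p assume "p \<in> G"
  then have g: "is_gap L (fst p) (snd p)" unfolding G_def by auto
  then have ab: "fst p < snd p" "fst p \<in> L" "snd p \<in> L" unfolding is_gap_def by auto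
  obtain \<kappa> \<kappa>' where "\<And>x. (\<kappa> has_real_derivative \<kappa>' x) (at x)" "bfam n e UNIV {()} (\<lambda>_. \<kappa>')"
   "\<And>x. x \<notin> {fst p<..<snd p} ==> \<kappa> x = 0 \<and> \<kappa>' x = 0"
   "\<And>x. x \<in> {fst p..snd p} ==> c - \<eta> \<le> f' x + \<kappa>' x \<and> f' x + \<kappa>' x \<le> l + \<eta>"
   by (rule gap_correction[OF e ab(1) d bf conjunct1[OF onL[OF ab(2)]] conjunct2[OF onL[OF ab(2)]]
    conjunct1[OF onL[OF ab(3)]] conjunct2[OF onL[OF ab(3)]] conjunct1[OF sec[OF g]] conjunct2[OF sec[OF g]] h]) (rule that)
  then show "\<exists>q. (\<forall>x. (fst q has_real_derivative snd q x) (at x)) \<and> bfam n e UNIV {()} (\<lambda>_. snd q) \<and>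
   (\<forall>x. x \<notin> {fst p<..<snd p} \<longrightarrow> fst q x = 0 \<and> snd q x = 0) \<and>
   (\<forall>x\<in>{fst p..snd p}. c - \<eta> \<le> f' x + snd q x \<and> f' x + snd q x \<le> l + \<eta>)"
   by (intro exI[of _ "(\<kappa>, \<kappa>')"]) auto
 qed
 from bchoice[OF this] obtain q where q: "\<forall>p\<in>G. (\<forall>x. (fst (q p) has_real_derivative snd (q p) x) (at x)) \<and> bfam n e UNIV {()} (\<lambda>_. snd (q p)) \<and>
  (\<forall>x. x \<notin> {fst p<..<snd p} \<longrightarrow> fst (q p) x = 0 \<and> snd (q p) x = 0) \<and>
  (\<forall>x\<in>{fst p..snd p}. c - \<eta> \<le> f' x + snd (q p) x \<and> f' x + snd (q p) x \<le> l + \<eta>)" ..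
 define g g' where "g = (\<lambda>x. f x + (\<Sum>p\<in>G. fst (q p) x))" and "g' = (\<lambda>x. f' x + (\<Sum>p\<in>G. snd (q p) x))"
 show thesis
 proof (rule that[of g g'])
  show "(g has_real_derivative g' x) (at x)" for x unfolding g_def g'_def
   by (intro DERIV_add d DERIV_sum) (use q in blast)
  show "bfam n e UNIV {()} (\<lambda>_. g')" unfolding g'_def
   by (rule bfam_add[OF bf bfam_sum[OF fin]]) (use q in blast)
  have notL: "x \<notin> {fst p<..<snd p}" if "x \<in> L" "p \<in> G" for x p using that unfolding G_def is_gap_def by auto
  show "g x = f x" if "x \<in> L" for x unfolding g_def using q notL[OF that] by simp
  show "c - \<eta> \<le> g' x \<and> g' x \<le> l + \<eta>" for x
  proof (cases "x \<in> L")
   case True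
   then have "g' x = f' x" unfolding g'_def using q notL by simp
   then show ?thesis using onL[OF True] h by auto
  next
   case False
   then obtain a b where ab: "is_gap L a b" "x \<in> {a<..<b}" using gaps by blast
   have other: "snd (q p) x = 0" if "p \<in> G" "p \<noteq> (a, b)" for p
   proof -
    have gp: "is_gap L (fst p) (snd p)" using that unfolding G_def by auto
    have "x \<notin> {fst p<..<snd p}"
    proof
     assume "x \<in> {fst p<..<snd p}"
     then have "fst p = a" "snd p = b" using is_gap_unique[OF gp ab(1) _ ab(2)] by auto
     then show False using that(2) by (metis prod.collapse)
    qed
    then show ?thesis using q that(1) by blast
   qed
   show ?thesis
   proof (cases "(a, b) \<in> G")
    case True
    have "(\<Sum>p\<in>G. snd (q p) x) = (\<Sum>p\<in>{(a,b)}. snd (q p) x)"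
     by (rule sum.mono_neutral_right[OF fin]) (use True other in auto)
    then have eq: "g' x = f' x + snd (q (a, b)) x" unfolding g'_def by simp
    show ?thesis unfolding eq using bspec[OF q True] ab(2) by auto
   next
    case F: False
    then have "g' x = f' x" unfolding g'_def by (metis (no_types, lifting) other add.right_neutral sum.neutral)
    moreover have "\<bar>x - a\<bar> \<le> \<delta>" using F ab unfolding G_def by auto
    then have "\<bar>f' x - f' a\<bar> \<le> \<eta>" by (rule near)
    moreover have "a \<in> L" using ab unfolding is_gap_def by auto
    ultimately show ?thesis using onL[of a] by auto
   qed
  qed
 qed
qed

section \<open>Sequences\<close>

lemma build_0 [simp]: "(i ## \<alpha>) 0 = i" and build_Suc [simp]: "(i ## \<alpha>) (Suc n) = \<alpha> n"
 by auto

lemma Sigma_build: "i \<in> {1..d} ==> \<alpha> \<in> Sigma_seq d ==> i ## \<alpha> \<in> Sigma_seq d"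
proof -
 assume a: "i \<in> {1..d}" "\<alpha> \<in> Sigma_seq d"
 have "(i ## \<alpha>) n \<in> {1..d}" for n
  using a unfolding Sigma_seq_def by (cases n) auto
 then show ?thesis unfolding Sigma_seq_def by blast
qed

lemma Sigma_suffix: "\<alpha> \<in> Sigma_seq d ==> suffix n \<alpha> \<in> Sigma_seq d"
 unfolding Sigma_seq_def by auto

lemma Sigma_nth: "\<alpha> \<in> Sigma_seq d ==> \<alpha> n \<in> {1..d}"
 unfolding Sigma_seq_def by auto

lemma Sigma_conc: "set u \<subseteq> {1..d} ==> \<alpha> \<in> Sigma_seq d ==> u \<frown> \<alpha> \<in> Sigma_seq d"
 by (induction u) (auto simp: Sigma_build)

lemma Sigma_const: "i \<in> {1..d} ==> (\<lambda>_. i) \<in> Sigma_seq d"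
 unfolding Sigma_seq_def by auto

lemma set_prefix_Sigma: "\<alpha> \<in> Sigma_seq d ==> set (prefix n \<alpha>) \<subseteq> {1..d}"
 using Sigma_nth by auto

lemma common_len_diff:
 assumes "\<alpha> \<noteq> \<beta>" shows "\<alpha> (common_len \<alpha> \<beta>) \<noteq> \<beta> (common_len \<alpha> \<beta>)" "m < common_len \<alpha> \<beta> ==> \<alpha> m = \<beta> m"
proof -
 obtain m0 where "\<alpha> m0 \<noteq> \<beta> m0" using assms by auto
 then show "\<alpha> (common_len \<alpha> \<beta>) \<noteq> \<beta> (common_len \<alpha> \<beta>)" unfolding common_len_def by (rule LeastI)
 show "m < common_len \<alpha> \<beta> ==> \<alpha> m = \<beta> m" unfolding common_len_def using not_less_Least by blast
qed

lemma common_len_eqI: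
 assumes "\<alpha> n \<noteq> \<beta> n" "\<And>m. m < n ==> \<alpha> m = \<beta> m" shows "common_len \<alpha> \<beta> = n"
 unfolding common_len_def by (rule Least_equality) (use assms in \<open>auto simp: not_less[symmetric]\<close>)

text \<open>
 The order condition on embeddings, separated from their continuity.
\<close>

definition lex_mono :: "nat \<Rightarrow> ((nat \<Rightarrow> nat) \<Rightarrow> real) \<Rightarrow> bool" where
 "lex_mono d h \<longleftrightarrow> (\<forall>\<alpha>\<in>Sigma_seq d. \<forall>\<beta>\<in>Sigma_seq d. \<alpha> \<noteq> \<beta> \<longrightarrow> (h \<alpha> > h \<beta> \<longleftrightarrow> \<alpha> (common_len \<alpha> \<beta>) > \<beta> (common_len \<alpha> \<beta>)))"

lemma lex_monoD: "lex_mono d h ==> \<alpha> \<in> Sigma_seq d ==> \<beta> \<in> Sigma_seq d ==> \<alpha> \<noteq> \<beta> ==>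
 h \<alpha> > h \<beta> \<longleftrightarrow> \<alpha> (common_len \<alpha> \<beta>) > \<beta> (common_len \<alpha> \<beta>)"
 unfolding lex_mono_def by blast

lemma lex_mono_inj: "lex_mono d f ==> inj_on f (Sigma_seq d)"
proof (rule inj_onI, rule ccontr)
 fix \<alpha> \<beta> assume f: "lex_mono d f" and a: "\<alpha> \<in> Sigma_seq d" "\<beta> \<in> Sigma_seq d" "f \<alpha> = f \<beta>" "\<alpha> \<noteq> \<beta>"
 have "common_len \<alpha> \<beta> = common_len \<beta> \<alpha>" unfolding common_len_def by metis
 then show False using common_len_diff(1)[OF a(4)] lex_monoD[OF f a(1,2,4)] lex_monoD[OF f a(2,1) a(4)[symmetric]] a(3) by force
qed

lemma order_embedding_bounds:
 assumes ord: "lex_mono d h"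
  and d: "d \<ge> 1" and \<alpha>: "\<alpha> \<in> Sigma_seq d"
 shows "h (\<lambda>_. 1) \<le> h \<alpha>" "h \<alpha> \<le> h (\<lambda>_. d)"
proof -
 have S: "(\<lambda>_. 1) \<in> Sigma_seq d" "(\<lambda>_. d) \<in> Sigma_seq d" using d by (auto intro: Sigma_const)
 show "h (\<lambda>_. 1) \<le> h \<alpha>"
 proof (cases "\<alpha> = (\<lambda>_. 1)")
  case False
  have "\<alpha> (common_len \<alpha> (\<lambda>_. 1)) > 1"
   using common_len_diff(1)[OF False] Sigma_nth[OF \<alpha>, of "common_len \<alpha> (\<lambda>_. 1)"] by auto
  then show ?thesis using lex_monoD[OF ord \<alpha> S(1) False] by simp
 qed simp
 show "h \<alpha> \<le> h (\<lambda>_. d)"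
 proof (cases "(\<lambda>_. d) = \<alpha>")
  case False
  have "\<alpha> (common_len (\<lambda>_. d) \<alpha>) < d"
   using common_len_diff(1)[OF False] Sigma_nth[OF \<alpha>, of "common_len (\<lambda>_. d) \<alpha>"] by auto
  then show ?thesis using lex_monoD[OF ord S(2) \<alpha> False] by simp
 qed simp
qed

lemma order_embedding_ends:
 assumes ord: "lex_mono d h"
  and d: "d \<ge> 1" and hull: "convex hull (h ` Sigma_seq d) = {0..1}"
 shows "h (\<lambda>_. 1) = 0" "h (\<lambda>_. d) = 1"
proof -
 have S: "(\<lambda>_. 1) \<in> Sigma_seq d" "(\<lambda>_. d) \<in> Sigma_seq d" using d by (auto intro: Sigma_const)
 have "h ` Sigma_seq d \<subseteq> {0..1}" using hull_subset[of "h ` Sigma_seq d" convex] hull by simp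
 then have 1: "0 \<le> h (\<lambda>_. 1)" "h (\<lambda>_. d) \<le> 1" using S by auto
 have "h ` Sigma_seq d \<subseteq> {h (\<lambda>_. 1)..h (\<lambda>_. d)}" using order_embedding_bounds[OF ord d] by (intro image_subsetI) simp
 then have "convex hull (h ` Sigma_seq d) \<subseteq> {h (\<lambda>_. 1)..h (\<lambda>_. d)}" by (rule hull_minimal) simp
 then have "0 \<in> {h (\<lambda>_. 1)..h (\<lambda>_. d)}" "1 \<in> {h (\<lambda>_. 1)..h (\<lambda>_. d)}" unfolding hull by auto
 then show "h (\<lambda>_. 1) = 0" "h (\<lambda>_. d) = 1" using 1 by auto
qed

lemma convex_hull_real_eq:
 fixes A :: "real set"
 assumes "A \<subseteq> {a..b}" "a \<in> A" "b \<in> A" shows "convex hull A = {a..b}"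
proof
 show "convex hull A \<subseteq> {a..b}" by (rule hull_minimal[OF assms(1)]) simp
 have "a \<le> b" using assms by auto
 have "closed_segment a b \<subseteq> convex hull A"
  by (rule closed_segment_subset_convex_hull) (use assms hull_subset[of A convex] in blast)+
 then show "{a..b} \<subseteq> convex hull A" using \<open>a \<le> b\<close> by (simp add: closed_segment_eq_real_ivl)
qed

lemma lex_mono_conc:
 assumes h: "lex_mono d h" and u: "set u \<subseteq> {1..d}" shows "lex_mono d (\<lambda>\<gamma>. h (u \<frown> \<gamma>))"
 unfolding lex_mono_def
proof (intro ballI impI)
 fix \<alpha> \<beta> assume a: "\<alpha> \<in> Sigma_seq d" "\<beta> \<in> Sigma_seq d" "\<alpha> \<noteq> \<beta>"
 let ?c = "length u + common_len \<alpha> \<beta>"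
 have c: "(u \<frown> \<alpha>) ?c = \<alpha> (common_len \<alpha> \<beta>)" "(u \<frown> \<beta>) ?c = \<beta> (common_len \<alpha> \<beta>)" by (simp_all add: conc_def)
 have "common_len (u \<frown> \<alpha>) (u \<frown> \<beta>) = ?c"
  by (rule common_len_eqI) (use common_len_diff[OF a(3)] c in \<open>auto simp: conc_def\<close>)
 moreover have "u \<frown> \<alpha> \<noteq> u \<frown> \<beta>" using common_len_diff(1)[OF a(3)] c by metis
 ultimately show "h (u \<frown> \<beta>) < h (u \<frown> \<alpha>) \<longleftrightarrow> \<beta> (common_len \<alpha> \<beta>) < \<alpha> (common_len \<alpha> \<beta>)"
  using lex_monoD[OF h Sigma_conc[OF u a(1)] Sigma_conc[OF u a(2)]] c by metis
qed

text \<open>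
 Prefixing a word preserves the order, so the extreme points of a cylinder are those of \<open>Sigma_seq d\<close>.
\<close>

lemma cyl_interval:
 assumes h: "lex_mono d h" and d: "d \<ge> 1" and js: "set js \<subseteq> {1..d}"
 shows "convex hull (cyl d h js) = {h (rev js \<frown> (\<lambda>_. 1))..h (rev js \<frown> (\<lambda>_. d))}" "h (rev js \<frown> (\<lambda>_. 1)) \<le> h (rev js \<frown> (\<lambda>_. d))"
proof -
 have u: "set (rev js) \<subseteq> {1..d}" using js by simp
 have S: "(\<lambda>_. 1) \<in> Sigma_seq d" "(\<lambda>_. d) \<in> Sigma_seq d" using d by (auto intro: Sigma_const)
 note b = order_embedding_bounds[OF lex_mono_conc[OF h u] d]
 have mem: "h (rev js \<frown> \<gamma>) \<in> cyl d h js" if "\<gamma> \<in> Sigma_seq d" for \<gamma>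
  unfolding cyl_def using Sigma_conc[OF u that] prefix_conc_length[of "rev js" \<gamma>] by (intro imageI) simp
 show "h (rev js \<frown> (\<lambda>_. 1)) \<le> h (rev js \<frown> (\<lambda>_. d))" by (rule b(1)[OF S(2)])
 show "convex hull (cyl d h js) = {h (rev js \<frown> (\<lambda>_. 1))..h (rev js \<frown> (\<lambda>_. d))}"
 proof (rule convex_hull_real_eq[OF _ mem[OF S(1)] mem[OF S(2)]])
  show "cyl d h js \<subseteq> {h (rev js \<frown> (\<lambda>_. 1))..h (rev js \<frown> (\<lambda>_. d))}"
  proof
   fix y assume "y \<in> cyl d h js"
   then obtain \<alpha> where \<alpha>: "\<alpha> \<in> Sigma_seq d" "prefix (length js) \<alpha> = rev js" "y = h \<alpha>" unfolding cyl_def by blast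
   have "y = h (rev js \<frown> suffix (length js) \<alpha>)" using prefix_suffix[of \<alpha> "length js"] \<alpha>(2,3) by metis
   then show "y \<in> {h (rev js \<frown> (\<lambda>_. 1))..h (rev js \<frown> (\<lambda>_. d))}" using b[OF Sigma_suffix[OF \<alpha>(1), of "length js"]] by simp
  qed
 qed
qed

lemma finite_scaling_interval:
 assumes h: "lex_mono d h" and d: "d \<ge> 1" and js: "set js \<subseteq> {1..d}" and i: "i \<in> {1..2*d-1}"
 shows "finite_scaling d h js i = (if i \<le> d then h (rev js \<frown> (i ## (\<lambda>_. d))) - h (rev js \<frown> (i ## (\<lambda>_. 1)))
  else h (rev js \<frown> (Suc (i - d) ## (\<lambda>_. 1))) - h (rev js \<frown> ((i - d) ## (\<lambda>_. d)))) / (h (rev js \<frown> (\<lambda>_. d)) - h (rev js \<frown> (\<lambda>_. 1)))"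
proof -
 have T: "set (t # js) \<subseteq> {1..d}" if "t \<in> {1..d}" for t using js that by simp
 have "rev (t # js) \<frown> \<gamma> = rev js \<frown> (t ## \<gamma>)" for t \<gamma> by simp
 note I = cyl_interval[OF h d js] cyl_interval[OF h d T, unfolded this]
 show ?thesis
 proof (cases "i \<le> d")
  case True
  then have "i \<in> {1..d}" using i by simp
  then show ?thesis using True I(2) I(4)[of i] unfolding finite_scaling_def hull_length_def by (simp add: I(1,3) del: build_def)
 next
  case False
  then have t: "i - d \<in> {1..d}" "i - d + 1 \<in> {1..d}" using i by auto
  show ?thesis using False I(2) I(4)[OF t(1)] I(4)[OF t(2)]
   unfolding finite_scaling_def hull_length_def gap_length_def I(1) I(3)[OF t(1)] I(3)[OF t(2)] by (simp del: build_def)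
 qed
qed

section \<open>Iterated smooth branches\<close>

locale smooth_branches =
 fixes d k :: nat and e :: real and h :: "(nat \<Rightarrow> nat) \<Rightarrow> real" and g dg :: "nat \<Rightarrow> real \<Rightarrow> real" and L c0 :: real
 assumes d2: "d \<ge> 2" and k1: "k \<ge> 1" and e0: "0 < e" and e1: "e \<le> 1"
  and ord: "lex_mono d h"
  and hull: "convex hull (h ` Sigma_seq d) = {0..1}"
  and conj: "\<And>i \<alpha>. i \<in> {1..d} ==> \<alpha> \<in> Sigma_seq d ==> g i (h \<alpha>) = h (i ## \<alpha>)"
  and gmono: "\<And>i. i \<in> {1..d} ==> strict_mono (g i)"
  and gder: "\<And>i x. i \<in> {1..d} ==> x \<in> {0..1} ==> (g i has_real_derivative dg i x) (at x within {0..1})"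
  and bdg: "bfam (k - 1) e {0..1} {1..d} dg"
  and c0: "c0 > 0" and dg0: "\<And>i x. i \<in> {1..d} ==> x \<in> {0..1} ==> c0 \<le> dg i x"
  and glip: "\<And>i x y. i \<in> {1..d} ==> \<bar>g i x - g i y\<bar> \<le> L * \<bar>x - y\<bar>" and L: "0 < L" "L < 1"
begin

abbreviation "Sg \<equiv> Sigma_seq d"

lemma d1: "d \<ge> 1" using d2 by simp
lemma cv: "convex {0..1::real}" by simp

lemma h_ends: "h (\<lambda>_. 1) = 0" "h (\<lambda>_. d) = 1"
 using order_embedding_ends[OF ord d1 hull] by auto

lemma Sigma_ends: "(\<lambda>_. 1) \<in> Sg" "(\<lambda>_. d) \<in> Sg"
 using d1 by (auto intro: Sigma_const)

lemma h_range: "\<alpha> \<in> Sg ==> h \<alpha> \<in> {0..1}"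
 using order_embedding_bounds[OF ord d1] h_ends by simp

lemma g_ends: "i \<in> {1..d} ==> g i 0 = h (i ## (\<lambda>_. 1))" "i \<in> {1..d} ==> g i 1 = h (i ## (\<lambda>_. d))"
 using conj[OF _ Sigma_ends(1)] conj[OF _ Sigma_ends(2)] h_ends by auto

lemma g_range: "i \<in> {1..d} ==> x \<in> {0..1} ==> g i x \<in> {0..1}"
proof -
 assume i: "i \<in> {1..d}" and x: "x \<in> {0..1}"
 have "g i 0 \<le> g i x" "g i x \<le> g i 1" using strict_mono_mono[OF gmono[OF i]] x by (auto simp: mono_def)
 moreover have "0 \<le> g i 0" "g i 1 \<le> 1" using g_ends[OF i] h_range Sigma_build[OF i] Sigma_ends by auto
 ultimately show ?thesis by auto
qed

lemma const_build: "1 ## (\<lambda>_. 1) = (\<lambda>_. 1::nat)" "d ## (\<lambda>_. d) = (\<lambda>_. d)"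
proof -
 have "(i ## (\<lambda>_. i)) n = i" for i n :: nat by (cases n) auto
 then show "1 ## (\<lambda>_. 1) = (\<lambda>_. 1::nat)" "d ## (\<lambda>_. d) = (\<lambda>_. d)" by blast+
qed

lemma g_first: "g 1 0 = 0" and g_last: "g d 1 = 1"
 using g_ends(1)[of 1] g_ends(2)[of d] d1 h_ends const_build by auto

text \<open>
 The branch for \<open>j 0\<close> is applied first, so the image is the interval of the string \<open>prefix n j\<close> in the
 reversed notation for intervals of finite strings.
\<close>

primrec G :: "nat \<Rightarrow> (nat \<Rightarrow> nat) \<Rightarrow> real \<Rightarrow> real" where
 "G 0 j x = x"
| "G (Suc n) j x = g (j n) (G n j x)"

definition dG :: "nat \<Rightarrow> (nat \<Rightarrow> nat) \<Rightarrow> real \<Rightarrow> real" where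
 "dG n j x = (\<Prod>t<n. dg (j t) (G t j x))"

definition len :: "nat \<Rightarrow> (nat \<Rightarrow> nat) \<Rightarrow> real" where "len n j = G n j 1 - G n j 0"

definition phi :: "nat \<Rightarrow> (nat \<Rightarrow> nat) \<Rightarrow> real \<Rightarrow> real" where "phi n j x = (G n j x - G n j 0) / len n j"

text \<open>
 The contribution of one step to the logarithm of the derivative, normalized at 0. It is controlled by a
 power of the length of an interval of level \<open>n\<close>, which is why all sums below converge.
\<close>

definition U :: "nat \<Rightarrow> (nat \<Rightarrow> nat) \<Rightarrow> real \<Rightarrow> real" where
 "U n j x = ln (dg (j n) (G n j x)) - ln (dg (j n) (G n j 0))"

text \<open>
 The derivative of the \<open>N\<close>-th iterated branch, normalized to be 1 at 0.
\<close>

definition density_upto :: "nat \<Rightarrow> (nat \<Rightarrow> nat) \<Rightarrow> real \<Rightarrow> real" where "density_upto N j x = exp (\<Sum>t<N. U t j x)"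

lemma G_range: "j \<in> Sg ==> x \<in> {0..1} ==> G n j x \<in> {0..1}"
 by (induction n) (auto simp del: atLeastAtMost_iff intro: g_range Sigma_nth)

lemma G_mono: "j \<in> Sg ==> x < y ==> G n j x < G n j y"
 by (induction n) (auto intro: strict_monoD[OF gmono] Sigma_nth)

lemma G_lip: "j \<in> Sg ==> \<bar>G n j x - G n j y\<bar> \<le> L ^ n * \<bar>x - y\<bar>"
proof (induction n)
 case (Suc n)
 have "\<bar>G (Suc n) j x - G (Suc n) j y\<bar> \<le> L * \<bar>G n j x - G n j y\<bar>" using glip[OF Sigma_nth[OF Suc.prems]] by simp
 also have "\<dots> \<le> L * (L ^ n * \<bar>x - y\<bar>)" using Suc L by (intro mult_left_mono) auto
 finally show ?case by simp
qed simp

lemma G_shift: "G (Suc n) (i ## j) x = G n j (g i x)"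
proof (induction n)
 case (Suc n)
 have "G (Suc (Suc n)) (i ## j) x = g (j n) (G (Suc n) (i ## j) x)" by simp
 then show ?case using Suc by simp
qed simp

lemma G_h: "j \<in> Sg ==> \<alpha> \<in> Sg ==> G n j (h \<alpha>) = h (rev (prefix n j) \<frown> \<alpha>)"
proof (induction n)
 case (Suc n)
 have "rev (prefix n j) \<frown> \<alpha> \<in> Sg" using Suc.prems set_prefix_Sigma[of j d n] by (intro Sigma_conc) auto
 then show ?case using Suc conj[OF Sigma_nth[OF Suc.prems(1)]] by simp
qed simp

lemma G_der:
 assumes j: "j \<in> Sg" and x: "x \<in> {0..1}"
 shows "(G n j has_real_derivative dG n j x) (at x within {0..1})"
proof (induction n)
 case 0
 have "((\<lambda>x. x) has_real_derivative 1) (at x within {0..1})" by (rule DERIV_ident)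
 then show ?case by (simp add: dG_def)
next
 case (Suc n)
 have sub: "G n j ` {0..1} \<subseteq> {0..1}" using G_range[OF j] by blast
 have "(g (j n) has_real_derivative dg (j n) (G n j x)) (at (G n j x) within G n j ` {0..1})"
  by (rule has_field_derivative_subset[OF gder[OF Sigma_nth[OF j] G_range[OF j x]] sub])
 from DERIV_image_chain[OF this Suc] show ?case by (simp add: dG_def o_def mult.commute)
qed

lemma len_bounds: "j \<in> Sg ==> 0 < len n j" "j \<in> Sg ==> len n j \<le> L ^ n" "j \<in> Sg ==> len n j \<le> 1"
proof -
 assume j: "j \<in> Sg"
 show 1: "0 < len n j" unfolding len_def using G_mono[OF j, of 0 1] by simp
 show "len n j \<le> L ^ n" using G_lip[OF j, of n 1 0] unfolding len_def by simp
 then show "len n j \<le> 1" using L power_le_one[of L n] by linarith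
qed

lemma dG_EN:
 assumes j: "j \<in> Sg" and x: "x \<in> {0..1}"
 shows "dG n j x = dG n j 0 * density_upto n j x" "dG n j x > 0"
proof -
 have pos: "dg (j t) (G t j y) > 0" if "y \<in> {0..1}" for t y
  using dg0[OF Sigma_nth[OF j] G_range[OF j that], of t t] c0 by linarith
 show "dG n j x > 0" unfolding dG_def by (intro prod_pos) (use pos x in auto)
 have "exp (U t j x) = dg (j t) (G t j x) / dg (j t) (G t j 0)" for t
  unfolding U_def using pos[OF x] pos[of 0] by (simp add: exp_diff)
 then have "density_upto n j x = (\<Prod>t<n. dg (j t) (G t j x) / dg (j t) (G t j 0))"
  unfolding density_upto_def by (simp add: exp_sum)
 then have "dG n j 0 * density_upto n j x = (\<Prod>t<n. dg (j t) (G t j 0) * (dg (j t) (G t j x) / dg (j t) (G t j 0)))"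
  unfolding dG_def by (simp only: prod.distrib)
 also have "\<dots> = dG n j x" unfolding dG_def by (rule prod.cong) (use pos[of 0] in \<open>auto simp: less_imp_neq[symmetric]\<close>)
 finally show "dG n j x = dG n j 0 * density_upto n j x" by simp
qed

lemma bldg: "bfam (k - 1) e {0..1} {1..d} (\<lambda>i x. ln (dg i x))"
 by (rule bfam_ln[OF e0 e1 cv bdg c0 dg0])

lemma U_hoelder: obtains K where "K > 0"
 "\<And>n j x y. j \<in> Sg ==> x \<in> {0..1} ==> y \<in> {0..1} ==> \<bar>U n j x - U n j y\<bar> \<le> K * \<bar>G n j x - G n j y\<bar> powr e"
proof -
 have "bfam 0 e {0..1} {1..d} (\<lambda>i x. ln (dg i x))" by (rule bfam_mono[OF e0 e1 cv bldg]) simp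
 then obtain K where K: "K \<ge> 0" "\<And>i x. i \<in> {1..d} ==> x \<in> {0..1} ==> \<bar>ln (dg i x)\<bar> \<le> K"
  "\<And>i x y. i \<in> {1..d} ==> x \<in> {0..1} ==> y \<in> {0..1} ==> \<bar>ln (dg i x) - ln (dg i y)\<bar> \<le> K * \<bar>x - y\<bar> powr e"
  by (rule bfam_0E) (rule that)
 show thesis
 proof (rule that[of "K + 1"])
  show "K + 1 > 0" using K(1) by simp
  fix n j x y assume a: "j \<in> Sg" "x \<in> {0..1::real}" "y \<in> {0..1::real}"
  have "\<bar>U n j x - U n j y\<bar> \<le> K * \<bar>G n j x - G n j y\<bar> powr e"
   unfolding U_def using K(3)[OF Sigma_nth[OF a(1)] G_range[OF a(1,2)] G_range[OF a(1,3)], of n n n] by simp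
  also have "\<dots> \<le> (K + 1) * \<bar>G n j x - G n j y\<bar> powr e" by (intro mult_right_mono) auto
  finally show "\<bar>U n j x - U n j y\<bar> \<le> (K + 1) * \<bar>G n j x - G n j y\<bar> powr e" .
 qed
qed

text \<open>
 Geometric weights dominating the terms \<open>U n j x\<close>.
\<close>

definition aa :: "nat \<Rightarrow> real" where "aa n = (L powr e) ^ n"

lemma aa: "summable aa" "0 < aa n" "aa n = (L ^ n) powr e"
proof -
 have "L powr e < 1" using powr_less_mono2[of e L 1] L e0 by simp
 then show "summable aa" unfolding aa_def using L by (intro summable_geometric) simp
 show "0 < aa n" unfolding aa_def using L by simp
 show "aa n = (L ^ n) powr e" unfolding aa_def using L by (simp add: powr_power powr_powr powr_realpow[symmetric] mult.commute)
qed

lemma U0 [simp]: "U n j 0 = 0" by (simp add: U_def)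

lemma U_bound: obtains K where "K > 0"
 "\<And>n j x. j \<in> Sg ==> x \<in> {0..1} ==> \<bar>U n j x\<bar> \<le> K * aa n"
proof -
 obtain K where K: "K > 0" "\<And>n j x y. j \<in> Sg ==> x \<in> {0..1} ==> y \<in> {0..1} ==> \<bar>U n j x - U n j y\<bar> \<le> K * \<bar>G n j x - G n j y\<bar> powr e"
  by (rule U_hoelder) (rule that)
 have "\<bar>U n j x\<bar> \<le> K * aa n" if j: "j \<in> Sg" and x: "x \<in> {0..1}" for n j x
 proof -
  have "\<bar>U n j x\<bar> \<le> K * \<bar>G n j x - G n j 0\<bar> powr e" using K(2)[OF j x, of 0 n] by simp
  also have "\<dots> \<le> K * (L ^ n) powr e"
  proof (intro mult_left_mono powr_mono2)
   have "L ^ n * \<bar>x - 0\<bar> \<le> L ^ n * 1" using x L by (intro mult_left_mono) auto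
   then show "\<bar>G n j x - G n j 0\<bar> \<le> L ^ n" using G_lip[OF j, of n x 0] by linarith
  qed (use K e0 in auto)
  finally show ?thesis using aa(3) by simp
 qed
 then show thesis using that K(1) by blast
qed

definition Kd :: real where "Kd = (SOME K. K > 0 \<and> (\<forall>N j x. j \<in> Sg \<longrightarrow> x \<in> {0..1} \<longrightarrow> (\<Sum>n<N. \<bar>U n j x\<bar>) \<le> K))"

lemma Kd: "Kd > 0" "\<And>N j x. j \<in> Sg ==> x \<in> {0..1} ==> (\<Sum>n<N. \<bar>U n j x\<bar>) \<le> Kd"
proof -
 obtain K where K: "K > 0" "\<And>n j x. j \<in> Sg ==> x \<in> {0..1} ==> \<bar>U n j x\<bar> \<le> K * aa n" by (rule U_bound) (rule that)
 have "(\<Sum>n<N. \<bar>U n j x\<bar>) \<le> K * (\<Sum>n. aa n)" if "j \<in> Sg" "x \<in> {0..1}" for N j x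
 proof -
  have "(\<Sum>n<N. \<bar>U n j x\<bar>) \<le> (\<Sum>n<N. K * aa n)" using K(2)[OF that] by (rule sum_mono)
  also have "\<dots> = K * (\<Sum>n<N. aa n)" by (simp add: sum_distrib_left)
  also have "\<dots> \<le> K * (\<Sum>n. aa n)" using K(1) aa(1,2) by (intro mult_left_mono sum_le_suminf) (auto intro: less_imp_le)
  finally show ?thesis .
 qed
 moreover have "K * (\<Sum>n. aa n) > 0" using K(1) suminf_pos[OF aa(1) aa(2)] by simp
 ultimately have "\<exists>K. K > 0 \<and> (\<forall>N j x. j \<in> Sg \<longrightarrow> x \<in> {0..1} \<longrightarrow> (\<Sum>n<N. \<bar>U n j x\<bar>) \<le> K)" by blast
 from someI_ex[OF this] show "Kd > 0" "\<And>N j x. j \<in> Sg ==> x \<in> {0..1} ==> (\<Sum>n<N. \<bar>U n j x\<bar>) \<le> Kd"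
  unfolding Kd_def by blast+
qed

lemma density_upto_bounds:
 assumes "j \<in> Sg" "x \<in> {0..1}" shows "exp (- Kd) \<le> density_upto N j x" "density_upto N j x \<le> exp Kd"
proof -
 have "\<bar>\<Sum>t<N. U t j x\<bar> \<le> Kd" using Kd(2)[OF assms, of N] sum_abs[of "\<lambda>t. U t j x" "{..<N}"] by linarith
 then show "exp (- Kd) \<le> density_upto N j x" "density_upto N j x \<le> exp Kd" unfolding density_upto_def by (auto simp: abs_le_iff)
qed

text \<open>
 The factor between the normalized derivative and the derivative of the rescaled branch.
\<close>

definition cc :: "nat \<Rightarrow> (nat \<Rightarrow> nat) \<Rightarrow> real" where "cc N j = dG N j 0 / len N j"

lemma cc_bounds: assumes j: "j \<in> Sg" shows "0 < cc N j" "cc N j \<le> exp Kd"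
proof -
 show "0 < cc N j" unfolding cc_def using dG_EN(2)[OF j] len_bounds(1)[OF j] by simp
 have "\<exists>z\<in>{0..1}. G N j 1 - G N j 0 = (\<lambda>h. dG N j z * h) (1 - 0)"
  by (rule mvt_very_simple) (use G_der[OF j] in \<open>auto simp: has_field_derivative_def\<close>)
 then obtain z where z: "z \<in> {0..1}" "len N j = dG N j z" unfolding len_def by auto
 have "len N j = dG N j 0 * density_upto N j z" using z dG_EN(1)[OF j z(1)] by simp
 then have "cc N j = 1 / density_upto N j z" unfolding cc_def using dG_EN(2)[OF j, of 0 N] by simp
 also have "\<dots> \<le> 1 / exp (- Kd)" using density_upto_bounds(1)[OF j z(1), of N] by (intro divide_left_mono mult_pos_pos) (auto simp: density_upto_def)
 finally show "cc N j \<le> exp Kd" by (simp add: exp_minus inverse_eq_divide)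
qed

lemma phi_der:
 assumes j: "j \<in> Sg" and x: "x \<in> {0..1}"
 shows "(phi n j has_real_derivative cc n j * density_upto n j x) (at x within {0..1})"
proof -
 have "((\<lambda>x. G n j x - G n j 0) has_real_derivative dG n j x - 0) (at x within {0..1})"
  by (intro DERIV_diff G_der[OF j x] DERIV_const)
 from DERIV_cdivide[OF this, of "len n j"] show ?thesis
  unfolding phi_def cc_def using dG_EN(1)[OF j x, of n] by (simp add: field_simps)
qed

abbreviation JN :: "((nat \<Rightarrow> nat) \<times> nat) set" where "JN \<equiv> Sg \<times> UNIV"

lemma phi_lip: "lfam 0 e {0..1} JN (\<lambda>(j,n). phi n j)"
proof (rule lfam_0I[of _ _ _ "exp Kd * exp Kd"])
 fix p x y assume p: "p \<in> JN" and xy: "x \<in> {0..1::real}" "y \<in> {0..1::real}"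
 obtain j n where jn: "p = (j,n)" "j \<in> Sg" using p by auto
 have "norm (phi n j x - phi n j y) \<le> (exp Kd * exp Kd) * norm (x - y)"
 proof (rule field_differentiable_bound[OF cv phi_der[OF jn(2)] _ xy])
  fix z assume z: "z \<in> {0..1::real}"
  have "0 \<le> density_upto n j z" unfolding density_upto_def by simp
  then show "norm (cc n j * density_upto n j z) \<le> exp Kd * exp Kd"
   using cc_bounds[OF jn(2), of n] density_upto_bounds(2)[OF jn(2) z, of n] by (auto simp: abs_mult intro!: mult_mono)
 qed
 then show "\<bar>(case p of (j,n) \<Rightarrow> phi n j) x - (case p of (j,n) \<Rightarrow> phi n j) y\<bar> \<le> exp Kd * exp Kd * \<bar>x - y\<bar>"
  using jn by simp
qed

lemma G_phi: "j \<in> Sg ==> G n j x = G n j 0 + len n j * phi n j x"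
 unfolding phi_def using len_bounds(1)[of j n] by simp

end

section \<open>Uniform smoothness of the rescaled branches\<close>

context smooth_branches begin

lemma len_abs: "j \<in> Sg ==> \<bar>len n j\<bar> \<le> 1"
 using len_bounds(1,3)[of j n] by linarith

lemma len_powr: "j \<in> Sg ==> \<bar>len n j powr (1 - e)\<bar> \<le> 1"
 using powr_le1[of "1 - e" "len n j"] len_bounds(1,3)[of j n] e1 by simp

lemma cc_abs: "j \<in> Sg ==> \<bar>cc n j\<bar> \<le> exp Kd"
 using cc_bounds[of j n] by linarith

lemma U_scaled_bounded:
 obtains K where "K \<ge> 0"
  "\<And>n j x. j \<in> Sg ==> x \<in> {0..1} ==> \<bar>U n j x / len n j powr e\<bar> \<le> K"
  "\<And>n j x y. j \<in> Sg ==> x \<in> {0..1} ==> y \<in> {0..1} ==> \<bar>U n j x / len n j powr e - U n j y / len n j powr e\<bar> \<le> K * \<bar>x - y\<bar> powr e"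
proof -
 obtain K where K: "K > 0" "\<And>n j x y. j \<in> Sg ==> x \<in> {0..1} ==> y \<in> {0..1} ==> \<bar>U n j x - U n j y\<bar> \<le> K * \<bar>G n j x - G n j y\<bar> powr e"
  by (rule U_hoelder) (rule that)
 obtain P where P: "P \<ge> 0" "\<And>p x y. p \<in> JN ==> x \<in> {0..1} ==> y \<in> {0..1} ==> \<bar>(case p of (j,n) \<Rightarrow> phi n j) x - (case p of (j,n) \<Rightarrow> phi n j) y\<bar> \<le> P * \<bar>x - y\<bar>"
  by (rule lfam_0E[OF phi_lip]) (rule that)
 define Q where "Q = K * P powr e"
 have Q0: "Q \<ge> 0" unfolding Q_def using K by simp
 have H: "\<bar>U n j x / len n j powr e - U n j y / len n j powr e\<bar> \<le> Q * \<bar>x - y\<bar> powr e"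
  if j: "j \<in> Sg" and xy: "x \<in> {0..1}" "y \<in> {0..1}" for n j x y
 proof -
  note l = len_bounds(1)[OF j, of n]
  have "\<bar>phi n j x - phi n j y\<bar> \<le> P * \<bar>x - y\<bar>" using P(2)[of "(j,n)" x y] j xy by simp
  then have ph: "\<bar>phi n j x - phi n j y\<bar> powr e \<le> P powr e * \<bar>x - y\<bar> powr e"
   using P(1) e0 powr_mono2[of e "\<bar>phi n j x - phi n j y\<bar>" "P * \<bar>x - y\<bar>"] by (simp add: powr_mult)
  have "G n j x - G n j y = len n j * (phi n j x - phi n j y)" unfolding phi_def using l by (simp add: field_simps)
  then have "\<bar>G n j x - G n j y\<bar> powr e = len n j powr e * \<bar>phi n j x - phi n j y\<bar> powr e"
   using l by (simp add: abs_mult powr_mult)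
  then have "\<bar>U n j x - U n j y\<bar> \<le> K * (len n j powr e * \<bar>phi n j x - phi n j y\<bar> powr e)" using K(2)[OF j xy, of n] by simp
  also have "\<dots> \<le> K * (len n j powr e * (P powr e * \<bar>x - y\<bar> powr e))" using ph K(1) by (intro mult_left_mono) auto
  finally have "\<bar>U n j x - U n j y\<bar> / len n j powr e \<le> Q * \<bar>x - y\<bar> powr e"
   using l unfolding Q_def by (simp add: divide_le_eq mult_ac)
  then show ?thesis by (simp add: diff_divide_distrib[symmetric] abs_divide)
 qed
 have B: "\<bar>U n j x / len n j powr e\<bar> \<le> Q" if j: "j \<in> Sg" and x: "x \<in> {0..1}" for n j x
 proof -
  have "\<bar>U n j x / len n j powr e\<bar> \<le> Q * \<bar>x\<bar> powr e" using H[OF j x, of 0 n] by simp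
  also have "\<dots> \<le> Q * 1" using x e0 Q0 by (intro mult_left_mono powr_le1) auto
  finally show ?thesis by simp
 qed
 show thesis using that[OF Q0 B H] .
qed

text \<open>
 In terms of the rescaled branch \<open>phi n j\<close> the function \<open>U n j\<close> lives on an interval of length
 \<open>len n j\<close>: one power of the length appears at the first differentiation, and only \<open>e\<close> of it is used up by
 the normalization.
\<close>

lemma U_scaled_bfam:
 assumes "lfam m e {0..1} JN (\<lambda>(j,n). phi n j)" "m \<le> k - 1"
 shows "bfam m e {0..1} JN (\<lambda>(j,n) x. U n j x / len n j powr e)"
proof -
 obtain K where K: "K \<ge> 0"
  "\<And>n j x. j \<in> Sg ==> x \<in> {0..1} ==> \<bar>U n j x / len n j powr e\<bar> \<le> K"
  "\<And>n j x y. j \<in> Sg ==> x \<in> {0..1} ==> y \<in> {0..1} ==> \<bar>U n j x / len n j powr e - U n j y / len n j powr e\<bar> \<le> K * \<bar>x - y\<bar> powr e"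
  by (rule U_scaled_bounded) (rule that)
 show ?thesis
 proof (cases m)
  case 0
  show ?thesis unfolding 0 by (rule bfam_0I[of _ _ _ K]) (use K(2,3) in auto)
 next
  case (Suc n')
  have b: "bfam (Suc n') e {0..1} {1..d} (\<lambda>i x. ln (dg i x))" by (rule bfam_mono[OF e0 e1 cv bldg]) (use assms(2) Suc in simp)
  obtain K' D where D: "\<And>i x. i \<in> {1..d} ==> x \<in> {0..1} ==> \<bar>ln (dg i x)\<bar> \<le> K'"
   "\<And>i x. i \<in> {1..d} ==> x \<in> {0..1} ==> ((\<lambda>x. ln (dg i x)) has_real_derivative D i x) (at x within {0..1})" "bfam n' e {0..1} {1..d} D"
   by (rule bfam_SucE[OF b]) (rule that)
  obtain dp where dp: "\<And>p x. p \<in> JN ==> x \<in> {0..1} ==> ((case p of (j,n) \<Rightarrow> phi n j) has_real_derivative dp p x) (at x within {0..1})" "bfam n' e {0..1} JN dp"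
   by (rule lfam_SucE[OF assms(1)[unfolded Suc]]) (rule that)
  have lG: "lfam n' e {0..1} JN (\<lambda>p x. G (snd p) (fst p) 0 + len (snd p) (fst p) * (case p of (j,n) \<Rightarrow> phi n j) x)"
   by (rule lfam_scale[OF e0 e1 cv lfam_Suc_imp[OF e0 e1 cv assms(1)[unfolded Suc]], where K = 1])
    (use len_abs in auto)
  have Grng: "G (snd p) (fst p) 0 + len (snd p) (fst p) * (case p of (j,n) \<Rightarrow> phi n j) x \<in> {0..1}" if "p \<in> JN" "x \<in> {0..1}" for p x
  proof -
   obtain j n where jn: "p = (j,n)" "j \<in> Sg" using \<open>p \<in> JN\<close> by auto
   show ?thesis using G_range[OF jn(2) \<open>x \<in> {0..1}\<close>, of n] unfolding G_phi[OF jn(2), of n x] jn(1) by simp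
  qed
  have "bfam n' e {0..1} JN (\<lambda>p. D (fst p (snd p)))"
   by (rule bfam_reindex[OF D(3)]) (metis Sigma_nth mem_Times_iff)
  then have "bfam n' e {0..1} JN (\<lambda>p y. D (fst p (snd p)) (G (snd p) (fst p) 0 + len (snd p) (fst p) * (case p of (j,n) \<Rightarrow> phi n j) y))"
   by (rule bfam_comp[OF e0 e1 cv _ lG cv Grng])
  then have b2: "bfam n' e {0..1} JN (\<lambda>p y. (len (snd p) (fst p) powr (1 - e)) * (D (fst p (snd p)) (G (snd p) (fst p) 0 + len (snd p) (fst p) * (case p of (j,n) \<Rightarrow> phi n j) y) * dp p y))"
   by (intro bfam_scale[OF e0 e1 cv bfam_mult[OF e0 e1 cv _ dp(2)], where K = 1])
    (use len_powr in auto)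
  show ?thesis unfolding Suc
  proof (rule bfam_SucI[OF _ _ b2, where K = K])
   fix p x assume p: "p \<in> JN" and x: "x \<in> {0..1::real}"
   obtain j n where jn: "p = (j,n)" "j \<in> Sg" using p by auto
   show "\<bar>(case p of (j,n) \<Rightarrow> \<lambda>x. U n j x / len n j powr e) x\<bar> \<le> K" using K(2)[OF jn(2) x] jn by simp
   note l = len_bounds(1)[OF jn(2), of n]
   have "((\<lambda>x. G n j 0 + len n j * phi n j x) has_real_derivative len n j * dp (j,n) x) (at x within {0..1})"
    using dp(1)[OF p x] jn by (auto intro!: derivative_eq_intros)
   then have Gd: "(G n j has_real_derivative len n j * dp (j,n) x) (at x within {0..1})"
    by (rule has_field_derivative_transform_within[OF _ zero_less_one x]) (rule G_phi[OF jn(2), symmetric])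
   have sub: "G n j ` {0..1} \<subseteq> {0..1}" using G_range[OF jn(2)] by blast
   have "((\<lambda>x. ln (dg (j n) x)) has_real_derivative D (j n) (G n j x)) (at (G n j x) within G n j ` {0..1})"
    by (rule has_field_derivative_subset[OF D(2)[OF Sigma_nth[OF jn(2)] G_range[OF jn(2) x]] sub])
   from DERIV_image_chain[OF this Gd]
   have "((\<lambda>x. ln (dg (j n) (G n j x))) has_real_derivative D (j n) (G n j x) * (len n j * dp (j,n) x)) (at x within {0..1})"
    by (simp add: o_def)
   from DERIV_diff[OF this DERIV_const[of "ln (dg (j n) (G n j 0))"]]
   have "(U n j has_real_derivative D (j n) (G n j x) * (len n j * dp (j,n) x)) (at x within {0..1})"
    unfolding U_def by simp
   from DERIV_cdivide[OF this, of "len n j powr e"]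
   have "((\<lambda>x. U n j x / len n j powr e) has_real_derivative D (j n) (G n j x) * (len n j * dp (j,n) x) / len n j powr e) (at x within {0..1})" .
   moreover have "D (j n) (G n j x) * (len n j * dp (j,n) x) / len n j powr e = len n j powr (1 - e) * (D (j n) (G n j x) * dp (j,n) x)"
    using l by (simp add: powr_diff)
   ultimately show "((case p of (j,n) \<Rightarrow> \<lambda>x. U n j x / len n j powr e) has_real_derivative
     (len (snd p) (fst p) powr (1 - e)) * (D (fst p (snd p)) (G (snd p) (fst p) 0 + len (snd p) (fst p) * (case p of (j,n) \<Rightarrow> phi n j) x) * dp p x)) (at x within {0..1})"
    using jn G_phi[OF jn(2), of n x] by simp
  qed
 qed
qed

lemma U_weighted_bfam:
 assumes "lfam m e {0..1} JN (\<lambda>(j,n). phi n j)" "m \<le> k - 1"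
 shows "bfam m e {0..1} JN (\<lambda>(j,n) x. U n j x / aa n)"
proof -
 have "bfam m e {0..1} JN (\<lambda>p x. (len (snd p) (fst p) powr e / aa (snd p)) * (case p of (j,n) \<Rightarrow> \<lambda>x. U n j x / len n j powr e) x)"
 proof (rule bfam_scale[OF e0 e1 cv U_scaled_bfam[OF assms], where K = 1])
  fix p assume "p \<in> JN"
  then obtain j n where jn: "p = (j,n)" "j \<in> Sg" by auto
  have "len n j powr e \<le> aa n" unfolding aa(3) using len_bounds[OF jn(2)] e0 by (intro powr_mono2) (auto intro: less_imp_le)
  then show "\<bar>len (snd p) (fst p) powr e / aa (snd p)\<bar> \<le> 1" using jn aa(2)[of n] by (simp add: abs_divide divide_le_eq)
 qed
 then show ?thesis
 proof (rule bfam_cong)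
  fix p x assume "p \<in> JN" "x \<in> {0..1::real}"
  then obtain j n where jn: "p = (j,n)" "j \<in> Sg" by auto
  then show "(len (snd p) (fst p) powr e / aa (snd p)) * (case p of (j,n) \<Rightarrow> \<lambda>x. U n j x / len n j powr e) x = (case p of (j,n) \<Rightarrow> \<lambda>x. U n j x / aa n) x"
   using len_bounds(1)[OF jn(2), of n] by simp
 qed
qed

lemma density_upto_bfam:
 assumes "lfam m e {0..1} JN (\<lambda>(j,n). phi n j)" "m \<le> k - 1"
 shows "bfam m e {0..1} JN (\<lambda>(j,N). density_upto N j)"
proof -
 have "bfam m e {0..1} (JN \<times> UNIV) (\<lambda>q x. (if snd q < snd (fst q) then 1 else 0) * (\<lambda>q. (\<lambda>(j,n) x. U n j x / aa n) (fst (fst q), snd q)) q x)"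
  by (rule bfam_scale[OF e0 e1 cv bfam_reindex[OF U_weighted_bfam[OF assms]], where K = 1]) auto
 then have "bfam m e {0..1} (JN \<times> UNIV) (\<lambda>(p,n) x. (if n < snd p then U n (fst p) x / aa n else 0))"
  by (rule bfam_cong) auto
 from bfam_series[OF e0 e1 cv this aa(1) less_imp_le[OF aa(2)]]
 have "bfam m e {0..1} JN (\<lambda>p x. \<Sum>n. aa n * (if n < snd p then U n (fst p) x / aa n else 0))" .
 from bfam_exp[OF e0 e1 cv this]
 show ?thesis
 proof (rule bfam_cong)
  fix p x assume "p \<in> JN" "x \<in> {0..1::real}"
  have "(\<Sum>n. aa n * (if n < snd p then U n (fst p) x / aa n else 0)) = (\<Sum>n<snd p. aa n * (if n < snd p then U n (fst p) x / aa n else 0))"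
   by (rule suminf_finite) auto
  also have "\<dots> = (\<Sum>n<snd p. U n (fst p) x)" by (rule sum.cong) (use aa(2) in \<open>auto simp: less_imp_neq[symmetric]\<close>)
  finally show "exp (\<Sum>n. aa n * (if n < snd p then U n (fst p) x / aa n else 0)) = (case p of (j,N) \<Rightarrow> density_upto N j) x"
   unfolding density_upto_def by (simp add: case_prod_unfold)
 qed
qed

text \<open>
 A bootstrap: smoothness of order \<open>m\<close> of the rescaled branches gives the same for the logarithms of the
 derivatives, hence order \<open>m + 1\<close> for the rescaled branches themselves.
\<close>

lemma phi_lfam: "m \<le> k ==> lfam m e {0..1} JN (\<lambda>(j,n). phi n j)"
proof (induction m)
 case 0 show ?case by (rule phi_lip)
next
 case (Suc m)
 have b: "bfam m e {0..1} JN (\<lambda>p x. cc (snd p) (fst p) * (case p of (j,N) \<Rightarrow> density_upto N j) x)"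
  by (rule bfam_scale[OF e0 e1 cv density_upto_bfam, where K = "exp Kd"])
   (use Suc cc_abs in auto)
 show ?case by (rule lfam_SucI[OF _ b]) (use phi_der in auto)
qed

end

section \<open>Limit charts and the scaling function\<close>

context smooth_branches begin

text \<open>
 The limit of the normalized derivatives; up to a factor the density of the limit chart.
\<close>

definition density :: "(nat \<Rightarrow> nat) \<Rightarrow> real \<Rightarrow> real" where "density j x = exp (\<Sum>n. U n j x)"

lemma U_summable: assumes "j \<in> Sg" "x \<in> {0..1}" shows "summable (\<lambda>n. U n j x)"
proof -
 obtain K where K: "K > 0" "\<And>n j x. j \<in> Sg ==> x \<in> {0..1} ==> \<bar>U n j x\<bar> \<le> K * aa n" by (rule U_bound) (rule that)
 show ?thesis
  by (rule summable_comparison_test'[OF summable_mult[OF aa(1), of K], of 0]) (use K(2)[OF assms] in auto)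
qed

lemma density_upto_lim: assumes "j \<in> Sg" "x \<in> {0..1}" shows "(\<lambda>N. density_upto N j x) \<longlonglongrightarrow> density j x"
 unfolding density_upto_def density_def using summable_LIMSEQ[OF U_summable[OF assms]] by (rule tendsto_exp)

lemma density_bounds:
 assumes "j \<in> Sg" "x \<in> {0..1}" shows "exp (- Kd) \<le> density j x" "density j x \<le> exp Kd"
proof -
 show "exp (- Kd) \<le> density j x" by (rule LIMSEQ_le_const[OF density_upto_lim[OF assms]]) (use density_upto_bounds(1)[OF assms] in auto)
 show "density j x \<le> exp Kd" by (rule LIMSEQ_le_const2[OF density_upto_lim[OF assms]]) (use density_upto_bounds(2)[OF assms] in auto)
qed

lemma density_bfam: "bfam (k - 1) e {0..1} Sg density"
proof -
 have "bfam (k - 1) e {0..1} (Sg \<times> UNIV) (\<lambda>(j,n) x. U n j x / aa n)"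
  by (rule U_weighted_bfam[OF phi_lfam]) auto
 from bfam_series[OF e0 e1 cv this aa(1) less_imp_le[OF aa(2)]]
 have "bfam (k - 1) e {0..1} Sg (\<lambda>j x. \<Sum>n. aa n * (U n j x / aa n))" .
 moreover have "aa n * (u / aa n) = u" for n u using aa(2)[of n] by simp
 ultimately have "bfam (k - 1) e {0..1} Sg (\<lambda>j x. \<Sum>n. U n j x)" by simp
 from bfam_exp[OF e0 e1 cv this] show ?thesis unfolding density_def .
qed

lemma bfam_cont01: assumes "bfam m e {0..1} I F" "i \<in> I" shows "continuous_on {0..1} (F i)"
proof -
 have "bfam 0 e {0..1} I F" by (rule bfam_mono[OF e0 e1 cv assms(1)]) simp
 from bfam_imp_Ck_eps_on[OF at_within_nontrivial(1) e0 this assms(2)] show ?thesis by (simp add: Ck_eps_on_0)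
qed

lemma density_cont: "j \<in> Sg ==> continuous_on {0..1} (density j)"
 by (rule bfam_cont01[OF density_bfam])

lemma density_upto_cont: "j \<in> Sg ==> continuous_on {0..1} (density_upto N j)"
 using bfam_cont01[OF density_upto_bfam[OF phi_lfam, of 0], of "(j,N)"] by simp

definition W :: "(nat \<Rightarrow> nat) \<Rightarrow> real \<Rightarrow> real" where "W j x = integral {0..x} (density j)"
text \<open>
 The limit chart of \<open>j\<close>, recovered from its derivative.
\<close>

definition chart :: "(nat \<Rightarrow> nat) \<Rightarrow> real \<Rightarrow> real" where "chart j x = W j x / W j 1"
definition dchart :: "(nat \<Rightarrow> nat) \<Rightarrow> real \<Rightarrow> real" where "dchart j x = 1 / W j 1 * density j x"

lemma W1_bounds: assumes j: "j \<in> Sg" shows "exp (- Kd) \<le> W j 1" "W j 1 \<le> exp Kd" "0 < W j 1"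
proof -
 have i: "density j integrable_on {0..1}" by (rule integrable_continuous_real[OF density_cont[OF j]])
 have c: "(\<lambda>_. c) integrable_on {0..1::real}" for c :: real by (rule integrable_continuous_real) simp
 have "integral {0..1::real} (\<lambda>_. exp (- Kd)) \<le> W j 1" unfolding W_def
  by (rule integral_le[OF c i]) (use density_bounds[OF j] in auto)
 then show 1: "exp (- Kd) \<le> W j 1" by simp
 have "W j 1 \<le> integral {0..1::real} (\<lambda>_. exp Kd)" unfolding W_def
  by (rule integral_le[OF i c]) (use density_bounds[OF j] in auto)
 then show "W j 1 \<le> exp Kd" by simp
 show "0 < W j 1" using 1 exp_gt_zero[of "- Kd"] by linarith
qed

lemma chart_der: assumes j: "j \<in> Sg" and x: "x \<in> {0..1}"
 shows "(chart j has_real_derivative dchart j x) (at x within {0..1})"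
proof -
 have "(W j has_real_derivative density j x) (at x within {0..1})" unfolding W_def
  by (rule integral_has_real_derivative[OF density_cont[OF j] x])
 from DERIV_cdivide[OF this, of "W j 1"] show ?thesis unfolding chart_def dchart_def by simp
qed

lemma dchart_bounds: assumes j: "j \<in> Sg" and x: "x \<in> {0..1}"
 shows "exp (- 2 * Kd) \<le> dchart j x" "dchart j x \<le> exp (2 * Kd)"
proof -
 have "0 \<le> density j x" by (simp add: density_def)
 note w = W1_bounds[OF j] and b = density_bounds[OF j x] this
 have "exp (- 2 * Kd) = exp (- Kd) / exp Kd" by (simp add: exp_diff[symmetric])
 also have "\<dots> \<le> density j x / W j 1" by (rule frac_le) (use w b in auto)
 finally show "exp (- 2 * Kd) \<le> dchart j x" unfolding dchart_def by simp
 have "density j x / W j 1 \<le> exp Kd / exp (- Kd)" by (rule frac_le) (use w b in auto)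
 also have "\<dots> = exp (2 * Kd)" by (simp add: exp_diff[symmetric])
 finally show "dchart j x \<le> exp (2 * Kd)" unfolding dchart_def by simp
qed

lemma dchart_bfam: "bfam (k - 1) e {0..1} Sg dchart"
 unfolding dchart_def
proof (rule bfam_scale[OF e0 e1 cv density_bfam])
 fix j assume j: "j \<in> Sg"
 have "1 / W j 1 \<le> 1 / exp (- Kd)" using W1_bounds[OF j] by (intro divide_left_mono) auto
 then show "\<bar>1 / W j 1\<bar> \<le> exp Kd" using W1_bounds(3)[OF j] by (simp add: exp_minus inverse_eq_divide)
qed

lemma chart_0 [simp]: "chart j 0 = 0" by (simp add: chart_def W_def)
lemma chart_1: "j \<in> Sg ==> chart j 1 = 1" using W1_bounds(3)[of j] by (simp add: chart_def)

lemma chart_secant: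
 assumes j: "j \<in> Sg" and xy: "x \<in> {0..1}" "y \<in> {0..1}" "x \<le> y"
 shows "exp (- 2 * Kd) * (y - x) \<le> chart j y - chart j x"
proof -
 have "\<exists>z\<in>{x..y}. chart j y - chart j x = (\<lambda>h. dchart j z * h) (y - x)"
 proof (rule mvt_very_simple[OF xy(3)])
  fix z assume "x \<le> z" "z \<le> y"
  then have "(chart j has_real_derivative dchart j z) (at z within {x..y})"
   by (intro has_field_derivative_subset[OF chart_der[OF j]]) (use xy in auto)
  then show "(chart j has_derivative (\<lambda>h. dchart j z * h)) (at z within {x..y})" by (simp add: has_field_derivative_def)
 qed
 then obtain z where z: "z \<in> {x..y}" "chart j y - chart j x = dchart j z * (y - x)" by auto
 have "z \<in> {0..1}" using z(1) xy by auto
 from dchart_bounds(1)[OF j this] show ?thesis unfolding z(2) using xy(3) by (intro mult_right_mono) auto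
qed

lemma chart_less: assumes "j \<in> Sg" "x \<in> {0..1}" "y \<in> {0..1}" "x < y" shows "chart j x < chart j y"
proof -
 have "0 < exp (- 2 * Kd) * (y - x)" using assms(4) by simp
 then show ?thesis using chart_secant[OF assms(1-3)] assms(4) by linarith
qed

lemma chart_range: "j \<in> Sg ==> x \<in> {0..1} ==> chart j x \<in> {0..1}"
 using chart_less[of j 0 x] chart_less[of j x 1] chart_1[of j] by (cases "x = 0"; cases "x = 1") auto

lemma chart_cont: "j \<in> Sg ==> continuous_on {0..1} (chart j)"
 by (rule DERIV_continuous_on[OF chart_der])

lemma chart_bij: assumes j: "j \<in> Sg" shows "bij_betw (chart j) {0..1} {0..1}"
proof -
 have "inj_on (chart j) {0..1}"
  by (rule inj_onI) (metis chart_less[OF j] less_irrefl linorder_neqE_linordered_idom)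
 moreover have "chart j ` {0..1} = {0..1}"
 proof
  show "chart j ` {0..1} \<subseteq> {0..1}" using chart_range[OF j] by blast
  show "{0..1} \<subseteq> chart j ` {0..1}"
  proof
   fix y :: real assume y: "y \<in> {0..1}"
   obtain x where "0 \<le> x" "x \<le> 1" "chart j x = y"
    using IVT'[of "chart j" 0 y 1] y chart_1[OF j] chart_cont[OF j] by auto
   then show "y \<in> chart j ` {0..1}" by auto
  qed
 qed
 ultimately show ?thesis by (simp add: bij_betw_def)
qed

lemma phi_integral:
 assumes j: "j \<in> Sg" and x: "x \<in> {0..1}"
 shows "phi n j x = integral {0..x} (density_upto n j) / integral {0..1} (density_upto n j)"
proof -
 have *: "phi n j y = cc n j * integral {0..y} (density_upto n j)" if y: "y \<in> {0..1}" for y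
 proof -
  have "((\<lambda>x. cc n j * density_upto n j x) has_integral (phi n j y - phi n j 0)) {0..y}"
  proof (rule fundamental_theorem_of_calculus)
   fix z assume "z \<in> {0..y}"
   then have "(phi n j has_real_derivative cc n j * density_upto n j z) (at z within {0..y})"
    by (intro has_field_derivative_subset[OF phi_der[OF j]]) (use y in auto)
   then show "(phi n j has_vector_derivative cc n j * density_upto n j z) (at z within {0..y})"
    by (simp add: has_real_derivative_iff_has_vector_derivative)
  qed (use y in auto)
  from integral_unique[OF this] have "cc n j * integral {0..y} (density_upto n j) = phi n j y - phi n j 0" by simp
  moreover have "phi n j 0 = 0" by (simp add: phi_def)
  ultimately show ?thesis by linarith
 qed
 have "phi n j 1 = 1" unfolding phi_def using len_bounds(1)[OF j, of n] by (simp add: len_def)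
 then have c: "cc n j * integral {0..1} (density_upto n j) = 1" using *[of 1] by simp
 then have "integral {0..1} (density_upto n j) \<noteq> 0" by auto
 then have "cc n j = 1 / integral {0..1} (density_upto n j)" using c by (simp add: eq_divide_eq)
 then show ?thesis unfolding *[OF x] by simp
qed

lemma phi_lim: assumes j: "j \<in> Sg" and x: "x \<in> {0..1}" shows "(\<lambda>n. phi n j x) \<longlonglongrightarrow> chart j x"
proof -
 have *: "(\<lambda>n. integral {0..y} (density_upto n j)) \<longlonglongrightarrow> integral {0..y} (density j)" if y: "y \<in> {0..1}" for y
 proof (rule dominated_convergence(2)[where h = "\<lambda>_. exp Kd"])
  have sub: "{0..y} \<subseteq> {0..1}" using y by auto
  show "density_upto n j integrable_on {0..y}" for n
   by (rule integrable_continuous_real[OF continuous_on_subset[OF density_upto_cont[OF j] sub]])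
  show "(\<lambda>_. exp Kd) integrable_on {0..y}" by (rule integrable_continuous_real) simp
  fix z assume z: "z \<in> {0..y}"
  then have z1: "z \<in> {0..1}" using sub by blast
  show "norm (density_upto n j z) \<le> exp Kd" for n using density_upto_bounds(2)[OF j z1, of n] by (simp add: density_upto_def)
  show "(\<lambda>n. density_upto n j z) \<longlonglongrightarrow> density j z" by (rule density_upto_lim[OF j z1])
 qed
 show ?thesis unfolding phi_integral[OF j x] chart_def W_def
  by (intro tendsto_divide * x) (use W1_bounds(3)[OF j] in \<open>auto simp: W_def\<close>)
qed

lemma g01: "i \<in> {1..d} ==> g i 0 \<in> {0..1}" "i \<in> {1..d} ==> g i 1 \<in> {0..1}" "i \<in> {1..d} ==> g i 0 < g i 1"
 using g_range[of i 0] g_range[of i 1] strict_monoD[OF gmono[of i], of 0 1] by auto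

text \<open>
 Putting \<open>i\<close> in front of \<open>j\<close> composes with the branch \<open>g i\<close> and rescales; this survives the limit.
\<close>

lemma chart_shift:
 assumes j: "j \<in> Sg" and i: "i \<in> {1..d}" and x: "x \<in> {0..1}"
 shows "chart (i ## j) x = (chart j (g i x) - chart j (g i 0)) / (chart j (g i 1) - chart j (g i 0))"
proof (rule LIMSEQ_unique)
 show "(\<lambda>n. phi (Suc n) (i ## j) x) \<longlonglongrightarrow> chart (i ## j) x"
  by (rule LIMSEQ_Suc[OF phi_lim[OF Sigma_build[OF i j] x]])
 have "phi (Suc n) (i ## j) x = (phi n j (g i x) - phi n j (g i 0)) / (phi n j (g i 1) - phi n j (g i 0))" for n
 proof -
  have l: "len n j \<noteq> 0" using len_bounds(1)[OF j, of n] by simp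
  have "phi n j u - phi n j v = (G n j u - G n j v) / len n j" for u v unfolding phi_def by (simp add: diff_divide_distrib[symmetric])
  then show ?thesis unfolding phi_def[of "Suc n"] len_def[of "Suc n"] G_shift using l by simp
 qed
 moreover have "chart j (g i 0) < chart j (g i 1)" by (rule chart_less[OF j g01[OF i]])
 ultimately show "(\<lambda>n. phi (Suc n) (i ## j) x) \<longlonglongrightarrow> (chart j (g i x) - chart j (g i 0)) / (chart j (g i 1) - chart j (g i 0))"
  using g01[OF i] g_range[OF i x] by (simp only:) (intro tendsto_intros phi_lim[OF j], auto)
qed

lemma finite_scaling_eq:
 assumes j: "j \<in> Sg"
 shows "i \<in> {1..d} ==> finite_scaling d h (prefix n j) i = phi n j (g i 1) - phi n j (g i 0)"
  and "m \<in> {1..<d} ==> finite_scaling d h (prefix n j) (d + m) = phi n j (g (m + 1) 0) - phi n j (g m 1)"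
proof -
 let ?u = "rev (prefix n j)"
 have ph: "phi n j u - phi n j v = (G n j u - G n j v) / len n j" for u v unfolding phi_def by (simp add: diff_divide_distrib[symmetric])
 have 0: "h (?u \<frown> (\<lambda>_. 1)) = G n j 0" "h (?u \<frown> (\<lambda>_. d)) = G n j 1"
  using G_h[OF j Sigma_ends(1), of n] G_h[OF j Sigma_ends(2), of n] h_ends by simp_all
 have 1: "h (?u \<frown> (i ## (\<lambda>_. 1))) = G n j (g i 0)" "h (?u \<frown> (i ## (\<lambda>_. d))) = G n j (g i 1)" if i: "i \<in> {1..d}" for i
  using G_h[OF j Sigma_build[OF i Sigma_ends(1)], of n] G_h[OF j Sigma_build[OF i Sigma_ends(2)], of n] g_ends[OF i] by simp_all
 note F = finite_scaling_interval[OF ord d1 set_prefix_Sigma[OF j], of _ n, unfolded 0, folded len_def]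
 show "finite_scaling d h (prefix n j) i = phi n j (g i 1) - phi n j (g i 0)" if i: "i \<in> {1..d}"
  unfolding ph 1[OF i, symmetric] using F[of i] i by auto
 assume m: "m \<in> {1..<d}"
 then have mm: "m \<in> {1..d}" "m + 1 \<in> {1..d}" by auto
 show "finite_scaling d h (prefix n j) (d + m) = phi n j (g (m + 1) 0) - phi n j (g m 1)"
  unfolding ph 1(1)[OF mm(2), symmetric] 1(2)[OF mm(1), symmetric] using F[of "d + m"] m by auto
qed

end

section \<open>Transition maps between limit charts\<close>

locale smooth_branches_scaled = smooth_branches +
 fixes S :: "(nat \<Rightarrow> nat) \<Rightarrow> nat \<Rightarrow> real"
 assumes scal: "has_scaling_function d h S"
begin

lemma S_eq:
 assumes j: "j \<in> Sg"
 shows "i \<in> {1..d} ==> S j i = chart j (g i 1) - chart j (g i 0)"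
  and "m \<in> {1..<d} ==> S j (d + m) = chart j (g (m + 1) 0) - chart j (g m 1)"
proof -
 {
  assume i: "i \<in> {1..d}"
  then have "(\<lambda>n. phi n j (g i 1) - phi n j (g i 0)) \<longlonglongrightarrow> S j i"
   using scal j unfolding has_scaling_function_def finite_scaling_eq(1)[OF j i, symmetric] by auto
  moreover have "(\<lambda>n. phi n j (g i 1) - phi n j (g i 0)) \<longlonglongrightarrow> chart j (g i 1) - chart j (g i 0)"
   by (intro tendsto_diff phi_lim[OF j] g01[OF i])
  ultimately show "S j i = chart j (g i 1) - chart j (g i 0)" by (rule LIMSEQ_unique)
 }
 assume m: "m \<in> {1..<d}"
 then have mm: "m \<in> {1..d}" "m + 1 \<in> {1..d}" "d + m \<in> {1..2*d-1}" by auto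
 have "(\<lambda>n. phi n j (g (m + 1) 0) - phi n j (g m 1)) \<longlonglongrightarrow> S j (d + m)"
  using scal j mm(3) unfolding has_scaling_function_def finite_scaling_eq(2)[OF j m, symmetric] by blast
 moreover have "(\<lambda>n. phi n j (g (m + 1) 0) - phi n j (g m 1)) \<longlonglongrightarrow> chart j (g (m + 1) 0) - chart j (g m 1)"
  by (intro tendsto_diff phi_lim[OF j] g01 mm)
 ultimately show "S j (d + m) = chart j (g (m + 1) 0) - chart j (g m 1)" by (rule LIMSEQ_unique)
qed

lemma left_end_eq: assumes j: "j \<in> Sg" shows "i \<in> {1..d} ==> left_end d (S j) i = chart j (g i 0)"
proof (induction i)
 case (Suc i)
 show ?case
 proof (cases "i = 0")
  case True
  then show ?thesis using g_first by (simp add: left_end_def)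
 next
  case False
  have "{1..<Suc i} = insert i {1..<i}" using False by auto
  then have "left_end d (S j) (Suc i) = left_end d (S j) i + (S j i + S j (d + i))"
   unfolding left_end_def by simp
  then show ?thesis using Suc False S_eq[OF j, of i] by simp
 qed
qed simp

definition A0 :: "real set" where "A0 = (\<Union>i\<in>{1..d}. {g i 0, g i 1})"

lemma A0_sub: "A0 \<subseteq> {0..1}" unfolding A0_def using g01 by blast

lemma A_set_eq: assumes j: "j \<in> Sg" shows "A_set d (S j) = chart j ` A0"
proof -
 have "A_set d (S j) = (\<Union>i\<in>{1..d}. {chart j (g i 0), chart j (g i 1)})" unfolding A_set_def
  by (rule SUP_cong) (use left_end_eq[OF j] S_eq(1)[OF j] in auto)
 then show ?thesis unfolding A0_def by auto
qed

definition chart_inv :: "(nat \<Rightarrow> nat) \<Rightarrow> real \<Rightarrow> real" where "chart_inv j = inv_into {0..1} (chart j)"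

lemma chart_inv: assumes j: "j \<in> Sg"
 shows "x \<in> {0..1} ==> chart_inv j (chart j x) = x" "y \<in> {0..1} ==> chart j (chart_inv j y) = y" "y \<in> {0..1} ==> chart_inv j y \<in> {0..1}"
 unfolding chart_inv_def using chart_bij[OF j]
 by (metis bij_betw_inv_into_left, metis bij_betw_inv_into_right, metis bij_betw_apply bij_betw_inv_into)

lemma chart_image: "j \<in> Sg ==> chart j ` {0..1} = {0..1}"
 using chart_bij by (simp add: bij_betw_def)

lemma chart_inv_lfam: "lfam k e {0..1} Sg chart_inv"
 by (rule lfam_inv(1)[OF e0 e1 cv cv chart_der, where c = "exp (- 2 * Kd)" and H = chart_inv and I = "Sg"])
  (use dchart_bounds(1) chart_image chart_inv(1) dchart_bfam in auto)

lemma chart_inv_der: assumes j: "j \<in> Sg" and y: "y \<in> {0..1}"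
 shows "(chart_inv j has_real_derivative 1 / dchart j (chart_inv j y)) (at y within {0..1})"
 by (rule lfam_inv(2)[OF e0 e1 cv cv chart_der, where c = "exp (- 2 * Kd)" and I = "Sg" and m = k and H = chart_inv])
  (use dchart_bounds(1) chart_image chart_inv(1) dchart_bfam assms in auto)

definition psi :: "(nat \<Rightarrow> nat) \<Rightarrow> (nat \<Rightarrow> nat) \<Rightarrow> real \<Rightarrow> real" where "psi j j' x = chart j' (chart_inv j x)"

lemma psi_der: assumes j: "j \<in> Sg" "j' \<in> Sg" and y: "y \<in> {0..1}"
 shows "(psi j j' has_real_derivative dchart j' (chart_inv j y) * (1 / dchart j (chart_inv j y))) (at y within {0..1})"
proof -
 have sub: "chart_inv j ` {0..1} \<subseteq> {0..1}" using chart_inv(3)[OF j(1)] by blast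
 have "(chart j' has_real_derivative dchart j' (chart_inv j y)) (at (chart_inv j y) within chart_inv j ` {0..1})"
  by (rule has_field_derivative_subset[OF chart_der[OF j(2) chart_inv(3)[OF j(1) y]] sub])
 from DERIV_image_chain[OF this chart_inv_der[OF j(1) y]] show ?thesis unfolding psi_def by (simp add: o_def)
qed

lemma psi_lfam: "lfam k e {0..1} (Sg \<times> Sg) (\<lambda>(j,j'). psi j j')"
proof -
 let ?I = "Sg \<times> Sg"
 have l: "lfam (k - 1) e {0..1} ?I (\<lambda>p. chart_inv (fst p))"
  by (rule lfam_reindex[OF lfam_mono[OF e0 e1 cv chart_inv_lfam]]) auto
 have r: "\<And>p y. p \<in> ?I ==> y \<in> {0..1} ==> chart_inv (fst p) y \<in> {0..1}" using chart_inv(3) by (auto simp del: atLeastAtMost_iff)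
 have b1: "bfam (k - 1) e {0..1} ?I (\<lambda>p. dchart (snd p))" by (rule bfam_reindex[OF dchart_bfam]) auto
 have b2: "bfam (k - 1) e {0..1} ?I (\<lambda>p. dchart (fst p))" by (rule bfam_reindex[OF dchart_bfam]) auto
 have 1: "bfam (k - 1) e {0..1} ?I (\<lambda>p y. dchart (snd p) (chart_inv (fst p) y))"
  by (rule bfam_comp[OF e0 e1 cv b1 l cv]) (rule r)
 have 2: "bfam (k - 1) e {0..1} ?I (\<lambda>p y. dchart (fst p) (chart_inv (fst p) y))"
  by (rule bfam_comp[OF e0 e1 cv b2 l cv]) (rule r)
 have 3: "bfam (k - 1) e {0..1} ?I (\<lambda>p y. 1 / dchart (fst p) (chart_inv (fst p) y))"
  by (rule bfam_inverse[OF e0 e1 cv 2, where c = "exp (- 2 * Kd)"]) (use dchart_bounds(1) r in auto)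
 have "lfam (Suc (k - 1)) e {0..1} ?I (\<lambda>(j,j'). psi j j')"
  by (rule lfam_SucI[OF _ bfam_mult[OF e0 e1 cv 1 3]]) (use psi_der in auto)
 then show ?thesis using k1 by simp
qed

lemma psi_ends: assumes j: "j \<in> Sg" "j' \<in> Sg" shows "psi j j' 0 = 0" "psi j j' 1 = 1"
 unfolding psi_def using chart_inv(1)[OF j(1), of 0] chart_inv(1)[OF j(1), of 1] chart_1 j by auto

lemma psi_bij: assumes j: "j \<in> Sg" "j' \<in> Sg" shows "bij_betw (psi j j') {0..1} {0..1}"
proof -
 have "bij_betw (chart j' \<circ> chart_inv j) {0..1} {0..1}" unfolding chart_inv_def
  by (rule bij_betw_trans[OF bij_betw_inv_into[OF chart_bij[OF j(1)]] chart_bij[OF j(2)]])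
 then show ?thesis unfolding psi_def by (simp add: o_def cong: bij_betw_cong)
qed

lemma psi_inv: assumes j: "j \<in> Sg" "j' \<in> Sg" and x: "x \<in> {0..1}"
 shows "psi j' j (psi j j' x) = x"
 unfolding psi_def using chart_inv j x by metis

lemma psi_secant: assumes j: "j \<in> Sg" "j' \<in> Sg" and xy: "x \<in> {0..1}" "y \<in> {0..1}" "x \<le> y"
 shows "exp (- 4 * Kd) * (y - x) \<le> psi j j' y - psi j j' x"
proof -
 have "\<exists>z\<in>{x..y}. psi j j' y - psi j j' x = (\<lambda>h. dchart j' (chart_inv j z) * (1 / dchart j (chart_inv j z)) * h) (y - x)"
 proof (rule mvt_very_simple[OF xy(3)])
  fix z assume "x \<le> z" "z \<le> y"
  then have "(psi j j' has_real_derivative dchart j' (chart_inv j z) * (1 / dchart j (chart_inv j z))) (at z within {x..y})"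
   by (intro has_field_derivative_subset[OF psi_der[OF j]]) (use xy in auto)
  then show "(psi j j' has_derivative (\<lambda>h. dchart j' (chart_inv j z) * (1 / dchart j (chart_inv j z)) * h)) (at z within {x..y})" by (simp only: has_field_derivative_def)
 qed
 then obtain z where z: "z \<in> {x..y}" "psi j j' y - psi j j' x = dchart j' (chart_inv j z) * (1 / dchart j (chart_inv j z)) * (y - x)" by auto
 have p: "chart_inv j z \<in> {0..1}" using chart_inv(3)[OF j(1)] z(1) xy by auto
 have "exp (- 4 * Kd) = exp (- 2 * Kd) / exp (2 * Kd)" by (simp add: exp_diff[symmetric])
 also have "\<dots> \<le> dchart j' (chart_inv j z) / dchart j (chart_inv j z)"
 proof (rule frac_le)
  have e: "0 < exp (- 2 * Kd)" by simp
  show "0 \<le> dchart j' (chart_inv j z)" "0 < dchart j (chart_inv j z)"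
   using dchart_bounds(1)[OF j(1) p] dchart_bounds(1)[OF j(2) p] e by linarith+
 qed (use dchart_bounds[OF j(1) p] dchart_bounds[OF j(2) p] in auto)
 finally show ?thesis unfolding z(2) using xy(3) by (intro mult_right_mono) auto
qed

lemma S_pos: assumes j: "j \<in> Sg" "i \<in> {1..d}" shows "0 < S j i"
 using S_eq(1)[OF j] chart_less[OF j(1) g01[OF j(2)]] by simp

lemma psi_shift: assumes j: "j \<in> Sg" "j' \<in> Sg" and i: "i \<in> {1..d}" and x: "x \<in> {0..1}"
 shows "psi (i ## j) (i ## j') x = (psi j j' (left_end d (S j) i + S j i * x) - left_end d (S j') i) / S j' i"
  and "left_end d (S j) i + S j i * x \<in> {0..1}"
proof -
 define y where "y = chart_inv (i ## j) x"
 have y: "y \<in> {0..1}" "chart (i ## j) y = x" unfolding y_def using chart_inv[OF Sigma_build[OF i j(1)]] x by auto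
 have nz: "chart j (g i 1) - chart j (g i 0) \<noteq> 0" using chart_less[OF j(1) g01[OF i]] by simp
 have eq: "left_end d (S j) i + S j i * x = chart j (g i y)"
  unfolding left_end_eq[OF j(1) i] S_eq(1)[OF j(1) i] y(2)[symmetric] chart_shift[OF j(1) i y(1)] using nz by simp
 show "left_end d (S j) i + S j i * x \<in> {0..1}" unfolding eq by (rule chart_range[OF j(1) g_range[OF i y(1)]])
 have "psi j j' (chart j (g i y)) = chart j' (g i y)" unfolding psi_def using chart_inv(1)[OF j(1) g_range[OF i y(1)]] by simp
 then show "psi (i ## j) (i ## j') x = (psi j j' (left_end d (S j) i + S j i * x) - left_end d (S j') i) / S j' i"
  unfolding eq psi_def[of "i ## j"] y_def[symmetric] chart_shift[OF j(2) i y(1)] left_end_eq[OF j(2) i] S_eq(1)[OF j(2) i] by simp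
qed

text \<open>
 The renormalization step of \<open>psi_shift\<close>, repeated for all common symbols.
\<close>

lemma psi_deep:
 "j \<in> Sg ==> j' \<in> Sg ==> (\<And>t. t < n ==> j t = j' t) ==>
  \<exists>a b s'. s' > 0 \<and> (\<forall>x\<in>{0..1}. a + (\<Prod>t<n. S (suffix (Suc t) j) (j t)) * x \<in> {0..1} \<and>
   psi j j' x = (psi (suffix n j) (suffix n j') (a + (\<Prod>t<n. S (suffix (Suc t) j) (j t)) * x) - b) / s')"
proof (induction n arbitrary: j j')
 case 0
 show ?case by (rule exI[of _ 0], rule exI[of _ 0], rule exI[of _ 1]) simp
next
 case (Suc n)
 define j1 j1' i where "j1 = suffix 1 j" and "j1' = suffix 1 j'" and "i = j 0"
 have S1: "j1 \<in> Sg" "j1' \<in> Sg" "i \<in> {1..d}"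
  unfolding j1_def j1'_def i_def using Suc.prems Sigma_suffix Sigma_nth by auto
 have "j' 0 = j 0" using Suc.prems(3)[of 0] by simp
 then have jj: "j = i ## j1" "j' = i ## j1'" unfolding j1_def j1'_def i_def using build_split by metis+
 have "j1 t = j1' t" if "t < n" for t unfolding j1_def j1'_def using Suc.prems(3)[of "Suc t"] that by simp
 from Suc.IH[OF S1(1,2) this] obtain a b s' where
  A: "s' > 0" "\<forall>x\<in>{0..1}. a + (\<Prod>t<n. S (suffix (Suc t) j1) (j1 t)) * x \<in> {0..1} \<and>
   psi j1 j1' x = (psi (suffix n j1) (suffix n j1') (a + (\<Prod>t<n. S (suffix (Suc t) j1) (j1 t)) * x) - b) / s'" by blast
 define s where "s = (\<Prod>t<n. S (suffix (Suc t) j1) (j1 t))"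
 note A2 = A(2)[folded s_def]
 have P: "(\<Prod>t<Suc n. S (suffix (Suc t) j) (j t)) = s * S j1 i"
  unfolding prod.lessThan_Suc_shift s_def j1_def i_def by (simp add: mult.commute)
 have su: "suffix (Suc n) j = suffix n j1" "suffix (Suc n) j' = suffix n j1'" unfolding j1_def j1'_def by simp_all
 show ?case unfolding P su
 proof (intro exI conjI ballI)
  show "s' * S j1' i > 0" using A(1) S_pos[OF S1(2,3)] by simp
  fix x :: real assume x: "x \<in> {0..1}"
  note sh = psi_shift[OF S1 x]
  have e: "a + s * left_end d (S j1) i + s * S j1 i * x = a + s * (left_end d (S j1) i + S j1 i * x)" by (simp add: algebra_simps)
  show "a + s * left_end d (S j1) i + s * S j1 i * x \<in> {0..1}" unfolding e using A2 sh(2) by blast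
  have "psi j1 j1' (left_end d (S j1) i + S j1 i * x) = (psi (suffix n j1) (suffix n j1') (a + s * (left_end d (S j1) i + S j1 i * x)) - b) / s'"
   using A2 sh(2) by blast
  then show "psi j j' x = (psi (suffix n j1) (suffix n j1') (a + s * left_end d (S j1) i + s * S j1 i * x) - (b + left_end d (S j1') i * s')) / (s' * S j1' i)"
   unfolding jj sh(1) e using A(1) S_pos[OF S1(2,3)] by (simp add: field_simps)
 qed
qed

lemma psi_Ck: assumes j: "j \<in> Sg" "j' \<in> Sg" shows "Ck_on k {0..1} (psi j j')"
proof -
 have "lfam (Suc (k - 1)) e {0..1} (Sg \<times> Sg) (\<lambda>(j,j'). psi j j')" using psi_lfam k1 by simp
 from lfam_imp_Ck_eps_on[OF at_within_nontrivial(1) e0 this, of "(j,j')"] show ?thesis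
  using j k1 unfolding Ck_eps_on_def by simp
qed

text \<open>
 With \<open>s\<close> the product of scaling ratios, the rescaling multiplies the \<open>k\<close>-th derivative by \<open>s ^ k / s'\<close>,
 where \<open>s'\<close> is comparable to \<open>s\<close>, and shrinks the distance of the points by \<open>s\<close>.
\<close>

lemma psi_var: obtains K where "K \<ge> 0"
 "\<And>j j' x y n. j \<in> Sg ==> j' \<in> Sg ==> \<forall>t<n. j t = j' t ==> x \<in> {0..1} ==> y \<in> {0..1} ==>
  \<bar>D01 k (psi j j') x - D01 k (psi j j') y\<bar> \<le> K * (\<Prod>t<n. S (suffix (Suc t) j) (j t)) powr (real k + e - 1)"
proof -
 have "lfam (Suc (k - 1)) e {0..1} (Sg \<times> Sg) (\<lambda>(j,j'). psi j j')" using psi_lfam k1 by simp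
 from lfam_nth_deriv_Hoelder[OF at_within_nontrivial(1) this] obtain K where
  "\<forall>i\<in>Sg \<times> Sg. \<forall>x\<in>{0..1}. \<forall>y\<in>{0..1}. \<bar>D01 k ((\<lambda>(j,j'). psi j j') i) x - D01 k ((\<lambda>(j,j'). psi j j') i) y\<bar> \<le> K * \<bar>x - y\<bar> powr e"
  using k1 by (auto simp del: nth_deriv.simps)
 then have K: "\<bar>D01 k (psi j j') x - D01 k (psi j j') y\<bar> \<le> \<bar>K\<bar> * \<bar>x - y\<bar> powr e"
  if "j \<in> Sg" "j' \<in> Sg" "x \<in> {0..1}" "y \<in> {0..1}" for j j' x y
  using that by (auto intro: order_trans[OF _ mult_right_mono[OF abs_ge_self]])
 show thesis
 proof (rule that[of "\<bar>K\<bar> / exp (- 4 * Kd)"])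
  show "0 \<le> \<bar>K\<bar> / exp (- 4 * Kd)" by simp
  fix j j' x y n assume j: "j \<in> Sg" "j' \<in> Sg" and eq: "\<forall>t<n. j t = j' t" and xy: "x \<in> {0..1::real}" "y \<in> {0..1::real}"
  define s where "s = (\<Prod>t<n. S (suffix (Suc t) j) (j t))"
  have s0: "s > 0" unfolding s_def by (intro prod_pos) (use S_pos Sigma_suffix Sigma_nth j in blast)
  define w w' where "w = suffix n j" and "w' = suffix n j'"
  have w: "w \<in> Sg" "w' \<in> Sg" unfolding w_def w'_def using j Sigma_suffix by auto
  obtain a b s' where A: "s' > 0" "\<And>x. x \<in> {0..1} ==> a + s * x \<in> {0..1}" "\<And>x. x \<in> {0..1} ==> psi j j' x = (psi w w' (a + s * x) - b) / s'"
   using psi_deep[OF j eq[rule_format]] unfolding s_def w_def w'_def by blast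
  have "psi j j' 1 - psi j j' 0 = (psi w w' (a + s) - psi w w' a) / s'"
   using A(3)[of 0] A(3)[of 1] by (simp add: diff_divide_distrib[symmetric])
  then have "1 = (psi w w' (a + s) - psi w w' a) / s'" using psi_ends[OF j] by simp
  then have "s' = psi w w' (a + s) - psi w w' a" using A(1) by (simp add: field_simps)
  moreover have "exp (- 4 * Kd) * (a + s - a) \<le> psi w w' (a + s) - psi w w' a"
   by (rule psi_secant[OF w]) (use A(2)[of 0] A(2)[of 1] s0 in auto)
  ultimately have s': "exp (- 4 * Kd) * s \<le> s'" by simp
  have D: "D01 k (psi j j') z = s ^ k / s' * D01 k (psi w w') (a + s * z)" if z: "z \<in> {0..1}" for z
  proof -
   have "D01 k (psi j j') z = D01 k (\<lambda>x. (psi w w' (a + s * x) - b) / s') z"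
    by (rule nth_deriv_cong[OF A(3) z])
   also have "\<dots> = s ^ k / s' * D01 k (psi w w') (a + s * z)"
    using nth_deriv_affine_shift[OF psi_Ck[OF w] order_refl z A(2)] k1 by simp
   finally show ?thesis .
  qed
  have "\<bar>D01 k (psi j j') x - D01 k (psi j j') y\<bar> =
   s ^ k / s' * \<bar>D01 k (psi w w') (a + s * x) - D01 k (psi w w') (a + s * y)\<bar>"
   unfolding D[OF xy(1)] D[OF xy(2)] right_diff_distrib[symmetric] abs_mult using s0 A(1) by simp
  also have "\<dots> \<le> s ^ k / s' * (\<bar>K\<bar> * \<bar>(a + s * x) - (a + s * y)\<bar> powr e)"
   using K[OF w A(2)[OF xy(1)] A(2)[OF xy(2)]] s0 A(1) by (intro mult_left_mono) auto
  also have "\<dots> \<le> s ^ k / (exp (- 4 * Kd) * s) * (\<bar>K\<bar> * s powr e)"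
  proof (intro mult_mono divide_left_mono powr_mono2)
   have "\<bar>s * x - s * y\<bar> = s * \<bar>x - y\<bar>" using s0 by (simp add: abs_mult right_diff_distrib[symmetric])
   also have "\<dots> \<le> s * 1" using xy s0 by (intro mult_left_mono) auto
   finally show "\<bar>(a + s * x) - (a + s * y)\<bar> \<le> s" by simp
  qed (use s' s0 A(1) e0 in auto)
  also have "\<dots> = \<bar>K\<bar> / exp (- 4 * Kd) * (s ^ k / s * s powr e)" by simp
  also have "s ^ k / s * s powr e = s powr (real k + e - 1)"
   using s0 by (simp add: powr_realpow[symmetric] powr_add powr_diff)
  finally show "\<bar>D01 k (psi j j') x - D01 k (psi j j') y\<bar> \<le> \<bar>K\<bar> / exp (- 4 * Kd) * (\<Prod>t<n. S (suffix (Suc t) j) (j t)) powr (real k + e - 1)"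
   unfolding s_def .
 qed
qed

definition rpsi :: "(nat \<Rightarrow> nat) \<Rightarrow> (nat \<Rightarrow> nat) \<Rightarrow> real \<Rightarrow> real" where "rpsi j j' = restrict (psi j j') {0..1}"

lemma rpsi_Diff: assumes j: "j \<in> Sg" "j' \<in> Sg"
 shows "rpsi j j' \<in> Diff k (A_set d (S j)) (A_set d (S j'))"
proof -
 have r: "rpsi j j' x = psi j j' x" if "x \<in> {0..1}" for x unfolding rpsi_def using that by simp
 have bij: "bij_betw (rpsi j j') {0..1} {0..1}" using psi_bij[OF j] bij_betw_cong[of "{0..1}" "rpsi j j'" "psi j j'"] r by blast
 have inv: "inv_into {0..1} (rpsi j j') y = psi j' j y" if y: "y \<in> {0..1}" for y
 proof -
  have y': "psi j' j y \<in> {0..1}" using bij_betw_apply[OF psi_bij[OF j(2,1)] y] .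
  have "rpsi j j' (psi j' j y) = y" using r[OF y'] psi_inv[OF j(2,1) y] by simp
  then show ?thesis using bij_betw_inv_into_left[OF bij y'] by simp
 qed
 have "strict_mono_on {0..1} (rpsi j j')"
 proof (rule strict_mono_onI)
  fix x y :: real assume xy: "x \<in> {0..1}" "y \<in> {0..1}" "x < y"
  have "0 < exp (- 4 * Kd) * (y - x)" using xy by simp
  then have "psi j j' x < psi j j' y" using psi_secant[OF j xy(1,2) less_imp_le[OF xy(3)]] by linarith
  then show "rpsi j j' x < rpsi j j' y" using r xy by simp
 qed
 moreover have "Ck_on k {0..1} (rpsi j j')" using Ck_on_cong[of "{0..1}" "rpsi j j'" "psi j j'" k] r psi_Ck[OF j] by blast
 moreover have "Ck_on k {0..1} (inv_into {0..1} (rpsi j j'))"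
  using Ck_on_cong[of "{0..1}" "inv_into {0..1} (rpsi j j')" "psi j' j" k] inv psi_Ck[OF j(2,1)] by blast
 moreover have "rpsi j j' ` A_set d (S j) = A_set d (S j')"
 proof -
  have "rpsi j j' (chart j x) = chart j' x" if "x \<in> A0" for x
  proof -
   have x: "x \<in> {0..1}" using that A0_sub by blast
   show ?thesis using r[OF chart_range[OF j(1) x]] chart_inv(1)[OF j(1) x] by (simp add: psi_def)
  qed
  then show ?thesis unfolding A_set_eq[OF j(1)] A_set_eq[OF j(2)] image_image by (intro image_cong) auto
 qed
 moreover have "rpsi j j' \<in> extensional {0..1}" unfolding rpsi_def by simp
 ultimately show ?thesis using bij unfolding Diff_def by blast
qed

lemma rpsi_renorm: assumes j: "j \<in> Sg" "j' \<in> Sg" and i: "i \<in> {1..d}"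
 shows "renorm d (S j) (S j') i (rpsi j j') = rpsi (i ## j) (i ## j')"
 unfolding renorm_def rpsi_def
 by (rule ext) (use psi_shift[OF j i] in \<open>auto simp: restrict_def simp del: atLeastAtMost_iff\<close>)

text \<open>
 The strict inequality in the definition of \<open>D^k_var\<close> is the reason for the constant \<open>K + 1\<close>, and the
 supremum in \<open>rho\<close> is estimated from below by its value at the sequence \<open>suffix n j\<close>.
\<close>

theorem scaling_condition:
 assumes SS: "S \<in> Sg \<rightarrow> Simp d"
 shows "\<exists>C. \<forall>j\<in>Sigma_dual d. \<forall>j'\<in>Sigma_dual d. j \<noteq> j' \<longrightarrow> (\<forall>j\<^sub>0\<in>{1..d}.
    Diff_var k (C * rho d S (j\<^sub>0 ## j) (j\<^sub>0 ## j') powr (real k + e - 1))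
     (A_set d (S (j\<^sub>0 ## j))) (A_set d (S (j\<^sub>0 ## j')))
    \<inter> renorm d (S j) (S j') j\<^sub>0 `
      Diff_var k (C * rho d S j j' powr (real k + e - 1))
       (A_set d (S j)) (A_set d (S j'))
    \<noteq> {})"
proof -
 obtain K where K: "K \<ge> 0"
 "\<And>j j' x y n. j \<in> Sg ==> j' \<in> Sg ==> \<forall>t<n. j t = j' t ==> x \<in> {0..1} ==> y \<in> {0..1} ==>
  \<bar>D01 k (psi j j') x - D01 k (psi j j') y\<bar> \<le> K * (\<Prod>t<n. S (suffix (Suc t) j) (j t)) powr (real k + e - 1)"
  by (rule psi_var) (rule that)
 have mem: "rpsi j j' \<in> Diff_var k ((K + 1) * rho d S j j' powr (real k + e - 1)) (A_set d (S j)) (A_set d (S j'))"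
  if j: "j \<in> Sg" "j' \<in> Sg" "j \<noteq> j'" for j j'
 proof -
  define n where "n = common_len j j'"
  have eq: "\<forall>t<n. j t = j' t" using common_len_diff(2)[OF j(3)] unfolding n_def by blast
  define s where "s = (\<Prod>t<n. S (suffix (Suc t) j) (j t))"
  have S01: "0 \<le> S v i \<and> S v i \<le> 1" if "v \<in> Sg" "i \<in> {1..d}" for v i
  proof -
   have "S v \<in> Simp d" "i \<in> {1..2*d-1}" using SS that d2 by auto
   then have "S v i \<in> {0<..<1}" unfolding Simp_def by blast
   then show ?thesis by auto
  qed
  have s0: "s > 0" unfolding s_def by (intro prod_pos) (use S_pos Sigma_suffix Sigma_nth j in blast)
  have "(\<Prod>t<n. S ((j [Suc t \<rightarrow> n]) \<frown> suffix n j) (j t)) \<le> (SUP w\<in>Sg. \<Prod>t<n. S ((j [Suc t \<rightarrow> n]) \<frown> w) (j t))"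
  proof (rule cSUP_upper[OF Sigma_suffix[OF j(1)]])
   show "bdd_above ((\<lambda>w. \<Prod>t<n. S ((j [Suc t \<rightarrow> n]) \<frown> w) (j t)) ` Sg)"
   proof (rule bdd_aboveI2)
    fix w assume w: "w \<in> Sg"
    have "(j [Suc t \<rightarrow> n]) \<frown> w \<in> Sg" for t using w Sigma_nth[OF j(1)] by (intro Sigma_conc) auto
    then show "(\<Prod>t<n. S ((j [Suc t \<rightarrow> n]) \<frown> w) (j t)) \<le> 1"
     using S01 Sigma_nth[OF j(1)] by (intro prod_le_1) blast
   qed
  qed
  also have "\<dots> = rho d S j j'" unfolding rho_def Let_def n_def using j(3) by simp
  also have "(\<Prod>t<n. S ((j [Suc t \<rightarrow> n]) \<frown> suffix n j) (j t)) = s" unfolding s_def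
   by (rule prod.cong) auto
  finally have s_rho: "s \<le> rho d S j j'" .
  have e': "0 \<le> real k + e - 1" using k1 e0 by linarith
  have pw: "s powr (real k + e - 1) \<le> rho d S j j' powr (real k + e - 1)" using s_rho s0 e' by (intro powr_mono2) auto
  have rho0: "rho d S j j' > 0" using s_rho s0 by linarith
  have "(SUP (x, y)\<in>{0..1} \<times> {0..1}. \<bar>D01 k (rpsi j j') x - D01 k (rpsi j j') y\<bar>) \<le> K * rho d S j j' powr (real k + e - 1)"
  proof (rule cSUP_least)
   fix p :: "real \<times> real" assume "p \<in> {0..1} \<times> {0..1}"
   then obtain x y where p: "p = (x,y)" "x \<in> {0..1}" "y \<in> {0..1}" by auto
   have r: "D01 k (rpsi j j') z = D01 k (psi j j') z" if "z \<in> {0..1}" for z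
    by (rule nth_deriv_cong[OF _ that]) (simp add: rpsi_def)
   have "\<bar>D01 k (psi j j') x - D01 k (psi j j') y\<bar> \<le> K * s powr (real k + e - 1)"
    unfolding s_def by (rule K(2)[OF j(1,2) eq p(2,3)])
   also have "\<dots> \<le> K * rho d S j j' powr (real k + e - 1)" using pw K(1) by (rule mult_left_mono)
   finally show "(case p of (x, y) \<Rightarrow> \<bar>D01 k (rpsi j j') x - D01 k (rpsi j j') y\<bar>) \<le> K * rho d S j j' powr (real k + e - 1)"
    using p r by simp
  qed simp
  also have "\<dots> < (K + 1) * rho d S j j' powr (real k + e - 1)" using rho0 by (intro mult_strict_right_mono) auto
  finally show ?thesis using rpsi_Diff[OF j(1,2)] unfolding Diff_var_def by blast
 qed
 show ?thesis
 proof (intro exI[of _ "K + 1"] ballI impI)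
  fix j j' i assume j: "j \<in> Sg" "j' \<in> Sg" "j \<noteq> j'" and i: "i \<in> {1..d}"
  have "rpsi (i ## j) (i ## j') \<in> Diff_var k ((K + 1) * rho d S (i ## j) (i ## j') powr (real k + e - 1)) (A_set d (S (i ## j))) (A_set d (S (i ## j')))"
   by (rule mem) (use j i Sigma_build in auto)
  then show "Diff_var k ((K + 1) * rho d S (i ## j) (i ## j') powr (real k + e - 1)) (A_set d (S (i ## j))) (A_set d (S (i ## j')))
    \<inter> renorm d (S j) (S j') i ` Diff_var k ((K + 1) * rho d S j j' powr (real k + e - 1)) (A_set d (S j)) (A_set d (S j')) \<noteq> {}"
   using imageI[OF mem[OF j], of "renorm d (S j) (S j') i"] unfolding rpsi_renorm[OF j(1,2) i] by blast
 qed
qed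

end

section \<open>From embeddings to the scaling condition\<close>

text \<open>
 The lower bound for the derivative comes from the inverse: it is differentiable on the range, so the
 derivative of \<open>g\<close> does not vanish on the compact unit interval.
\<close>

lemma smooth_contraction_data:
 assumes g: "smooth_contraction k e g" and k: "k \<ge> 1" and e: "0 < e" "e \<le> 1"
 obtains L c dg where "L < 1" "0 < c" "\<And>x y. \<bar>g x - g y\<bar> \<le> L * \<bar>x - y\<bar>" "strict_mono g"
  "\<And>x. (g has_real_derivative dg x) (at x)" "bfam (k - 1) e {0..1} {()} (\<lambda>_. dg)" "\<And>x. x \<in> {0..1} ==> c \<le> dg x"
proof -
 obtain L where L: "L < 1" "L-lipschitz_on UNIV g" and sm: "strict_mono g"
  and C: "Ck_eps_on k e UNIV g" and Ci: "Ck_eps_on k e (range g) (inv g)"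
  using g unfolding smooth_contraction_def by blast
 have "Ck_eps_on (Suc (k - 1)) e UNIV g" using C k by simp
 then obtain dg where dg: "\<And>x. (g has_real_derivative dg x) (at x)" "Ck_eps_on (k - 1) e UNIV dg"
  unfolding Ck_eps_on_Suc_UNIV by blast
 have b: "bfam (k - 1) e {0..1} {()} (\<lambda>_. dg)" by (rule Ck_eps_on_imp_bfam[OF dg(2) e(1)])
 have "inv g differentiable_on range g" using Ci k unfolding Ck_eps_on_def Ck_on_def by (metis Suc_le_eq One_nat_def nth_deriv.simps(1))
 then have ne: "dg x \<noteq> 0" for x
 proof -
  have "inv g differentiable (at (g x) within range g)" using \<open>inv g differentiable_on range g\<close> unfolding differentiable_on_def by blast
  then obtain D where "(inv g has_real_derivative D) (at (g x) within range g)" by (auto simp: real_differentiable_def)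
  from DERIV_image_chain[OF this, of "dg x"] dg(1)[of x]
  have "((inv g \<circ> g) has_real_derivative D * dg x) (at x)" by simp
  moreover have "inv g \<circ> g = (\<lambda>x. x)" using strict_mono_imp_inj_on[OF sm] by (auto simp: inv_f_f)
  ultimately have "((\<lambda>x. x) has_real_derivative D * dg x) (at x)" by simp
  then have "D * dg x = 1" using DERIV_ident DERIV_unique by blast
  then show "dg x \<noteq> 0" by auto
 qed
 have "dg x \<ge> 0" for x
 proof (rule ccontr)
  assume "\<not> 0 \<le> dg x"
  then obtain d where d: "d > 0" "\<And>h. 0 < h ==> h < d ==> g (x + h) < g x"
   using DERIV_neg_dec_right[OF dg(1)[of x]] by auto
  have "g x < g (x + d / 2)" using strict_monoD[OF sm, of x "x + d / 2"] d(1) by simp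
  then show False using d(2)[of "d / 2"] d(1) by simp
 qed
 then have pos: "dg x > 0" for x using ne[of x] by (simp add: less_le)
 have "continuous_on {0..1} dg"
 proof -
  have "bfam 0 e {0..1} {()} (\<lambda>_. dg)" by (rule bfam_mono[OF e _ b]) auto
  from bfam_imp_Ck_eps_on[OF at_within_nontrivial(1) e(1) this] show ?thesis by (simp add: Ck_eps_on_0)
 qed
 then obtain z where z: "z \<in> {0..1}" "\<And>x. x \<in> {0..1} ==> dg z \<le> dg x"
  using continuous_attains_inf[of "{0..1::real}" dg] by auto
 have lip: "\<bar>g x - g y\<bar> \<le> L * \<bar>x - y\<bar>" for x y
  using L(2) unfolding lipschitz_on_def dist_real_def by blast
 show thesis by (rule that[OF L(1) pos[of z] lip sm dg(1) b z(2)])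
qed

theorem embedding_imp_scaling_condition:
 assumes d: "d \<ge> 2" and k: "k \<ge> 1" and e: "0 < e" "e \<le> 1" and SS: "S \<in> Sigma_dual d \<rightarrow> Simp d"
  and C: "C_embedding d k e h" and sc: "has_scaling_function d h S"
 shows "\<exists>C. \<forall>j\<in>Sigma_dual d. \<forall>j'\<in>Sigma_dual d. j \<noteq> j' \<longrightarrow> (\<forall>j\<^sub>0\<in>{1..d}.
    Diff_var k (C * rho d S (j\<^sub>0 ## j) (j\<^sub>0 ## j') powr (real k + e - 1))
     (A_set d (S (j\<^sub>0 ## j))) (A_set d (S (j\<^sub>0 ## j')))
    \<inter> renorm d (S j) (S j') j\<^sub>0 `
      Diff_var k (C * rho d S j j' powr (real k + e - 1))
       (A_set d (S j)) (A_set d (S j'))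
    \<noteq> {})"
proof -
 define Q where "Q = (\<lambda>i (p :: (real \<Rightarrow> real) \<times> (real \<Rightarrow> real) \<times> real \<times> real). case p of (g, dg, L, c) \<Rightarrow>
  L < 1 \<and> 0 < c \<and> (\<forall>x y. \<bar>g x - g y\<bar> \<le> L * \<bar>x - y\<bar>) \<and> strict_mono g \<and>
  (\<forall>x. (g has_real_derivative dg x) (at x)) \<and> bfam (k - 1) e {0..1} {()} (\<lambda>_. dg) \<and> (\<forall>x\<in>{0..1}. c \<le> dg x) \<and>
  (\<forall>x\<in>h ` Sigma_seq d. g x = branch d h i x))"
 have "\<forall>i\<in>{1..d}. \<exists>p. Q i p"
 proof
  fix i assume "i \<in> {1..d}"
  then obtain g where g: "smooth_contraction k e g" "\<forall>x\<in>h ` Sigma_seq d. g x = branch d h i x"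
   using C unfolding C_embedding_def by blast
  obtain L c dg where "L < 1" "0 < c" "\<And>x y. \<bar>g x - g y\<bar> \<le> L * \<bar>x - y\<bar>" "strict_mono g"
   "\<And>x. (g has_real_derivative dg x) (at x)" "bfam (k - 1) e {0..1} {()} (\<lambda>_. dg)" "\<And>x. x \<in> {0..1} ==> c \<le> dg x"
   by (rule smooth_contraction_data[OF g(1) k e]) (rule that)
  then show "\<exists>p. Q i p" unfolding Q_def using g(2) by (intro exI[of _ "(g, dg, L, c)"]) auto
 qed
 from bchoice[OF this] obtain q where q: "\<forall>i\<in>{1..d}. Q i (q i)" ..
 define g dg L c where "g = (\<lambda>i. fst (q i))" and "dg = (\<lambda>i. fst (snd (q i)))"
  and "L = (\<lambda>i. fst (snd (snd (q i))))" and "c = (\<lambda>i. snd (snd (snd (q i))))"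
 have Q: "L i < 1" "0 < c i" "\<forall>x y. \<bar>g i x - g i y\<bar> \<le> L i * \<bar>x - y\<bar>" "strict_mono (g i)"
  "\<forall>x. (g i has_real_derivative dg i x) (at x)" "bfam (k - 1) e {0..1} {()} (\<lambda>_. dg i)" "\<forall>x\<in>{0..1}. c i \<le> dg i x"
  "\<forall>x\<in>h ` Sigma_seq d. g i x = branch d h i x" if "i \<in> {1..d}" for i
  using bspec[OF q that] unfolding Q_def g_def dg_def L_def c_def by (simp_all add: case_prod_unfold)
 define L1 where "L1 = Max (insert (1/2) (L ` {1..d}))"
 define c1 where "c1 = Min (c ` {1..d})"
 have fin: "finite {1..d}" "{1..d} \<noteq> {}" using d by auto
 have L1: "0 < L1" "L1 < 1" "\<And>i. i \<in> {1..d} ==> L i \<le> L1"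
 proof -
  show "L1 < 1" unfolding L1_def using Q(1) by (subst Max_less_iff) auto
  have "1/2 \<le> L1" unfolding L1_def by (rule Max_ge) auto
  then show "0 < L1" by simp
  show "L i \<le> L1" if "i \<in> {1..d}" for i unfolding L1_def by (rule Max_ge) (use that in auto)
 qed
 have c1: "0 < c1" "\<And>i. i \<in> {1..d} ==> c1 \<le> c i"
 proof -
  show "0 < c1" unfolding c1_def using Q(2) fin by (subst Min_gr_iff) auto
  show "c1 \<le> c i" if "i \<in> {1..d}" for i unfolding c1_def by (rule Min_le) (use that in auto)
 qed
 have ord: "lex_mono d h" and hull: "convex hull (h ` Sigma_seq d) = {0..1}"
 proof -
  have "is_embedding d h" using C unfolding C_embedding_def by (rule conjunct1)
  then show "lex_mono d h" "convex hull (h ` Sigma_seq d) = {0..1}"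
   unfolding is_embedding_def lex_mono_def by (rule conjunct1[OF conjunct2], rule conjunct2[OF conjunct2])
 qed
 have inj: "inj_on h (Sigma_seq d)" by (rule lex_mono_inj[OF ord])
 interpret smooth_branches_scaled d k e h g dg L1 c1 S
 proof
  fix i assume i: "i \<in> {1..d}"
  show "g i (h \<alpha>) = h (i ## \<alpha>)" if a: "\<alpha> \<in> Sigma_seq d" for \<alpha>
  proof -
   have "g i (h \<alpha>) = branch d h i (h \<alpha>)" using Q(8)[OF i] a by blast
   then show ?thesis unfolding branch_def using inv_into_f_f[OF inj a] by simp
  qed
  show "strict_mono (g i)" by (rule Q(4)[OF i])
  show "(g i has_real_derivative dg i x) (at x within {0..1})" for x using Q(5)[OF i] has_field_derivative_at_within by blast
  show "c1 \<le> dg i x" if "x \<in> {0..1}" for x using Q(7)[OF i] c1(2)[OF i] that by force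
  show "\<bar>g i x - g i y\<bar> \<le> L1 * \<bar>x - y\<bar>" for x y
   using Q(3)[OF i] mult_right_mono[OF L1(3)[OF i] abs_ge_zero[of "x - y"]] by (meson order_trans)
 next
  show "bfam (k - 1) e {0..1} {1..d} dg"
  proof (rule bfam_finite)
   fix i assume "i \<in> {1..d}"
   from bfam_singleton[OF Q(6)[OF this], of i] have "bfam (k - 1) e {0..1} {i} (\<lambda>_. dg i)" .
   then show "bfam (k - 1) e {0..1} {i} dg" by (rule bfam_cong) simp
  qed simp
 qed (use d k e ord hull c1 L1 sc in auto)
 show ?thesis by (rule scaling_condition[OF SS])
qed

section \<open>Diffeomorphisms with small variation\<close>

lemma D01_deriv:
 assumes "Ck_on k {0..1} f" "i < k" "x \<in> {0..1}"
 shows "(D01 i f has_real_derivative D01 (Suc i) f x) (at x within {0..1})"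
 by (rule Ck_on_has_derivative[OF _ assms]) (rule at_within_nontrivial)

lemma D01_lip:
 assumes "Ck_on k {0..1} f" "i < k" "\<And>x. x \<in> {0..1} ==> \<bar>D01 (Suc i) f x\<bar> \<le> B" "x \<in> {0..1}" "y \<in> {0..1}"
 shows "\<bar>D01 i f x - D01 i f y\<bar> \<le> B * \<bar>x - y\<bar>"
proof -
 have "norm (D01 i f x - D01 i f y) \<le> B * norm (x - y)"
  by (rule field_differentiable_bound[of "{0..1}" "D01 i f" "D01 (Suc i) f"])
   (use assms D01_deriv[OF assms(1,2)] in \<open>auto simp del: nth_deriv.simps atLeastAtMost_iff\<close>)
 then show ?thesis by simp
qed

lemma Ck_on_le: "Ck_on k {0..1} f ==> m \<le> k ==> continuous_on {0..1} (D01 m f)"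
proof (cases "m = k")
 case False
 assume a: "Ck_on k {0..1} f" "m \<le> k"
 then have "m < k" using False by simp
 then show ?thesis using DERIV_continuous_on[OF D01_deriv[OF a(1)]] by blast
qed (simp add: Ck_on_def)

lemma Diff_var_imp:
 assumes "\<phi> \<in> Diff_var k M A A'" "x \<in> {0..1}" "y \<in> {0..1}"
 shows "\<bar>D01 k \<phi> x - D01 k \<phi> y\<bar> \<le> M"
proof -
 have C: "Ck_on k {0..1} \<phi>" using assms(1) unfolding Diff_var_def Diff_def by blast
 have "compact (D01 k \<phi> ` {0..1})" by (rule compact_continuous_image[OF Ck_on_le[OF C order_refl]]) simp
 then obtain B where B: "\<And>x. x \<in> {0..1} ==> \<bar>D01 k \<phi> x\<bar> \<le> B"
  using compact_imp_bounded bounded_iff by (metis image_eqI real_norm_def)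
 have "\<bar>D01 k \<phi> x - D01 k \<phi> y\<bar> \<le> (SUP (x, y)\<in>{0..1} \<times> {0..1}. \<bar>D01 k \<phi> x - D01 k \<phi> y\<bar>)"
 proof -
  have bdd: "bdd_above ((\<lambda>(x, y). \<bar>D01 k \<phi> x - D01 k \<phi> y\<bar>) ` ({0..1} \<times> {0..1}))"
  proof (rule bdd_aboveI2)
   fix p :: "real \<times> real" assume "p \<in> {0..1} \<times> {0..1}"
   then obtain u v where "p = (u, v)" "u \<in> {0..1}" "v \<in> {0..1}" by auto
   then show "(case p of (x, y) \<Rightarrow> \<bar>D01 k \<phi> x - D01 k \<phi> y\<bar>) \<le> 2 * B" using B[of u] B[of v] by simp
  qed
  have "(x, y) \<in> {0..1} \<times> {0..1}" using assms by simp
  from cSUP_upper[OF this bdd] show ?thesis by simp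
 qed
 also have "\<dots> < M" using assms(1) unfolding Diff_var_def by blast
 finally show ?thesis by simp
qed

lemma rolle_zeros:
 fixes f f' :: "real \<Rightarrow> real"
 assumes d: "\<And>x. x \<in> {0..1} ==> (f has_real_derivative f' x) (at x within {0..1})"
 shows "finite Z ==> card Z = Suc n ==> Z \<subseteq> {0..1} ==> (\<And>z. z \<in> Z ==> f z = 0) ==>
  \<exists>Z'. finite Z' \<and> card Z' = n \<and> Z' \<subseteq> {0..1} \<and> (\<forall>z\<in>Z'. f' z = 0 \<and> Min Z \<le> z)"
proof (induction n arbitrary: Z)
 case 0 show ?case by (rule exI[of _ "{}"]) simp
next
 case (Suc n)
 have ne: "Z \<noteq> {}" using Suc.prems by auto
 define z0 Z1 where "z0 = Min Z" and "Z1 = Z - {z0}"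
 have z0: "z0 \<in> Z" unfolding z0_def using Suc.prems ne by simp
 have Z1: "finite Z1" "card Z1 = Suc n" "Z1 \<subseteq> {0..1}" "\<And>z. z \<in> Z1 ==> f z = 0"
  unfolding Z1_def using Suc.prems z0 by auto
 have Z1ne: "Z1 \<noteq> {}" using Z1(2) by auto
 obtain Z' where Z': "finite Z'" "card Z' = n" "Z' \<subseteq> {0..1}" "\<forall>z\<in>Z'. f' z = 0 \<and> Min Z1 \<le> z"
  using Suc.IH[OF Z1] by blast
 have m: "Min Z1 \<in> Z1" using Z1 Z1ne by simp
 have lt: "z0 < Min Z1"
  using m Suc.prems(1) unfolding Z1_def z0_def by (metis DiffD1 DiffD2 Min_le insertI1 order_le_imp_less_or_eq)
 have r01: "0 \<le> z0" "Min Z1 \<le> 1" using z0 m Suc.prems(3) Z1(3) by auto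
 have "\<exists>x\<in>{z0<..<Min Z1}. f (Min Z1) - f z0 = (\<lambda>h. f' x * h) (Min Z1 - z0)"
 proof (rule mvt_simple[OF lt])
  fix x assume "z0 \<le> x" "x \<le> Min Z1"
  then have "(f has_real_derivative f' x) (at x within {z0..Min Z1})"
   by (intro has_field_derivative_subset[OF d]) (use r01 in auto)
  then show "(f has_derivative (\<lambda>h. f' x * h)) (at x within {z0..Min Z1})" by (simp only: has_field_derivative_def)
 qed
 then obtain x where x: "z0 < x" "x < Min Z1" "f (Min Z1) - f z0 = f' x * (Min Z1 - z0)" by auto
 have fx: "f' x = 0" using x(3) lt Suc.prems(4)[OF z0] Z1(4)[OF m] by simp
 have xn: "x \<notin> Z'" using x(2) Z'(4) by auto
 show ?case
 proof (intro exI[of _ "insert x Z'"] conjI ballI)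
  show "card (insert x Z') = Suc n" using xn Z' by simp
  show "insert x Z' \<subseteq> {0..1}" using Z'(3) x r01 by auto
  fix z assume z: "z \<in> insert x Z'"
  show "f' z = 0" using z fx Z'(4) by auto
  show "Min Z \<le> z" using z x(1) lt Z'(4) unfolding z0_def by force
 qed (use Z' in simp)
qed

lemma zeros_of_derivatives:
 assumes C: "Ck_on k {0..1} f" and Z: "finite Z" "Suc k \<le> card Z" "Z \<subseteq> {0..1}" "\<And>z. z \<in> Z ==> f z = 0" and m: "m \<le> k"
 shows "\<exists>z\<in>{0..1}. D01 m f z = 0"
proof -
 have "\<exists>Z'. finite Z' \<and> card Z' = Suc k - m \<and> Z' \<subseteq> {0..1} \<and> (\<forall>z\<in>Z'. D01 m f z = 0)"
  using m
 proof (induction m)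
  case 0
  obtain Y where "Y \<subseteq> Z" "card Y = Suc k" using obtain_subset_with_card_n[OF Z(2)] by blast
  then show ?case using Z finite_subset[of Y Z] by (intro exI[of _ Y]) auto
 next
  case (Suc m)
  then obtain Z' where Z': "finite Z'" "card Z' = Suc k - m" "Z' \<subseteq> {0..1}" "\<forall>z\<in>Z'. D01 m f z = 0" by auto
  have c: "card Z' = Suc (Suc k - Suc m)" using Z'(2) Suc.prems by simp
  have "m < k" using Suc.prems by simp
  from rolle_zeros[OF D01_deriv[OF C this] Z'(1) c Z'(3)] Z'(4)
  show ?case by blast
 qed
 then obtain Z' where "finite Z'" "card Z' = Suc k - m" "Z' \<subseteq> {0..1}" "\<forall>z\<in>Z'. D01 m f z = 0" by blast
 moreover have "Z' \<noteq> {}" using calculation(2) m by auto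
 ultimately show ?thesis by blast
qed

text \<open>
 By Rolle's theorem every derivative of \<open>f - g\<close> up to order \<open>k\<close> has a zero. The \<open>k\<close>-th derivative varies by
 at most \<open>2 * M\<close>, and integrating from the zeros carries this bound down to the lower orders.
\<close>

lemma variation_agree:
 assumes C: "Ck_on k {0..1} f" "Ck_on k {0..1} g"
  and v: "\<And>x y. x \<in> {0..1} ==> y \<in> {0..1} ==> \<bar>D01 k f x - D01 k f y\<bar> \<le> M"
   "\<And>x y. x \<in> {0..1} ==> y \<in> {0..1} ==> \<bar>D01 k g x - D01 k g y\<bar> \<le> M"
  and Z: "finite Z" "Suc k \<le> card Z" "Z \<subseteq> {0..1}" "\<And>z. z \<in> Z ==> f z = g z"
  and m: "m \<le> k" and x: "x \<in> {0..1}"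
 shows "\<bar>D01 m f x - D01 m g x\<bar> \<le> 2 * M"
proof -
 define \<delta> where "\<delta> = (\<lambda>x. f x - g x)"
 have Cd: "Ck_on k {0..1} \<delta>" unfolding \<delta>_def by (rule Ck_on_diff[OF _ C]) (rule at_within_nontrivial)
 have Dd: "D01 i \<delta> z = D01 i f z - D01 i g z" if "i \<le> k" "z \<in> {0..1}" for i z
  unfolding \<delta>_def by (rule nth_deriv_diff[OF _ C that(2,1)]) (rule at_within_nontrivial)
 have zero: "\<exists>z\<in>{0..1}. D01 i \<delta> z = 0" if "i \<le> k" for i
  by (rule zeros_of_derivatives[OF Cd Z(1-3) _ that]) (simp add: \<delta>_def Z(4))
 have "\<forall>z\<in>{0..1}. \<bar>D01 (k - i) \<delta> z\<bar> \<le> 2 * M" if "i \<le> k" for i using that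
 proof (induction i)
  case 0
  obtain z0 where z0: "z0 \<in> {0..1}" "D01 k \<delta> z0 = 0" using zero[OF order_refl] by blast
  have "\<bar>D01 k \<delta> z\<bar> \<le> 2 * M" if z: "z \<in> {0..1}" for z
   using z0(2) v(1)[OF z z0(1)] v(2)[OF z z0(1)] Dd[OF order_refl z] Dd[OF order_refl z0(1)] by linarith
  then show ?case by simp
 next
  case (Suc i)
  define n where "n = k - Suc i"
  have n: "n < k" "Suc n = k - i" unfolding n_def using Suc.prems by auto
  obtain z0 where z0: "z0 \<in> {0..1}" "D01 n \<delta> z0 = 0" using zero[of n] n by auto
  have M0: "0 \<le> 2 * M" using v(1)[OF x x] by simp
  have "\<bar>D01 n \<delta> z\<bar> \<le> 2 * M" if z: "z \<in> {0..1}" for z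
  proof -
   have "\<bar>D01 n \<delta> z - D01 n \<delta> z0\<bar> \<le> 2 * M * \<bar>z - z0\<bar>"
    by (rule D01_lip[OF Cd n(1) _ z z0(1)]) (use Suc n in \<open>auto simp del: nth_deriv.simps\<close>)
   also have "\<dots> \<le> 2 * M * 1" using M0 z z0(1) by (intro mult_left_mono) auto
   finally show ?thesis using z0(2) by simp
  qed
  then show ?case unfolding n_def by blast
 qed
 from this[OF diff_le_self, of m] have "\<forall>z\<in>{0..1}. \<bar>D01 m \<delta> z\<bar> \<le> 2 * M" using m by simp
 then have "\<bar>D01 m \<delta> x\<bar> \<le> 2 * M" using x by blast
 then show ?thesis unfolding Dd[OF m x] .
qed

text \<open>
 Divided differences: between two points in the outer thirds of an interval where the \<open>m\<close>-th derivative is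
 bounded there is a point where the next derivative is bounded.
\<close>

lemma small_derivative_point:
 assumes l: "0 < (l::real)"
 shows "\<exists>K\<ge>0. \<forall>f a. Ck_on k {0..1} f \<and> (\<forall>x\<in>{0..1}. \<bar>f x\<bar> \<le> 1) \<and> 0 \<le> a \<and> a + l \<le> 1 \<longrightarrow>
  m \<le> k \<longrightarrow> (\<exists>x\<in>{a..a+l}. \<bar>D01 m f x\<bar> \<le> K)"
 using l
proof (induction m arbitrary: l)
 case 0
 show ?case by (rule exI[of _ 1]) (use 0 in \<open>auto intro!: bexI\<close>)
next
 case (Suc m)
 obtain K where K: "K \<ge> 0" "\<And>f a. Ck_on k {0..1} f ==> (\<forall>x\<in>{0..1}. \<bar>f x\<bar> \<le> 1) ==> 0 \<le> a ==> a + l/3 \<le> 1 ==>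
  m \<le> k ==> (\<exists>x\<in>{a..a+l/3}. \<bar>D01 m f x\<bar> \<le> K)" using Suc.IH[of "l/3"] Suc.prems by auto
 show ?case
 proof (intro exI[of _ "2 * K / (l/3)"] conjI allI impI)
  show "0 \<le> 2 * K / (l/3)" using K(1) Suc.prems by simp
  fix f a assume A: "Ck_on k {0..1} f \<and> (\<forall>x\<in>{0..1}. \<bar>f x\<bar> \<le> 1) \<and> 0 \<le> a \<and> a + l \<le> 1" and m: "Suc m \<le> k"
  obtain x where x: "x \<in> {a..a+l/3}" "\<bar>D01 m f x\<bar> \<le> K" using K(2)[of f a] A m Suc.prems by auto
  obtain y where y: "y \<in> {a+2*l/3..a+2*l/3+l/3}" "\<bar>D01 m f y\<bar> \<le> K" using K(2)[of f "a+2*l/3"] A m Suc.prems by auto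
  have xy: "x + l/3 \<le> y" using x(1) y(1) by simp
  then have lt: "x < y" using Suc.prems by linarith
  have "\<exists>z\<in>{x<..<y}. D01 m f y - D01 m f x = (\<lambda>h. D01 (Suc m) f z * h) (y - x)"
  proof (rule mvt_simple[OF lt])
   fix z assume z: "x \<le> z" "z \<le> y"
   have "(D01 m f has_real_derivative D01 (Suc m) f z) (at z within {x..y})"
    by (rule has_field_derivative_subset[OF D01_deriv[of k]]) (use A m z x(1) y(1) in auto)
   then show "(D01 m f has_derivative (\<lambda>h. D01 (Suc m) f z * h)) (at z within {x..y})" by (simp only: has_field_derivative_def)
  qed
  then obtain z where z: "z \<in> {x<..<y}" "D01 m f y - D01 m f x = D01 (Suc m) f z * (y - x)" by auto
  have "\<bar>D01 (Suc m) f z\<bar> * (l/3) \<le> \<bar>D01 (Suc m) f z\<bar> * (y - x)" using xy by (intro mult_left_mono) auto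
  also have "\<dots> = \<bar>D01 m f y - D01 m f x\<bar>" unfolding z(2) abs_mult using lt by simp
  also have "\<dots> \<le> 2 * K" using x(2) y(2) by linarith
  finally have "\<bar>D01 (Suc m) f z\<bar> \<le> 2 * K / (l/3)" using Suc.prems by (subst le_divide_eq) auto
  moreover have "z \<in> {a..a+l}" using z(1) x(1) y(1) by auto
  ultimately show "\<exists>x\<in>{a..a+l}. \<bar>D01 (Suc m) f x\<bar> \<le> 2 * K / (l/3)" by blast
 qed
qed

lemma derivative_bound:
 "\<exists>B\<ge>1. \<forall>f. Ck_on k {0..1} f \<and> (\<forall>x\<in>{0..1}. \<bar>f x\<bar> \<le> 1) \<and> (\<forall>x\<in>{0..1}. \<forall>y\<in>{0..1}. \<bar>D01 k f x - D01 k f y\<bar> \<le> M) \<longrightarrow>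
  (\<forall>m\<le>k. \<forall>x\<in>{0..1}. \<bar>D01 m f x\<bar> \<le> B)"
proof -
 define Q where "Q = (\<lambda>f. Ck_on k {0..1} f \<and> (\<forall>x\<in>{0..1}. \<bar>f x\<bar> \<le> 1) \<and> (\<forall>x\<in>{0..1}. \<forall>y\<in>{0..1}. \<bar>D01 k f x - D01 k f y\<bar> \<le> M))"
 have pt: "\<exists>K\<ge>0. \<forall>f. Q f \<longrightarrow> (\<exists>x\<in>{0..1}. \<bar>D01 m f x\<bar> \<le> K)" if "m \<le> k" for m
 proof -
  obtain K where K: "K \<ge> 0" "\<forall>f a. Ck_on k {0..1} f \<and> (\<forall>x\<in>{0..1}. \<bar>f x\<bar> \<le> 1) \<and> 0 \<le> a \<and> a + 1 \<le> 1 \<longrightarrow>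
   m \<le> k \<longrightarrow> (\<exists>x\<in>{a..a+1}. \<bar>D01 m f x\<bar> \<le> K)" using small_derivative_point[of 1 k m] by auto
  have "\<exists>x\<in>{0..1}. \<bar>D01 m f x\<bar> \<le> K" if "Q f" for f
   using K(2)[rule_format, of f 0] \<open>m \<le> k\<close> that unfolding Q_def by simp
  then show ?thesis using K(1) by blast
 qed
 have "\<exists>B\<ge>0. \<forall>f. Q f \<longrightarrow> (\<forall>x\<in>{0..1}. \<bar>D01 (k - i) f x\<bar> \<le> B)" if "i \<le> k" for i using that
 proof (induction i)
  case 0
  obtain K where K: "K \<ge> 0" "\<And>f. Q f ==> (\<exists>x\<in>{0..1}. \<bar>D01 k f x\<bar> \<le> K)" using pt[OF order_refl] by blast
  have "\<bar>D01 k f x\<bar> \<le> K + \<bar>M\<bar>" if f: "Q f" and x: "x \<in> {0..1}" for f x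
  proof -
   obtain y where y: "y \<in> {0..1}" "\<bar>D01 k f y\<bar> \<le> K" using K(2)[OF f] by blast
   have "\<bar>D01 k f x - D01 k f y\<bar> \<le> M" using f x y(1) unfolding Q_def by blast
   then show ?thesis using y(2) by linarith
  qed
  then show ?case using K(1) by (intro exI[of _ "K + \<bar>M\<bar>"]) auto
 next
  case (Suc i)
  define n where "n = k - Suc i"
  have n: "n < k" "Suc n = k - i" unfolding n_def using Suc.prems by auto
  obtain B where B: "B \<ge> 0" "\<And>f x. Q f ==> x \<in> {0..1} ==> \<bar>D01 (Suc n) f x\<bar> \<le> B" using Suc n by auto
  obtain K where K: "K \<ge> 0" "\<And>f. Q f ==> (\<exists>x\<in>{0..1}. \<bar>D01 n f x\<bar> \<le> K)" using pt[of n] n by auto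
  have "\<bar>D01 n f x\<bar> \<le> K + B" if f: "Q f" and x: "x \<in> {0..1}" for f x
  proof -
   obtain y where y: "y \<in> {0..1}" "\<bar>D01 n f y\<bar> \<le> K" using K(2)[OF f] by blast
   have "\<bar>D01 n f x - D01 n f y\<bar> \<le> B * \<bar>x - y\<bar>"
    by (rule D01_lip[OF _ n(1) B(2)[OF f] x y(1)]) (use f Q_def in auto)
   also have "\<dots> \<le> B * 1" using B(1) x y(1) by (intro mult_left_mono) auto
   finally show ?thesis using y(2) by linarith
  qed
  then show ?case using K(1) B(1) unfolding n_def[symmetric] by (intro exI[of _ "K + B"]) auto
 qed
 then have "\<forall>m\<in>{..k}. \<exists>B. B \<ge> 0 \<and> (\<forall>f. Q f \<longrightarrow> (\<forall>x\<in>{0..1}. \<bar>D01 m f x\<bar> \<le> B))"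
  by (metis atMost_iff diff_diff_cancel diff_le_self)
 from bchoice[OF this] obtain Bf where Bf: "\<forall>m\<in>{..k}. Bf m \<ge> 0 \<and> (\<forall>f. Q f \<longrightarrow> (\<forall>x\<in>{0..1}. \<bar>D01 m f x\<bar> \<le> Bf m))" ..
 define B where "B = (\<Sum>m\<le>k. Bf m) + 1"
 have le: "Bf m \<le> B" if "m \<le> k" for m
  using member_le_sum[of m "{..k}" Bf] that Bf unfolding B_def by auto
 have "0 \<le> (\<Sum>m\<le>k. Bf m)" by (rule sum_nonneg) (use Bf in blast)
 then have "1 \<le> B" unfolding B_def by simp
 moreover have "\<bar>D01 m f x\<bar> \<le> B" if "Q f" "m \<le> k" "x \<in> {0..1}" for f m x
 proof -
  have "\<bar>D01 m f x\<bar> \<le> Bf m" using Bf that by (simp del: nth_deriv.simps)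
  then show ?thesis using le[OF that(2)] by linarith
 qed
 ultimately show ?thesis unfolding Q_def by (intro exI[of _ B] conjI allI impI ballI) auto
qed

text \<open>
 Both functions are the increasing enumeration of the same finite set.
\<close>

lemma strict_mono_on_finite_unique:
 fixes f g :: "real \<Rightarrow> real"
 assumes A: "finite A" "strict_mono_on A f" "strict_mono_on A g" "f ` A = g ` A" and a: "a \<in> A"
 shows "f a = g a"
proof -
 have card: "card {c \<in> f ` A. c < f a} = card {b \<in> A. b < a}" if sm: "strict_mono_on A f" and a: "a \<in> A" for f :: "real \<Rightarrow> real" and a
 proof -
  have "{c \<in> f ` A. c < f a} = f ` {b \<in> A. b < a}"
   using strict_mono_on_less[OF sm] a by auto
  moreover have "inj_on f {b \<in> A. b < a}" using strict_mono_on_imp_inj_on[OF sm] by (rule inj_on_subset) auto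
  ultimately show ?thesis by (simp add: card_image)
 qed
 have no: "\<not> f a < g a" if sm: "strict_mono_on A f" "strict_mono_on A g" and im: "f ` A = g ` A" for f g :: "real \<Rightarrow> real"
 proof
  assume lt: "f a < g a"
  have "{c \<in> f ` A. c < f a} \<subset> {c \<in> g ` A. c < g a}" using lt a im by auto
  moreover have "finite {c \<in> g ` A. c < g a}" using A(1) by simp
  ultimately have "card {c \<in> f ` A. c < f a} < card {c \<in> g ` A. c < g a}" by (rule psubset_card_mono[rotated])
  then show False using card[OF sm(1) a] card[OF sm(2) a] by simp
 qed
 show ?thesis using no[OF A(2,3,4)] no[OF A(3,2) A(4)[symmetric]] by linarith
qed

lemma taylor_variation:
 assumes C: "Ck_on k {0..1} f" and v: "\<And>x y. x \<in> {0..1} ==> y \<in> {0..1} ==> \<bar>D01 k f x - D01 k f y\<bar> \<le> M"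
  and m: "m \<le> k" and x: "x \<in> {0..1}" and y: "y \<in> {0..1}"
 shows "\<bar>D01 m f y - jet_taylor k (\<lambda>i. D01 i f) m x y\<bar> \<le> M"
proof -
 have M0: "0 \<le> M" using v[OF x x] by simp
 have "\<forall>y\<in>{0..1}. \<bar>D01 (k - i) f y - jet_taylor k (\<lambda>i. D01 i f) (k - i) x y\<bar> \<le> M" if "i \<le> k" for i using that
 proof (induction i)
  case 0
  show ?case using v x by (auto simp: jet_taylor_def simp del: nth_deriv.simps)
 next
  case (Suc i)
  define n where "n = k - Suc i"
  have n: "n < k" "Suc n = k - i" unfolding n_def using Suc.prems by auto
  have "\<bar>D01 n f y - jet_taylor k (\<lambda>i. D01 i f) n x y\<bar> \<le> M" if y: "y \<in> {0..1}" for y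
  proof -
   let ?r = "\<lambda>n y. D01 n f y - jet_taylor k (\<lambda>i. D01 i f) n x y"
   have "norm (?r n y - ?r n x) \<le> M * norm (y - x)"
   proof (rule field_differentiable_bound[of "{0..1}" "?r n" "?r (Suc n)"])
    fix z :: real assume z: "z \<in> {0..1}"
    show "(?r n has_real_derivative ?r (Suc n) z) (at z within {0..1})"
     by (rule DERIV_diff[OF D01_deriv[OF C n(1) z] jet_taylor_deriv[OF n(1)]])
    show "norm (?r (Suc n) z) \<le> M" using Suc n z by (simp del: nth_deriv.simps)
   qed (use x y in auto)
   moreover have "?r n x = 0" by (simp add: jet_taylor_self)
   ultimately have "\<bar>?r n y\<bar> \<le> M * \<bar>y - x\<bar>" by (simp del: nth_deriv.simps)
   also have "\<dots> \<le> M * 1" using x y M0 by (intro mult_left_mono) auto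
   finally show ?thesis by simp
  qed
  then show ?case unfolding n_def by blast
 qed
 from this[of "k - m"] show ?thesis using m y by (simp del: nth_deriv.simps)
qed

lemma left_end_Suc: "i \<ge> 1 ==> left_end d v (Suc i) = left_end d v i + (v i + v (d + i))"
proof -
 assume "i \<ge> 1"
 then have "{1..<Suc i} = insert i {1..<i}" by auto
 then show ?thesis unfolding left_end_def by simp
qed

lemma left_end_1: "left_end d v 1 = 0" by (simp add: left_end_def)

lemma Simp_pos: "v \<in> Simp d ==> i \<in> {1..2*d-1} ==> 0 < v i \<and> v i < 1"
 unfolding Simp_def by auto

lemma left_end_less:
 assumes v: "v \<in> Simp d" and ii: "1 \<le> i" "i < i'" "i' \<le> d"
 shows "left_end d v i + v i + v (d + i) \<le> left_end d v i'"
proof -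
 have "left_end d v (Suc i) \<le> left_end d v i'" unfolding left_end_def
 proof (rule sum_mono2)
  fix b assume b: "b \<in> {1..<i'} - {1..<Suc i}"
  then have "b \<in> {1..2*d-1}" "d + b \<in> {1..2*d-1}" using ii by auto
  then show "0 \<le> v b + v (d + b)" using Simp_pos[OF v, of b] Simp_pos[OF v, of "d + b"] by linarith
 qed (use ii in auto)
 then show ?thesis using left_end_Suc[OF ii(1)] by simp
qed

lemma left_end_nonneg: assumes v: "v \<in> Simp d" and "i \<le> d" shows "0 \<le> left_end d v i"
 unfolding left_end_def
proof (rule sum_nonneg)
 fix b assume b: "b \<in> {1..<i}"
 then have "b \<in> {1..2*d-1}" "d + b \<in> {1..2*d-1}" using assms by auto
 then show "0 \<le> v b + v (d + b)" using Simp_pos[OF v, of b] Simp_pos[OF v, of "d + b"] by linarith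
qed

lemma left_end_last: assumes v: "v \<in> Simp d" and d: "d \<ge> 1" shows "left_end d v d + v d = 1"
proof -
 have "(\<Sum>m\<in>{1..<d}. v (d + m)) = (\<Sum>m\<in>{d+1..<2*d}. v m)"
  using sum.shift_bounds_nat_ivl[of v 1 d d] by (simp add: add.commute mult_2)
 then have "left_end d v d + v d = (\<Sum>m\<in>{1..<d}. v m) + v d + (\<Sum>m\<in>{d+1..<2*d}. v m)"
  unfolding left_end_def by (simp add: sum.distrib)
 also have "(\<Sum>m\<in>{1..<d}. v m) + v d = (\<Sum>m\<in>{1..d}. v m)"
 proof -
  have "{1..d} = insert d {1..<d}" using d by auto
  then show ?thesis by simp
 qed
 also have "(\<Sum>m\<in>{1..d}. v m) + (\<Sum>m\<in>{d+1..<2*d}. v m) = (\<Sum>m\<in>{1..d} \<union> {d+1..<2*d}. v m)"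
  by (rule sum.union_disjoint[symmetric]) auto
 also have "{1..d} \<union> {d+1..<2*d} = {1..2*d-1}" using d by auto
 also have "(\<Sum>m\<in>{1..2*d-1}. v m) = 1" using v unfolding Simp_def by blast
 finally show ?thesis .
qed

lemma left_end_right_le_1: assumes v: "v \<in> Simp d" and i: "i \<in> {1..d}" shows "left_end d v i + v i \<le> 1"
proof (cases "i = d")
 case True then show ?thesis using left_end_last[OF v] i by simp
next
 case False
 then have "left_end d v i + v i + v (d + i) \<le> left_end d v d" using left_end_less[OF v, of i d] i by auto
 moreover have "0 < v (d + i)" "0 < v d" using Simp_pos[OF v, of "d+i"] Simp_pos[OF v, of d] i False by auto
 ultimately show ?thesis using left_end_last[OF v] i by simp
qed

lemma A_set_card: assumes v: "v \<in> Simp d" and d: "d \<ge> 2" shows "finite (A_set d v)" "card (A_set d v) = 2 * d" "A_set d v \<subseteq> {0..1}"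
proof -
 show "finite (A_set d v)" unfolding A_set_def by auto
 have pos: "0 < v i" if "i \<in> {1..d}" for i using Simp_pos[OF v, of i] that d by auto
 have "card (A_set d v) = (\<Sum>i\<in>{1..d}. card {left_end d v i, left_end d v i + v i})"
  unfolding A_set_def
 proof (rule card_UN_disjoint)
  show "\<forall>i\<in>{1..d}. \<forall>j\<in>{1..d}. i \<noteq> j \<longrightarrow> {left_end d v i, left_end d v i + v i} \<inter> {left_end d v j, left_end d v j + v j} = {}"
  proof (intro ballI impI)
   have *: "{left_end d v i, left_end d v i + v i} \<inter> {left_end d v j, left_end d v j + v j} = {}" if ij: "i \<in> {1..d}" "j \<in> {1..d}" "i < j" for i j
   proof -
    have "left_end d v i + v i + v (d + i) \<le> left_end d v j" using left_end_less[OF v, of i j] ij by auto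
    moreover have "0 < v (d + i)" using Simp_pos[OF v, of "d+i"] ij by auto
    ultimately show ?thesis using pos[OF ij(1)] pos[OF ij(2)] by auto
   qed
   fix i j assume "i \<in> {1..d}" "j \<in> {1..d}" "i \<noteq> j"
   then show "{left_end d v i, left_end d v i + v i} \<inter> {left_end d v j, left_end d v j + v j} = {}"
    using *[of i j] *[of j i] by (cases "i < j") auto
  qed
 qed auto
 also have "\<dots> = (\<Sum>i\<in>{1..d}. 2)" by (rule sum.cong) (use pos in \<open>auto simp: card_insert_if less_imp_neq[symmetric]\<close>)
 finally show "card (A_set d v) = 2 * d" by simp
 show "A_set d v \<subseteq> {0..1}" unfolding A_set_def
  using left_end_right_le_1[OF v] left_end_nonneg[OF v] pos by (fastforce intro: less_imp_le order_trans)
qed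

section \<open>Cantor sets with prescribed ratios\<close>

declare nth_deriv.simps [simp del]

text \<open>
 The spaces \<open>D^k_var\<close> with a weak inequality; for \<open>j = j'\<close>, where the bound is 0, they still contain the
 identity.
\<close>

definition Vset :: "nat \<Rightarrow> nat \<Rightarrow> real \<Rightarrow> ((nat \<Rightarrow> nat) \<Rightarrow> nat \<Rightarrow> real) \<Rightarrow> real \<Rightarrow> (nat \<Rightarrow> nat) \<Rightarrow> (nat \<Rightarrow> nat) \<Rightarrow> (real \<Rightarrow> real) set" where
 "Vset d k e S C j j' = {\<phi> \<in> Diff k (A_set d (S j)) (A_set d (S j')).
   \<forall>x\<in>{0..1}. \<forall>y\<in>{0..1}. \<bar>D01 k \<phi> x - D01 k \<phi> y\<bar> \<le> C * rho d S j j' powr (real k + e - 1)}"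

lemma DiffD:
 assumes "\<phi> \<in> Diff k A A'"
 shows "Ck_on k {0..1} \<phi>" "strict_mono_on {0..1} \<phi>" "\<phi> ` A = A'" "\<phi> 0 = 0" "\<phi> 1 = 1" "\<And>x. x \<in> {0..1} ==> \<phi> x \<in> {0..1}"
proof -
 have b: "bij_betw \<phi> {0..1} {0..1}" and m: "strict_mono_on {0..1} \<phi>" using assms unfolding Diff_def by auto
 show "Ck_on k {0..1} \<phi>" "strict_mono_on {0..1} \<phi>" "\<phi> ` A = A'" using assms unfolding Diff_def by auto
 have im: "\<phi> ` {0..1} = {0..1}" using b by (rule bij_betw_imp_surj_on)
 show rng: "\<phi> x \<in> {0..1}" if "x \<in> {0..1}" for x using im that by blast
 have "0 \<in> \<phi> ` {0..1}" "1 \<in> \<phi> ` {0..1}" unfolding im by auto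
 then obtain a c where ac: "a \<in> {0..1}" "\<phi> a = 0" "c \<in> {0..1}" "\<phi> c = 1" by (metis imageE)
 have mono: "\<phi> x \<le> \<phi> y" if "x \<in> {0..1}" "y \<in> {0..1}" "x \<le> y" for x y
  using strict_mono_onD[OF m that(1,2)] that(3) by (cases "x = y") auto
 show "\<phi> 0 = 0" using mono[of 0 a] rng[of 0] ac by auto
 show "\<phi> 1 = 1" using mono[of c 1] rng[of 1] ac by auto
qed

lemma identity_Diff: "k \<ge> 1 ==> A \<subseteq> {0..1} ==> (\<lambda>x\<in>{0..1}. x) \<in> Diff k A A"
proof -
 assume k: "k \<ge> 1" and A: "A \<subseteq> {0..1::real}"
 have C0: "Ck_on k {0..1} (\<lambda>x::real. x)"
 proof -
  obtain n where n: "k = Suc n" using k by (cases k) auto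
  show ?thesis unfolding n by (subst Ck_on_Suc01) (auto intro!: exI[of _ "\<lambda>_. 1"] Ck_on_const)
 qed
 have inv: "inv_into {0..1} (\<lambda>x\<in>{0..1}. x) y = y" if "y \<in> {0..1::real}" for y
  by (rule inv_into_f_eq) (use that in \<open>auto simp: inj_on_def\<close>)
 show ?thesis unfolding Diff_def
 proof (intro CollectI conjI)
  show "bij_betw (\<lambda>x\<in>{0..1}. x) {0..1} {0..1::real}" by (auto simp: bij_betw_def inj_on_def)
  show "strict_mono_on {0..1} (\<lambda>x\<in>{0..1::real}. x)" by (auto simp: strict_mono_on_def)
  show "Ck_on k {0..1} (\<lambda>x\<in>{0..1}. x)" using C0 by (rule iffD1[OF Ck_on_cong, rotated]) auto
  show "Ck_on k {0..1} (inv_into {0..1} (\<lambda>x\<in>{0..1}. x))" using C0 by (rule iffD1[OF Ck_on_cong, rotated]) (simp only: inv)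
  show "(\<lambda>x\<in>{0..1}. x) ` A = A" using A by force
 qed auto
qed

text \<open>
 The word \<open>\<alpha> (n - 1) ... \<alpha> 0\<close> followed by \<open>w\<close>.
\<close>

primrec push :: "(nat \<Rightarrow> nat) \<Rightarrow> nat \<Rightarrow> (nat \<Rightarrow> nat) \<Rightarrow> nat \<Rightarrow> nat" where
 "push \<alpha> 0 w = w"
| "push \<alpha> (Suc n) w = \<alpha> n ## push \<alpha> n w"

lemma push_add: "push \<alpha> (m + n) w = push (suffix m \<alpha>) n (push \<alpha> m w)"
 by (induction n) (auto simp del: build_def)

lemma push_cong: "(\<And>t. t < n ==> \<alpha> t = \<beta> t) ==> push \<alpha> n w = push \<beta> n w"
 by (induction n) auto

lemma push_Sigma: "\<alpha> \<in> Sigma_seq d ==> w \<in> Sigma_seq d ==> push \<alpha> n w \<in> Sigma_seq d"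
 by (induction n) (auto intro!: Sigma_build simp del: atLeastAtMost_iff build_def intro: Sigma_nth)

lemma push_nth: "push \<alpha> n w t = (if t < n then \<alpha> (n - 1 - t) else w (t - n))"
proof (induction n arbitrary: t)
 case (Suc n)
 show ?case using Suc by (cases t) auto
qed simp

lemma push_common_len:
 assumes "w \<noteq> w'" shows "push \<alpha> n w \<noteq> push \<alpha> n w'" "common_len (push \<alpha> n w) (push \<alpha> n w') = n + common_len w w'"
proof -
 have 1: "push \<alpha> n w (n + common_len w w') \<noteq> push \<alpha> n w' (n + common_len w w')"
  using common_len_diff(1)[OF assms] by (simp add: push_nth)
 then show "push \<alpha> n w \<noteq> push \<alpha> n w'" by metis
 show "common_len (push \<alpha> n w) (push \<alpha> n w') = n + common_len w w'"
  by (rule common_len_eqI, rule 1) (use common_len_diff(2)[OF assms] in \<open>auto simp: push_nth\<close>)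
qed

lemma push_conc: assumes "t < n"
 shows "((push \<alpha> n w) [Suc t \<rightarrow> n + q]) \<frown> x = push \<alpha> (n - 1 - t) (prefix q w \<frown> x)"
proof
 fix s
 show "(((push \<alpha> n w) [Suc t \<rightarrow> n + q]) \<frown> x) s = push \<alpha> (n - 1 - t) (prefix q w \<frown> x) s"
  using assms by (auto simp: push_nth conc_def intro!: arg_cong[of _ _ \<alpha>] arg_cong[of _ _ w] arg_cong[of _ _ x])
qed

locale scaling_data =
 fixes d k :: nat and e :: real and S :: "(nat \<Rightarrow> nat) \<Rightarrow> nat \<Rightarrow> real" and C :: real
 assumes d2: "d \<ge> 2" and k1: "k \<ge> 1" and kd: "k < 2 * d" and e0: "0 < e" and e1: "e \<le> 1"
  and S: "S \<in> Sigma_seq d \<rightarrow> Simp d" and C: "0 \<le> C"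
  and cond: "\<And>j j' i. j \<in> Sigma_seq d ==> j' \<in> Sigma_seq d ==> i \<in> {1..d} ==>
   \<exists>\<psi>\<in>Vset d k e S C j j'. renorm d (S j) (S j') i \<psi> \<in> Vset d k e S C (i ## j) (i ## j')"
begin

abbreviation "Sg \<equiv> Sigma_seq d"
abbreviation "V \<equiv> Vset d k e S C"
abbreviation "r \<equiv> real k + e - 1"
abbreviation "le j i \<equiv> left_end d (S j) i"

lemma r0: "r > 0" "r \<ge> e" using k1 e0 by auto

lemma Ssimp: "j \<in> Sg ==> S j \<in> Simp d" using S by blast

lemma Spos: "j \<in> Sg ==> i \<in> {1..2*d-1} ==> 0 < S j i" "j \<in> Sg ==> i \<in> {1..2*d-1} ==> S j i < 1"
 using Simp_pos[OF Ssimp] by blast+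

lemma idx: "i \<in> {1..d} ==> i \<in> {1..2*d-1}" "i \<in> {1..<d} ==> d + i \<in> {1..2*d-1}" using d2 by auto

lemma rho_factors:
 assumes "j \<in> Sg" "x \<in> Sg" shows "(j [Suc t \<rightarrow> n]) \<frown> x \<in> Sg"
 by (rule Sigma_conc) (use assms Sigma_nth[OF assms(1)] in \<open>auto simp: subsequence_def simp del: atLeastAtMost_iff\<close>)

lemma rho_le:
 assumes j: "j \<in> Sg" "j' \<in> Sg" and b: "\<And>x. x \<in> Sg ==> j \<noteq> j' ==> (\<Prod>t<common_len j j'. S ((j [Suc t \<rightarrow> common_len j j']) \<frown> x) (j t)) \<le> b" and b0: "0 \<le> b"
 shows "rho d S j j' \<le> b"
proof (cases "j = j'")
 case True then show ?thesis using b0 by (simp add: rho_def)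
next
 case False
 show ?thesis unfolding rho_def Let_def using False j b by (auto intro!: cSUP_least)
qed

lemma rho_prod_le: assumes j: "j \<in> Sg" "x \<in> Sg" shows "(\<Prod>t<n. S ((j [Suc t \<rightarrow> n]) \<frown> x) (j t)) \<in> {0..1}"
proof -
 have "0 < S ((j [Suc t \<rightarrow> n]) \<frown> x) (j t)" "S ((j [Suc t \<rightarrow> n]) \<frown> x) (j t) < 1" for t
  using Spos[OF rho_factors[OF j] idx(1)[OF Sigma_nth[OF j(1)]]] by blast+
 then have "0 \<le> S ((j [Suc t \<rightarrow> n]) \<frown> x) (j t)" "S ((j [Suc t \<rightarrow> n]) \<frown> x) (j t) \<le> 1" for t
  by (auto intro: less_imp_le)
 then show ?thesis unfolding atLeastAtMost_iff by (intro conjI prod_nonneg prod_le_1) auto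
qed

lemma rho_range: assumes "j \<in> Sg" "j' \<in> Sg" shows "0 \<le> rho d S j j'" "rho d S j j' \<le> 1"
proof -
 show "rho d S j j' \<le> 1" by (rule rho_le[OF assms]) (use rho_prod_le[OF assms(1)] in auto)
 show "0 \<le> rho d S j j'"
 proof (cases "j = j'")
  case False
  let ?f = "\<lambda>x. \<Prod>t<common_len j j'. S ((j [Suc t \<rightarrow> common_len j j']) \<frown> x) (j t)"
  have "bdd_above (?f ` Sg)" by (rule bdd_aboveI2[of _ _ 1]) (use rho_prod_le[OF assms(1)] in auto)
  then have "?f j \<le> (SUP x\<in>Sg. ?f x)" by (rule cSUP_upper[OF assms(1)])
  moreover have "0 \<le> ?f j" using rho_prod_le[OF assms(1) assms(1)] by auto
  ultimately show ?thesis using False unfolding rho_def Let_def by simp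
 qed (simp add: rho_def)
qed

lemma V_var:
 assumes j: "j \<in> Sg" "j' \<in> Sg" and \<phi>: "\<phi> \<in> V j j'" and xy: "x \<in> {0..1}" "y \<in> {0..1}"
 shows "\<bar>D01 k \<phi> x - D01 k \<phi> y\<bar> \<le> C * rho d S j j' powr r" "\<bar>D01 k \<phi> x - D01 k \<phi> y\<bar> \<le> C"
proof -
 show 1: "\<bar>D01 k \<phi> x - D01 k \<phi> y\<bar> \<le> C * rho d S j j' powr r" using \<phi> xy unfolding Vset_def by blast
 have "rho d S j j' powr r \<le> 1 powr r" using rho_range[OF j] r0 by (intro powr_mono2) auto
 then have "C * rho d S j j' powr r \<le> C * 1" using C by (intro mult_left_mono) auto
 then show "\<bar>D01 k \<phi> x - D01 k \<phi> y\<bar> \<le> C" using 1 by linarith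
qed

lemma V_Diff: "\<phi> \<in> V j j' ==> \<phi> \<in> Diff k (A_set d (S j)) (A_set d (S j'))" unfolding Vset_def by blast
lemmas V_props = DiffD[OF V_Diff]

definition B :: real where "B = (SOME B. B \<ge> 1 \<and> (\<forall>f. Ck_on k {0..1} f \<and> (\<forall>x\<in>{0..1}. \<bar>f x\<bar> \<le> 1) \<and>
 (\<forall>x\<in>{0..1}. \<forall>y\<in>{0..1}. \<bar>D01 k f x - D01 k f y\<bar> \<le> C) \<longrightarrow> (\<forall>m\<le>k. \<forall>x\<in>{0..1}. \<bar>D01 m f x\<bar> \<le> B)))"

lemma B: "B \<ge> 1" "\<And>j j' \<phi> m x. j \<in> Sg ==> j' \<in> Sg ==> \<phi> \<in> V j j' ==> m \<le> k ==> x \<in> {0..1} ==> \<bar>D01 m \<phi> x\<bar> \<le> B"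
proof -
 have *: "B \<ge> 1 \<and> (\<forall>f. Ck_on k {0..1} f \<and> (\<forall>x\<in>{0..1}. \<bar>f x\<bar> \<le> 1) \<and>
 (\<forall>x\<in>{0..1}. \<forall>y\<in>{0..1}. \<bar>D01 k f x - D01 k f y\<bar> \<le> C) \<longrightarrow> (\<forall>m\<le>k. \<forall>x\<in>{0..1}. \<bar>D01 m f x\<bar> \<le> B))"
  unfolding B_def by (rule someI_ex[OF derivative_bound])
 show "B \<ge> 1" using * by blast
 fix j j' \<phi> m x assume a: "j \<in> Sg" "j' \<in> Sg" "\<phi> \<in> V j j'" "m \<le> k" "x \<in> {0..1::real}"
 have "\<forall>x\<in>{0..1}. \<bar>\<phi> x\<bar> \<le> 1" using V_props(6)[OF a(3)] by fastforce
 then show "\<bar>D01 m \<phi> x\<bar> \<le> B" using * V_props(1)[OF a(3)] V_var(2)[OF a(1-3)] a(4,5) by blast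
qed

lemma V_lip:
 assumes "j \<in> Sg" "j' \<in> Sg" "\<phi> \<in> V j j'" "x \<in> {0..1}" "y \<in> {0..1}" shows "\<bar>\<phi> x - \<phi> y\<bar> \<le> B * \<bar>x - y\<bar>"
proof -
 have "\<bar>D01 0 \<phi> x - D01 0 \<phi> y\<bar> \<le> B * \<bar>x - y\<bar>"
  by (rule D01_lip[OF V_props(1)[OF assms(3)] _ _ assms(4,5)]) (use k1 B(2)[OF assms(1-3)] in auto)
 then show ?thesis by (simp add: nth_deriv.simps)
qed

lemma V_agree:
 assumes "\<phi> \<in> V j j'" "\<psi> \<in> V j j'" "j \<in> Sg" "a \<in> A_set d (S j)" shows "\<phi> a = \<psi> a"
proof (rule strict_mono_on_finite_unique[OF _ _ _ _ assms(4)])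
 note A = A_set_card[OF Ssimp[OF assms(3)] d2]
 show "finite (A_set d (S j))" by (rule A)
 show "strict_mono_on (A_set d (S j)) \<phi>" "strict_mono_on (A_set d (S j)) \<psi>"
  using V_props(2)[OF assms(1)] V_props(2)[OF assms(2)] A(3) by (auto simp: strict_mono_on_def subset_iff)
 show "\<phi> ` A_set d (S j) = \<psi> ` A_set d (S j)" using V_props(3)[OF assms(1)] V_props(3)[OF assms(2)] by simp
qed

text \<open>
 Here \<open>k < 2 * d\<close> enters: the two maps agree on the \<open>2 * d\<close> points of \<open>A(j)\<close>.
\<close>

lemma V_close:
 assumes "\<phi> \<in> V j j'" "\<psi> \<in> V j j'" "j \<in> Sg" "j' \<in> Sg" "m \<le> k" "x \<in> {0..1}"
 shows "\<bar>D01 m \<phi> x - D01 m \<psi> x\<bar> \<le> 2 * (C * rho d S j j' powr r)"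
 by (rule variation_agree[OF V_props(1)[OF assms(1)] V_props(1)[OF assms(2)] _ _ A_set_card(1)[OF Ssimp[OF assms(3)] d2] _ A_set_card(3)[OF Ssimp[OF assms(3)] d2] _ assms(5,6)])
  (use V_var(1)[OF assms(3,4)] assms(1,2) V_agree[OF assms(1-3)] A_set_card(2)[OF Ssimp[OF assms(3)] d2] kd in auto)

text \<open>
 For the particular map supplied by the hypothesis the end points correspond because its renormalization
 fixes 0 and 1. Every other map in the space agrees with it on \<open>A(j)\<close>.
\<close>

lemma V_ends:
 assumes j: "j \<in> Sg" "j' \<in> Sg" and \<phi>: "\<phi> \<in> V j j'" and i: "i \<in> {1..d}"
 shows "\<phi> (le j i) = le j' i" "\<phi> (le j i + S j i) = le j' i + S j' i"
proof -
 obtain \<psi> where \<psi>: "\<psi> \<in> V j j'" "renorm d (S j) (S j') i \<psi> \<in> V (i ## j) (i ## j')" using cond[OF j i] by blast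
 have p: "S j' i > 0" using Spos(1)[OF j(2) idx(1)[OF i]] .
 have "le j i \<in> A_set d (S j)" "le j i + S j i \<in> A_set d (S j)" unfolding A_set_def using i by auto
 then have "\<phi> (le j i) = \<psi> (le j i)" "\<phi> (le j i + S j i) = \<psi> (le j i + S j i)" using V_agree[OF \<phi> \<psi>(1) j(1)] by blast+
 moreover have "\<psi> (le j i) = le j' i" "\<psi> (le j i + S j i) = le j' i + S j' i"
  using V_props(4,5)[OF \<psi>(2)] p by (auto simp: renorm_def field_simps)
 ultimately show "\<phi> (le j i) = le j' i" "\<phi> (le j i + S j i) = le j' i + S j' i" by auto
qed

lemma le_range: "j \<in> Sg ==> i \<in> {1..d} ==> le j i \<in> {0..1}" "j \<in> Sg ==> i \<in> {1..d} ==> le j i + S j i \<in> {0..1}"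
 using left_end_nonneg[OF Ssimp, of j i] left_end_right_le_1[OF Ssimp, of j i] Spos(1)[of j i] idx(1)[of i] by auto

lemma S_comparable:
 assumes j: "j \<in> Sg" "j' \<in> Sg" and i: "i \<in> {1..2*d-1}" shows "S j' i \<le> B * S j i"
proof -
 have "1 \<in> {1..d}" using d2 by simp
 then obtain \<phi> where \<phi>: "\<phi> \<in> V j j'" using cond[OF j] by blast
 show ?thesis
 proof (cases "i \<le> d")
  case True
  then have i: "i \<in> {1..d}" using i by auto
  show ?thesis using V_lip[OF j \<phi> le_range(2,1)[OF j(1) i]] V_ends[OF j \<phi> i] Spos(1)[OF j(1) idx(1)[OF i]] Spos(1)[OF j(2) idx(1)[OF i]] by simp
 next
  case False
  define t where "t = i - d"
  have t: "t \<in> {1..d}" "Suc t \<in> {1..d}" "i = d + t" "t \<ge> 1" using False i unfolding t_def by auto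
  have "le j (Suc t) = le j t + (S j t + S j i)" "le j' (Suc t) = le j' t + (S j' t + S j' i)"
   unfolding t(3) by (rule left_end_Suc[OF t(4)])+
  then show ?thesis
   using V_lip[OF j \<phi> le_range(1)[OF j(1) t(2)] le_range(2)[OF j(1) t(1)]] V_ends[OF j \<phi> t(1)] V_ends[OF j \<phi> t(2)] Spos(1)[OF j(1) i] Spos(1)[OF j(2) i] by simp
 qed
qed

definition w0 :: "nat \<Rightarrow> nat" where "w0 = (\<lambda>_. 1)"
definition wd :: "nat \<Rightarrow> nat" where "wd = (\<lambda>_. d)"

lemma w0: "w0 \<in> Sg" "wd \<in> Sg" unfolding w0_def wd_def using d2 by (auto intro: Sigma_const)

text \<open>
 Scaling ratios of different sequences are comparable, so those of one sequence bound all others from below.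
\<close>

definition c0 :: real where "c0 = Min (S w0 ` {1..2*d-1}) / B"

lemma c0: "0 < c0" "\<And>j i. j \<in> Sg ==> i \<in> {1..2*d-1} ==> c0 \<le> S j i"
proof -
 have f: "finite (S w0 ` {1..2*d-1})" "S w0 ` {1..2*d-1} \<noteq> {}" using d2 by auto
 have B0: "B > 0" using B(1) by simp
 have "0 < Min (S w0 ` {1..2*d-1})" by (subst Min_gr_iff[OF f]) (use Spos(1)[OF w0(1)] in blast)
 then show "0 < c0" unfolding c0_def using B0 by simp
 fix j i assume j: "j \<in> Sg" "i \<in> {1..2*d-1}"
 have "Min (S w0 ` {1..2*d-1}) \<le> S w0 i" by (rule Min_le[OF f(1)]) (use j in blast)
 also have "\<dots> \<le> B * S j i" by (rule S_comparable[OF j(1) w0(1) j(2)])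
 finally show "c0 \<le> S j i" unfolding c0_def using B0 by (simp add: field_simps)
qed

definition lam :: real where "lam = 1 - c0"

lemma S_sum_le: "j \<in> Sg ==> (\<Sum>i=1..d. S j i) \<le> lam"
proof -
 assume j: "j \<in> Sg"
 have "(\<Sum>i\<in>insert (d+1) {1..d}. S j i) \<le> (\<Sum>i=1..2*d-1. S j i)"
  by (rule sum_mono2) (use d2 Spos(1)[OF j] in \<open>auto intro: less_imp_le\<close>)
 also have "\<dots> = 1" using Ssimp[OF j] unfolding Simp_def by blast
 finally have "S j (d+1) + (\<Sum>i=1..d. S j i) \<le> 1" by simp
 moreover have "c0 \<le> S j (d+1)" by (rule c0(2)[OF j]) (use d2 in auto)
 ultimately show ?thesis unfolding lam_def by linarith
qed

lemma S_le_lam: "j \<in> Sg ==> i \<in> {1..d} ==> S j i \<le> lam"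
proof -
 assume j: "j \<in> Sg" and i: "i \<in> {1..d}"
 have "S j i \<le> (\<Sum>i=1..d. S j i)" by (rule member_le_sum[OF i]) (use Spos(1)[OF j idx(1)] in \<open>auto intro: less_imp_le\<close>)
 then show ?thesis using S_sum_le[OF j] by linarith
qed

lemma lam: "0 < lam" "lam < 1" "c0 < 1" "c0 \<le> lam"
proof -
 have i: "1 \<in> {1..d}" using d2 by simp
 show "c0 \<le> lam" using c0(2)[OF w0(1) idx(1)[OF i]] S_le_lam[OF w0(1) i] by linarith
 then show "0 < lam" "lam < 1" "c0 < 1" unfolding lam_def using c0(1) by auto
qed

text \<open>
 With \<open>lo\<close> and \<open>p\<close>: the length and the left end of the interval of level \<open>n\<close> with address \<open>\<alpha>\<close>, and the point
 with address \<open>\<alpha>\<close>, in the Cantor set that belongs to the parameter \<open>w\<close>.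
\<close>

definition len :: "(nat \<Rightarrow> nat) \<Rightarrow> nat \<Rightarrow> (nat \<Rightarrow> nat) \<Rightarrow> real" where "len \<alpha> n w = (\<Prod>t<n. S (push \<alpha> t w) (\<alpha> t))"
definition lo :: "(nat \<Rightarrow> nat) \<Rightarrow> nat \<Rightarrow> (nat \<Rightarrow> nat) \<Rightarrow> real" where "lo \<alpha> n w = (\<Sum>t<n. len \<alpha> t w * le (push \<alpha> t w) (\<alpha> t))"
definition p :: "(nat \<Rightarrow> nat) \<Rightarrow> (nat \<Rightarrow> nat) \<Rightarrow> real" where "p \<alpha> w = (\<Sum>t. len \<alpha> t w * le (push \<alpha> t w) (\<alpha> t))"

lemma len_0 [simp]: "len \<alpha> 0 w = 1" and lo_0 [simp]: "lo \<alpha> 0 w = 0" by (simp_all add: len_def lo_def)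
lemma len_Suc: "len \<alpha> (Suc n) w = len \<alpha> n w * S (push \<alpha> n w) (\<alpha> n)" by (simp add: len_def)
lemma lo_Suc: "lo \<alpha> (Suc n) w = lo \<alpha> n w + len \<alpha> n w * le (push \<alpha> n w) (\<alpha> n)" by (simp add: lo_def)

lemma len_lo_cong: "(\<And>t. t < n ==> \<alpha> t = \<beta> t) ==> len \<alpha> n w = len \<beta> n w \<and> lo \<alpha> n w = lo \<beta> n w"
 by (induction n) (auto simp: len_Suc lo_Suc push_cong[of _ \<alpha> \<beta>])

lemma len_add: "len \<alpha> (m + n) w = len \<alpha> m w * len (suffix m \<alpha>) n (push \<alpha> m w)"
proof (induction n)
 case (Suc n)
 show ?case unfolding add_Suc_right len_Suc push_add Suc by simp
qed simp

lemma len_bounds: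
 assumes "\<alpha> \<in> Sg" "w \<in> Sg" shows "0 < len \<alpha> n w" "len \<alpha> n w \<le> lam ^ n" "c0 ^ n \<le> len \<alpha> n w" "len \<alpha> n w \<le> 1"
proof -
 note P = push_Sigma[OF assms] Sigma_nth[OF assms(1)]
 have s: "0 < S (push \<alpha> t w) (\<alpha> t)" "c0 \<le> S (push \<alpha> t w) (\<alpha> t)" "S (push \<alpha> t w) (\<alpha> t) \<le> lam" for t
  using Spos(1)[OF P(1) idx(1)[OF P(2)]] c0(2)[OF P(1) idx(1)[OF P(2)]] S_le_lam[OF P] by blast+
 show "0 < len \<alpha> n w" unfolding len_def using s(1) by (intro prod_pos) auto
 show "c0 ^ n \<le> len \<alpha> n w" using prod_mono[of "{..<n}" "\<lambda>_. c0" "\<lambda>t. S (push \<alpha> t w) (\<alpha> t)"] s(2) c0(1) unfolding len_def by (simp add: less_imp_le)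
 show l: "len \<alpha> n w \<le> lam ^ n" using prod_mono[of "{..<n}" "\<lambda>t. S (push \<alpha> t w) (\<alpha> t)" "\<lambda>_. lam"] s(1,3) unfolding len_def by (simp add: less_imp_le)
 show "len \<alpha> n w \<le> 1" by (rule order_trans[OF l power_le_one]) (use lam in auto)
qed

lemma len_Suc_le: "\<alpha> \<in> Sg ==> w \<in> Sg ==> len \<alpha> (Suc n) w \<le> lam * len \<alpha> n w"
 unfolding len_Suc using S_le_lam[OF push_Sigma Sigma_nth, of \<alpha> w \<alpha> n n] len_bounds(1)[of \<alpha> w n] by (simp add: mult.commute)

lemma len_0_lim: assumes "\<alpha> \<in> Sg" "w \<in> Sg" shows "(\<lambda>n. len \<alpha> n w) \<longlonglongrightarrow> 0"
 by (rule tendsto_sandwich[of "\<lambda>_. 0" _ _ "\<lambda>n. lam ^ n"])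
  (use len_bounds[OF assms] lam in \<open>auto intro!: LIMSEQ_realpow_zero always_eventually less_imp_le\<close>)

lemma p_sums: assumes "\<alpha> \<in> Sg" "w \<in> Sg" shows "summable (\<lambda>t. len \<alpha> t w * le (push \<alpha> t w) (\<alpha> t))" "(\<lambda>n. lo \<alpha> n w) \<longlonglongrightarrow> p \<alpha> w"
proof -
 note P = push_Sigma[OF assms] Sigma_nth[OF assms(1)]
 show s: "summable (\<lambda>t. len \<alpha> t w * le (push \<alpha> t w) (\<alpha> t))"
 proof (rule summable_comparison_test'[of "\<lambda>n. lam ^ n" 0])
  show "summable (\<lambda>n. lam ^ n)" using lam by (intro summable_geometric) auto
  fix n
  have "len \<alpha> n w * le (push \<alpha> n w) (\<alpha> n) \<le> lam ^ n * 1"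
   by (rule mult_mono) (use len_bounds[OF assms] le_range(1)[OF P] lam in auto)
  then show "norm (len \<alpha> n w * le (push \<alpha> n w) (\<alpha> n)) \<le> lam ^ n"
   using len_bounds(1)[OF assms, of n] le_range(1)[OF P, of n n] by simp
 qed
 show "(\<lambda>n. lo \<alpha> n w) \<longlonglongrightarrow> p \<alpha> w" unfolding lo_def p_def by (rule summable_LIMSEQ[OF s])
qed

lemma lo_len_le: assumes "\<alpha> \<in> Sg" "w \<in> Sg" shows "lo \<alpha> n w + len \<alpha> n w \<le> 1" "0 \<le> lo \<alpha> n w"
proof -
 note P = push_Sigma[OF assms] Sigma_nth[OF assms(1)]
 show "lo \<alpha> n w + len \<alpha> n w \<le> 1"
 proof (induction n)
  case (Suc n)
  have "len \<alpha> n w * (le (push \<alpha> n w) (\<alpha> n) + S (push \<alpha> n w) (\<alpha> n)) \<le> len \<alpha> n w * 1"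
   by (rule mult_left_mono) (use le_range(2)[OF P, of n n] len_bounds(1)[OF assms, of n] in auto)
  then show ?case using Suc by (simp add: lo_Suc len_Suc distrib_left)
 qed simp
 show "0 \<le> lo \<alpha> n w" unfolding lo_def
  by (intro sum_nonneg mult_nonneg_nonneg) (use len_bounds(1)[OF assms] le_range(1)[OF P] in \<open>auto intro: less_imp_le\<close>)
qed

lemma p_range: assumes "\<alpha> \<in> Sg" "w \<in> Sg" shows "p \<alpha> w \<in> {0..1}"
proof -
 have "lo \<alpha> n w \<le> 1" for n using lo_len_le(1)[OF assms, of n] len_bounds(1)[OF assms, of n] by linarith
 then show ?thesis using LIMSEQ_le_const2[OF p_sums(2)[OF assms], of 1] LIMSEQ_le_const[OF p_sums(2)[OF assms], of 0] lo_len_le(2)[OF assms] by auto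
qed

lemma p_split: assumes "\<alpha> \<in> Sg" "w \<in> Sg" shows "p \<alpha> w = lo \<alpha> n w + len \<alpha> n w * p (suffix n \<alpha>) (push \<alpha> n w)"
proof -
 have a: "suffix n \<alpha> \<in> Sg" "push \<alpha> n w \<in> Sg" using assms Sigma_suffix push_Sigma by auto
 have "p \<alpha> w = (\<Sum>t. len \<alpha> (t + n) w * le (push \<alpha> (t + n) w) (\<alpha> (t + n))) + lo \<alpha> n w"
  unfolding p_def lo_def by (rule suminf_split_initial_segment[OF p_sums(1)[OF assms]])
 also have "(\<Sum>t. len \<alpha> (t + n) w * le (push \<alpha> (t + n) w) (\<alpha> (t + n))) =
  (\<Sum>t. len \<alpha> n w * (len (suffix n \<alpha>) t (push \<alpha> n w) * le (push (suffix n \<alpha>) t (push \<alpha> n w)) (suffix n \<alpha> t)))"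
  by (rule arg_cong[of _ _ suminf]) (auto simp: add.commute[of _ n] len_add push_add)
 also have "\<dots> = len \<alpha> n w * p (suffix n \<alpha>) (push \<alpha> n w)"
  unfolding p_def by (rule suminf_mult[OF p_sums(1)[OF a]])
 finally show ?thesis by simp
qed

lemma p_rec: assumes "\<alpha> \<in> Sg" "w \<in> Sg" shows "p \<alpha> w = le w (\<alpha> 0) + S w (\<alpha> 0) * p (suffix 1 \<alpha>) (\<alpha> 0 ## w)"
 using p_split[OF assms, of 1] by (simp add: lo_Suc len_Suc)

lemma p_build: assumes "i \<in> {1..d}" "\<alpha> \<in> Sg" "w \<in> Sg" shows "p (i ## \<alpha>) w = le w i + S w i * p \<alpha> (i ## w)"
proof -
 have s: "suffix 1 (i ## \<alpha>) = \<alpha>" by (rule ext) simp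
 show ?thesis using p_rec[OF Sigma_build[OF assms(1,2)] assms(3)] unfolding s build_0 .
qed

lemma p_ends: assumes "w \<in> Sg" shows "p w0 w = 0" "p wd w = 1"
proof -
 have l: "le j 1 = 0" for j by (rule left_end_1)
 show "p w0 w = 0" unfolding p_def w0_def l by simp
 have "lo wd n w + len wd n w = 1" for n
 proof (induction n)
  case (Suc n)
  have s: "S (push wd n w) \<in> Simp d" by (rule Ssimp[OF push_Sigma[OF w0(2) assms]])
  have "le (push wd n w) d + S (push wd n w) d = 1" by (rule left_end_last[OF s]) (use d2 in simp)
  then have "len wd n w * (le (push wd n w) d + S (push wd n w) d) = len wd n w" by simp
  then show ?case using Suc by (simp add: lo_Suc len_Suc distrib_left) (simp add: wd_def)
 qed simp
 then have "(\<lambda>n. 1) \<longlonglongrightarrow> p wd w + 0" using tendsto_add[OF p_sums(2)[OF w0(2) assms] len_0_lim[OF w0(2) assms]] by simp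
 then show "p wd w = 1" by (simp add: LIMSEQ_const_iff)
qed

text \<open>
 At the first different symbol the points are separated by at least one gap of that level.
\<close>

lemma p_less:
 assumes a: "\<alpha> \<in> Sg" "\<beta> \<in> Sg" "w \<in> Sg" and n: "\<And>t. t < n ==> \<alpha> t = \<beta> t" "\<alpha> n < \<beta> n"
 shows "p \<alpha> w + c0 * len \<alpha> n w \<le> p \<beta> w"
proof -
 define v where "v = push \<alpha> n w"
 have v: "v \<in> Sg" "push \<beta> n w = v"
  unfolding v_def by (rule push_Sigma[OF a(1,3)]) (rule push_cong[of n \<alpha> \<beta> w, OF n(1), symmetric])
 let ?a = "suffix n \<alpha>" and ?b = "suffix n \<beta>"
 have ab: "?a \<in> Sg" "?b \<in> Sg" "suffix 1 ?a \<in> Sg" "suffix 1 ?b \<in> Sg" using a Sigma_suffix by blast+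
 have i: "\<alpha> n \<in> {1..d}" "\<beta> n \<in> {1..d}" using Sigma_nth a by blast+
 have "p ?a v = le v (\<alpha> n) + S v (\<alpha> n) * p (suffix 1 ?a) (\<alpha> n ## v)" using p_rec[OF ab(1) v(1)] by simp
 also have "\<dots> \<le> le v (\<alpha> n) + S v (\<alpha> n) * 1"
  by (intro add_left_mono mult_left_mono) (use p_range[OF ab(3) Sigma_build[OF i(1) v(1)]] Spos(1)[OF v(1) idx(1)[OF i(1)]] in auto)
 finally have 1: "p ?a v \<le> le v (\<alpha> n) + S v (\<alpha> n)" by simp
 have "le v (\<alpha> n) + S v (\<alpha> n) + S v (d + \<alpha> n) \<le> le v (\<beta> n)" using left_end_less[OF Ssimp[OF v(1)], of "\<alpha> n" "\<beta> n"] i n(2) by auto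
 moreover have "c0 \<le> S v (d + \<alpha> n)" by (rule c0(2)[OF v(1) idx(2)]) (use i n(2) in auto)
 moreover have "p ?b v = le v (\<beta> n) + S v (\<beta> n) * p (suffix 1 ?b) (\<beta> n ## v)" using p_rec[OF ab(2) v(1)] by simp
 moreover have "0 \<le> S v (\<beta> n) * p (suffix 1 ?b) (\<beta> n ## v)"
  using p_range[OF ab(4) Sigma_build[OF i(2) v(1)]] Spos(1)[OF v(1) idx(1)[OF i(2)]] by simp
 ultimately have "p ?a v + c0 \<le> p ?b v" using 1 by linarith
 then have "len \<alpha> n w * (p ?a v + c0) \<le> len \<alpha> n w * p ?b v" using len_bounds(1)[OF a(1,3)] by (intro mult_left_mono) (auto intro: less_imp_le)
 then show ?thesis using p_split[OF a(1,3), of n] p_split[OF a(2,3), of n] len_lo_cong[of n \<alpha> \<beta> w, OF n(1)] v(2)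
  unfolding v_def by (simp add: distrib_left mult.commute)
qed

lemma p_lex: assumes "w \<in> Sg" shows "lex_mono d (\<lambda>\<alpha>. p \<alpha> w)"
 unfolding lex_mono_def
proof (intro ballI impI)
 have *: "p \<alpha> w < p \<beta> w" if a: "\<alpha> \<in> Sg" "\<beta> \<in> Sg" "\<alpha> \<noteq> \<beta>" "\<alpha> (common_len \<alpha> \<beta>) < \<beta> (common_len \<alpha> \<beta>)" for \<alpha> \<beta>
  using p_less[OF a(1,2) assms common_len_diff(2)[OF a(3)] a(4)] c0(1) len_bounds(1)[OF a(1) assms, of "common_len \<alpha> \<beta>"]
  by (smt (verit) mult_pos_pos)
 fix \<alpha> \<beta> assume a: "\<alpha> \<in> Sg" "\<beta> \<in> Sg" "\<alpha> \<noteq> \<beta>"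
 have s: "common_len \<beta> \<alpha> = common_len \<alpha> \<beta>" unfolding common_len_def by metis
 show "p \<beta> w < p \<alpha> w \<longleftrightarrow> \<beta> (common_len \<alpha> \<beta>) < \<alpha> (common_len \<alpha> \<beta>)"
  using *[OF a] *[OF a(2,1) a(3)[symmetric]] common_len_diff(1)[OF a(3)] unfolding s by (meson linorder_neqE_nat order.asym)
qed

lemma p_distance:
 assumes a: "\<alpha> \<in> Sg" "\<beta> \<in> Sg" "w \<in> Sg" "\<alpha> \<noteq> \<beta>"
 shows "c0 * len \<alpha> (common_len \<alpha> \<beta>) w \<le> \<bar>p \<beta> w - p \<alpha> w\<bar>"
proof -
 let ?n = "common_len \<alpha> \<beta>"
 have e: "len \<alpha> ?n w = len \<beta> ?n w" using len_lo_cong[of ?n \<alpha> \<beta>] common_len_diff(2)[OF a(4)] by blast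
 show ?thesis
 proof (cases "\<alpha> ?n < \<beta> ?n")
  case True
  then show ?thesis using p_less[OF a(1-3) common_len_diff(2)[OF a(4)] True] by linarith
 next
  case False
  then have "\<beta> ?n < \<alpha> ?n" using common_len_diff(1)[OF a(4)] by simp
  from p_less[OF a(2,1,3) common_len_diff(2)[OF a(4), symmetric] this] show ?thesis unfolding e by linarith
 qed
qed

lemma p_difference:
 assumes a: "\<alpha> \<in> Sg" "\<beta> \<in> Sg" "w \<in> Sg" and n: "\<And>t. t < n ==> \<alpha> t = \<beta> t"
 shows "p \<beta> w - p \<alpha> w = len \<alpha> n w * (p (suffix n \<beta>) (push \<alpha> n w) - p (suffix n \<alpha>) (push \<alpha> n w))"
 using p_split[OF a(1,3), of n] p_split[OF a(2,3), of n] len_lo_cong[of n \<alpha> \<beta> w, OF n] push_cong[of n \<alpha> \<beta> w, OF n] by (simp add: right_diff_distrib)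

text \<open>
 The factors of the product that belong to the common part of \<open>w\<close> and \<open>w'\<close> are at most 1; the others
 form the length of an interval of level \<open>n\<close> for some parameter \<open>x\<close>. Only a uniform bound over the parameters is
 assumed in the second part, since \<open>rho\<close> is a supremum over them.
\<close>

lemma rho_push_le:
 assumes a: "\<alpha> \<in> Sg" "w \<in> Sg" "w' \<in> Sg"
 shows "rho d S (push \<alpha> n w) (push \<alpha> n w') \<le> lam ^ n"
  and "(\<And>x. x \<in> Sg ==> len \<alpha> n x \<le> b) ==> rho d S (push \<alpha> n w) (push \<alpha> n w') \<le> b"
proof -
 have P: "push \<alpha> n w \<in> Sg" "push \<alpha> n w' \<in> Sg" using push_Sigma a by auto
 have *: "rho d S (push \<alpha> n w) (push \<alpha> n w') \<le> b" if b: "\<And>x. x \<in> Sg ==> len \<alpha> n x \<le> b" for b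
 proof (rule rho_le[OF P])
  show "0 \<le> b" using b[OF a(2)] len_bounds(1)[OF a(1,2), of n] by linarith
  fix x assume x: "x \<in> Sg" and ne: "push \<alpha> n w \<noteq> push \<alpha> n w'"
  then have ne': "w \<noteq> w'" by auto
  define q where "q = common_len w w'"
  let ?j = "push \<alpha> n w"
  let ?f = "\<lambda>t. S ((?j [Suc t \<rightarrow> n + q]) \<frown> x) (?j t)"
  have f: "0 < ?f t" "?f t < 1" for t
   using Spos[OF rho_factors[OF P(1) x] idx(1)[OF Sigma_nth[OF P(1)]]] by blast+
  have y: "prefix q w \<frown> x \<in> Sg" by (rule Sigma_conc[OF set_prefix_Sigma[OF a(2)] x])
  \<comment> \<open>the factors with index at least n come from the common part of w and w' and are at most 1\<close>
  have "(\<Prod>t<n + q. ?f t) \<le> (\<Prod>t<n. ?f t)"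
  proof -
   have "(\<Prod>t<n + q. ?f t) = (\<Prod>t<n. ?f t) * (\<Prod>t\<in>{n..<n+q}. ?f t)"
    by (subst prod.union_disjoint[symmetric]) (auto intro!: prod.cong)
   also have "\<dots> \<le> (\<Prod>t<n. ?f t) * 1"
    by (intro mult_left_mono prod_le_1 prod_nonneg) (use f in \<open>auto intro: less_imp_le\<close>)
   finally show ?thesis by simp
  qed
  also have "\<dots> = (\<Prod>t<n. S (push \<alpha> (n - 1 - t) (prefix q w \<frown> x)) (\<alpha> (n - 1 - t)))"
   by (rule prod.cong) (auto simp: push_conc push_nth)
  also have "\<dots> = len \<alpha> n (prefix q w \<frown> x)" unfolding len_def
   using prod.nat_diff_reindex[of "\<lambda>t. S (push \<alpha> t (prefix q w \<frown> x)) (\<alpha> t)" n] by simp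
  also have "\<dots> \<le> b" by (rule b[OF y])
  finally show "(\<Prod>t<common_len ?j (push \<alpha> n w'). S ((?j [Suc t \<rightarrow> common_len ?j (push \<alpha> n w')]) \<frown> x) (?j t)) \<le> b"
   unfolding push_common_len(2)[OF ne'] q_def .
 qed
 show "rho d S (push \<alpha> n w) (push \<alpha> n w') \<le> lam ^ n" by (rule *) (rule len_bounds(2)[OF a(1)])
 show "(\<And>x. x \<in> Sg ==> len \<alpha> n x \<le> b) ==> rho d S (push \<alpha> n w) (push \<alpha> n w') \<le> b" by (rule *)
qed

end

section \<open>Distortion and limiting jets\<close>

lemma geometric_limit:
 fixes a L :: "nat \<Rightarrow> real"
 assumes s: "\<And>n. \<bar>a (Suc n) - a n\<bar> \<le> K * L n" and L: "\<And>n. 0 \<le> L n" "\<And>n. L (Suc n) \<le> q * L n" and q: "0 \<le> q" "q < 1" and K: "0 \<le> K"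
 shows "a \<longlonglongrightarrow> lim a" "\<bar>lim a - a n\<bar> \<le> K / (1 - q) * L n"
proof -
 have Lq: "L (n + j) \<le> q ^ j * L n" for n j
 proof (induction j)
  case (Suc j)
  have "L (n + Suc j) \<le> q * L (n + j)" using L(2)[of "n + j"] by simp
  also have "\<dots> \<le> q * (q ^ j * L n)" using Suc q by (intro mult_left_mono)
  finally show ?case by simp
 qed simp
 have sq: "summable (\<lambda>j. q ^ j)" using q by (intro summable_geometric) simp
 have t: "\<bar>a (Suc (n + j)) - a (n + j)\<bar> \<le> q ^ j * (K * L n)" for n j
  using s[of "n + j"] mult_left_mono[OF Lq[of n j] K] by (simp add: mult.commute mult.left_commute)
 have sm: "summable (\<lambda>j. norm (a (Suc (n + j)) - a (n + j)))" for n
  by (rule summable_comparison_test'[OF summable_mult2[OF sq, of "K * L n"], of 0]) (use t[of n] in simp)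
 have conv: "(\<lambda>j. a (Suc j) - a j) sums (\<Sum>j. a (Suc j) - a j)" using summable_norm_cancel[OF sm[of 0]] by (simp add: summable_sums)
 then have "(\<lambda>n. \<Sum>j<n. a (Suc j) - a j) \<longlonglongrightarrow> (\<Sum>j. a (Suc j) - a j)" unfolding sums_def .
 then have "(\<lambda>n. a n - a 0) \<longlonglongrightarrow> (\<Sum>j. a (Suc j) - a j)" by (simp only: sum_lessThan_telescope)
 then have "(\<lambda>n. (a n - a 0) + a 0) \<longlonglongrightarrow> (\<Sum>j. a (Suc j) - a j) + a 0" by (rule tendsto_add) simp
 then have "convergent a" by (auto simp: convergent_def)
 then show lim: "a \<longlonglongrightarrow> lim a" by (simp add: convergent_LIMSEQ_iff)
 have bd: "\<bar>a (n + j) - a n\<bar> \<le> K / (1 - q) * L n" for j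
 proof -
  have "a (n + j) - a n = (\<Sum>i<j. a (Suc (n + i)) - a (n + i))" using sum_lessThan_telescope[of "\<lambda>i. a (n + i)" j] by simp
  then have "\<bar>a (n + j) - a n\<bar> \<le> (\<Sum>i<j. \<bar>a (Suc (n + i)) - a (n + i)\<bar>)" by simp
  also have "\<dots> \<le> (\<Sum>i<j. q ^ i * (K * L n))" by (intro sum_mono t)
  also have "\<dots> = (\<Sum>i<j. q ^ i) * (K * L n)" by (simp add: sum_distrib_right)
  also have "\<dots> \<le> (\<Sum>i. q ^ i) * (K * L n)"
   by (intro mult_right_mono sum_le_suminf[OF sq]) (use q K L in auto)
  also have "\<dots> = K / (1 - q) * L n" using suminf_geometric[of q] q by simp
  finally show ?thesis .
 qed
 have "(\<lambda>j. \<bar>a (j + n) - a n\<bar>) \<longlonglongrightarrow> \<bar>lim a - a n\<bar>" by (intro tendsto_intros LIMSEQ_ignore_initial_segment lim)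
 then show "\<bar>lim a - a n\<bar> \<le> K / (1 - q) * L n" by (rule LIMSEQ_le_const2) (use bd in \<open>auto simp: add.commute\<close>)
qed

context scaling_data
begin

lemma affine_in: assumes "j \<in> Sg" "i \<in> {1..d}" "x \<in> {0..1}" shows "le j i + S j i * x \<in> {0..1}"
proof -
 have s: "0 < S j i" by (rule Spos(1)[OF assms(1) idx(1)[OF assms(2)]])
 then have "S j i * x \<le> S j i * 1" "0 \<le> S j i * x" using assms(3) by (auto intro!: mult_left_mono simp del: mult_1_right)
 then show ?thesis using le_range[OF assms(1,2)] by auto
qed

lemma renorm_deriv:
 assumes j: "j \<in> Sg" "j' \<in> Sg" and i: "i \<in> {1..d}" and \<psi>: "\<psi> \<in> V j j'" and m: "m \<le> k" and x: "x \<in> {0..1}"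
 shows "D01 m (renorm d (S j) (S j') i \<psi>) x = S j i ^ m / S j' i * D01 m \<psi> (le j i + S j i * x) - (if m = 0 then le j' i / S j' i else 0)"
proof -
 have "D01 m (renorm d (S j) (S j') i \<psi>) x = D01 m (\<lambda>x. (\<psi> (le j i + S j i * x) - le j' i) / S j' i) x"
  by (rule nth_deriv_cong[OF _ x]) (simp add: renorm_def)
 also have "\<dots> = S j i ^ m / S j' i * D01 m \<psi> (le j i + S j i * x) - (if m = 0 then le j' i / S j' i else 0)"
  by (rule nth_deriv_affine_shift[OF V_props(1)[OF \<psi>] m x]) (rule affine_in[OF j(1) i])
 finally show ?thesis .
qed

lemma V_slope_one: assumes \<phi>: "\<phi> \<in> V j j'" obtains y where "y \<in> {0..1}" "D01 1 \<phi> y = 1"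
proof -
 have "\<exists>z\<in>{0<..<1}. \<phi> 1 - \<phi> 0 = (\<lambda>h. D01 1 \<phi> z * h) (1 - 0)"
 proof (rule mvt_simple)
  fix z :: real assume z: "0 \<le> z" "z \<le> 1"
  have "(D01 0 \<phi> has_real_derivative D01 (Suc 0) \<phi> z) (at z within {0..1})"
   by (rule D01_deriv[OF V_props(1)[OF \<phi>]]) (use k1 z in auto)
  then show "(\<phi> has_derivative (\<lambda>h. D01 1 \<phi> z * h)) (at z within {0..1})"
   by (simp only: has_field_derivative_def nth_deriv.simps(1) One_nat_def)
 qed simp
 then obtain z where "z \<in> {0<..<1}" "\<phi> 1 - \<phi> 0 = D01 1 \<phi> z" by auto
 then show thesis using that[of z] V_props(4,5)[OF \<phi>] by auto
qed

definition KD :: real where "KD = B * exp (2 * C / (1 - lam powr r))"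

lemma lam_r: "0 < lam powr r" "lam powr r < 1" "(lam ^ n) powr r = (lam powr r) ^ n"
 using lam r0 powr_less_mono2[of r lam 1] by (auto simp: powr_powr powr_realpow[symmetric] mult.commute)

lemma KD: "KD \<ge> 1"
proof -
 have "1 * 1 \<le> B * exp (2 * C / (1 - lam powr r))" by (rule mult_mono) (use B(1) C lam_r in auto)
 then show ?thesis unfolding KD_def by simp
qed

text \<open>
 For \<open>\<phi>\<close> in the space at depth \<open>n\<close> the quantity \<open>T n * \<phi>'\<close> is unchanged by renormalization, and
 passing to another map in the same space changes \<open>\<phi>'\<close> by \<open>c n\<close>. As every \<open>\<phi>\<close> has slope 1 somewhere, \<open>T n\<close> is
 itself bounded by the product of the factors \<open>1 + c t\<close>.
\<close>

lemma distortion: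
 assumes a: "\<alpha> \<in> Sg" "w \<in> Sg" "w' \<in> Sg"
 shows "len \<alpha> n w' \<le> KD * len \<alpha> n w"
proof -
 define T where "T = (\<lambda>n. len \<alpha> n w' / len \<alpha> n w)"
 define c where "c = (\<lambda>t. 2 * C * (lam powr r) ^ Suc t)"
 define X where "X = (\<lambda>n. B * (\<Prod>t<n. 1 + c t))"
 have c0: "0 \<le> c t" for t unfolding c_def using C lam_r by simp
 have T0: "T n > 0" for n unfolding T_def using len_bounds(1)[OF a(1,2)] len_bounds(1)[OF a(1,3)] by simp
 have main: "\<forall>\<phi>\<in>V (push \<alpha> n w) (push \<alpha> n w'). \<forall>x\<in>{0..1}. T n * D01 1 \<phi> x \<le> X n" for n
 proof (induction n)
  case 0
  show ?case using B(2)[OF a(2,3) _ k1] by (auto simp: T_def X_def abs_le_iff)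
 next
  case (Suc n)
  let ?w = "push \<alpha> n w" and ?w' = "push \<alpha> n w'" and ?i = "\<alpha> n"
  have P: "?w \<in> Sg" "?w' \<in> Sg" "push \<alpha> (Suc n) w \<in> Sg" "push \<alpha> (Suc n) w' \<in> Sg" using push_Sigma a by blast+
  have i: "?i \<in> {1..d}" by (rule Sigma_nth[OF a(1)])
  obtain \<psi> where \<psi>: "\<psi> \<in> V ?w ?w'" and R: "renorm d (S ?w) (S ?w') ?i \<psi> \<in> V (push \<alpha> (Suc n) w) (push \<alpha> (Suc n) w')"
   using cond[OF P(1,2) i] by auto
  let ?R = "renorm d (S ?w) (S ?w') ?i \<psi>"
  have s: "0 < S ?w ?i" "0 < S ?w' ?i" using Spos(1)[OF P(1) idx(1)[OF i]] Spos(1)[OF P(2) idx(1)[OF i]] .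
  have RX: "T (Suc n) * D01 1 ?R z \<le> X n" if z: "z \<in> {0..1}" for z
  proof -
   have "T (Suc n) * D01 1 ?R z = T n * D01 1 \<psi> (le ?w ?i + S ?w ?i * z)"
    unfolding renorm_deriv[OF P(1,2) i \<psi> k1 z] T_def len_Suc using s by simp
   also have "\<dots> \<le> X n" using Suc \<psi> affine_in[OF P(1) i z] by blast
   finally show ?thesis .
  qed
  obtain y where y: "y \<in> {0..1}" "D01 1 ?R y = 1" by (rule V_slope_one[OF R])
  \<comment> \<open>the slope of the renormalized map is 1 at y\<close>
  have TX: "T (Suc n) \<le> X n" using RX[OF y(1)] y(2) by simp
  show ?case
  proof (intro ballI)
   fix \<phi> x assume \<phi>: "\<phi> \<in> V (push \<alpha> (Suc n) w) (push \<alpha> (Suc n) w')" and x: "x \<in> {0..1::real}"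
   have "rho d S (push \<alpha> (Suc n) w) (push \<alpha> (Suc n) w') powr r \<le> (lam ^ Suc n) powr r"
    by (rule powr_mono2) (use r0 rho_range[OF P(3,4)] rho_push_le(1)[OF a, of "Suc n"] in auto)
   then have "2 * (C * rho d S (push \<alpha> (Suc n) w) (push \<alpha> (Suc n) w') powr r) \<le> c n"
    unfolding c_def lam_r(3) using C by (simp add: mult_left_mono)
   then have "D01 1 \<phi> x \<le> D01 1 ?R x + c n" using V_close[OF \<phi> R P(3,4) k1 x] by linarith
   then have "T (Suc n) * D01 1 \<phi> x \<le> T (Suc n) * (D01 1 ?R x + c n)" using T0[of "Suc n"] by (intro mult_left_mono) auto
   also have "\<dots> = T (Suc n) * D01 1 ?R x + T (Suc n) * c n" by (rule distrib_left)
   also have "\<dots> \<le> X n + X n * c n" by (rule add_mono[OF RX[OF x] mult_right_mono[OF TX c0]])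
   also have "\<dots> = X (Suc n)" by (simp add: X_def algebra_simps)
   finally show "T (Suc n) * D01 1 \<phi> x \<le> X (Suc n)" .
  qed
 qed
 have P: "push \<alpha> n w \<in> Sg" "push \<alpha> n w' \<in> Sg" using push_Sigma a by blast+
 have "1 \<in> {1..d}" using d2 by simp
 then obtain \<phi> where \<phi>: "\<phi> \<in> V (push \<alpha> n w) (push \<alpha> n w')" using cond[OF P] by blast
 obtain y where "y \<in> {0..1}" "D01 1 \<phi> y = 1" by (rule V_slope_one[OF \<phi>])
 then have "T n \<le> X n" using main[of n] \<phi> by force
 also have "\<dots> \<le> KD"
 proof -
  let ?q = "lam powr r"
  have "(\<Prod>t<n. 1 + c t) \<le> (\<Prod>t<n. exp (c t))" using c0 by (intro prod_mono) (auto intro: add_nonneg_nonneg)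
  also have "\<dots> = exp (\<Sum>t<n. c t)" by (simp add: exp_sum)
  also have "(\<Sum>t<n. c t) = 2 * C * (\<Sum>t<n. ?q ^ Suc t)" unfolding c_def by (simp add: sum_distrib_left)
  also have "(\<Sum>t<n. ?q ^ Suc t) \<le> (\<Sum>t<n. ?q ^ t)" using lam_r by (intro sum_mono) (auto simp: mult_le_cancel_right1)
  also have "\<dots> \<le> (\<Sum>t. ?q ^ t)" by (rule sum_le_suminf) (use lam_r in \<open>auto intro!: summable_geometric\<close>)
  also have "\<dots> = 1 / (1 - ?q)" by (rule suminf_geometric) (use lam_r in auto)
  finally have "(\<Prod>t<n. 1 + c t) \<le> exp (2 * C * (1 / (1 - ?q)))" using C by (simp add: mult_left_mono)
  then show ?thesis unfolding X_def KD_def using B(1) by (intro mult_left_mono) auto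
 qed
 finally show ?thesis unfolding T_def using len_bounds(1)[OF a(1,2), of n] by (simp add: divide_le_eq)
qed

lemma rho_len: assumes a: "\<alpha> \<in> Sg" "w \<in> Sg" "w' \<in> Sg"
 shows "rho d S (push \<alpha> n w) (push \<alpha> n w') \<le> KD * len \<alpha> n w"
 by (rule rho_push_le(2)[OF a]) (rule distortion[OF a(1,2)])

text \<open>
 The power counting for derivatives of order \<open>m\<close>: one power of the length from the scale of the values, \<open>-m\<close>
 from the scale of the argument and \<open>k + e - 1\<close> from the variation.
\<close>

lemma scaled_bound:
 assumes a: "\<alpha> \<in> Sg" "w \<in> Sg" "w' \<in> Sg" and c: "0 \<le> c"
 shows "len \<alpha> n w' / len \<alpha> n w ^ m * (c * rho d S (push \<alpha> n w) (push \<alpha> n w') powr r)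
  \<le> c * KD powr (real k + e) * len \<alpha> n w powr (real k + e - real m)"
proof -
 let ?l = "len \<alpha> n w"
 have l: "0 < ?l" using len_bounds(1)[OF a(1,2)] .
 have P: "push \<alpha> n w \<in> Sg" "push \<alpha> n w' \<in> Sg" using push_Sigma a by blast+
 have "rho d S (push \<alpha> n w) (push \<alpha> n w') powr r \<le> (KD * ?l) powr r"
  by (rule powr_mono2) (use r0 rho_range[OF P] rho_len[OF a] in auto)
 then have "len \<alpha> n w' / ?l ^ m * (c * rho d S (push \<alpha> n w) (push \<alpha> n w') powr r) \<le> (KD * ?l) / ?l ^ m * (c * (KD * ?l) powr r)"
  using distortion[OF a, of n] l c KD len_bounds(1)[OF a(1,3), of n] by (intro mult_mono divide_right_mono mult_left_mono) auto
 also have "\<dots> = c * ((KD * ?l) * (KD * ?l) powr r) / ?l ^ m" by simp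
 also have "(KD * ?l) * (KD * ?l) powr r = (KD * ?l) powr (real k + e)"
  using l KD powr_add[of "KD * ?l" 1 r] by simp
 also have "\<dots> = KD powr (real k + e) * ?l powr (real k + e)" using l KD by (intro powr_mult)
 also have "c * (KD powr (real k + e) * ?l powr (real k + e)) / ?l ^ m = c * KD powr (real k + e) * (?l powr (real k + e) / ?l powr real m)"
  using l by (simp add: powr_realpow)
 also have "?l powr (real k + e) / ?l powr real m = ?l powr (real k + e - real m)" by (simp add: powr_diff)
 finally show ?thesis .
qed

definition phi where "phi w w' \<alpha> n = (SOME \<phi>. \<phi> \<in> V (push \<alpha> n w) (push \<alpha> n w'))"

lemma phi: assumes a: "\<alpha> \<in> Sg" "w \<in> Sg" "w' \<in> Sg" shows "phi w w' \<alpha> n \<in> V (push \<alpha> n w) (push \<alpha> n w')"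
proof -
 have P: "push \<alpha> n w \<in> Sg" "push \<alpha> n w' \<in> Sg" using push_Sigma a by blast+
 have "1 \<in> {1..d}" using d2 by simp
 then obtain \<phi> where "\<phi> \<in> V (push \<alpha> n w) (push \<alpha> n w')" using cond[OF P] by blast
 then show ?thesis unfolding phi_def by (rule someI[of "\<lambda>\<phi>. \<phi> \<in> V (push \<alpha> n w) (push \<alpha> n w')"])
qed

text \<open>
 The \<open>m\<close>-th derivative at \<open>p \<alpha> w\<close> of \<open>\<phi>\<close>, transported by the affine maps to the intervals of level \<open>n\<close>
 for the parameters \<open>w\<close> and \<open>w'\<close>.
\<close>

definition jt where "jt m w w' \<alpha> n \<phi> = (if m = 0 then lo \<alpha> n w' else 0) +
 len \<alpha> n w' / len \<alpha> n w ^ m * D01 m \<phi> (p (suffix n \<alpha>) (push \<alpha> n w))"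

text \<open>
 The limiting jet at \<open>p \<alpha> w\<close> of the map \<open>p \<alpha> w \<mapsto> p \<alpha> w'\<close>.
\<close>

definition F where "F m w w' \<alpha> = lim (\<lambda>n. jt m w w' \<alpha> n (phi w w' \<alpha> n))"

lemma jt_renorm:
 assumes a: "\<alpha> \<in> Sg" "w \<in> Sg" "w' \<in> Sg" and m: "m \<le> k" and \<psi>: "\<psi> \<in> V (push \<alpha> n w) (push \<alpha> n w')"
 shows "jt m w w' \<alpha> (Suc n) (renorm d (S (push \<alpha> n w)) (S (push \<alpha> n w')) (\<alpha> n) \<psi>) = jt m w w' \<alpha> n \<psi>"
proof -
 let ?w = "push \<alpha> n w" and ?w' = "push \<alpha> n w'" and ?i = "\<alpha> n" and ?q = "p (suffix (Suc n) \<alpha>) (push \<alpha> (Suc n) w)"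
 have P: "?w \<in> Sg" "?w' \<in> Sg" "push \<alpha> (Suc n) w \<in> Sg" using push_Sigma a by blast+
 have i: "?i \<in> {1..d}" by (rule Sigma_nth[OF a(1)])
 have s: "0 < S ?w ?i" "0 < S ?w' ?i" using Spos(1)[OF P(1) idx(1)[OF i]] Spos(1)[OF P(2) idx(1)[OF i]] .
 have q: "?q \<in> {0..1}" by (rule p_range[OF Sigma_suffix[OF a(1)] P(3)])
 have q': "p (suffix n \<alpha>) ?w = le ?w ?i + S ?w ?i * ?q" using p_rec[OF Sigma_suffix[OF a(1)] P(1), of n] by simp
 have l: "len \<alpha> n w \<noteq> 0" "len \<alpha> n w' \<noteq> 0" using len_bounds(1)[OF a(1,2), of n] len_bounds(1)[OF a(1,3), of n] by auto
 show ?thesis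
  unfolding jt_def renorm_deriv[OF P(1,2) i \<psi> m q] q' lo_Suc len_Suc using s l by (simp add: field_simps power_mult_distrib)
qed

lemma jt_close:
 assumes a: "\<alpha> \<in> Sg" "w \<in> Sg" "w' \<in> Sg" and m: "m \<le> k" and \<phi>: "\<phi> \<in> V (push \<alpha> n w) (push \<alpha> n w')" "\<psi> \<in> V (push \<alpha> n w) (push \<alpha> n w')"
 shows "\<bar>jt m w w' \<alpha> n \<phi> - jt m w w' \<alpha> n \<psi>\<bar> \<le> 2 * C * KD powr (real k + e) * len \<alpha> n w powr (real k + e - real m)"
proof -
 have P: "push \<alpha> n w \<in> Sg" "push \<alpha> n w' \<in> Sg" using push_Sigma a by blast+
 let ?q = "p (suffix n \<alpha>) (push \<alpha> n w)"
 have q: "?q \<in> {0..1}" by (rule p_range[OF Sigma_suffix[OF a(1)] P(1)])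
 have l: "0 < len \<alpha> n w' / len \<alpha> n w ^ m" using len_bounds(1)[OF a(1,2)] len_bounds(1)[OF a(1,3)] by simp
 have "\<bar>jt m w w' \<alpha> n \<phi> - jt m w w' \<alpha> n \<psi>\<bar> = \<bar>len \<alpha> n w' / len \<alpha> n w ^ m * (D01 m \<phi> ?q - D01 m \<psi> ?q)\<bar>"
  unfolding jt_def by (simp add: right_diff_distrib diff_divide_distrib)
 also have "\<dots> = len \<alpha> n w' / len \<alpha> n w ^ m * \<bar>D01 m \<phi> ?q - D01 m \<psi> ?q\<bar>" unfolding abs_mult by (simp only: abs_of_pos[OF l])
 also have "\<dots> \<le> len \<alpha> n w' / len \<alpha> n w ^ m * (2 * C * rho d S (push \<alpha> n w) (push \<alpha> n w') powr r)"
  by (rule mult_left_mono) (use V_close[OF \<phi> P m q] l in auto)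
 also have "\<dots> \<le> 2 * C * KD powr (real k + e) * len \<alpha> n w powr (real k + e - real m)" by (rule scaled_bound[OF a]) (use C in simp)
 finally show ?thesis .
qed

definition K2 where "K2 = 4 * C * KD powr (real k + e) / (1 - lam powr e)"

lemma lam_e: "0 < lam powr e" "lam powr e < 1" "(lam ^ n) powr e = (lam powr e) ^ n"
 using lam e0 powr_less_mono2[of e lam 1] by (auto simp: powr_powr powr_realpow[symmetric] mult.commute)

lemma K2: "K2 \<ge> 0" unfolding K2_def using C lam_e by simp

text \<open>
 Consecutive terms are compared through the pair of maps supplied by the hypothesis, for which the values of
 \<open>jt\<close> coincide.
\<close>

lemma jet_limit:
 assumes a: "\<alpha> \<in> Sg" "w \<in> Sg" "w' \<in> Sg" and m: "m \<le> k"
 shows "(\<lambda>n. jt m w w' \<alpha> n (phi w w' \<alpha> n)) \<longlonglongrightarrow> F m w w' \<alpha>"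
  "\<bar>F m w w' \<alpha> - jt m w w' \<alpha> n (phi w w' \<alpha> n)\<bar> \<le> K2 * len \<alpha> n w powr (real k + e - real m)"
proof -
 let ?L = "\<lambda>n. len \<alpha> n w powr (real k + e - real m)"
 have ex: "e \<le> real k + e - real m" "0 \<le> real k + e - real m" using m e0 by auto
 have L: "?L (Suc n) \<le> lam powr e * ?L n" for n
 proof -
  have l: "0 < len \<alpha> n w" "0 < len \<alpha> (Suc n) w" using len_bounds(1)[OF a(1,2)] by auto
  have "?L (Suc n) \<le> (lam * len \<alpha> n w) powr (real k + e - real m)"
   using len_Suc_le[OF a(1,2)] l(2) ex by (intro powr_mono2) auto
  also have "\<dots> = lam powr (real k + e - real m) * ?L n" using lam l by (intro powr_mult)
  also have "\<dots> \<le> lam powr e * ?L n" using ex lam by (intro mult_right_mono powr_mono') auto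
  finally show ?thesis .
 qed
 have st: "\<bar>jt m w w' \<alpha> (Suc n) (phi w w' \<alpha> (Suc n)) - jt m w w' \<alpha> n (phi w w' \<alpha> n)\<bar> \<le> 4 * C * KD powr (real k + e) * ?L n" for n
 proof -
  let ?w = "push \<alpha> n w" and ?w' = "push \<alpha> n w'"
  have P: "?w \<in> Sg" "?w' \<in> Sg" using push_Sigma a by blast+
  obtain \<psi> where \<psi>: "\<psi> \<in> V ?w ?w'" and R: "renorm d (S ?w) (S ?w') (\<alpha> n) \<psi> \<in> V (push \<alpha> (Suc n) w) (push \<alpha> (Suc n) w')"
   using cond[OF P Sigma_nth[OF a(1)], of n] by auto
  have "?L (Suc n) \<le> 1 * ?L n" using L[of n] lam_e mult_right_mono[of "lam powr e" 1 "?L n"] by simp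
  then have "2 * C * KD powr (real k + e) * ?L (Suc n) \<le> 2 * C * KD powr (real k + e) * ?L n" using C by (intro mult_left_mono) auto
  then show ?thesis
   using jt_close[OF a m phi[OF a] R] jt_close[OF a m phi[OF a] \<psi>] jt_renorm[OF a m \<psi>] by linarith
 qed
 show "(\<lambda>n. jt m w w' \<alpha> n (phi w w' \<alpha> n)) \<longlonglongrightarrow> F m w w' \<alpha>"
  unfolding F_def by (rule geometric_limit(1)[where a = "\<lambda>n. jt m w w' \<alpha> n (phi w w' \<alpha> n)" and L = ?L and q = "lam powr e" and K = "4 * C * KD powr (real k + e)", OF st _ L]) (use lam_e C in auto)
 show "\<bar>F m w w' \<alpha> - jt m w w' \<alpha> n (phi w w' \<alpha> n)\<bar> \<le> K2 * ?L n"
  unfolding F_def K2_def by (rule geometric_limit(2)[where a = "\<lambda>n. jt m w w' \<alpha> n (phi w w' \<alpha> n)" and L = ?L and q = "lam powr e" and K = "4 * C * KD powr (real k + e)", OF st _ L]) (use lam_e C in auto)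
qed

lemma F_0: assumes a: "\<alpha> \<in> Sg" "w \<in> Sg" "w' \<in> Sg" shows "F 0 w w' \<alpha> = p \<alpha> w'"
proof (rule LIMSEQ_unique[OF jet_limit(1)[OF a]])
 have P: "push \<alpha> n w \<in> Sg" "push \<alpha> n w' \<in> Sg" for n using push_Sigma a by blast+
 have "(\<lambda>n. len \<alpha> n w' * phi w w' \<alpha> n (p (suffix n \<alpha>) (push \<alpha> n w))) \<longlonglongrightarrow> 0"
 proof (rule tendsto_sandwich[OF _ _ tendsto_const len_0_lim[OF a(1,3)]])
  have *: "phi w w' \<alpha> n (p (suffix n \<alpha>) (push \<alpha> n w)) \<in> {0..1}" for n
   by (rule V_props(6)[OF phi[OF a] p_range[OF Sigma_suffix[OF a(1)] P(1)]])
  have "0 \<le> len \<alpha> n w' * phi w w' \<alpha> n (p (suffix n \<alpha>) (push \<alpha> n w))"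
   "len \<alpha> n w' * phi w w' \<alpha> n (p (suffix n \<alpha>) (push \<alpha> n w)) \<le> len \<alpha> n w' * 1" for n
   using *[of n] len_bounds(1)[OF a(1,3), of n] by (auto intro!: mult_left_mono simp del: mult_1_right)
  then show "\<forall>\<^sub>F n in sequentially. 0 \<le> len \<alpha> n w' * phi w w' \<alpha> n (p (suffix n \<alpha>) (push \<alpha> n w))"
   "\<forall>\<^sub>F n in sequentially. len \<alpha> n w' * phi w w' \<alpha> n (p (suffix n \<alpha>) (push \<alpha> n w)) \<le> len \<alpha> n w'"
   by (auto intro!: always_eventually)
 qed
 from tendsto_add[OF p_sums(2)[OF a(1,3)] this]
 show "(\<lambda>n. jt 0 w w' \<alpha> n (phi w w' \<alpha> n)) \<longlonglongrightarrow> p \<alpha> w'" by (simp add: jt_def nth_deriv.simps)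
qed simp

lemma F_bound: assumes a: "\<alpha> \<in> Sg" "w \<in> Sg" "w' \<in> Sg" and m: "m \<le> k" shows "\<bar>F m w w' \<alpha>\<bar> \<le> B + K2"
proof -
 have "\<bar>jt m w w' \<alpha> 0 (phi w w' \<alpha> 0)\<bar> \<le> B"
  using B(2)[OF a(2,3) phi[OF a, of 0, simplified] m p_range[OF a(1,2)]] by (cases "m = 0") (simp_all add: jt_def)
 then show ?thesis using jet_limit(2)[OF a m, of 0] by simp
qed

definition K5 where "K5 = (C * KD powr (real k + e) + K2 + real (Suc k) * K2) * (1 / c0) powr (real k + e)"

lemma K5: "K5 \<ge> 0" unfolding K5_def using C K2 by simp

text \<open>
 Both points are viewed at the level \<open>n\<close> of their first different symbol, where the same map \<open>\<phi>\<close> serves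
 both. There the claim is Taylor's formula for \<open>\<phi>\<close>, and replacing \<open>F\<close> by its \<open>n\<close>-th approximation costs
 an error of the same order, because the length of the interval is comparable to the distance.
\<close>

lemma F_whitney:
 assumes a: "\<alpha> \<in> Sg" "\<beta> \<in> Sg" "w \<in> Sg" "w' \<in> Sg" and m: "m \<le> k"
 shows "\<bar>F m w w' \<beta> - (\<Sum>l\<le>k-m. F (m + l) w w' \<alpha> * (p \<beta> w - p \<alpha> w) ^ l / fact l)\<bar> \<le> K5 * \<bar>p \<beta> w - p \<alpha> w\<bar> powr (real k + e - real m)"
proof (cases "\<alpha> = \<beta>")
 case True
 have "(\<Sum>l\<le>k-m. F (m + l) w w' \<beta> * (0::real) ^ l / fact l) = (\<Sum>l\<le>k-m. if l = 0 then F m w w' \<beta> else 0)"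
  by (rule sum.cong) auto
 then show ?thesis using True by simp
next
 case False
 define n where "n = common_len \<alpha> \<beta>"
 define \<phi> where "\<phi> = phi w w' \<alpha> n"
 define x where "x = p (suffix n \<alpha>) (push \<alpha> n w)"
 define y where "y = p (suffix n \<beta>) (push \<alpha> n w)"
 let ?l = "len \<alpha> n w" and ?l' = "len \<alpha> n w'" and ?D = "p \<beta> w - p \<alpha> w"
 let ?E = "\<lambda>m. real k + e - real m"
 have ag: "\<And>t. t < n ==> \<alpha> t = \<beta> t" unfolding n_def by (rule common_len_diff(2)[OF False])
 have pc: "push \<beta> n v = push \<alpha> n v" "len \<beta> n v = len \<alpha> n v" "lo \<beta> n v = lo \<alpha> n v" for v
  using push_cong[of n \<alpha> \<beta> v, OF ag] len_lo_cong[of n \<alpha> \<beta> v, OF ag] by auto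
 have P: "push \<alpha> n w \<in> Sg" "push \<alpha> n w' \<in> Sg" using push_Sigma a by blast+
 have \<phi>V: "\<phi> \<in> V (push \<alpha> n w) (push \<alpha> n w')" unfolding \<phi>_def by (rule phi[OF a(1,3,4)])
 have \<phi>\<beta>: "phi w w' \<beta> n = \<phi>" unfolding \<phi>_def phi_def pc ..
 have xy: "x \<in> {0..1}" "y \<in> {0..1}" unfolding x_def y_def using p_range[OF Sigma_suffix P(1)] a by blast+
 have l: "0 < ?l" "0 < ?l'" "?l \<le> 1" using len_bounds[OF a(1,3)] len_bounds[OF a(1,4)] by blast+
 have D: "?D = ?l * (y - x)" unfolding x_def y_def by (rule p_difference[OF a(1-3) ag])
 have absD: "\<bar>?D\<bar> \<le> ?l" unfolding D abs_mult using xy l by (auto simp: mult_le_cancel_left1)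
 let ?J = "\<lambda>m \<gamma>. jt m w w' \<gamma> n (phi w w' \<gamma> n)"
 have main: "?J m \<beta> - (\<Sum>l\<le>k-m. ?J (m + l) \<alpha> * ?D ^ l / fact l) = ?l' / ?l ^ m * (D01 m \<phi> y - jet_taylor k (\<lambda>i. D01 i \<phi>) m x y)"
 proof -
  have b: "?J m \<beta> = (if m = 0 then lo \<alpha> n w' else 0) + ?l' / ?l ^ m * D01 m \<phi> y" unfolding jt_def \<phi>\<beta> pc y_def ..
  have "(\<Sum>l\<le>k-m. ?J (m + l) \<alpha> * ?D ^ l / fact l) =
   (\<Sum>l\<le>k-m. (if l = 0 then (if m = 0 then lo \<alpha> n w' else 0) else 0) + ?l' / ?l ^ m * (D01 (m + l) \<phi> x * (y - x) ^ l / fact l))"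
  proof (rule sum.cong[OF refl])
   fix i
   have "?J (m + i) \<alpha> * ?D ^ i / fact i = (if m + i = 0 then lo \<alpha> n w' else 0) * ?D ^ i / fact i +
    ?l' / ?l ^ (m + i) * D01 (m + i) \<phi> x * (?l ^ i * (y - x) ^ i) / fact i"
    unfolding jt_def \<phi>_def[symmetric] x_def[symmetric] D power_mult_distrib by (simp add: distrib_right add_divide_distrib)
   also have "(if m + i = 0 then lo \<alpha> n w' else 0) * ?D ^ i / fact i = (if i = 0 then (if m = 0 then lo \<alpha> n w' else 0) else 0)" by simp
   also have "?l' / ?l ^ (m + i) * D01 (m + i) \<phi> x * (?l ^ i * (y - x) ^ i) / fact i = ?l' / ?l ^ m * (D01 (m + i) \<phi> x * (y - x) ^ i / fact i)"
    using l by (simp add: power_add)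
   finally show "?J (m + i) \<alpha> * ?D ^ i / fact i = (if i = 0 then (if m = 0 then lo \<alpha> n w' else 0) else 0) + ?l' / ?l ^ m * (D01 (m + i) \<phi> x * (y - x) ^ i / fact i)" .
  qed
  also have "\<dots> = (if m = 0 then lo \<alpha> n w' else 0) + ?l' / ?l ^ m * jet_taylor k (\<lambda>i. D01 i \<phi>) m x y"
   unfolding jet_taylor_def sum.distrib sum_distrib_left by simp
  finally show ?thesis unfolding b by (simp add: right_diff_distrib diff_divide_distrib)
 qed
 have t1: "\<bar>?J m \<beta> - (\<Sum>l\<le>k-m. ?J (m + l) \<alpha> * ?D ^ l / fact l)\<bar> \<le> C * KD powr (real k + e) * ?l powr ?E m"
 proof -
  have "\<bar>D01 m \<phi> y - jet_taylor k (\<lambda>i. D01 i \<phi>) m x y\<bar> \<le> C * rho d S (push \<alpha> n w) (push \<alpha> n w') powr r"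
   by (rule taylor_variation[OF V_props(1)[OF \<phi>V] V_var(1)[OF P \<phi>V] m xy])
  then have "?l' / ?l ^ m * \<bar>D01 m \<phi> y - jet_taylor k (\<lambda>i. D01 i \<phi>) m x y\<bar> \<le> ?l' / ?l ^ m * (C * rho d S (push \<alpha> n w) (push \<alpha> n w') powr r)"
   using l by (intro mult_left_mono) auto
  also have "\<dots> \<le> C * KD powr (real k + e) * ?l powr ?E m" by (rule scaled_bound[OF a(1,3,4) C])
  finally show ?thesis unfolding main abs_mult using l by simp
 qed
 have t2: "\<bar>F m w w' \<beta> - ?J m \<beta>\<bar> \<le> K2 * ?l powr ?E m" using jet_limit(2)[OF a(2,3,4) m, of n] unfolding pc .
 have t3: "\<bar>(\<Sum>l\<le>k-m. ?J (m + l) \<alpha> * ?D ^ l / fact l) - (\<Sum>l\<le>k-m. F (m + l) w w' \<alpha> * ?D ^ l / fact l)\<bar> \<le> real (Suc k) * K2 * ?l powr ?E m"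
 proof -
  have "\<bar>?J (m + i) \<alpha> * ?D ^ i / fact i - F (m + i) w w' \<alpha> * ?D ^ i / fact i\<bar> \<le> K2 * ?l powr ?E m" if i: "i \<le> k - m" for i
  proof -
   have "?J (m + i) \<alpha> * ?D ^ i / fact i - F (m + i) w w' \<alpha> * ?D ^ i / fact i = (?J (m + i) \<alpha> - F (m + i) w w' \<alpha>) * (?D ^ i / fact i)"
    by (simp add: left_diff_distrib diff_divide_distrib)
   then have "\<bar>?J (m + i) \<alpha> * ?D ^ i / fact i - F (m + i) w w' \<alpha> * ?D ^ i / fact i\<bar> = \<bar>?J (m + i) \<alpha> - F (m + i) w w' \<alpha>\<bar> * (\<bar>?D\<bar> ^ i / fact i)"
    by (simp add: abs_mult power_abs)
   also have "\<dots> \<le> (K2 * ?l powr ?E (m + i)) * (?l ^ i / 1)"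
   proof (rule mult_mono)
    show "\<bar>?J (m + i) \<alpha> - F (m + i) w w' \<alpha>\<bar> \<le> K2 * ?l powr ?E (m + i)"
     using jet_limit(2)[OF a(1,3,4), of "m + i" n] i m by (simp add: abs_minus_commute)
    show "\<bar>?D\<bar> ^ i / fact i \<le> ?l ^ i / 1" by (rule frac_le) (use l absD in \<open>auto intro!: power_mono fact_ge_1\<close>)
   qed (use K2 in auto)
   also have "\<dots> = K2 * (?l powr ?E (m + i) * ?l powr real i)" using l by (simp add: powr_realpow)
   also have "?l powr ?E (m + i) * ?l powr real i = ?l powr ?E m" unfolding powr_add[symmetric] by (rule arg_cong[of _ _ "\<lambda>z. ?l powr z"]) simp
   finally show ?thesis .
  qed
  then have "\<bar>\<Sum>i\<le>k-m. ?J (m + i) \<alpha> * ?D ^ i / fact i - F (m + i) w w' \<alpha> * ?D ^ i / fact i\<bar> \<le> real (card {..k-m}) * (K2 * ?l powr ?E m)"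
   by (intro abs_sum_le_card) auto
  also have "\<dots> \<le> real (Suc k) * (K2 * ?l powr ?E m)" using K2 by (intro mult_right_mono) auto
  finally show ?thesis by (simp add: sum_subtractf)
 qed
 have "\<bar>F m w w' \<beta> - (\<Sum>l\<le>k-m. F (m + l) w w' \<alpha> * ?D ^ l / fact l)\<bar> \<le> (C * KD powr (real k + e) + K2 + real (Suc k) * K2) * ?l powr ?E m"
  using t1 t2 t3 unfolding distrib_right by linarith
 also have "\<dots> \<le> (C * KD powr (real k + e) + K2 + real (Suc k) * K2) * ((1 / c0) powr (real k + e) * \<bar>?D\<bar> powr ?E m)"
 proof (rule mult_left_mono)
  have "?l \<le> 1 / c0 * \<bar>?D\<bar>" using p_distance[OF a(1-3) False] c0(1) unfolding n_def[symmetric] by (simp add: field_simps)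
  then have "?l powr ?E m \<le> (1 / c0 * \<bar>?D\<bar>) powr ?E m" using l m e0 by (intro powr_mono2) auto
  also have "\<dots> = (1 / c0) powr ?E m * \<bar>?D\<bar> powr ?E m" using c0(1) by (intro powr_mult)
  also have "\<dots> \<le> (1 / c0) powr (real k + e) * \<bar>?D\<bar> powr ?E m" using c0(1) lam(3) by (intro mult_right_mono powr_mono) auto
  finally show "?l powr ?E m \<le> (1 / c0) powr (real k + e) * \<bar>?D\<bar> powr ?E m" .
 qed (use C K2 in simp)
 finally show ?thesis unfolding K5_def by (simp add: mult.assoc)
qed

end

section \<open>Averaging over the dual Cantor set\<close>

context scaling_data
begin

definition K4 where "K4 = KD / c0"
lemma K4: "K4 > 0" unfolding K4_def using KD c0(1) by simp

text \<open>
 Both distances are comparable to the lengths of intervals with the same address, for \<open>w\<close> and for \<open>w'\<close>.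
\<close>

lemma p_comparable:
 assumes a: "\<alpha> \<in> Sg" "\<beta> \<in> Sg" "w \<in> Sg" "w' \<in> Sg"
 shows "\<bar>p \<beta> w' - p \<alpha> w'\<bar> \<le> K4 * \<bar>p \<beta> w - p \<alpha> w\<bar>"
proof (cases "\<alpha> = \<beta>")
 case False
 define n where "n = common_len \<alpha> \<beta>"
 have P: "push \<alpha> n w' \<in> Sg" using push_Sigma a by blast
 have l: "0 < len \<alpha> n w'" using len_bounds(1)[OF a(1,4)] .
 have "\<bar>p (suffix n \<beta>) (push \<alpha> n w') - p (suffix n \<alpha>) (push \<alpha> n w')\<bar> \<le> 1"
  using p_range[OF Sigma_suffix[OF a(1)] P, of n] p_range[OF Sigma_suffix[OF a(2)] P, of n] by auto
 moreover have "p \<beta> w' - p \<alpha> w' = len \<alpha> n w' * (p (suffix n \<beta>) (push \<alpha> n w') - p (suffix n \<alpha>) (push \<alpha> n w'))"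
  by (rule p_difference[OF a(1,2,4)]) (rule common_len_diff(2)[OF False, folded n_def])
 ultimately have "\<bar>p \<beta> w' - p \<alpha> w'\<bar> \<le> len \<alpha> n w'" using l by (simp add: abs_mult mult_le_cancel_left1)
 also have "\<dots> \<le> KD * len \<alpha> n w" by (rule distortion[OF a(1,3,4)])
 also have "\<dots> \<le> KD * (\<bar>p \<beta> w - p \<alpha> w\<bar> / c0)"
  by (rule mult_left_mono) (use p_distance[OF a(1-3) False] c0(1) KD in \<open>auto simp: n_def field_simps\<close>)
 finally show ?thesis unfolding K4_def by simp
qed simp

lemma append_seq:
 assumes a: "\<alpha> \<in> Sg" "\<gamma> \<in> Sg" "w \<in> Sg"
 shows "prefix n \<alpha> \<frown> \<gamma> \<in> Sg" "p (prefix n \<alpha> \<frown> \<gamma>) w = lo \<alpha> n w + len \<alpha> n w * p \<gamma> (push \<alpha> n w)"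
proof -
 let ?b = "prefix n \<alpha> \<frown> \<gamma>"
 show S: "?b \<in> Sg" by (rule Sigma_conc[OF set_prefix_Sigma[OF a(1)] a(2)])
 have ag: "?b t = \<alpha> t" if "t < n" for t using that by (simp add: conc_def)
 have suf: "suffix n ?b = \<gamma>" by (rule ext) (simp add: conc_def)
 show "p ?b w = lo \<alpha> n w + len \<alpha> n w * p \<gamma> (push \<alpha> n w)"
  using p_split[OF S a(3), of n] push_cong[of n ?b \<alpha> w, OF ag] len_lo_cong[of n ?b \<alpha> w, OF ag] unfolding suf by simp
qed

definition K7 where "K7 = K5 + real (Suc k) * (B + K2)"
lemma K7: "K7 \<ge> 0" unfolding K7_def using K5 K2 B(1) by simp

text \<open>
 The expansion of \<open>F_whitney\<close> at the left end of an interval of level \<open>n\<close>, with all terms beyond the linear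
 one put into the error.
\<close>

lemma affine_approximation:
 assumes a: "\<alpha> \<in> Sg" "\<gamma> \<in> Sg" "w \<in> Sg" "w' \<in> Sg"
 shows "\<bar>len \<alpha> n w' * p \<gamma> (push \<alpha> n w') - F 1 w w' (prefix n \<alpha> \<frown> w0) * (len \<alpha> n w * p \<gamma> (push \<alpha> n w))\<bar> \<le> K7 * len \<alpha> n w powr (1 + e)"
proof -
 let ?a = "prefix n \<alpha> \<frown> w0" and ?b = "prefix n \<alpha> \<frown> \<gamma>"
 let ?l = "len \<alpha> n w"
 note Sa = append_seq(1)[OF a(1) w0(1) a(3)] and Sb = append_seq(1)[OF a(1,2,3)]
 define D where "D = p ?b w - p ?a w"
 have pa: "p ?a v = lo \<alpha> n v" if "v \<in> Sg" for v
  unfolding append_seq(2)[OF a(1) w0(1) that] by (simp add: p_ends(1)[OF push_Sigma[OF a(1) that]])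
 have D: "D = ?l * p \<gamma> (push \<alpha> n w)" unfolding D_def pa[OF a(3)] append_seq(2)[OF a(1-3)] by simp
 have l: "0 < ?l" "?l \<le> 1" using len_bounds[OF a(1,3)] by blast+
 have q: "p \<gamma> (push \<alpha> n w) \<in> {0..1}" by (rule p_range[OF a(2) push_Sigma[OF a(1,3)]])
 have D0: "0 \<le> D" "D \<le> ?l" unfolding D using l q by (auto simp: mult_le_cancel_left1)
 have sp: "(\<Sum>i\<le>k. F i w w' ?a * D ^ i / fact i) = F 0 w w' ?a + F 1 w w' ?a * D + (\<Sum>i\<in>{2..k}. F i w w' ?a * D ^ i / fact i)"
 proof -
  have "{..k} = {0, 1} \<union> {2..k}" using k1 by auto
  then show ?thesis by (simp add: sum.union_disjoint)
 qed
 have r: "\<bar>\<Sum>i\<in>{2..k}. F i w w' ?a * D ^ i / fact i\<bar> \<le> real (card {2..k}) * ((B + K2) * ?l powr (1 + e))"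
 proof (rule abs_sum_le_card)
  fix i assume i: "i \<in> {2..k}"
  have "\<bar>F i w w' ?a * D ^ i / fact i\<bar> = \<bar>F i w w' ?a\<bar> * (D ^ i / fact i)" using D0(1) by (simp add: abs_mult)
  also have "\<dots> \<le> (B + K2) * ?l powr (1 + e)"
  proof (rule mult_mono)
   show "\<bar>F i w w' ?a\<bar> \<le> B + K2" by (rule F_bound[OF Sa a(3,4)]) (use i in auto)
   have "D ^ i / fact i \<le> ?l ^ i / 1" by (rule frac_le) (use l D0 in \<open>auto intro!: power_mono fact_ge_1\<close>)
   also have "\<dots> = ?l powr real i" using l by (simp add: powr_realpow)
   also have "\<dots> \<le> ?l powr (1 + e)" by (rule powr_mono') (use l i e1 in auto)
   finally show "D ^ i / fact i \<le> ?l powr (1 + e)" .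
  qed (use B(1) K2 D0 in auto)
  finally show "\<bar>F i w w' ?a * D ^ i / fact i\<bar> \<le> (B + K2) * ?l powr (1 + e)" .
 qed
 also have "\<dots> \<le> real (Suc k) * ((B + K2) * ?l powr (1 + e))" using B(1) K2 by (intro mult_right_mono) auto
 finally have r: "\<bar>\<Sum>i\<in>{2..k}. F i w w' ?a * D ^ i / fact i\<bar> \<le> real (Suc k) * (B + K2) * ?l powr (1 + e)" by simp
 have "\<bar>F 0 w w' ?b - (\<Sum>i\<le>k. F i w w' ?a * D ^ i / fact i)\<bar> \<le> K5 * \<bar>D\<bar> powr (real k + e)"
  using F_whitney[OF Sa Sb a(3,4), of 0] unfolding D_def by simp
 also have "\<dots> \<le> K5 * ?l powr (1 + e)"
 proof (rule mult_left_mono[OF _ K5])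
  have "\<bar>D\<bar> powr (real k + e) \<le> ?l powr (real k + e)" by (rule powr_mono2) (use D0 e0 in auto)
  also have "\<dots> \<le> ?l powr (1 + e)" by (rule powr_mono') (use l k1 in auto)
  finally show "\<bar>D\<bar> powr (real k + e) \<le> ?l powr (1 + e)" .
 qed
 finally have "\<bar>(F 0 w w' ?b - F 0 w w' ?a) - F 1 w w' ?a * D\<bar> \<le> K7 * ?l powr (1 + e)"
  using r unfolding sp K7_def distrib_right by linarith
 moreover have "F 0 w w' ?b - F 0 w w' ?a = len \<alpha> n w' * p \<gamma> (push \<alpha> n w')"
  unfolding F_0[OF Sa a(3,4)] F_0[OF Sb a(3,4)] pa[OF a(4)] append_seq(2)[OF a(1,2,4)] by simp
 ultimately show ?thesis unfolding D by simp
qed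

definition K6 where "K6 = 2 * K7 * KD"
lemma K6: "K6 \<ge> 0" unfolding K6_def using K7 KD by simp

text \<open>
 The affine approximation applied to \<open>\<gamma>\<close> and to the right end determines the relative position of \<open>\<gamma>\<close> in the
 interval up to \<open>len powr e\<close>.
\<close>

lemma p_push_close:
 assumes a: "\<alpha> \<in> Sg" "\<gamma> \<in> Sg" "w \<in> Sg" "w' \<in> Sg"
 shows "\<bar>p \<gamma> (push \<alpha> n w') - p \<gamma> (push \<alpha> n w)\<bar> \<le> K6 * (lam powr e) ^ n"
proof -
 let ?l = "len \<alpha> n w" and ?l' = "len \<alpha> n w'" and ?f = "F 1 w w' (prefix n \<alpha> \<frown> w0)"
 let ?q = "p \<gamma> (push \<alpha> n w)" and ?q' = "p \<gamma> (push \<alpha> n w')"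
 have P: "push \<alpha> n w \<in> Sg" "push \<alpha> n w' \<in> Sg" using push_Sigma a by blast+
 have l: "0 < ?l" "0 < ?l'" using len_bounds[OF a(1,3)] len_bounds[OF a(1,4)] by blast+
 have q: "?q \<in> {0..1}" by (rule p_range[OF a(2) P(1)])
 have 1: "\<bar>?l' * ?q' - ?f * (?l * ?q)\<bar> \<le> K7 * ?l powr (1 + e)" by (rule affine_approximation[OF a])
 have 2: "\<bar>?l' - ?f * ?l\<bar> \<le> K7 * ?l powr (1 + e)"
  using affine_approximation[OF a(1) w0(2) a(3,4), of n] p_ends(2)[OF P(1)] p_ends(2)[OF P(2)] by simp
 have "\<bar>?q * (?l' - ?f * ?l)\<bar> \<le> 1 * \<bar>?l' - ?f * ?l\<bar>" unfolding abs_mult using q by (intro mult_right_mono) auto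
 then have 3: "\<bar>?q * (?l' - ?f * ?l)\<bar> \<le> K7 * ?l powr (1 + e)" using 2 by (simp only: mult_1_left)
 have "?l' * (?q' - ?q) = (?l' * ?q' - ?f * (?l * ?q)) - ?q * (?l' - ?f * ?l)" by algebra
 then have "\<bar>?l' * (?q' - ?q)\<bar> \<le> \<bar>?l' * ?q' - ?f * (?l * ?q)\<bar> + \<bar>?q * (?l' - ?f * ?l)\<bar>" by (simp only: abs_triangle_ineq4)
 also have "\<dots> \<le> K7 * ?l powr (1 + e) + K7 * ?l powr (1 + e)" by (rule add_mono[OF 1 3])
 finally have "\<bar>?l' * (?q' - ?q)\<bar> \<le> 2 * K7 * ?l powr (1 + e)" by simp
 then have "?l' * \<bar>?q' - ?q\<bar> \<le> 2 * K7 * (?l * ?l powr e)" using l by (simp add: abs_mult powr_add)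
 also have "\<dots> \<le> 2 * K7 * ((KD * ?l') * ?l powr e)"
  using distortion[OF a(1,4,3), of n] K7 by (intro mult_left_mono mult_right_mono) auto
 also have "\<dots> = ?l' * (K6 * ?l powr e)" unfolding K6_def by simp
 finally have "\<bar>?q' - ?q\<bar> \<le> K6 * ?l powr e" using l by simp
 also have "\<dots> \<le> K6 * (lam ^ n) powr e"
  by (rule mult_left_mono[OF powr_mono2 K6]) (use e0 l len_bounds(2)[OF a(1,3)] in auto)
 finally show ?thesis unfolding lam_e(3) .
qed

text \<open>
 Scaling ratios are distances between points of the Cantor set, so the continuity of \<open>p\<close> passes to \<open>S\<close>.
\<close>

lemma S_as_difference:
 assumes w: "w \<in> Sg"
 shows "i \<in> {1..d} ==> S w i = p (i ## wd) w - p (i ## w0) w"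
  and "i \<in> {1..<d} ==> S w (d + i) = p (Suc i ## w0) w - p (i ## wd) w"
proof -
 have e: "p (i ## wd) w = le w i + S w i" "p (i ## w0) w = le w i" if i: "i \<in> {1..d}" for i
  using p_build[OF i w0(1) w] p_build[OF i w0(2) w] p_ends[OF Sigma_build[OF i w]] by auto
 show "i \<in> {1..d} ==> S w i = p (i ## wd) w - p (i ## w0) w" by (simp only: e)
 assume i: "i \<in> {1..<d}"
 then have "i \<in> {1..d}" "Suc i \<in> {1..d}" "1 \<le> i" by auto
 then show "S w (d + i) = p (Suc i ## w0) w - p (i ## wd) w" by (simp only: e left_end_Suc)
qed

lemma S_uniform:
 assumes a: "\<alpha> \<in> Sg" "w \<in> Sg" "w' \<in> Sg" and i: "i \<in> {1..2*d-1}"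
 shows "\<bar>S (push \<alpha> n w') i - S (push \<alpha> n w) i\<bar> \<le> 2 * K6 * (lam powr e) ^ n"
proof -
 have P: "push \<alpha> n w \<in> Sg" "push \<alpha> n w' \<in> Sg" using push_Sigma a by blast+
 obtain \<gamma> \<gamma>' where g: "\<gamma> \<in> Sg" "\<gamma>' \<in> Sg" "\<And>v. v \<in> Sg ==> S v i = p \<gamma> v - p \<gamma>' v"
 proof (cases "i \<le> d")
  case True
  then have "i \<in> {1..d}" using i by auto
  then show thesis using that[of "i ## wd" "i ## w0"] S_as_difference(1) w0 Sigma_build by blast
 next
  case False
  then have "i - d \<in> {1..<d}" "d + (i - d) = i" using i by auto
  moreover have "i - d \<in> {1..d}" "Suc (i - d) \<in> {1..d}" using calculation by auto
  ultimately show thesis using that[of "Suc (i - d) ## w0" "(i - d) ## wd"] S_as_difference(2)[of _ "i - d"] w0 Sigma_build by metis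
 qed
 show ?thesis unfolding g(3)[OF P(1)] g(3)[OF P(2)]
  using p_push_close[OF a(1) g(1) a(2,3), of n] p_push_close[OF a(1) g(2) a(2,3), of n] by linarith
qed

definition bd where "bd f \<longleftrightarrow> (\<exists>K. \<forall>w\<in>Sg. \<bar>f w\<bar> \<le> K)" for f :: "(nat \<Rightarrow> nat) \<Rightarrow> real"

definition transfer :: "((nat \<Rightarrow> nat) \<Rightarrow> real) \<Rightarrow> (nat \<Rightarrow> nat) \<Rightarrow> real" where
 "transfer f w = (\<Sum>i=1..d. S w i * f (i ## w))"

text \<open>
 Any number strictly between the norm bound of the transfer operator and 1 serves.
\<close>

definition mu :: real where "mu = (1 + lam) / 2"
lemma mu: "0 < mu" "lam < mu" "mu < 1" unfolding mu_def using lam by auto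

text \<open>
 The resolvent of the transfer operator at \<open>mu\<close>, evaluated at \<open>w0\<close> and up to a factor.
\<close>

definition resolvent :: "((nat \<Rightarrow> nat) \<Rightarrow> real) \<Rightarrow> real" where
 "resolvent f = (\<Sum>n. (1 / mu) ^ n * (transfer ^^ n) f w0)"

definition mean :: "((nat \<Rightarrow> nat) \<Rightarrow> real) \<Rightarrow> real" where "mean f = resolvent f / resolvent (\<lambda>_. 1)"

lemma bdI: "(\<And>w. w \<in> Sg ==> \<bar>f w\<bar> \<le> K) ==> bd f" unfolding bd_def by blast

lemma bd_ops: "bd f ==> bd g ==> bd (\<lambda>w. f w + g w)" "bd f ==> bd (\<lambda>w. c * f w)" "bd (\<lambda>_. c)"
proof -
 show "bd (\<lambda>_. c)" by (rule bdI[of _ "\<bar>c\<bar>"]) simp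
 show "bd f ==> bd g ==> bd (\<lambda>w. f w + g w)" unfolding bd_def using abs_triangle_ineq add_mono order_trans by meson
 assume "bd f"
 then obtain K where "\<And>w. w \<in> Sg ==> \<bar>f w\<bar> \<le> K" unfolding bd_def by blast
 then show "bd (\<lambda>w. c * f w)" by (intro bdI[of _ "\<bar>c\<bar> * K"]) (simp add: abs_mult mult_left_mono)
qed

lemma transfer_pow_lin: "(transfer ^^ n) (\<lambda>w. f w + g w) = (\<lambda>w. (transfer ^^ n) f w + (transfer ^^ n) g w)"
 "(transfer ^^ n) (\<lambda>w. c * f w) = (\<lambda>w. c * (transfer ^^ n) f w)"
 by (induction n) (auto simp: transfer_def fun_eq_iff distrib_left sum.distrib sum_distrib_left intro!: sum.cong)

lemma transfer_pow_nonneg: "(\<And>w. w \<in> Sg ==> 0 \<le> f w) ==> w \<in> Sg ==> 0 \<le> (transfer ^^ n) f w"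
proof (induction n arbitrary: w)
 case (Suc n)
 show ?case unfolding funpow.simps o_def transfer_def[of _ w]
  by (rule sum_nonneg, rule mult_nonneg_nonneg) (use Suc Spos(1)[OF Suc.prems(2) idx(1)] Sigma_build in \<open>auto intro: less_imp_le simp del: build_def\<close>)
qed simp

lemma transfer_pow_bound: "(\<And>w. w \<in> Sg ==> \<bar>f w\<bar> \<le> K) ==> w \<in> Sg ==> \<bar>(transfer ^^ n) f w\<bar> \<le> K * lam ^ n"
proof (induction n arbitrary: w)
 case (Suc n)
 have K0: "0 \<le> K * lam ^ n" using Suc.IH[OF Suc.prems(1) w0(1)] by simp
 have "\<bar>(transfer ^^ Suc n) f w\<bar> \<le> (\<Sum>i=1..d. \<bar>S w i * (transfer ^^ n) f (i ## w)\<bar>)"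
  unfolding funpow.simps o_def transfer_def[of _ w] by (rule sum_abs)
 also have "\<dots> \<le> (\<Sum>i=1..d. S w i * (K * lam ^ n))"
 proof (rule sum_mono)
  fix i assume i: "i \<in> {1..d}"
  show "\<bar>S w i * (transfer ^^ n) f (i ## w)\<bar> \<le> S w i * (K * lam ^ n)"
   unfolding abs_mult using Suc.IH[OF Suc.prems(1) Sigma_build[OF i Suc.prems(2)]] Spos(1)[OF Suc.prems(2) idx(1)[OF i]]
   by (auto intro!: mult_mono)
 qed
 also have "\<dots> = (\<Sum>i=1..d. S w i) * (K * lam ^ n)" by (simp add: sum_distrib_right)
 also have "\<dots> \<le> lam * (K * lam ^ n)" by (rule mult_right_mono[OF S_sum_le[OF Suc.prems(2)] K0])
 finally show ?case by (simp add: mult.commute mult.left_commute)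
qed simp

lemma resolvent_summable: "bd f ==> summable (\<lambda>n. (1 / mu) ^ n * (transfer ^^ n) f w0)"
proof -
 assume "bd f"
 then obtain K where K: "\<And>w. w \<in> Sg ==> \<bar>f w\<bar> \<le> K" unfolding bd_def by blast
 have "summable (\<lambda>n. (lam / mu) ^ n * K)" using lam mu by (intro summable_mult2 summable_geometric) auto
 then show ?thesis
 proof (rule summable_comparison_test'[of _ 0])
  fix n
  have "\<bar>(1 / mu) ^ n * (transfer ^^ n) f w0\<bar> = (1 / mu) ^ n * \<bar>(transfer ^^ n) f w0\<bar>" using mu by (simp add: abs_mult power_abs)
  also have "\<dots> \<le> (1 / mu) ^ n * (K * lam ^ n)" using mu by (intro mult_left_mono transfer_pow_bound[OF K w0(1)]) auto
  finally show "norm ((1 / mu) ^ n * (transfer ^^ n) f w0) \<le> (lam / mu) ^ n * K" by (simp add: power_divide mult.commute)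
 qed
qed

lemma resolvent_lin: "bd f ==> bd g ==> resolvent (\<lambda>w. f w + g w) = resolvent f + resolvent g"
 "bd f ==> resolvent (\<lambda>w. c * f w) = c * resolvent f"
proof -
 show "resolvent (\<lambda>w. f w + g w) = resolvent f + resolvent g" if b: "bd f" "bd g"
  using suminf_add[OF resolvent_summable[OF b(1)] resolvent_summable[OF b(2)]] unfolding resolvent_def transfer_pow_lin by (simp add: distrib_left)
 show "resolvent (\<lambda>w. c * f w) = c * resolvent f" if b: "bd f"
  using suminf_mult[OF resolvent_summable[OF b], of c] unfolding resolvent_def transfer_pow_lin by (simp add: mult.left_commute)
qed

lemma resolvent_nonneg: "bd f ==> (\<And>w. w \<in> Sg ==> 0 \<le> f w) ==> f w0 \<le> resolvent f"
proof -
 assume b: "bd f" and f: "\<And>w. w \<in> Sg ==> 0 \<le> f w"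
 have "(\<Sum>n<1. (1 / mu) ^ n * (transfer ^^ n) f w0) \<le> (\<Sum>n. (1 / mu) ^ n * (transfer ^^ n) f w0)"
  by (rule sum_le_suminf[OF resolvent_summable[OF b]]) (use transfer_pow_nonneg[OF f w0(1)] mu in auto)
 then show ?thesis unfolding resolvent_def by simp
qed

lemma Z: "resolvent (\<lambda>_. 1) \<ge> 1" using resolvent_nonneg[OF bd_ops(3)[of 1]] by simp

lemma mean_add: "bd f ==> bd g ==> mean (\<lambda>w. f w + g w) = mean f + mean g"
 unfolding mean_def by (simp add: resolvent_lin add_divide_distrib)
lemma mean_scale: "bd f ==> mean (\<lambda>w. c * f w) = c * mean f"
 unfolding mean_def by (simp add: resolvent_lin)
lemma mean_diff: "bd f ==> bd g ==> mean (\<lambda>w. f w - g w) = mean f - mean g"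
 using mean_add[of f "\<lambda>w. -1 * g w"] mean_scale[of g "-1"] bd_ops(2)[of g "-1"] by simp
lemma mean_const: "mean (\<lambda>_. c) = c"
 using mean_scale[OF bd_ops(3)[of 1], of c] Z unfolding mean_def by simp
lemma mean_nonneg: "bd f ==> (\<And>w. w \<in> Sg ==> 0 \<le> f w) ==> 0 \<le> mean f"
 unfolding mean_def using resolvent_nonneg[of f] w0(1) Z by (smt (verit) divide_nonneg_nonneg)
lemma mean_mono: "bd f ==> bd g ==> (\<And>w. w \<in> Sg ==> f w \<le> g w) ==> mean f \<le> mean g"
 using mean_nonneg[of "\<lambda>w. g w - f w"] mean_diff[of g f] bd_ops(1)[of g "\<lambda>w. -1 * f w"] bd_ops(2)[of f "-1"] by simp
lemma mean_cong: "bd f ==> bd g ==> (\<And>w. w \<in> Sg ==> f w = g w) ==> mean f = mean g"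
 using mean_mono[of f g] mean_mono[of g f] by fastforce
lemma mean_abs: "(\<And>w. w \<in> Sg ==> \<bar>f w\<bar> \<le> K) ==> \<bar>mean f\<bar> \<le> K"
proof -
 assume K: "\<And>w. w \<in> Sg ==> \<bar>f w\<bar> \<le> K"
 have b: "bd f" by (rule bdI[OF K])
 have "f w \<le> K" "- K \<le> f w" if "w \<in> Sg" for w using K[OF that] by auto
 then show ?thesis using mean_mono[OF b bd_ops(3)[of K]] mean_mono[OF bd_ops(3)[of "-K"] b] mean_const by auto
qed
lemma mean_sum: "finite A ==> (\<And>a. a \<in> A ==> bd (f a)) ==> bd (\<lambda>w. \<Sum>a\<in>A. f a w) \<and> mean (\<lambda>w. \<Sum>a\<in>A. f a w) = (\<Sum>a\<in>A. mean (f a))"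
 by (induction A rule: finite_induct) (auto simp: mean_const bd_ops mean_add)

lemma bd_branch: "bd f ==> i \<in> {1..d} ==> bd (\<lambda>w. S w i * f (i ## w))"
proof -
 assume "bd f" and i: "i \<in> {1..d}"
 then obtain K where K: "\<And>w. w \<in> Sg ==> \<bar>f w\<bar> \<le> K" unfolding bd_def by blast
 show ?thesis
 proof (rule bdI)
  fix w assume w: "w \<in> Sg"
  have "\<bar>S w i\<bar> \<le> 1" using Spos[OF w idx(1)[OF i]] by simp
  then show "\<bar>S w i * f (i ## w)\<bar> \<le> 1 * K" unfolding abs_mult by (intro mult_mono K Sigma_build i w) auto
 qed
qed

text \<open>
 The resolvent series without its first term is the resolvent of \<open>transfer f\<close> divided by \<open>mu\<close>.
\<close>

lemma mean_contract:
 assumes b: "bd f" and f: "\<And>w. w \<in> Sg ==> 0 \<le> f w" and i: "i \<in> {1..d}"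
 shows "mean (\<lambda>w. S w i * f (i ## w)) \<le> mu * mean f"
proof -
 have bt: "bd (transfer f)" unfolding transfer_def
  using mean_sum[of "{1..d}" "\<lambda>i w. S w i * f (i ## w)"] bd_branch[OF b] by (simp add: transfer_def[abs_def])
 have "mean (\<lambda>w. S w i * f (i ## w)) \<le> mean (transfer f)"
 proof (rule mean_mono[OF bd_branch[OF b i] bt])
  fix w assume w: "w \<in> Sg"
  have nn: "0 \<le> S w x * f (x ## w)" if x: "x \<in> {1..d}" for x
   using Spos(1)[OF w idx(1)[OF x]] f[OF Sigma_build[OF x w]] by simp
  show "S w i * f (i ## w) \<le> transfer f w" unfolding transfer_def
   by (rule member_le_sum[OF i, of "\<lambda>i. S w i * f (i ## w)"]) (use nn in auto)
 qed
 also have "\<dots> \<le> mu * mean f"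
 proof -
  let ?t = "\<lambda>n. (1 / mu) ^ n * (transfer ^^ n) f w0"
  have "resolvent f = f w0 + (\<Sum>n. ?t (Suc n))"
   unfolding resolvent_def using suminf_split_head[OF resolvent_summable[OF b]] by simp
  also have "(\<Sum>n. ?t (Suc n)) = (\<Sum>n. (1 / mu) * ((1 / mu) ^ n * (transfer ^^ n) (transfer f) w0))"
   by (rule arg_cong[of _ _ suminf]) (auto simp: funpow_Suc_right simp del: funpow.simps)
  also have "\<dots> = (1 / mu) * resolvent (transfer f)" unfolding resolvent_def by (rule suminf_mult[OF resolvent_summable[OF bt]])
  finally have "resolvent (transfer f) \<le> mu * resolvent f" using f[OF w0(1)] mu by (simp add: field_simps)
  then show ?thesis unfolding mean_def using Z by (simp add: divide_right_mono)
 qed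
 finally show ?thesis .
qed

end

section \<open>Contractions from jets\<close>

text \<open>
 Derivatives at accumulation points of \<open>L\<close> are limits of secants within \<open>L\<close>.
\<close>

lemma secant_slope_limit:
 assumes d: "(f has_real_derivative D) (at x)" and x: "x \<in> L" "x islimpt L"
  and sec: "\<And>x y. x \<in> L ==> y \<in> L ==> x < y ==> c * (y - x) \<le> f y - f x \<and> f y - f x \<le> l * (y - x)"
 shows "c \<le> D \<and> D \<le> l"
proof -
 have nb: "at x within L \<noteq> bot" using x(2) by (simp add: trivial_limit_within)
 have lim: "((\<lambda>y. (f y - f x) / (y - x)) \<longlongrightarrow> D) (at x within L)"
  using has_field_derivative_at_within[OF d, of L] by (simp add: has_field_derivative_iff)
 have q: "c \<le> (f y - f x) / (y - x) \<and> (f y - f x) / (y - x) \<le> l" if y: "y \<in> L" "y \<noteq> x" for y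
 proof (cases "x < y")
  case True
  then show ?thesis using sec[OF x(1) y(1)] by (simp add: field_simps)
 next
  case False
  then have "y < x" using y(2) by simp
  moreover have "(f y - f x) / (y - x) = (f x - f y) / (x - y)" by (metis minus_diff_eq minus_divide_divide)
  ultimately show ?thesis using sec[OF y(1) x(1)] by (simp add: field_simps)
 qed
 have "eventually (\<lambda>y. y \<in> L \<and> y \<noteq> x) (at x within L)" by (simp add: eventually_at_filter)
 then have "eventually (\<lambda>y. c \<le> (f y - f x) / (y - x)) (at x within L)" "eventually (\<lambda>y. (f y - f x) / (y - x) \<le> l) (at x within L)"
  by (auto elim!: eventually_mono dest: q)
 then show ?thesis using tendsto_lowerbound[OF lim _ nb] tendsto_upperbound[OF lim _ nb] by blast
qed

text \<open>
 Bounds on secants are additive, so it suffices to pass through 0 or 1 on the way from \<open>X\<close> to a ray.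
\<close>

lemma secants_with_rays:
 fixes f :: "real \<Rightarrow> real"
 assumes X: "X \<subseteq> {0..1}" "0 \<in> X" "1 \<in> X"
  and sec: "\<And>x y. x \<in> X ==> y \<in> X ==> x < y ==> c * (y - x) \<le> f y - f x \<and> f y - f x \<le> l * (y - x)"
  and ray: "\<And>x. x \<le> -1 \<or> 2 \<le> x ==> f x = f 0 + (f 1 - f 0) * x"
  and xy: "x \<in> with_rays X" "y \<in> with_rays X" "x < y"
 shows "c * (y - x) \<le> f y - f x \<and> f y - f x \<le> l * (y - x)"
proof -
 define Q where "Q = (\<lambda>x y. c * (y - x) \<le> f y - f x \<and> f y - f x \<le> l * (y - x))"
 define s where "s = f 1 - f 0"
 have tr: "Q x y ==> Q y z ==> Q x z" for x y z unfolding Q_def by (simp add: algebra_simps)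
 have s: "c \<le> s" "s \<le> l" using sec[OF X(2,3)] unfolding s_def by auto
 have inX: "Q x y" if "x \<in> X" "y \<in> X" "x \<le> y" for x y using sec[OF that(1,2)] that(3) unfolding Q_def by (cases "x = y") auto
 define R where "R = {..-1::real} \<union> {0, 1} \<union> {2..}"
 have fR: "f x = f 0 + s * x" if "x \<in> R" for x using that ray[of x] unfolding R_def s_def by auto
 have inR: "Q x y" if "x \<in> R" "y \<in> R" "x \<le> y" for x y
 proof -
  have "f y - f x = s * (y - x)" using fR[OF that(1)] fR[OF that(2)] by (simp add: algebra_simps)
  then show ?thesis unfolding Q_def using s that(3) by (auto intro: mult_right_mono)
 qed
 have cases: "x \<in> R \<or> x \<in> X" "y \<in> R \<or> y \<in> X" using xy unfolding with_rays_def R_def by auto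
 have R01: "0 \<in> R" "1 \<in> R" unfolding R_def by auto
 have RX: "z \<le> 0 \<or> 1 \<le> z" if "z \<in> R" for z using that unfolding R_def by auto
 have X01: "0 \<le> z" "z \<le> 1" if "z \<in> X" for z using X that by auto
 have "Q x y"
 proof (cases "x \<in> R")
  case xR: True
  show ?thesis
  proof (cases "y \<in> R")
   case True then show ?thesis using inR[OF xR] xy by simp
  next
   case False
   then have y: "y \<in> X" using cases by simp
   have "x \<le> 0"
   proof (rule ccontr)
    assume "\<not> x \<le> 0"
    then have "1 \<le> x" using RX[OF xR] by simp
    then show False using xy(3) X01(2)[OF y] by simp
   qed
   then show ?thesis using tr[OF inR[OF xR R01(1)] inX[OF X(2) y]] X01(1)[OF y] by simp
  qed
 next
  case False
  then have x: "x \<in> X" using cases by simp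
  show ?thesis
  proof (cases "y \<in> X")
   case True then show ?thesis using inX[OF x] xy by simp
  next
   case False
   then have yR: "y \<in> R" using cases by simp
   have "1 \<le> y"
   proof (rule ccontr)
    assume "\<not> 1 \<le> y"
    then have "y \<le> 0" using RX[OF yR] by simp
    then show False using xy(3) X01(1)[OF x] by simp
   qed
   then show ?thesis using tr[OF inX[OF x X(3)] inR[OF R01(2) yR]] X01(2)[OF x] by simp
  qed
 qed
 then show ?thesis unfolding Q_def .
qed

text \<open>
 Since \<open>X\<close> has no isolated points, the bounds on secants also bound the derivative on \<open>X\<close>.
\<close>

lemma adjust_on_compact:
 fixes f f' :: "real \<Rightarrow> real"
 assumes e: "0 < e" "e \<le> 1"
  and X: "compact X" "X \<subseteq> {0..1}" "0 \<in> X" "1 \<in> X" and perf: "\<And>x. x \<in> X ==> x islimpt X"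
  and d: "\<And>x. (f has_real_derivative f' x) (at x)" and bf: "bfam n e UNIV {()} (\<lambda>_. f')"
  and sec: "\<And>x y. x \<in> X ==> y \<in> X ==> x < y ==> c * (y - x) \<le> f y - f x \<and> f y - f x \<le> l * (y - x)"
  and ray: "\<And>x. x \<le> -1 \<or> 2 \<le> x ==> f x = f 0 + (f 1 - f 0) * x" and \<eta>: "\<eta> > 0"
 obtains g g' where "\<And>x. (g has_real_derivative g' x) (at x)" "bfam n e UNIV {()} (\<lambda>_. g')"
  "\<And>x. x \<in> with_rays X ==> g x = f x" "\<And>x. c - \<eta> \<le> g' x \<and> g' x \<le> l + \<eta>"
proof -
 let ?L = "with_rays X"
 have lp: "x islimpt ?L" if "x \<in> ?L" for x
 proof (cases "x \<in> X")
  case True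
  then show ?thesis using islimpt_subset[OF perf[OF True], of ?L] unfolding with_rays_def by blast
 next
  case False
  then have x: "x \<le> -1 \<or> 2 \<le> x" using that unfolding with_rays_def by auto
  show ?thesis unfolding islimpt_approachable
  proof (intro allI impI)
   fix \<delta> :: real assume "\<delta> > 0"
   then show "\<exists>y\<in>?L. y \<noteq> x \<and> dist y x < \<delta>"
    using x unfolding with_rays_def by (intro bexI[of _ "if x \<le> -1 then x - \<delta>/2 else x + \<delta>/2"]) (auto simp: dist_real_def)
  qed
 qed
 have secL: "x \<in> ?L ==> y \<in> ?L ==> x < y ==> c * (y - x) \<le> f y - f x \<and> f y - f x \<le> l * (y - x)" for x y
  by (rule secants_with_rays[OF X(2-4) sec ray])
 show thesis
 proof (rule adjust_derivative[OF e, of ?L f f' n c l \<eta>])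
  show "\<exists>a b. is_gap ?L a b \<and> x \<in> {a<..<b}" if "x \<notin> ?L" for x by (rule with_rays_gaps[OF X(1) that])
  show "-1 \<le> a \<and> b \<le> 2" if "is_gap ?L a b" for a b using with_rays_gap_bounds(1,2)[OF X(2-4) that] ..
  show "(f has_real_derivative f' x) (at x)" for x by (rule d)
  show "bfam n e UNIV {()} (\<lambda>_. f')" by (rule bf)
  show "c \<le> f' x \<and> f' x \<le> l" if "x \<in> ?L" for x by (rule secant_slope_limit[OF d that lp[OF that] secL])
  show "c * (b - a) \<le> f b - f a \<and> f b - f a \<le> l * (b - a)" if "is_gap ?L a b" for a b
   by (rule secL) (use that in \<open>auto simp: is_gap_def\<close>)
  show "\<eta> > 0" by (rule \<eta>)
 qed (assumption | (rule that; assumption))+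
qed

lemma increasing_diffeomorphism:
 fixes g g' :: "real \<Rightarrow> real"
 assumes e: "0 < e" "e \<le> 1" and k: "1 \<le> k" and d: "\<And>x. (g has_real_derivative g' x) (at x)"
  and b: "bfam (k - 1) e UNIV {()} (\<lambda>_. g')" and c: "0 < c" "\<And>x. c \<le> g' x"
 shows "strict_mono g" "surj g" "lfam k e UNIV {()} (\<lambda>_. g)" "lfam k e UNIV {()} (\<lambda>_. inv g)"
  "(inv g has_real_derivative 1 / g' (inv g y)) (at y)"
proof -
 have sec: "c * (y - x) \<le> g y - g x" if "x < y" for x y
 proof -
  have "\<exists>z>x. z < y \<and> g y - g x = (y - x) * g' z" by (rule MVT2[OF that]) (rule d)
  then obtain z where "g y - g x = (y - x) * g' z" by blast
  then show ?thesis using mult_left_mono[OF c(2)[of z], of "y - x"] that by (simp add: mult.commute)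
 qed
 show sm: "strict_mono g"
 proof (rule strict_monoI)
  fix x y :: real assume "x < y"
  then show "g x < g y" using sec[of x y] mult_pos_pos[OF c(1), of "y - x"] by linarith
 qed
 have cont: "continuous_on A g" for A by (rule continuous_at_imp_continuous_on) (use d DERIV_isCont in blast)
 show sj: "surj g"
 proof (rule surjI)
  fix y
  have "\<exists>x. g x = y"
  proof -
   define t where "t = \<bar>y - g 0\<bar> / c + 1"
   have t: "0 < t" "\<bar>y - g 0\<bar> \<le> c * t" unfolding t_def using c(1) by (auto simp: field_simps add_pos_nonneg intro: add_nonneg_pos)
   have "g (-t) \<le> y" "y \<le> g t" using sec[of 0 t] sec[of "-t" 0] t by auto
   then obtain x where "-t \<le> x" "x \<le> t" "g x = y" using IVT'[of g "-t" y t] cont t(1) by auto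
   then show ?thesis by blast
  qed
  then show "g (SOME x. g x = y) = y" by (rule someI_ex)
 qed
 obtain n where n: "k = Suc n" using k by (cases k) auto
 show "lfam k e UNIV {()} (\<lambda>_. g)" unfolding n by (rule lfam_SucI[OF _ b[unfolded n, simplified]]) (use d in simp)
 have inv: "inv g (g x) = x" for x by (rule inv_f_f[OF strict_mono_imp_inj_on[OF sm]])
 note I = lfam_inv[OF e convex_UNIV convex_UNIV, of "{()}" "\<lambda>_. g" "\<lambda>_. g'" c "\<lambda>_. inv g" k]
 show "lfam k e UNIV {()} (\<lambda>_. inv g)" by (rule I(1)) (use d c sj inv b in auto)
 show "(inv g has_real_derivative 1 / g' (inv g y)) (at y)"
  by (rule I(2)) (use d c sj inv b in auto)
qed

lemma smooth_contraction_from_slopes: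
 fixes g g' :: "real \<Rightarrow> real"
 assumes e: "0 < e" "e \<le> 1" and k: "1 \<le> k" and d: "\<And>x. (g has_real_derivative g' x) (at x)"
  and b: "bfam (k - 1) e UNIV {()} (\<lambda>_. g')" and c: "0 < c" "\<And>x. c \<le> g' x" and l: "l < 1" "\<And>x. g' x \<le> l"
 shows "smooth_contraction k e g"
proof -
 note D = increasing_diffeomorphism[OF e k d b c]
 obtain n where n: "k = Suc n" using k by (cases k) auto
 have l0: "0 \<le> l" using c(1) c(2)[of 0] l(2)[of 0] by linarith
 have "l-lipschitz_on UNIV g"
 proof (rule lipschitz_onI)
  fix x y
  have "norm (g x - g y) \<le> l * norm (x - y)"
  proof (rule field_differentiable_bound[OF convex_UNIV, of g g'])
   fix z show "norm (g' z) \<le> l" using c(1) c(2)[of z] l(2)[of z] by simp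
  qed (use d in auto)
  then show "dist (g x) (g y) \<le> l * dist x y" by (simp add: dist_norm)
 qed (rule l0)
 moreover have "Ck_eps_on k e UNIV f" if f: "lfam k e UNIV {()} (\<lambda>_. f)" for f
  unfolding n by (rule lfam_imp_Ck_eps_on[OF _ e(1) f[unfolded n]]) (auto intro: at_within_nontrivial(2))
 note this[OF D(3)] this[OF D(4)]
 ultimately show ?thesis unfolding smooth_contraction_def using l(1) D(1,2) by auto
qed

text \<open>
 \<open>Fh\<close> and \<open>Fb\<close> describe the embedding and one of its branches in the same auxiliary coordinate. The
 branch is the extension of \<open>Fb\<close> composed with the inverse of the extension of \<open>Fh\<close>; it is smooth but need not
 contract outside the Cantor set, which is repaired by a second adjustment, now in the coordinate of the
 embedding.
\<close>

theorem contraction_from_jets: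
 fixes Fh Fb :: "nat \<Rightarrow> real \<Rightarrow> real" and e K :: real
 assumes e: "0 < e" "e \<le> 1" and k: "1 \<le> k" and K0: "K \<ge> 0"
  and X: "compact X" "X \<subseteq> {0..1}" "0 \<in> X" "1 \<in> X" and perf: "\<And>x. x \<in> X ==> x islimpt X"
  and Wh: "\<And>m x y. m \<le> k ==> x \<in> X ==> y \<in> X ==> \<bar>Fh m y - jet_taylor k Fh m x y\<bar> \<le> K * \<bar>y - x\<bar> powr (real k + e - real m)"
  and bh: "\<And>m x. m \<le> k ==> x \<in> X ==> \<bar>Fh m x\<bar> \<le> K"
  and Wb: "\<And>m x y. m \<le> k ==> x \<in> X ==> y \<in> X ==> \<bar>Fb m y - jet_taylor k Fb m x y\<bar> \<le> K * \<bar>y - x\<bar> powr (real k + e - real m)"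
  and bb: "\<And>m x. m \<le> k ==> x \<in> X ==> \<bar>Fb m x\<bar> \<le> K"
  and h01: "Fh 0 0 = 0" "Fh 0 1 = 1"
  and c1: "0 < c1" and sech: "\<And>x y. x \<in> X ==> y \<in> X ==> x < y ==> c1 * (y - x) \<le> Fh 0 y - Fh 0 x \<and> Fh 0 y - Fh 0 x \<le> l1 * (y - x)"
  and c2: "0 < c2" and \<mu>: "\<mu> < 1"
  and secb: "\<And>x y. x \<in> X ==> y \<in> X ==> x < y ==> c2 * (Fh 0 y - Fh 0 x) \<le> Fb 0 y - Fb 0 x \<and> Fb 0 y - Fb 0 x \<le> \<mu> * (Fh 0 y - Fh 0 x)"
 shows "\<exists>g. smooth_contraction k e g \<and> (\<forall>x\<in>X. g (Fh 0 x) = b + Fb 0 x)"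
proof -
 obtain f f' where f: "\<And>x. (f has_real_derivative f' x) (at x)" "bfam (k - 1) e UNIV {()} (\<lambda>_. f')"
  "\<And>x. x \<in> X ==> f x = Fh 0 x" "\<And>x. x \<le> -1 \<or> 2 \<le> x ==> f x = Fh 0 0 + (Fh 0 1 - Fh 0 0) * x"
  by (rule extension_from_compact[OF e k K0 X Wh bh]) (assumption | (rule that; assumption))+
 have f01: "f 0 = 0" "f 1 = 1" using f(3) X h01 by auto
 obtain H H' where H: "\<And>x. (H has_real_derivative H' x) (at x)" "bfam (k - 1) e UNIV {()} (\<lambda>_. H')"
  "\<And>x. x \<in> with_rays X ==> H x = f x" "\<And>x. c1 - c1/2 \<le> H' x \<and> H' x \<le> l1 + c1/2"
 proof (rule adjust_on_compact[OF e X perf f(1,2), of c1 l1 "c1/2"])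
  show "c1 * (y - x) \<le> f y - f x \<and> f y - f x \<le> l1 * (y - x)" if "x \<in> X" "y \<in> X" "x < y" for x y
   using sech[OF that] f(3) that by simp
  show "f x = f 0 + (f 1 - f 0) * x" if "x \<le> -1 \<or> 2 \<le> x" for x using f(4)[OF that] f01 h01 by simp
  show "0 < c1/2" using c1 by simp
 qed (assumption | (rule that; assumption))+
 have Hs: "0 < c1/2" "\<And>x. c1/2 \<le> H' x"
 proof -
  show "0 < c1/2" using c1 by simp
  show "c1/2 \<le> H' x" for x using H(4)[of x] by simp
 qed
 note HD = increasing_diffeomorphism[OF e k H(1,2) Hs]
 have HX: "H x = Fh 0 x" if "x \<in> X" for x using H(3)[of x] f(3)[OF that] that unfolding with_rays_def by simp
 have Hray: "H x = x" if "x \<le> -1 \<or> 2 \<le> x" for x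
  using H(3)[of x] f(4)[OF that] that h01 unfolding with_rays_def by auto
 have Hinv: "inv H (H x) = x" for x by (rule inv_f_f[OF strict_mono_imp_inj_on[OF HD(1)]])
 obtain q q' where q: "\<And>x. (q has_real_derivative q' x) (at x)" "bfam (k - 1) e UNIV {()} (\<lambda>_. q')"
  "\<And>x. x \<in> X ==> q x = Fb 0 x" "\<And>x. x \<le> -1 \<or> 2 \<le> x ==> q x = Fb 0 0 + (Fb 0 1 - Fb 0 0) * x"
  by (rule extension_from_compact[OF e k K0 X Wb bb]) (assumption | (rule that; assumption))+
 define u where "u = (\<lambda>y. b + q (inv H y))"
 define u' where "u' = (\<lambda>y. q' (inv H y) * (1 / H' (inv H y)))"
 have du: "(u has_real_derivative u' y) (at y)" for y
  unfolding u_def u'_def using DERIV_add[OF DERIV_const[of b] DERIV_chain2[OF q(1) HD(5)]] by simp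
 have il: "lfam (k - 1) e UNIV {()} (\<lambda>_. inv H)" by (rule lfam_mono[OF e convex_UNIV HD(4)]) simp
 have bu: "bfam (k - 1) e UNIV {()} (\<lambda>_. u')"
 proof -
  have 1: "bfam (k - 1) e UNIV {()} (\<lambda>_ y. q' (inv H y))" by (rule bfam_comp[OF e convex_UNIV q(2) il convex_UNIV]) simp
  have 2: "bfam (k - 1) e UNIV {()} (\<lambda>_ y. H' (inv H y))" by (rule bfam_comp[OF e convex_UNIV H(2) il convex_UNIV]) simp
  have 3: "bfam (k - 1) e UNIV {()} (\<lambda>_ y. 1 / H' (inv H y))" by (rule bfam_inverse[OF e convex_UNIV 2 Hs(1)]) (rule Hs(2))
  show ?thesis unfolding u'_def by (rule bfam_mult[OF e convex_UNIV 1 3])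
 qed
 define Y where "Y = H ` X"
 have uY: "u (H x) = b + Fb 0 x" if "x \<in> X" for x unfolding u_def Hinv using q(3)[OF that] by simp
 have H01: "H 0 = 0" "H 1 = 1" using HX X h01 by auto
 have Hcont: "continuous_on A H" for A by (rule continuous_at_imp_continuous_on) (use H(1) DERIV_isCont in blast)
 have Y: "compact Y" "Y \<subseteq> {0..1}" "0 \<in> Y" "1 \<in> Y"
 proof -
  show "compact Y" unfolding Y_def by (rule compact_continuous_image[OF Hcont X(1)])
  show "Y \<subseteq> {0..1}" unfolding Y_def
  proof
   fix y assume "y \<in> H ` X"
   then obtain x where x: "x \<in> X" "y = H x" by blast
   then have "0 \<le> x" "x \<le> 1" using X(2) by auto
   then show "y \<in> {0..1}" using strict_mono_less_eq[OF HD(1), of 0 x] strict_mono_less_eq[OF HD(1), of x 1] H01 x(2) by simp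
  qed
  show "0 \<in> Y" "1 \<in> Y" unfolding Y_def using H01 X(3,4) by force+
 qed
 have Yperf: "y islimpt Y" if yY: "y \<in> Y" for y
 proof -
  obtain x where x: "x \<in> X" "y = H x" using yY unfolding Y_def by blast
  have "isCont H x" by (rule DERIV_isCont[OF H(1)])
  then have lim: "(H \<longlongrightarrow> H x) (at x within X)" unfolding isCont_def by (rule tendsto_within_subset) simp
  show ?thesis unfolding islimpt_approachable
  proof (intro allI impI)
   fix \<delta> :: real assume "\<delta> > 0"
   then have "eventually (\<lambda>z. dist (H z) (H x) < \<delta>) (at x within X)" using lim by (rule tendstoD[rotated])
   moreover have "eventually (\<lambda>z. z \<in> X \<and> z \<noteq> x) (at x within X)" by (simp add: eventually_at_filter)
   ultimately have "eventually (\<lambda>z. dist (H z) (H x) < \<delta> \<and> z \<in> X \<and> z \<noteq> x) (at x within X)" by (rule eventually_conj)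
   moreover have "at x within X \<noteq> bot" using perf[OF x(1)] by (simp add: trivial_limit_within)
   ultimately obtain z where z: "dist (H z) (H x) < \<delta>" "z \<in> X" "z \<noteq> x" by (metis (mono_tags, lifting) eventually_happens')
   moreover have "H z \<noteq> H x" using z(3) strict_mono_eq[OF HD(1)] by blast
   ultimately show "\<exists>x'\<in>Y. x' \<noteq> y \<and> dist x' y < \<delta>" unfolding Y_def x(2) by blast
  qed
 qed
 \<comment> \<open>small enough to keep the slopes positive and below 1\<close>
 define \<eta> where "\<eta> = min (c2/2) ((1 - \<mu>)/2)"
 have \<eta>: "0 < \<eta>" "\<eta> < c2" "\<mu> + \<eta> < 1" unfolding \<eta>_def using c2 \<mu> by (auto simp: min_def field_simps)
 obtain g g' where g: "\<And>x. (g has_real_derivative g' x) (at x)" "bfam (k - 1) e UNIV {()} (\<lambda>_. g')"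
  "\<And>x. x \<in> with_rays Y ==> g x = u x" "\<And>x. c2 - \<eta> \<le> g' x \<and> g' x \<le> \<mu> + \<eta>"
 proof (rule adjust_on_compact[OF e Y Yperf du bu, of c2 \<mu> \<eta>])
  show "c2 * (y - x) \<le> u y - u x \<and> u y - u x \<le> \<mu> * (y - x)" if xy: "x \<in> Y" "y \<in> Y" "x < y" for x y
  proof -
   obtain s t where st: "s \<in> X" "t \<in> X" "x = H s" "y = H t" using xy(1,2) unfolding Y_def by blast
   then have "s < t" using xy(3) strict_mono_less[OF HD(1)] by blast
   from secb[OF st(1,2) this] show ?thesis unfolding st(3,4) uY[OF st(1)] uY[OF st(2)] unfolding HX[OF st(1)] HX[OF st(2)] by simp
  qed
  have u01: "u 0 = b + Fb 0 0" "u 1 = b + Fb 0 1" using uY[OF X(3)] uY[OF X(4)] H01 by auto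
  show "u x = u 0 + (u 1 - u 0) * x" if "x \<le> -1 \<or> 2 \<le> x" for x
   using Hinv[of x] q(4)[OF that] unfolding Hray[OF that] u01 by (simp add: u_def)
 qed (assumption | rule \<eta>(1) | (rule that; assumption))+
 have "smooth_contraction k e g"
 proof (rule smooth_contraction_from_slopes[OF e k g(1,2) _ _ \<eta>(3)])
  show "0 < c2 - \<eta>" using \<eta>(2) by simp
  show "c2 - \<eta> \<le> g' x" "g' x \<le> \<mu> + \<eta>" for x using g(4)[of x] by auto
 qed
 moreover have "g (Fh 0 x) = b + Fb 0 x" if x: "x \<in> X" for x
  using g(3)[of "H x"] uY[OF x] x unfolding HX[OF x, symmetric] Y_def with_rays_def by auto
 ultimately show ?thesis by blast
qed

section \<open>The averaged embedding\<close>

lemma compact_Sigma: "compact (Sigma_seq d)"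
proof -
 have "compactin (product_topology (\<lambda>_. euclidean) UNIV) (PiE UNIV (\<lambda>_::nat. {1..d}))"
  by (subst compactin_PiE) (simp add: finite_imp_compact)
 moreover have "PiE UNIV (\<lambda>_. {1..d}) = Sigma_seq d" unfolding Sigma_seq_def by (auto simp: PiE_def)
 ultimately show ?thesis unfolding euclidean_product_topology by simp
qed

lemma continuous_on_Sigma:
 fixes f :: "(nat \<Rightarrow> nat) \<Rightarrow> real"
 assumes q: "0 \<le> q" "q < 1" and f: "\<And>\<alpha> \<beta> n. \<alpha> \<in> Sigma_seq d ==> \<beta> \<in> Sigma_seq d ==> (\<And>t. t < n ==> \<alpha> t = \<beta> t) ==> \<bar>f \<beta> - f \<alpha>\<bar> \<le> q ^ n"
 shows "continuous_on (Sigma_seq d) f"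
 unfolding continuous_on_topological
proof (intro ballI allI impI)
 fix \<alpha> B assume a: "\<alpha> \<in> Sigma_seq d" and B: "open B" "f \<alpha> \<in> B"
 obtain \<delta> where \<delta>: "\<delta> > 0" "\<And>y. \<bar>y - f \<alpha>\<bar> < \<delta> ==> y \<in> B" using B unfolding open_dist dist_real_def by blast
 obtain n where n: "q ^ n < \<delta>" using real_arch_pow_inv[OF \<delta>(1) q(2)] by blast
 let ?A = "\<Inter>t\<in>{..<n}. (\<lambda>\<beta>. \<beta> t) -` {\<alpha> t}"
 have "open ((\<lambda>\<beta>. \<beta> t) -` {\<alpha> t})" for t by (rule open_vimage) (auto simp: open_discrete)
 then have "open ?A" by (intro open_INT) auto
 moreover have "\<alpha> \<in> ?A" by auto
 moreover have "f \<beta> \<in> B" if "\<beta> \<in> Sigma_seq d" "\<beta> \<in> ?A" for \<beta>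
 proof (rule \<delta>(2))
  have "\<bar>f \<beta> - f \<alpha>\<bar> \<le> q ^ n" by (rule f[OF a that(1)]) (use that(2) in auto)
  then show "\<bar>f \<beta> - f \<alpha>\<bar> < \<delta>" using n by simp
 qed
 ultimately show "\<exists>A. open A \<and> \<alpha> \<in> A \<and> (\<forall>y\<in>Sigma_seq d. y \<in> A \<longrightarrow> f y \<in> B)" by blast
qed

context scaling_data
begin

lemma p_close: assumes a: "\<alpha> \<in> Sg" "\<beta> \<in> Sg" "w \<in> Sg" and ag: "\<And>t. t < n ==> \<alpha> t = \<beta> t" shows "\<bar>p \<beta> w - p \<alpha> w\<bar> \<le> lam ^ n"
proof -
 have P: "push \<alpha> n w \<in> Sg" using push_Sigma a by blast
 have "\<bar>p (suffix n \<beta>) (push \<alpha> n w) - p (suffix n \<alpha>) (push \<alpha> n w)\<bar> \<le> 1"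
  using p_range[OF Sigma_suffix[OF a(1)] P, of n] p_range[OF Sigma_suffix[OF a(2)] P, of n] by auto
 then have "len \<alpha> n w * \<bar>p (suffix n \<beta>) (push \<alpha> n w) - p (suffix n \<alpha>) (push \<alpha> n w)\<bar> \<le> lam ^ n * 1"
  by (intro mult_mono) (use len_bounds[OF a(1,3), of n] lam in auto)
 moreover have "p \<beta> w - p \<alpha> w = len \<alpha> n w * (p (suffix n \<beta>) (push \<alpha> n w) - p (suffix n \<alpha>) (push \<alpha> n w))"
  by (rule p_difference[OF a ag])
 ultimately show ?thesis using len_bounds(1)[OF a(1,3), of n] by (simp add: abs_mult)
qed

definition h :: "(nat \<Rightarrow> nat) \<Rightarrow> real" where "h \<alpha> = mean (\<lambda>w. p \<alpha> w)"

lemma bd_p: "\<alpha> \<in> Sg ==> bd (\<lambda>w. p \<alpha> w)" by (rule bdI[of _ 1]) (use p_range in fastforce)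

lemma bd_diff: "bd f ==> bd g ==> bd (\<lambda>w. f w - g w)" using bd_ops(1)[of f "\<lambda>w. -1 * g w"] bd_ops(2)[of g "-1"] by simp

lemma bd_cong: "bd g ==> (\<And>w. w \<in> Sg ==> f w = g w) ==> bd f"
proof -
 assume "bd g" and fg: "\<And>w. w \<in> Sg ==> f w = g w"
 then obtain K where "\<And>w. w \<in> Sg ==> \<bar>g w\<bar> \<le> K" unfolding bd_def by blast
 then show "bd f" by (intro bdI[of _ K]) (simp add: fg)
qed

lemma h_diff: "\<alpha> \<in> Sg ==> \<beta> \<in> Sg ==> h \<beta> - h \<alpha> = mean (\<lambda>w. p \<beta> w - p \<alpha> w)"
 unfolding h_def by (rule mean_diff[symmetric]) (rule bd_p, assumption)+

lemma p_less_iff: "\<alpha> \<in> Sg ==> \<beta> \<in> Sg ==> w \<in> Sg ==> w' \<in> Sg ==> p \<alpha> w < p \<beta> w ==> p \<alpha> w' < p \<beta> w'"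
 using lex_monoD[OF p_lex[of w], of \<beta> \<alpha>] lex_monoD[OF p_lex[of w'], of \<beta> \<alpha>] by blast

lemma h_secants:
 assumes a: "\<alpha> \<in> Sg" "\<beta> \<in> Sg" "p \<alpha> w0 < p \<beta> w0"
 shows "(1 / K4) * (p \<beta> w0 - p \<alpha> w0) \<le> h \<beta> - h \<alpha>" "h \<beta> - h \<alpha> \<le> K4 * (p \<beta> w0 - p \<alpha> w0)"
proof -
 have l: "p \<alpha> w < p \<beta> w" if "w \<in> Sg" for w by (rule p_less_iff[OF a(1,2) w0(1) that a(3)])
 have b: "bd (\<lambda>w. p \<beta> w - p \<alpha> w)" by (rule bd_diff[OF bd_p[OF a(2)] bd_p[OF a(1)]])
 have 1: "(1 / K4) * (p \<beta> w0 - p \<alpha> w0) \<le> p \<beta> w - p \<alpha> w" if w: "w \<in> Sg" for w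
  using p_comparable[OF a(1,2) w w0(1)] l[OF w] a(3) K4 by (simp add: field_simps)
 have 2: "p \<beta> w - p \<alpha> w \<le> K4 * (p \<beta> w0 - p \<alpha> w0)" if w: "w \<in> Sg" for w
  using p_comparable[OF a(1,2) w0(1) w] l[OF w] a(3) by simp
 show "(1 / K4) * (p \<beta> w0 - p \<alpha> w0) \<le> h \<beta> - h \<alpha>" using mean_mono[OF bd_ops(3) b 1] unfolding h_diff[OF a(1,2)] mean_const by simp
 show "h \<beta> - h \<alpha> \<le> K4 * (p \<beta> w0 - p \<alpha> w0)" using mean_mono[OF b bd_ops(3) 2] unfolding h_diff[OF a(1,2)] mean_const by simp
qed

lemma h_less: "\<alpha> \<in> Sg ==> \<beta> \<in> Sg ==> p \<alpha> w0 < p \<beta> w0 ==> h \<alpha> < h \<beta>"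
proof -
 assume a: "\<alpha> \<in> Sg" "\<beta> \<in> Sg" "p \<alpha> w0 < p \<beta> w0"
 have "0 < (1 / K4) * (p \<beta> w0 - p \<alpha> w0)" using K4 a(3) by simp
 then show "h \<alpha> < h \<beta>" using h_secants(1)[OF a] by linarith
qed

lemma h_lex: "lex_mono d h"
 unfolding lex_mono_def
proof (intro ballI impI)
 fix \<alpha> \<beta> assume a: "\<alpha> \<in> Sg" "\<beta> \<in> Sg" "\<alpha> \<noteq> \<beta>"
 have ne: "p \<alpha> w0 \<noteq> p \<beta> w0" using p_distance[OF a(1,2) w0(1) a(3)] c0(1) len_bounds(1)[OF a(1) w0(1), of "common_len \<alpha> \<beta>"] by (auto simp: mult_le_0_iff)
 have "h \<beta> < h \<alpha> \<longleftrightarrow> p \<beta> w0 < p \<alpha> w0" using h_less[OF a(1,2)] h_less[OF a(2,1)] ne by force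
 then show "h \<beta> < h \<alpha> \<longleftrightarrow> \<beta> (common_len \<alpha> \<beta>) < \<alpha> (common_len \<alpha> \<beta>)" using lex_monoD[OF p_lex[OF w0(1)] a] by simp
qed

lemma h_ends: "h w0 = 0" "h wd = 1"
proof -
 have "h w0 = mean (\<lambda>_. 0)" unfolding h_def by (rule mean_cong[OF bd_p[OF w0(1)] bd_ops(3)]) (rule p_ends(1))
 then show "h w0 = 0" by (simp add: mean_const)
 have "h wd = mean (\<lambda>_. 1)" unfolding h_def by (rule mean_cong[OF bd_p[OF w0(2)] bd_ops(3)]) (rule p_ends(2))
 then show "h wd = 1" by (simp add: mean_const)
qed

lemma is_embedding_h: "is_embedding d h"
proof -
 have "continuous_on Sg h"
 proof (rule continuous_on_Sigma[of lam])
  fix \<alpha> \<beta> n assume a: "\<alpha> \<in> Sg" "\<beta> \<in> Sg" "\<And>t. t < n ==> \<alpha> t = \<beta> t"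
  show "\<bar>h \<beta> - h \<alpha>\<bar> \<le> lam ^ n" unfolding h_diff[OF a(1,2)] by (rule mean_abs) (rule p_close[OF a(1,2) _ a(3)])
 qed (use lam in auto)
 then have "embedding_map (top_of_set Sg) euclidean h"
 proof (intro continuous_imp_embedding_map)
  show "compact_space (top_of_set Sg)" using compact_Sigma[of d] by (simp add: compact_space_subtopology)
  show "inj_on h (topspace (top_of_set Sg))" using lex_mono_inj[OF h_lex] by simp
 qed simp_all
 moreover have "convex hull (h ` Sg) = {0..1}"
 proof (rule convex_hull_real_eq)
  show "h ` Sg \<subseteq> {0..1}"
  proof
   fix y assume "y \<in> h ` Sg"
   then obtain \<alpha> where \<alpha>: "\<alpha> \<in> Sg" "y = h \<alpha>" by blast
   have "1 \<le> d" using d2 by simp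
   from order_embedding_bounds[OF h_lex this \<alpha>(1), folded w0_def wd_def] show "y \<in> {0..1}" unfolding h_ends \<alpha>(2) by simp
  qed
  show "0 \<in> h ` Sg" "1 \<in> h ` Sg" using h_ends w0 by force+
 qed
 ultimately show ?thesis using h_lex unfolding is_embedding_def lex_mono_def by blast
qed

definition X where "X = (\<lambda>\<alpha>. p \<alpha> w0) ` Sg"

lemma X: "compact X" "X \<subseteq> {0..1}" "0 \<in> X" "1 \<in> X" "\<And>x. x \<in> X ==> x islimpt X"
proof -
 have "continuous_on Sg (\<lambda>\<alpha>. p \<alpha> w0)"
  by (rule continuous_on_Sigma[of lam]) (use lam p_close[OF _ _ w0(1)] in auto)
 then show "compact X" unfolding X_def by (rule compact_continuous_image[OF _ compact_Sigma])
 show "X \<subseteq> {0..1}" unfolding X_def using p_range[OF _ w0(1)] by blast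
 show "0 \<in> X" "1 \<in> X" unfolding X_def using p_ends[OF w0(1)] w0 by force+
 fix x assume "x \<in> X"
 then obtain \<alpha> where \<alpha>: "\<alpha> \<in> Sg" "x = p \<alpha> w0" unfolding X_def by blast
 show "x islimpt X" unfolding islimpt_approachable
 proof (intro allI impI)
  fix \<delta> :: real assume "\<delta> > 0"
  then obtain n where n: "lam ^ n < \<delta>" using real_arch_pow_inv lam by blast
  define i where "i = (if \<alpha> n = 1 then 2 else 1::nat)"
  define \<beta> where "\<beta> = \<alpha>(n := i)"
  have i: "i \<in> {1..d}" "i \<noteq> \<alpha> n" unfolding i_def using d2 by auto
  have \<beta>: "\<beta> \<in> Sg" unfolding Sigma_seq_def \<beta>_def using i(1) \<alpha>(1) Sigma_nth[OF \<alpha>(1)] by auto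
  have "\<bar>p \<beta> w0 - p \<alpha> w0\<bar> \<le> lam ^ n" by (rule p_close[OF \<alpha>(1) \<beta> w0(1)]) (simp add: \<beta>_def)
  moreover have "\<beta> \<noteq> \<alpha>" unfolding \<beta>_def using i(2) by (metis fun_upd_same)
  then have "p \<beta> w0 \<noteq> p \<alpha> w0" using inj_onD[OF lex_mono_inj[OF p_lex[OF w0(1)]] _ \<beta> \<alpha>(1)] by blast
  ultimately show "\<exists>y\<in>X. y \<noteq> x \<and> dist y x < \<delta>" using n \<beta> unfolding \<alpha>(2) X_def dist_real_def by (intro bexI[of _ "p \<beta> w0"]) auto
 qed
qed

definition addr :: "real \<Rightarrow> nat \<Rightarrow> nat" where "addr x = inv_into Sg (\<lambda>\<alpha>. p \<alpha> w0) x"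

lemma addr: "x \<in> X ==> addr x \<in> Sg" "x \<in> X ==> p (addr x) w0 = x" "\<alpha> \<in> Sg ==> addr (p \<alpha> w0) = \<alpha>"
 unfolding X_def addr_def using inv_into_into f_inv_into_f inv_into_f_f[OF lex_mono_inj[OF p_lex[OF w0(1)]]] by metis+

text \<open>
 The Whitney condition is linear in the jet and holds with the same constant for every \<open>w\<close>.
\<close>

lemma averaged_jets:
 assumes b: "\<And>m \<alpha> w. m \<le> k ==> \<alpha> \<in> Sg ==> w \<in> Sg ==> \<bar>G m w \<alpha>\<bar> \<le> K"
  and W: "\<And>m \<alpha> \<beta> w. m \<le> k ==> \<alpha> \<in> Sg ==> \<beta> \<in> Sg ==> w \<in> Sg ==>
   \<bar>G m w \<beta> - (\<Sum>l\<le>k-m. G (m + l) w \<alpha> * (p \<beta> w0 - p \<alpha> w0) ^ l / fact l)\<bar> \<le> K * \<bar>p \<beta> w0 - p \<alpha> w0\<bar> powr (real k + e - real m)"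
  and m: "m \<le> k" and xy: "x \<in> X" "y \<in> X"
 shows "\<bar>mean (\<lambda>w. G m w (addr y)) - jet_taylor k (\<lambda>m x. mean (\<lambda>w. G m w (addr x))) m x y\<bar> \<le> K * \<bar>y - x\<bar> powr (real k + e - real m)"
  "\<bar>mean (\<lambda>w. G m w (addr x))\<bar> \<le> K"
proof -
 note A = addr(1)[OF xy(1)] addr(1)[OF xy(2)]
 show "\<bar>mean (\<lambda>w. G m w (addr x))\<bar> \<le> K" by (rule mean_abs) (rule b[OF m A(1)])
 let ?c = "\<lambda>l. (y - x) ^ l / fact l"
 have bG: "bd (\<lambda>w. G i w \<alpha>)" if "i \<le> k" "\<alpha> \<in> Sg" for i \<alpha> by (rule bdI) (rule b[OF that])
 have s: "bd (\<lambda>w. \<Sum>l\<le>k-m. ?c l * G (m + l) w (addr x)) \<and> mean (\<lambda>w. \<Sum>l\<le>k-m. ?c l * G (m + l) w (addr x)) = (\<Sum>l\<le>k-m. mean (\<lambda>w. ?c l * G (m + l) w (addr x)))"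
 proof (rule mean_sum)
  fix l assume "l \<in> {..k-m}"
  then have "m + l \<le> k" using m by auto
  from bd_ops(2)[OF bG[OF this A(1)]] show "bd (\<lambda>w. ?c l * G (m + l) w (addr x))" .
 qed simp
 have "mean (\<lambda>w. ?c l * G (m + l) w (addr x)) = ?c l * mean (\<lambda>w. G (m + l) w (addr x))" if "l \<le> k - m" for l
  by (rule mean_scale[OF bG[OF _ A(1)]]) (use that m in auto)
 then have "(\<Sum>l\<le>k-m. mean (\<lambda>w. ?c l * G (m + l) w (addr x))) = jet_taylor k (\<lambda>m x. mean (\<lambda>w. G m w (addr x))) m x y"
  unfolding jet_taylor_def by (intro sum.cong) auto
 then have eq: "mean (\<lambda>w. G m w (addr y) - (\<Sum>l\<le>k-m. ?c l * G (m + l) w (addr x))) = mean (\<lambda>w. G m w (addr y)) - jet_taylor k (\<lambda>m x. mean (\<lambda>w. G m w (addr x))) m x y"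
  using mean_diff[OF bG[OF m A(2)] conjunct1[OF s]] conjunct2[OF s] by simp
 show "\<bar>mean (\<lambda>w. G m w (addr y)) - jet_taylor k (\<lambda>m x. mean (\<lambda>w. G m w (addr x))) m x y\<bar> \<le> K * \<bar>y - x\<bar> powr (real k + e - real m)"
  unfolding eq[symmetric]
 proof (rule mean_abs)
  fix w assume w: "w \<in> Sg"
  show "\<bar>G m w (addr y) - (\<Sum>l\<le>k-m. ?c l * G (m + l) w (addr x))\<bar> \<le> K * \<bar>y - x\<bar> powr (real k + e - real m)"
   using W[OF m A w] unfolding addr(2)[OF xy(1)] addr(2)[OF xy(2)] by (simp add: mult.commute)
 qed
qed

text \<open>
 The branch replaces the parameter \<open>w\<close> by \<open>i ## w\<close>; averaging turns this into a function of \<open>\<alpha>\<close> alone.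
\<close>

lemma h_branch_eq: assumes i: "i \<in> {1..d}" and \<alpha>: "\<alpha> \<in> Sg"
 shows "h (i ## \<alpha>) = mean (\<lambda>w. le w i) + mean (\<lambda>w. S w i * p \<alpha> (i ## w))"
proof -
 have b1: "bd (\<lambda>w. le w i)" by (rule bdI[of _ 1]) (use le_range(1)[OF _ i] in fastforce)
 have b2: "bd (\<lambda>w. S w i * p \<alpha> (i ## w))" by (rule bd_branch[OF bd_p[OF \<alpha>] i])
 have "h (i ## \<alpha>) = mean (\<lambda>w. le w i + S w i * p \<alpha> (i ## w))"
  unfolding h_def by (rule mean_cong[OF bd_p[OF Sigma_build[OF i \<alpha>]] bd_ops(1)[OF b1 b2]]) (rule p_build[OF i \<alpha>])
 then show ?thesis using mean_add[OF b1 b2] by simp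
qed

text \<open>
 The coordinate is \<open>p \<alpha> w0\<close>. The upper bound for the secants of the branch is \<open>mean_contract\<close>; the
 lower bounds come from the comparability of distances for different parameters.
\<close>

lemma smooth_branch_exists:
 assumes i: "i \<in> {1..d}"
 shows "\<exists>g. smooth_contraction k e g \<and> (\<forall>\<alpha>\<in>Sg. g (h \<alpha>) = h (i ## \<alpha>))"
proof -
 define K where "K = max (B + K2) K5"
 have K: "0 \<le> K" "B + K2 \<le> K" "K5 \<le> K" unfolding K_def using K5 by auto
 define Gh where "Gh = (\<lambda>m w \<alpha>. F m w0 w \<alpha>)"
 define Gb where "Gb = (\<lambda>m w \<alpha>. S w i * F m w0 (i ## w) \<alpha>)"
 define Fh where "Fh = (\<lambda>m x. mean (\<lambda>w. Gh m w (addr x)))"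
 define Fb where "Fb = (\<lambda>m x. mean (\<lambda>w. Gb m w (addr x)))"
 have S1: "0 \<le> S w i" "S w i \<le> 1" if "w \<in> Sg" for w using Spos[OF that idx(1)[OF i]] by (auto intro: less_imp_le)
 have bh: "\<bar>Gh m w \<alpha>\<bar> \<le> K" if "m \<le> k" "\<alpha> \<in> Sg" "w \<in> Sg" for m \<alpha> w
  unfolding Gh_def using F_bound[OF that(2) w0(1) that(3,1)] K(2) by simp
 have Wh: "\<bar>Gh m w \<beta> - (\<Sum>l\<le>k-m. Gh (m + l) w \<alpha> * (p \<beta> w0 - p \<alpha> w0) ^ l / fact l)\<bar> \<le> K * \<bar>p \<beta> w0 - p \<alpha> w0\<bar> powr (real k + e - real m)"
  if a: "m \<le> k" "\<alpha> \<in> Sg" "\<beta> \<in> Sg" "w \<in> Sg" for m \<alpha> \<beta> w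
  unfolding Gh_def by (rule order_trans[OF F_whitney[OF a(2,3) w0(1) a(4,1)] mult_right_mono[OF K(3)]]) simp
 have scale: "\<bar>S w i * t\<bar> \<le> c" if w: "w \<in> Sg" and t: "\<bar>t\<bar> \<le> c" for w t c
 proof -
  have "S w i * \<bar>t\<bar> \<le> 1 * c" by (rule mult_mono) (use S1[OF w] t in auto)
  then show ?thesis unfolding abs_mult using S1[OF w] by simp
 qed
 have bb: "\<bar>Gb m w \<alpha>\<bar> \<le> K" if "m \<le> k" "\<alpha> \<in> Sg" "w \<in> Sg" for m \<alpha> w
  unfolding Gb_def by (rule scale[OF that(3)]) (use bh[OF that(1,2) Sigma_build[OF i that(3)]] in \<open>simp add: Gh_def\<close>)
 have Wb: "\<bar>Gb m w \<beta> - (\<Sum>l\<le>k-m. Gb (m + l) w \<alpha> * (p \<beta> w0 - p \<alpha> w0) ^ l / fact l)\<bar> \<le> K * \<bar>p \<beta> w0 - p \<alpha> w0\<bar> powr (real k + e - real m)"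
  if a: "m \<le> k" "\<alpha> \<in> Sg" "\<beta> \<in> Sg" "w \<in> Sg" for m \<alpha> \<beta> w
 proof -
  have "Gb m w \<beta> - (\<Sum>l\<le>k-m. Gb (m + l) w \<alpha> * (p \<beta> w0 - p \<alpha> w0) ^ l / fact l) =
   S w i * (Gh m (i ## w) \<beta> - (\<Sum>l\<le>k-m. Gh (m + l) (i ## w) \<alpha> * (p \<beta> w0 - p \<alpha> w0) ^ l / fact l))"
   unfolding Gb_def Gh_def right_diff_distrib sum_distrib_left by (simp add: mult.assoc)
  then show ?thesis using scale[OF a(4) Wh[OF a(1-3) Sigma_build[OF i a(4)]]] by (simp only:)
 qed
 have Fh0: "Fh 0 x = h (addr x)" if "x \<in> X" for x
  unfolding Fh_def Gh_def h_def
  by (rule mean_cong) (use F_0[OF addr(1)[OF that] w0(1)] bh[of 0 "addr x"] addr(1)[OF that] in \<open>auto intro!: bdI[of _ K] bd_p simp: Gh_def\<close>)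
 have Fb0: "mean (\<lambda>w. le w i) + Fb 0 x = h (i ## addr x)" if x: "x \<in> X" for x
 proof -
  have "Fb 0 x = mean (\<lambda>w. S w i * p (addr x) (i ## w))" unfolding Fb_def
  proof (rule mean_cong)
   show "bd (\<lambda>w. Gb 0 w (addr x))" by (rule bdI[of _ K]) (rule bb[OF le0 addr(1)[OF x]])
   show "bd (\<lambda>w. S w i * p (addr x) (i ## w))" by (rule bd_branch[OF bd_p[OF addr(1)[OF x]] i])
   show "Gb 0 w (addr x) = S w i * p (addr x) (i ## w)" if "w \<in> Sg" for w
    unfolding Gb_def using F_0[OF addr(1)[OF x] w0(1) Sigma_build[OF i that]] by simp
  qed
  then show ?thesis using h_branch_eq[OF i addr(1)[OF x]] by simp
 qed
 have "\<exists>g. smooth_contraction k e g \<and> (\<forall>x\<in>X. g (Fh 0 x) = mean (\<lambda>w. le w i) + Fb 0 x)"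
 proof (rule contraction_from_jets[OF e0 e1 k1 K(1) X, where ?c1.0 = "1 / K4" and ?l1.0 = K4 and ?c2.0 = "c0 / (K4 * K4)" and \<mu> = mu])
  fix m x y assume a: "m \<le> k" "x \<in> X" "y \<in> X"
  show "\<bar>Fh m y - jet_taylor k Fh m x y\<bar> \<le> K * \<bar>y - x\<bar> powr (real k + e - real m)"
   unfolding Fh_def by (rule averaged_jets(1)[OF bh Wh a])
  show "\<bar>Fb m y - jet_taylor k Fb m x y\<bar> \<le> K * \<bar>y - x\<bar> powr (real k + e - real m)"
   unfolding Fb_def by (rule averaged_jets(1)[OF bb Wb a])
 next
  fix m x assume a: "m \<le> k" "x \<in> X"
  show "\<bar>Fh m x\<bar> \<le> K" unfolding Fh_def by (rule averaged_jets(2)[OF bh Wh a a(2)])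
  show "\<bar>Fb m x\<bar> \<le> K" unfolding Fb_def by (rule averaged_jets(2)[OF bb Wb a a(2)])
 next
  show "Fh 0 0 = 0" "Fh 0 1 = 1"
   using Fh0[OF X(3)] Fh0[OF X(4)] addr(3)[OF w0(1)] addr(3)[OF w0(2)] p_ends[OF w0(1)] h_ends by auto
  show "0 < 1 / K4" "0 < c0 / (K4 * K4)" using K4 c0(1) by auto
  show "mu < 1" by (rule mu)
 next
  fix x y assume a: "x \<in> X" "y \<in> X" "x < y"
  define \<alpha> \<beta> where "\<alpha> = addr x" and "\<beta> = addr y"
  have ab: "\<alpha> \<in> Sg" "\<beta> \<in> Sg" "p \<alpha> w0 = x" "p \<beta> w0 = y" unfolding \<alpha>_def \<beta>_def using addr a by auto
  have lt: "p \<alpha> w0 < p \<beta> w0" using ab a(3) by simp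
  note hs = h_secants[OF ab(1,2) lt, unfolded ab(3,4)]
  have Fe: "Fh 0 x = h \<alpha>" "Fh 0 y = h \<beta>" unfolding \<alpha>_def \<beta>_def using Fh0 a by auto
  show "1 / K4 * (y - x) \<le> Fh 0 y - Fh 0 x \<and> Fh 0 y - Fh 0 x \<le> K4 * (y - x)" unfolding Fe using hs by simp
  have pl: "p \<alpha> w < p \<beta> w" if "w \<in> Sg" for w by (rule p_less_iff[OF ab(1,2) w0(1) that lt])
  have bdp: "bd (\<lambda>w. p \<beta> w - p \<alpha> w)" by (rule bd_diff[OF bd_p[OF ab(2)] bd_p[OF ab(1)]])
  have Fbe: "Fb 0 y - Fb 0 x = mean (\<lambda>w. S w i * (p \<beta> (i ## w) - p \<alpha> (i ## w)))"
  proof -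
   have "Fb 0 y - Fb 0 x = mean (\<lambda>w. S w i * p \<beta> (i ## w)) - mean (\<lambda>w. S w i * p \<alpha> (i ## w))"
    using Fb0[OF a(1)] Fb0[OF a(2)] h_branch_eq[OF i ab(1)] h_branch_eq[OF i ab(2)] unfolding \<alpha>_def \<beta>_def by linarith
   also have "\<dots> = mean (\<lambda>w. S w i * p \<beta> (i ## w) - S w i * p \<alpha> (i ## w))"
    by (rule mean_diff[symmetric]) (rule bd_branch[OF bd_p i], rule ab)+
   finally show ?thesis by (simp only: right_diff_distrib)
  qed
  have up: "mean (\<lambda>w. S w i * (p \<beta> (i ## w) - p \<alpha> (i ## w))) \<le> mu * mean (\<lambda>w. p \<beta> w - p \<alpha> w)"
   by (rule mean_contract[OF bdp _ i]) (use pl in \<open>auto intro: less_imp_le\<close>)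
  have low: "c0 / K4 * (y - x) \<le> mean (\<lambda>w. S w i * (p \<beta> (i ## w) - p \<alpha> (i ## w)))"
  proof -
   have "c0 / K4 * (y - x) = mean (\<lambda>_. c0 / K4 * (y - x))" by (rule mean_const[symmetric])
   also have "\<dots> \<le> mean (\<lambda>w. S w i * (p \<beta> (i ## w) - p \<alpha> (i ## w)))"
   proof (rule mean_mono[OF bd_ops(3) bd_branch[OF bdp i]])
    fix w assume w: "w \<in> Sg"
    have "y - x \<le> K4 * (p \<beta> (i ## w) - p \<alpha> (i ## w))"
     using p_comparable[OF ab(1,2) Sigma_build[OF i w] w0(1)] pl[OF Sigma_build[OF i w]] a(3) unfolding ab(3,4) by simp
    then have "(y - x) / K4 \<le> p \<beta> (i ## w) - p \<alpha> (i ## w)" using K4 by (simp add: divide_le_eq mult.commute)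
    then have "c0 * ((y - x) / K4) \<le> S w i * (p \<beta> (i ## w) - p \<alpha> (i ## w))"
     by (intro mult_mono) (use c0 w idx(1)[OF i] a(3) K4 S1 in auto)
    then show "c0 / K4 * (y - x) \<le> S w i * (p \<beta> (i ## w) - p \<alpha> (i ## w))" by simp
   qed
   finally show ?thesis .
  qed
  have "c0 / (K4 * K4) * (h \<beta> - h \<alpha>) \<le> c0 / (K4 * K4) * (K4 * (y - x))"
   by (rule mult_left_mono[OF hs(2)]) (use c0(1) K4 in auto)
  also have "\<dots> = c0 / K4 * (y - x)" using K4 by simp
  finally show "c0 / (K4 * K4) * (Fh 0 y - Fh 0 x) \<le> Fb 0 y - Fb 0 x \<and> Fb 0 y - Fb 0 x \<le> mu * (Fh 0 y - Fh 0 x)"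
   unfolding Fe Fbe using low up h_diff[OF ab(1,2)] by simp
 qed
 then obtain g where g: "smooth_contraction k e g" "\<And>x. x \<in> X ==> g (Fh 0 x) = mean (\<lambda>w. le w i) + Fb 0 x" by blast
 have "g (h \<alpha>) = h (i ## \<alpha>)" if \<alpha>: "\<alpha> \<in> Sg" for \<alpha>
 proof -
  have x: "p \<alpha> w0 \<in> X" unfolding X_def using \<alpha> by blast
  show ?thesis using g(2)[OF x] Fb0[OF x] Fh0[OF x] addr(3)[OF \<alpha>] by simp
 qed
 then show ?thesis using g(1) by blast
qed

lemma C_embedding_h: "C_embedding d k e h"
 unfolding C_embedding_def
proof (intro conjI ballI)
 show "is_embedding d h" by (rule is_embedding_h)
 fix i assume i: "i \<in> {1..d}"
 obtain g where g: "smooth_contraction k e g" "\<And>\<alpha>. \<alpha> \<in> Sg ==> g (h \<alpha>) = h (i ## \<alpha>)" using smooth_branch_exists[OF i] by blast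
 have "g (h \<alpha>) = branch d h i (h \<alpha>)" if "\<alpha> \<in> Sg" for \<alpha>
  unfolding branch_def o_def inv_into_f_f[OF lex_mono_inj[OF h_lex] that] by (rule g(2)[OF that])
 then show "\<exists>g. smooth_contraction k e g \<and> (\<forall>x\<in>h ` Sg. g x = branch d h i x)" using g(1) by blast
qed

lemma h_conc_diff:
 assumes a: "\<alpha> \<in> Sg" "\<gamma> \<in> Sg" "\<gamma>' \<in> Sg"
 shows "h (prefix n \<alpha> \<frown> \<gamma>') - h (prefix n \<alpha> \<frown> \<gamma>) = mean (\<lambda>w. len \<alpha> n w * (p \<gamma>' (push \<alpha> n w) - p \<gamma> (push \<alpha> n w)))"
proof -
 note A = append_seq(1)[OF a(1,2) w0(1), of n] append_seq(1)[OF a(1,3) w0(1), of n]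
 have b: "bd (\<lambda>w. p (prefix n \<alpha> \<frown> \<gamma>') w - p (prefix n \<alpha> \<frown> \<gamma>) w)" by (rule bd_diff[OF bd_p[OF A(2)] bd_p[OF A(1)]])
 have eq: "p (prefix n \<alpha> \<frown> \<gamma>') w - p (prefix n \<alpha> \<frown> \<gamma>) w = len \<alpha> n w * (p \<gamma>' (push \<alpha> n w) - p \<gamma> (push \<alpha> n w))" if "w \<in> Sg" for w
  using append_seq(2)[OF a(1,2) that, of n] append_seq(2)[OF a(1,3) that, of n] by (simp add: right_diff_distrib)
 have b': "bd (\<lambda>w. len \<alpha> n w * (p \<gamma>' (push \<alpha> n w) - p \<gamma> (push \<alpha> n w)))" by (rule bd_cong[OF b eq[symmetric]])
 show ?thesis unfolding h_diff[OF A] by (rule mean_cong[OF b b' eq])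
qed

text \<open>
 The finite scaling ratio is a quotient of two averages whose integrands have the ratio \<open>S (push \<alpha> n w) i\<close>,
 where \<open>\<alpha>\<close> is chosen so that these sequences start with \<open>prefix n j\<close>.
\<close>

lemma finite_scaling_estimate:
 assumes j: "j \<in> Sg" and i: "i \<in> {1..2*d-1}"
 shows "\<bar>finite_scaling d h (prefix n j) i - S j i\<bar> \<le> 2 * K6 * (lam powr e) ^ n"
proof -
 let ?js = "prefix n j" and ?u = "rev (prefix n j)"
 define \<alpha> where "\<alpha> = ?u \<frown> w0"
 have js: "set ?js \<subseteq> {1..d}" by (rule set_prefix_Sigma[OF j])
 have \<alpha>: "\<alpha> \<in> Sg" unfolding \<alpha>_def by (rule Sigma_conc) (use js w0 in auto)
 have pre: "prefix n \<alpha> = ?u" unfolding \<alpha>_def using prefix_conc_length[of ?u w0] by simp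
 have jp: "push \<alpha> n (suffix n j) = j"
 proof
  fix t
  show "push \<alpha> n (suffix n j) t = j t"
  proof (cases "t < n")
   case True
   then have "\<alpha> (n - 1 - t) = j t" unfolding \<alpha>_def by (simp add: conc_def rev_nth)
   then show ?thesis using True by (simp add: push_nth)
  qed (simp add: push_nth)
 qed
 define l where "l = (\<lambda>w. len \<alpha> n w)"
 have l: "0 < l w" "l w \<le> 1" "c0 ^ n \<le> l w" if "w \<in> Sg" for w unfolding l_def using len_bounds[OF \<alpha> that] by blast+
 have P: "push \<alpha> n w \<in> Sg" if "w \<in> Sg" for w using push_Sigma \<alpha> that by blast
 have bl: "bd l" by (rule bdI[of _ 1]) (use l in fastforce)
 have Ml: "0 < mean l" using mean_mono[OF bd_ops(3) bl l(3)] c0(1) unfolding mean_const by (meson order_less_le_trans zero_less_power)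
 have Sb: "\<bar>S (push \<alpha> n w) i\<bar> \<le> 1" if "w \<in> Sg" for w using Spos[OF P[OF that] i] by simp
 have blS: "bd (\<lambda>w. l w * S (push \<alpha> n w) i)"
 proof (rule bdI[of _ 1])
  fix w assume w: "w \<in> Sg"
  have "\<bar>l w\<bar> * \<bar>S (push \<alpha> n w) i\<bar> \<le> 1 * 1" by (rule mult_mono) (use l[OF w] Sb[OF w] in auto)
  then show "\<bar>l w * S (push \<alpha> n w) i\<bar> \<le> 1" by (simp add: abs_mult)
 qed
 have hd: "h (?u \<frown> \<gamma>') - h (?u \<frown> \<gamma>) = mean (\<lambda>w. l w * (p \<gamma>' (push \<alpha> n w) - p \<gamma> (push \<alpha> n w)))" if "\<gamma> \<in> Sg" "\<gamma>' \<in> Sg" for \<gamma> \<gamma>'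
  using h_conc_diff[OF \<alpha> that, of n] unfolding pre l_def .
 have Mdiff: "mean (\<lambda>w. l w * (p \<gamma>' (push \<alpha> n w) - p \<gamma> (push \<alpha> n w))) = mean (\<lambda>w. l w * S (push \<alpha> n w) i)"
  if g: "\<gamma> \<in> Sg" "\<gamma>' \<in> Sg" and eq: "\<And>w. w \<in> Sg ==> S (push \<alpha> n w) i = p \<gamma>' (push \<alpha> n w) - p \<gamma> (push \<alpha> n w)" for \<gamma> \<gamma>'
 proof (rule mean_cong[OF _ blS])
  show e: "l w * (p \<gamma>' (push \<alpha> n w) - p \<gamma> (push \<alpha> n w)) = l w * S (push \<alpha> n w) i" if "w \<in> Sg" for w using eq[OF that] by simp
  show "bd (\<lambda>w. l w * (p \<gamma>' (push \<alpha> n w) - p \<gamma> (push \<alpha> n w)))" by (rule bd_cong[OF blS e])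
 qed
 have num: "(if i \<le> d then h (?u \<frown> (i ## wd)) - h (?u \<frown> (i ## w0))
  else h (?u \<frown> (Suc (i - d) ## w0)) - h (?u \<frown> ((i - d) ## wd))) = mean (\<lambda>w. l w * S (push \<alpha> n w) i)"
 proof (cases "i \<le> d")
  case True
  then have t: "i \<in> {1..d}" using i by simp
  note G = Sigma_build[OF t w0(1)] Sigma_build[OF t w0(2)]
  have "h (?u \<frown> (i ## wd)) - h (?u \<frown> (i ## w0)) = mean (\<lambda>w. l w * S (push \<alpha> n w) i)"
   unfolding hd[OF G] by (rule Mdiff[OF G]) (rule S_as_difference(1)[OF P t])
  then show ?thesis using True by simp
 next
  case False
  define t where "t = i - d"
  have t: "t \<in> {1..d}" "Suc t \<in> {1..d}" "t \<in> {1..<d}" "d + t = i" using False i unfolding t_def by auto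
  note G = Sigma_build[OF t(1) w0(2)] Sigma_build[OF t(2) w0(1)]
  have "h (?u \<frown> (Suc t ## w0)) - h (?u \<frown> (t ## wd)) = mean (\<lambda>w. l w * S (push \<alpha> n w) i)"
   unfolding hd[OF G] by (rule Mdiff[OF G]) (use S_as_difference(2)[OF P t(3)] t(4) in simp)
  then show ?thesis using False unfolding t_def by simp
 qed
 have den: "h (?u \<frown> wd) - h (?u \<frown> w0) = mean l" unfolding hd[OF w0]
 proof (rule mean_cong[OF _ bl])
  show e: "l w * (p wd (push \<alpha> n w) - p w0 (push \<alpha> n w)) = l w" if "w \<in> Sg" for w using p_ends[OF P[OF that]] by simp
  show "bd (\<lambda>w. l w * (p wd (push \<alpha> n w) - p w0 (push \<alpha> n w)))" by (rule bd_cong[OF bl e])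
 qed
 have "1 \<le> d" using d2 by simp
 from finite_scaling_interval[OF h_lex this js i, folded w0_def wd_def, unfolded num den]
 have fs: "finite_scaling d h ?js i = mean (\<lambda>w. l w * S (push \<alpha> n w) i) / mean l" .
 let ?\<epsilon> = "2 * K6 * (lam powr e) ^ n"
 have *: "\<bar>S (push \<alpha> n w) i - S j i\<bar> \<le> ?\<epsilon>" if "w \<in> Sg" for w
  using S_uniform[OF \<alpha> Sigma_suffix[OF j] that i, of n n] unfolding jp .
 have "S (push \<alpha> n w) i \<le> S j i + ?\<epsilon>" "S j i - ?\<epsilon> \<le> S (push \<alpha> n w) i" if "w \<in> Sg" for w
  using *[OF that] by linarith+
 then have dl: "l w * S (push \<alpha> n w) i \<le> (S j i + ?\<epsilon>) * l w" "(S j i - ?\<epsilon>) * l w \<le> l w * S (push \<alpha> n w) i" if "w \<in> Sg" for w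
  using l(1)[OF that] that by (simp_all add: mult.commute[of _ "l w"])
 have "mean (\<lambda>w. l w * S (push \<alpha> n w) i) \<le> (S j i + ?\<epsilon>) * mean l" "(S j i - ?\<epsilon>) * mean l \<le> mean (\<lambda>w. l w * S (push \<alpha> n w) i)"
  using mean_mono[OF blS bd_ops(2)[OF bl] dl(1)] mean_mono[OF bd_ops(2)[OF bl] blS dl(2)] unfolding mean_scale[OF bl] by auto
 then show ?thesis unfolding fs using Ml by (simp add: abs_le_iff divide_le_eq le_divide_eq field_simps)
qed

lemma scaling_function_h: "has_scaling_function d h S"
 unfolding has_scaling_function_def
proof (intro ballI)
 fix j i assume j: "j \<in> Sg" and i: "i \<in> {1..2*d-1}"
 have "(\<lambda>n. (lam powr e) ^ n) \<longlonglongrightarrow> 0" using lam_e by (intro LIMSEQ_realpow_zero) auto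
 then have "(\<lambda>n. 2 * K6 * (lam powr e) ^ n) \<longlonglongrightarrow> 0" by (rule tendsto_mult_right_zero)
 then have "(\<lambda>n. finite_scaling d h (prefix n j) i - S j i) \<longlonglongrightarrow> 0"
  by (rule Lim_null_comparison[rotated]) (use finite_scaling_estimate[OF j i] in auto)
 then show "(\<lambda>n. finite_scaling d h (prefix n j) i) \<longlonglongrightarrow> S j i" by (rule LIM_zero_cancel)
qed

end

theorem scaling_condition_imp_embedding:
 assumes d: "d \<ge> 2" and k: "k \<ge> 1" "k < 2 * d" and e: "0 < e" "e \<le> 1" and S: "S \<in> Sigma_dual d \<rightarrow> Simp d"
  and cnd: "\<forall>j\<in>Sigma_dual d. \<forall>j'\<in>Sigma_dual d. j \<noteq> j' \<longrightarrow> (\<forall>i\<in>{1..d}.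
    Diff_var k (C * rho d S (i ## j) (i ## j') powr (real k + e - 1)) (A_set d (S (i ## j))) (A_set d (S (i ## j')))
    \<inter> renorm d (S j) (S j') i ` Diff_var k (C * rho d S j j' powr (real k + e - 1)) (A_set d (S j)) (A_set d (S j')) \<noteq> {})"
 shows "\<exists>h. C_embedding d k e h \<and> has_scaling_function d h S"
proof -
 have V: "\<phi> \<in> Vset d k e S \<bar>C\<bar> j j'" if "\<phi> \<in> Diff_var k (C * rho d S j j' powr (real k + e - 1)) (A_set d (S j)) (A_set d (S j'))" for \<phi> j j'
 proof -
  have le: "C * rho d S j j' powr (real k + e - 1) \<le> \<bar>C\<bar> * rho d S j j' powr (real k + e - 1)" by (intro mult_right_mono) auto
  have "\<phi> \<in> Diff k (A_set d (S j)) (A_set d (S j'))" using that unfolding Diff_var_def by blast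
  then show ?thesis unfolding Vset_def by (intro CollectI conjI ballI) (assumption, rule order_trans[OF Diff_var_imp[OF that] le])
 qed
 interpret scaling_data d k e S "\<bar>C\<bar>"
 proof
  fix j j' i assume a: "j \<in> Sigma_seq d" "j' \<in> Sigma_seq d" "i \<in> {1..d}"
  show "\<exists>\<psi>\<in>Vset d k e S \<bar>C\<bar> j j'. renorm d (S j) (S j') i \<psi> \<in> Vset d k e S \<bar>C\<bar> (i ## j) (i ## j')"
  proof (cases "j = j'")
   case False
   then obtain \<psi> where "\<psi> \<in> Diff_var k (C * rho d S j j' powr (real k + e - 1)) (A_set d (S j)) (A_set d (S j'))"
    "renorm d (S j) (S j') i \<psi> \<in> Diff_var k (C * rho d S (i ## j) (i ## j') powr (real k + e - 1)) (A_set d (S (i ## j))) (A_set d (S (i ## j')))"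
    using cnd a by blast
   then show ?thesis using V by blast
  next
   case True
   let ?id = "\<lambda>x\<in>{0..1::real}. x"
   have id: "?id \<in> Vset d k e S \<bar>C\<bar> j j" if j: "j \<in> Sigma_seq d" for j
   proof -
    have s: "S j \<in> Simp d" using S j by blast
    obtain n where n: "k = Suc n" using k by (cases k) auto
    have "D01 k ?id x = (if n = 0 then 1 else 0)" if x: "x \<in> {0..1}" for x
    proof -
     have "D01 k ?id x = D01 k (\<lambda>x. x) x" by (rule nth_deriv_cong[OF _ x]) simp
     also have "\<dots> = D01 n (\<lambda>_. 1) x" unfolding n by (rule nth_deriv_Suc_shift01[OF DERIV_ident x])
     finally show ?thesis unfolding nth_deriv_const[OF x] .
    qed
    then show ?thesis unfolding Vset_def using identity_Diff[OF k(1) A_set_card(3)[OF s d]] by (simp add: rho_def)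
   qed
   have sj: "S j \<in> Simp d" using S a by blast
   have pos: "0 < S j i" using Simp_pos[OF sj, of i] a(3) d by auto
   have "renorm d (S j) (S j) i ?id = ?id"
   proof
    fix x
    show "renorm d (S j) (S j) i ?id x = ?id x"
    proof (cases "x \<in> {0..1}")
     case x: True
     have "S j i * x \<le> S j i * 1" "0 \<le> S j i * x" using pos x by (auto intro!: mult_left_mono simp del: mult_1_right)
     then have "left_end d (S j) i + S j i * x \<in> {0..1}"
      using left_end_nonneg[OF sj, of i] left_end_right_le_1[OF sj a(3)] a(3) by auto
     then show ?thesis unfolding renorm_def using x pos by simp
    qed (auto simp: renorm_def)
   qed
   then have "renorm d (S j) (S j) i ?id \<in> Vset d k e S \<bar>C\<bar> (i ## j) (i ## j)"
    by (simp only:) (rule id[OF Sigma_build[OF a(3,1)]])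
   then show ?thesis unfolding True[symmetric] by (rule bexI[OF _ id[OF a(1)]])
  qed
 qed (use d k e S in auto)
 show ?thesis using C_embedding_h scaling_function_h by blast
qed

theorem mainTheorem2:
  fixes d k :: nat and \<epsilon> :: real and S :: "(nat \<Rightarrow> nat) \<Rightarrow> nat \<Rightarrow> real"
  assumes "d \<ge> 2" and "k \<ge> 1" and "k < 2 * d"
    and "0 < \<epsilon>" and "\<epsilon> \<le> 1"
    and "S \<in> Sigma_dual d \<rightarrow> Simp d"
  shows "(\<exists>h. C_embedding d k \<epsilon> h \<and> has_scaling_function d h S) \<longleftrightarrow>
    (\<exists>C. \<forall>j\<in>Sigma_dual d. \<forall>j'\<in>Sigma_dual d. j \<noteq> j' \<longrightarrow> (\<forall>j\<^sub>0\<in>{1..d}.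
       Diff_var k (C * rho d S (j\<^sub>0 ## j) (j\<^sub>0 ## j') powr (real k + \<epsilon> - 1))
         (A_set d (S (j\<^sub>0 ## j))) (A_set d (S (j\<^sub>0 ## j')))
       \<inter> renorm d (S j) (S j') j\<^sub>0 `
           Diff_var k (C * rho d S j j' powr (real k + \<epsilon> - 1))
             (A_set d (S j)) (A_set d (S j'))
       \<noteq> {}))"
  (is "?L \<longleftrightarrow> ?R")
proof
  assume ?L
  then obtain h where "C_embedding d k \<epsilon> h" "has_scaling_function d h S" by blast
  from embedding_imp_scaling_condition[OF assms(1,2,4-6) this] show ?R .
next
  assume ?R
  then obtain C where C: "\<forall>j\<in>Sigma_dual d. \<forall>j'\<in>Sigma_dual d. j \<noteq> j' \<longrightarrow> (\<forall>i\<in>{1..d}.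
       Diff_var k (C * rho d S (i ## j) (i ## j') powr (real k + \<epsilon> - 1)) (A_set d (S (i ## j))) (A_set d (S (i ## j')))
       \<inter> renorm d (S j) (S j') i ` Diff_var k (C * rho d S j j' powr (real k + \<epsilon> - 1)) (A_set d (S j)) (A_set d (S j')) \<noteq> {})" ..
  from scaling_condition_imp_embedding[OF assms C] show ?L .
qed

end
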